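(* Let $h:=(g,\alpha)\in G^J_1$, $g\in\mathrm{SU}(1,1)$, $\alpha\in\mathbb{C}$, consider the representation $\pi(h):=S(g)D(\alpha)$, and write $x:=(z,w)\in\mathcal{D}^J_1:=\mathbb{C}\times\mathcal{D}_1$. Then the continuous unitary representation $(\pi_K,\mathcal{H}_K)$ of $G^J_1$ attached to the positive definite holomorphic kernel $$K(z,w;\bar z',\bar w')=(1-w\bar w')^{-2k}\exp\frac{2\bar z'z+z^2\bar w'+\bar z'^2w}{2(1-w\bar w')}$$ is given by $$(\pi_K(h).f)(x)=J(h^{-1},x)^{-1}f(h^{-1}.x),$$ where the cocycle is $J(h^{-1},x)^{-1}:=\lambda(h^{-1},x)$, with, for $h=(g,\alpha)$, $g=\begin{pmatrix}a&b\\ \bar b&\bar a\end{pmatrix}$, $$\lambda(h,x)=\lambda(g,\alpha;z,w)=(\bar a+\bar bw)^{-2k}\exp\Big(\frac z2\bar\alpha_0-\frac{z_1}{2}\bar\alpha_2\Big)\exp\big(i\operatorname{Im}(\alpha_1\bar\alpha_0)\big),$$ $$\alpha_0=\frac{z+\bar zw}{1-w\bar w},\quad\alpha_1=\alpha+\alpha_0,\quad\alpha_2=a\alpha_1+b\bar\alpha_1,\quad h.x=(z_1,w_1)=\Big(\frac{\alpha-\bar\alpha w+z}{\bar bw+\bar a},\frac{aw+b}{\bar bw+\bar a}\Big),$$ and the function $f$ belongs to the Hilbert space of holomorphic functions $\mathcal{H}_K\equiv\mathcal{F}_K$ endowed with the scalar product $$(f_1,f_2)=\Lambda\int_{z\in\mathbb{C},\,|w|<1}\bar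 f_1(z,w)f_2(z,w)(1-w\bar w)^{2k}\exp\Big(-\frac{|z|^2}{1-w\bar w}-\frac{z^2\bar w+\bar z^2w}{2(1-w\bar w)}\Big)\frac{d\operatorname{Re}w\,d\operatorname{Im}w\,d\operatorname{Re}z\,d\operatorname{Im}z}{(1-w\bar w)^3},\qquad\Lambda=\frac{4k-3}{2\pi^2}.$$
   Context: $\mathcal{D}_1=\{w\in\mathbb{C}:|w|<1\}$; $k>0$ with $2k\in\{2,3,\dots\}$. $\mathcal{F}_K=\mathcal{H}_K$ is the reproducing kernel Hilbert space of holomorphic functions on $\mathcal{D}^J_1$ with kernel $K$. Jacobi group: $G^J_1=H_1\rtimes\mathrm{SU}(1,1)$ consists of triples $(g,\alpha,t)$, $g=\begin{pmatrix}a&b\\ \bar b&\bar a\end{pmatrix}\in\mathrm{SU}(1,1)$ ($|a|^2-|b|^2=1$), $\alpha\in\mathbb{C}$, $t\in\mathbb{R}$, with composition law $(g_1,\alpha_1,t_1)\circ(g_2,\alpha_2,t_2)=(g_1g_2,\ g_2^{-1}\cdot\alpha_1+\alpha_2,\ t_1+t_2+\operatorname{Im}((g_2^{-1}\cdot\alpha_1)\bar\alpha_2))$, where $g\cdot\alpha:=a\alpha+b\bar\alpha$. The pair $h=(g,\alpha)$ denotes the element $(g,\alpha,0)$, whose inverse is $h^{-1}=(g^{-1},-g\cdot\alpha)$; these elements generate $G^J_1$, and the formula for $\pi_K$ is asserted on them. Origin of $\lambda$: The Jacobi algebra $\mathfrak{g}^J_1$ is spanned (after complexification) by $1,a,a^+,K_0,K_\pm$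 with $1$ central and $[a,a^+]=1$; $[K_0,K_\pm]=\pm K_\pm$; $[K_-,K_+]=2K_0$; $[a,K_+]=a^+$; $[K_-,a^+]=a$; $[K_+,a^+]=[K_-,a]=0$; $[K_0,a^+]=\frac12a^+$; $[K_0,a]=-\frac12a$. In a continuous unitary representation of $G^J_1$ on a Hilbert space $\mathcal{H}$ (scalar product antilinear in the first argument), $a,a^+,\boldsymbol{K}_0,\boldsymbol{K}_\pm$ are the representing operators on smooth vectors ($1$ acting as identity, $(a^+)^+=a$, $\boldsymbol{K}_0^+=\boldsymbol{K}_0$, $\boldsymbol{K}_\pm^+=\boldsymbol{K}_\mp$), with a normalized cyclic vector $e_0$ satisfying $ae_0=0$, $\boldsymbol{K}_-e_0=0$, $\boldsymbol{K}_0e_0=ke_0$. Here $D(\alpha)=\exp(\alpha a^+-\bar\alpha a)$, $S\left(\exp\begin{pmatrix}i\theta&\zeta\\ \bar\zeta&-i\theta\end{pmatrix}\right)=\exp(2i\theta\boldsymbol{K}_0+\zeta\boldsymbol{K}_+-\bar\zeta\boldsymbol{K}_-)$, $e_{z,w}=e^{za^++w\boldsymbol{K}_+}e_0$, and $S(g)D(\alpha)e_x=\lambda(h,x)e_{h.x}$, $(e_{\bar z,\bar w},e_{\bar z',\bar w'})=K(z,w;\bar z',\bar w')$. *)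

theory Defs
  imports "HOL-Analysis.Analysis" "HOL-Algebra.Group" "HOL-Library.Function_Algebras"
begin

section \<open>Complex Hilbert spaces and continuous unitary representations\<close>

text \<open>
  A Hilbert space is a carrier \<open>V\<close> inside some complex vector space, so that spaces of functions
  depending on a real parameter are covered. Scalar products are antilinear in the first argument.
  The distance is cut off outside \<open>V\<close> only because \<^locale>\<open>Metric_space\<close> asks for symmetry
  on the whole type.
\<close>

definition hdist :: "'v::ab_group_add set \<Rightarrow> ('v \<Rightarrow> 'v \<Rightarrow> complex) \<Rightarrow> 'v \<Rightarrow> 'v \<Rightarrow> real" where
  "hdist V ip u v = (if u \<in> V \<and> v \<in> V then sqrt (Re (ip (u - v) (u - v))) else 0)"

abbreviation htopology :: "'v::ab_group_add set \<Rightarrow> ('v \<Rightarrow> 'v \<Rightarrow> complex) \<Rightarrow> 'v topology" where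
  "htopology V ip \<equiv> Metric_space.mtopology V (hdist V ip)"

locale complex_hilbert_space = vector_space scale
  for scale :: "complex \<Rightarrow> 'v::ab_group_add \<Rightarrow> 'v" +
  fixes V :: "'v set" and ip :: "'v \<Rightarrow> 'v \<Rightarrow> complex"
  assumes carrier_subspace: "subspace V"
    and ip_add_right: "\<lbrakk>u \<in> V; v \<in> V; w \<in> V\<rbrakk> \<Longrightarrow> ip u (v + w) = ip u v + ip u w"
    and ip_scale_right: "\<lbrakk>u \<in> V; v \<in> V\<rbrakk> \<Longrightarrow> ip u (scale c v) = c * ip u v"
    and ip_commute: "\<lbrakk>u \<in> V; v \<in> V\<rbrakk> \<Longrightarrow> ip v u = cnj (ip u v)"
    and ip_pos: "\<lbrakk>v \<in> V; v \<noteq> 0\<rbrakk> \<Longrightarrow> 0 < Re (ip v v)"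
    and complete: "Metric_space.mcomplete V (hdist V ip)"

locale continuous_unitary_rep = complex_hilbert_space scale V ip + group G
  for scale :: "complex \<Rightarrow> 'v::ab_group_add \<Rightarrow> 'v" and V :: "'v set"
    and ip :: "'v \<Rightarrow> 'v \<Rightarrow> complex" and G :: "'g::topological_space monoid" (structure) +
  fixes rep :: "'g \<Rightarrow> 'v \<Rightarrow> 'v"
  assumes rep_closed: "\<lbrakk>h \<in> carrier G; v \<in> V\<rbrakk> \<Longrightarrow> rep h v \<in> V"
    and rep_add: "\<lbrakk>h \<in> carrier G; u \<in> V; v \<in> V\<rbrakk> \<Longrightarrow> rep h (u + v) = rep h u + rep h v"
    and rep_scale: "\<lbrakk>h \<in> carrier G; v \<in> V\<rbrakk> \<Longrightarrow> rep h (scale c v) = scale c (rep h v)"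
    and rep_unitary: "\<lbrakk>h \<in> carrier G; u \<in> V; v \<in> V\<rbrakk> \<Longrightarrow> ip (rep h u) (rep h v) = ip u v"
    and rep_one: "v \<in> V \<Longrightarrow> rep \<one> v = v"
    and rep_mult: "\<lbrakk>h1 \<in> carrier G; h2 \<in> carrier G; v \<in> V\<rbrakk> \<Longrightarrow>
      rep (h1 \<otimes> h2) v = rep h1 (rep h2 v)"
    and rep_continuous: "v \<in> V \<Longrightarrow>
      continuous_map (top_of_set (carrier G)) (htopology V ip) (\<lambda>h. rep h v)"
begin

definition rep_deriv :: "(real \<Rightarrow> 'g) \<Rightarrow> 'v \<Rightarrow> 'v \<Rightarrow> bool" where
  "rep_deriv \<gamma> v w \<longleftrightarrow>
     limitin (htopology V ip) (\<lambda>s. scale (of_real (inverse s)) (rep (\<gamma> s) v - v)) w (at 0)"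

definition one_parameter_subgroup :: "(real \<Rightarrow> 'g) \<Rightarrow> bool" where
  "one_parameter_subgroup \<gamma> \<longleftrightarrow> continuous_on UNIV \<gamma> \<and> range \<gamma> \<subseteq> carrier G \<and>
     (\<forall>s t. \<gamma> (s + t) = \<gamma> s \<otimes> \<gamma> t)"

text \<open>
  The elements of the Lie algebra are the one-parameter subgroups. The derivative of the orbit map
  \<open>h \<mapsto> rep h v\<close> along the left invariant vector field belonging to \<open>\<gamma>\<close> is \<open>h \<mapsto> rep h w\<close>, where
  \<open>rep_deriv \<gamma> v w\<close>, and is continuous as soon as it exists. So the orbit map of \<open>v\<close> is smooth
  iff all iterated derivatives of \<open>v\<close> exist, i.e. iff \<open>v\<close> lies in some set that is closed under
  all the derivatives.
\<close>

definition smooth_vectors :: "'v set" where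
  "smooth_vectors = \<Union>{S. S \<subseteq> V \<and>
     (\<forall>v\<in>S. \<forall>\<gamma>. one_parameter_subgroup \<gamma> \<longrightarrow> (\<exists>w\<in>S. rep_deriv \<gamma> v w))}"

end


section \<open>The Jacobi group and its action\<close>

definition su_mat :: "complex \<Rightarrow> complex \<Rightarrow> complex^2^2" where
  "su_mat a b = vector [vector [a, b], vector [cnj b, cnj a]]"

definition SU11 :: "(complex^2^2) set" where
  "SU11 = {su_mat a b | a b. (cmod a)\<^sup>2 - (cmod b)\<^sup>2 = 1}"

definition su_act :: "complex^2^2 \<Rightarrow> complex \<Rightarrow> complex" where
  "su_act g \<alpha> = g$1$1 * \<alpha> + g$1$2 * cnj \<alpha>"

type_synonym jacobi = "(complex^2^2) \<times> complex \<times> real"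

definition jacobi_group :: "jacobi monoid" where
  "jacobi_group =
     \<lparr>carrier = SU11 \<times> UNIV \<times> UNIV,
      mult = (\<lambda>(g1, \<alpha>1, t1) (g2, \<alpha>2, t2).
        (g1 ** g2,
         su_act (matrix_inv g2) \<alpha>1 + \<alpha>2,
         t1 + t2 + Im (su_act (matrix_inv g2) \<alpha>1 * cnj \<alpha>2))),
      one = (mat 1, 0, 0)\<rparr>"

definition jacobi_disk :: "(complex \<times> complex) set" where
  "jacobi_disk = UNIV \<times> ball 0 1"

fun jacobi_act :: "jacobi \<Rightarrow> complex \<times> complex \<Rightarrow> complex \<times> complex" where
  "jacobi_act (g, \<alpha>, t) (z, w) =
     (let a = g$1$1; b = g$1$2 in
       ((\<alpha> - cnj \<alpha> * w + z) / (cnj b * w + cnj a), (a * w + b) / (cnj b * w + cnj a)))"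

text \<open>
  Complex powers are principal ones; the exponent \<open>-2k\<close> will be an integer, so that the choice of
  the branch does not matter.
\<close>

fun jacobi_lambda :: "real \<Rightarrow> complex^2^2 \<Rightarrow> complex \<Rightarrow> complex \<times> complex \<Rightarrow> complex" where
  "jacobi_lambda k g \<alpha> (z, w) =
     (let a = g$1$1; b = g$1$2;
          \<alpha>0 = (z + cnj z * w) / (1 - w * cnj w);
          \<alpha>1 = \<alpha> + \<alpha>0;
          \<alpha>2 = a * \<alpha>1 + b * cnj \<alpha>1;
          z1 = fst (jacobi_act (g, \<alpha>, 0) (z, w))
      in (cnj a + cnj b * w) powr (- of_real (2 * k))
         * exp (z / 2 * cnj \<alpha>0 - z1 / 2 * cnj \<alpha>2)
         * exp (\<i> * of_real (Im (\<alpha>1 * cnj \<alpha>0))))"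

text \<open>
  On the elements \<open>(g, \<alpha>, 0)\<close> the cocycle is the reciprocal of \<open>\<lambda>\<close>. These elements generate the
  group, and the factor \<open>exp (i t)\<close> is what the cocycle identity then dictates for the others.
\<close>

fun jacobi_cocycle :: "real \<Rightarrow> jacobi \<Rightarrow> complex \<times> complex \<Rightarrow> complex" where
  "jacobi_cocycle k (g, \<alpha>, t) x = inverse (exp (\<i> * of_real t) * jacobi_lambda k g \<alpha> x)"


section \<open>Reproducing kernels and the space of holomorphic functions\<close>

definition holomorphic2_on :: "(complex \<times> complex \<Rightarrow> complex) \<Rightarrow> (complex \<times> complex) set \<Rightarrow> bool"
    (infixl "(holomorphic'2'_on)" 50) where
  "f holomorphic2_on D \<longleftrightarrow>
     (\<forall>x\<in>D. \<exists>p q. (f has_derivative (\<lambda>(u, v). p * u + q * v)) (at x))"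

definition positive_definite_holomorphic_kernel ::
    "(complex \<times> complex) set \<Rightarrow> (complex \<times> complex \<Rightarrow> complex \<times> complex \<Rightarrow> complex) \<Rightarrow> bool" where
  "positive_definite_holomorphic_kernel D K \<longleftrightarrow>
     (\<forall>y\<in>D. (\<lambda>x. K x y) holomorphic2_on D) \<and>
     (\<forall>x\<in>D. \<forall>y\<in>D. K y x = cnj (K x y)) \<and>
     (\<forall>F c. finite F \<and> F \<subseteq> D \<longrightarrow>
        (\<Sum>x\<in>F. \<Sum>y\<in>F. c x * cnj (c y) * K x y) \<in> \<real>\<^sub>\<ge>\<^sub>0)"

text \<open>
  Functions on \<open>D\<close> are represented by their extension by zero, so that distinct elements of the
  carrier are distinct as functions on \<open>D\<close>.
\<close>

definition reproducing_kernel_hilbert_space ::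
    "'x set \<Rightarrow> ('x \<Rightarrow> 'x \<Rightarrow> complex) \<Rightarrow> ('x \<Rightarrow> complex) set \<Rightarrow>
     (('x \<Rightarrow> complex) \<Rightarrow> ('x \<Rightarrow> complex) \<Rightarrow> complex) \<Rightarrow> bool" where
  "reproducing_kernel_hilbert_space D K H ip \<longleftrightarrow>
     complex_hilbert_space (\<lambda>c f x. c * f x) H ip \<and>
     (\<forall>f\<in>H. \<forall>x. x \<notin> D \<longrightarrow> f x = 0) \<and>
     (\<forall>y\<in>D. (\<lambda>x. if x \<in> D then K x y else 0) \<in> H \<and>
        (\<forall>f\<in>H. ip (\<lambda>x. if x \<in> D then K x y else 0) f = f y))"

text \<open>The second argument is the point \<open>(z', w')\<close> itself, not its conjugate.\<close>

fun jacobi_kernel :: "real \<Rightarrow> complex \<times> complex \<Rightarrow> complex \<times> complex \<Rightarrow> complex" where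
  "jacobi_kernel k (z, w) (z', w') =
     (1 - w * cnj w') powr (- of_real (2 * k))
     * exp ((2 * cnj z' * z + z\<^sup>2 * cnj w' + (cnj z')\<^sup>2 * w) / (2 * (1 - w * cnj w')))"

fun jacobi_weight :: "real \<Rightarrow> complex \<times> complex \<Rightarrow> real" where
  "jacobi_weight k (z, w) =
     (1 - (cmod w)\<^sup>2) powr (2 * k)
     * exp (- (cmod z)\<^sup>2 / (1 - (cmod w)\<^sup>2)
            - Re (z\<^sup>2 * cnj w + (cnj z)\<^sup>2 * w) / (2 * (1 - (cmod w)\<^sup>2)))
     / (1 - (cmod w)\<^sup>2) ^ 3"

definition jacobi_space :: "real \<Rightarrow> (complex \<times> complex \<Rightarrow> complex) set" where
  "jacobi_space k =
     {f. f holomorphic2_on jacobi_disk \<and> (\<forall>x. x \<notin> jacobi_disk \<longrightarrow> f x = 0) \<and>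
         set_integrable lborel jacobi_disk (\<lambda>x. (cmod (f x))\<^sup>2 * jacobi_weight k x)}"

definition jacobi_ip ::
    "real \<Rightarrow> (complex \<times> complex \<Rightarrow> complex) \<Rightarrow> (complex \<times> complex \<Rightarrow> complex) \<Rightarrow> complex" where
  "jacobi_ip k f1 f2 = of_real ((4 * k - 3) / (2 * pi\<^sup>2)) *
     (LINT x:jacobi_disk|lborel. cnj (f1 x) * f2 x * of_real (jacobi_weight k x))"


section \<open>Representations with a cyclic lowest weight vector, and coherent vectors\<close>

definition mat_exp :: "complex^2^2 \<Rightarrow> complex^2^2" where
  "mat_exp A = (\<Sum>n. (1 / fact n) *\<^sub>R (((**) A) ^^ n) (mat 1))"

definition su11_alg :: "real \<Rightarrow> complex \<Rightarrow> complex^2^2" where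
  "su11_alg \<theta> \<zeta> = vector [vector [\<i> * of_real \<theta>, \<zeta>], vector [cnj \<zeta>, - \<i> * of_real \<theta>]]"

text \<open>
  The operators \<open>A, A', K0, Kp, Km\<close> represent \<open>a, a\<^sup>+, K\<^sub>0, K\<^sub>+, K\<^sub>-\<close> on the smooth vectors. That
  \<open>D(\<alpha>) = rep (1, \<alpha>, 0)\<close> is \<open>exp (\<alpha> a\<^sup>+ - \<alpha>\<^sup>* a)\<close>, and similarly for \<open>S(g) = rep (g, 0, 0)\<close>, means
  that these skew-symmetric operators are the derivatives of the unitary one-parameter groups in
  question. The third of these conditions says that the central element \<open>1\<close> of the complexified
  algebra, which is \<open>-i\<close> times the tangent vector of \<open>t \<mapsto> (1, 0, t)\<close>, acts as the identity.
\<close>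

locale jacobi_lowest_weight_rep = continuous_unitary_rep scale V ip jacobi_group rep
  for scale :: "complex \<Rightarrow> 'v::ab_group_add \<Rightarrow> 'v" and V :: "'v set"
    and ip :: "'v \<Rightarrow> 'v \<Rightarrow> complex" and rep :: "jacobi \<Rightarrow> 'v \<Rightarrow> 'v" +
  fixes k :: real and A A' K0 Kp Km :: "'v \<Rightarrow> 'v" and e0 :: 'v
  assumes deriv_D: "v \<in> smooth_vectors \<Longrightarrow>
      rep_deriv (\<lambda>s. (mat 1, of_real s * \<alpha>, 0)) v (scale \<alpha> (A' v) - scale (cnj \<alpha>) (A v))"
    and deriv_S: "v \<in> smooth_vectors \<Longrightarrow>
      rep_deriv (\<lambda>s. (mat_exp (s *\<^sub>R su11_alg \<theta> \<zeta>), 0, 0)) v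
        (scale (2 * \<i> * of_real \<theta>) (K0 v) + scale \<zeta> (Kp v) - scale (cnj \<zeta>) (Km v))"
    and deriv_center: "v \<in> smooth_vectors \<Longrightarrow> rep_deriv (\<lambda>s. (mat 1, 0, s)) v (scale \<i> v)"
    and comm_A_A': "v \<in> smooth_vectors \<Longrightarrow> A (A' v) - A' (A v) = v"
    and comm_K0_Kp: "v \<in> smooth_vectors \<Longrightarrow> K0 (Kp v) - Kp (K0 v) = Kp v"
    and comm_K0_Km: "v \<in> smooth_vectors \<Longrightarrow> K0 (Km v) - Km (K0 v) = - Km v"
    and comm_Km_Kp: "v \<in> smooth_vectors \<Longrightarrow> Km (Kp v) - Kp (Km v) = scale 2 (K0 v)"
    and comm_A_Kp: "v \<in> smooth_vectors \<Longrightarrow> A (Kp v) - Kp (A v) = A' v"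
    and comm_Km_A': "v \<in> smooth_vectors \<Longrightarrow> Km (A' v) - A' (Km v) = A v"
    and comm_Kp_A': "v \<in> smooth_vectors \<Longrightarrow> Kp (A' v) - A' (Kp v) = 0"
    and comm_Km_A: "v \<in> smooth_vectors \<Longrightarrow> Km (A v) - A (Km v) = 0"
    and comm_K0_A': "v \<in> smooth_vectors \<Longrightarrow> K0 (A' v) - A' (K0 v) = scale (1 / 2) (A' v)"
    and comm_K0_A: "v \<in> smooth_vectors \<Longrightarrow> K0 (A v) - A (K0 v) = scale (- 1 / 2) (A v)"
    and adj_A: "\<lbrakk>u \<in> smooth_vectors; v \<in> smooth_vectors\<rbrakk> \<Longrightarrow> ip (A' u) v = ip u (A v)"
    and adj_K0: "\<lbrakk>u \<in> smooth_vectors; v \<in> smooth_vectors\<rbrakk> \<Longrightarrow> ip (K0 u) v = ip u (K0 v)"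
    and adj_K: "\<lbrakk>u \<in> smooth_vectors; v \<in> smooth_vectors\<rbrakk> \<Longrightarrow> ip (Kp u) v = ip u (Km v)"
    and e0_smooth: "e0 \<in> smooth_vectors"
    and e0_normalized: "ip e0 e0 = 1"
    and e0_cyclic: "htopology V ip closure_of span ((\<lambda>h. rep h e0) ` carrier jacobi_group) = V"
    and A_e0: "A e0 = 0"
    and Km_e0: "Km e0 = 0"
    and K0_e0: "K0 e0 = scale (of_real k) e0"

text \<open>\<open>coherent_vector \<dots> (z, w) v\<close> says that \<open>v\<close> is \<open>exp (z a\<^sup>+ + w K\<^sub>+) e\<^sub>0\<close>, as a convergent series.\<close>

fun coherent_vector ::
    "(complex \<Rightarrow> 'v::ab_group_add \<Rightarrow> 'v) \<Rightarrow> 'v set \<Rightarrow> ('v \<Rightarrow> 'v \<Rightarrow> complex) \<Rightarrow>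
     ('v \<Rightarrow> 'v) \<Rightarrow> ('v \<Rightarrow> 'v) \<Rightarrow> 'v \<Rightarrow> complex \<times> complex \<Rightarrow> 'v \<Rightarrow> bool" where
  "coherent_vector sc V ip A' Kp e0 (z, w) v \<longleftrightarrow>
     limitin (htopology V ip)
       (\<lambda>N. \<Sum>n<N. sc (1 / fact n) (((\<lambda>u. sc z (A' u) + sc w (Kp u)) ^^ n) e0))
       v sequentially"

end

theory Submission
  imports Defs "HOL-Complex_Analysis.Complex_Analysis" "HOL-Probability.Probability"
begin

unbundle no fps_syntax

text \<open>
  The factor \<open>\<lambda>\<close> has a closed form that is holomorphic in \<open>(z, w)\<close>. The cocycle identity and the
  covariance of \<open>K\<close> are computations with it, and they make \<open>\<pi>\<^sub>K\<close> unitary because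
  \<open>(1 - |w|\<^sup>2)\<^sup>-\<^sup>3\<close> is the density of an invariant measure and the weight is \<open>1 / K(x, x)\<close>. The
  weighted measure is invariant under \<open>(z, w) \<mapsto> (uz, u\<^sup>2w)\<close> with \<open>|u| = 1\<close>, so the mean value property
  shows that \<open>1 = K(\<cdot>, 0)\<close> reproduces the value at the origin; as the group acts transitively by
  unitary operators, \<open>K\<close> is reproducing everywhere. Point evaluations are thus locally uniformly
  bounded, which gives completeness.

  In a lowest weight representation the commutation relations bound the norms of the vectors
  \<open>(a\<^sup>+)\<^sup>m K\<^sub>+\<^sup>n e\<^sub>0\<close>, so that the series of \<open>e\<^sub>x\<close> converges on the disk, and they turn
  \<open>x \<mapsto> (u, e\<^sub>x)\<close> for smooth \<open>u\<close> into a power series on which the Lie algebra acts by first order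
  differential operators. For \<open>u = e\<^sub>y\<close> this gives a differential equation with the only solution \<open>K\<close>.
  For a one-parameter subgroup \<open>\<gamma>\<close> it says that \<open>s \<mapsto> \<lambda>(\<gamma>(s), x) (\<pi>(\<gamma>(s)) u, e\<^sub>y)\<close> with
  \<open>y = \<gamma>(s).x\<close> has derivative zero, so that \<open>\<pi>(\<gamma>(s)) e\<^sub>x = \<lambda>(\<gamma>(s), x) e\<^sub>y\<close>. Translations, rotations and
  boosts generate what is needed of the group.
\<close>

section \<open>The Jacobi group, its action and the cocycle\<close>

text \<open>The second half is shaped by one obstacle: \<open>ev x\<close> is not known to be
  smooth, while the Lie algebra acts on smooth vectors only. So every derivative is taken in the
  other slot of the scalar product, and equations between vectors are recovered from the density of
  the smooth vectors, which follows from cyclicity. The operators are given through derivatives,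
  commutators and adjoints; that they preserve smooth vectors and are linear there has to be
  extracted first. Strong continuity of \<open>pi_K\<close> comes without any dominating function:
  pointwise convergence together with constant norms forces convergence in the mean. The formula on
  the elements (g, \<alpha>, 0) fixes a representation because (1, 0, t) is a product of three
  translations. As 2k is an integer, all powers are natural powers of automorphy factors, and no
  branch of a logarithm is followed along the group. The constant \<Lambda> is the reciprocal of the
  total mass of the weighted measure, so the function 1 is a unit vector.\<close>

lemma su_mat_nth [simp]:
  "su_mat a b $ 1 $ 1 = a" "su_mat a b $ 1 $ 2 = b"
  "su_mat a b $ 2 $ 1 = cnj b" "su_mat a b $ 2 $ 2 = cnj a"
  by (simp_all add: su_mat_def)

lemma su_mat_eq_iff: "su_mat a b = su_mat c d \<longleftrightarrow> a = c \<and> b = d"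
  by (metis su_mat_nth(1,2))

lemma su_mat_mult:
  "su_mat a b ** su_mat c d = su_mat (a * c + b * cnj d) (a * d + b * cnj c)"
  by (simp add: vec_eq_iff forall_2 matrix_matrix_mult_def sum_2 algebra_simps)

lemma su_mat_one: "mat 1 = su_mat 1 0"
  by (simp add: vec_eq_iff forall_2 mat_def)

text \<open>The determinant condition in polynomial form, ready for ring normalisation;
  \<open>su_pair_cmod\<close> links it to the moduli in \<open>SU11\<close>.\<close>

definition su_pair :: "complex \<Rightarrow> complex \<Rightarrow> bool" where
  "su_pair a b \<longleftrightarrow> a * cnj a - b * cnj b = 1"

lemma su_pair_cmod: "su_pair a b \<longleftrightarrow> (cmod a)\<^sup>2 - (cmod b)\<^sup>2 = 1"
proof -
  have "a * cnj a - b * cnj b = of_real ((cmod a)\<^sup>2 - (cmod b)\<^sup>2)"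
    by (simp only: complex_norm_square of_real_diff)
  then show ?thesis
    unfolding su_pair_def by (metis of_real_eq_1_iff)
qed

lemma SU11_iff: "g \<in> SU11 \<longleftrightarrow> (\<exists>a b. g = su_mat a b \<and> su_pair a b)"
  by (simp add: SU11_def su_pair_cmod)

lemma su_mat_in_SU11 [simp]: "su_mat a b \<in> SU11 \<longleftrightarrow> su_pair a b"
  by (metis SU11_iff su_mat_eq_iff)

lemma su_pair_one [simp]: "su_pair 1 0"
  by (simp add: su_pair_def)

lemma su_pair_inv: "su_pair a b \<Longrightarrow> su_pair (cnj a) (- b)"
  by (simp add: su_pair_def algebra_simps)

text \<open>Multiplicativity of the determinant.\<close>

lemma su_pair_mult:
  assumes "su_pair a b" "su_pair c d"
  shows "su_pair (a * c + b * cnj d) (a * d + b * cnj c)"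
proof -
  have "(a * c + b * cnj d) * cnj (a * c + b * cnj d) - (a * d + b * cnj c) * cnj (a * d + b * cnj c)
      = (a * cnj a - b * cnj b) * (c * cnj c - d * cnj d)"
    by (simp add: algebra_simps)
  then show ?thesis
    using assms by (simp add: su_pair_def)
qed

lemma matrix_inv_su_mat:
  assumes "su_pair a b"
  shows "matrix_inv (su_mat a b) = su_mat (cnj a) (- b)"
proof -
  let ?B = "su_mat (cnj a) (- b)"
  have 1: "su_mat a b ** ?B = mat 1" "?B ** su_mat a b = mat 1"
    using assms by (simp_all add: su_mat_mult su_mat_one su_mat_eq_iff su_pair_def algebra_simps)
  \<comment> \<open>\<open>matrix_inv\<close> is a Hilbert choice, so a one-sided equation is
    extracted from it; associativity then identifies it with \<open>?B\<close>.\<close>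
  then have "su_mat a b ** matrix_inv (su_mat a b) = mat 1"
    unfolding matrix_inv_def by (rule someI2[where P = "\<lambda>B. su_mat a b ** B = mat 1 \<and> B ** su_mat a b = mat 1", OF conjI]) simp
  then show ?thesis
    by (metis "1"(2) matrix_mul_assoc matrix_mul_lid matrix_mul_rid)
qed

lemma su_act_su_mat [simp]: "su_act (su_mat a b) \<alpha> = a * \<alpha> + b * cnj \<alpha>"
  by (simp add: su_act_def)

lemma jacobi_mult:
  assumes "su_pair c d"
  shows "(su_mat a b, \<alpha>, s) \<otimes>\<^bsub>jacobi_group\<^esub> (su_mat c d, \<beta>, t)
    = (su_mat (a * c + b * cnj d) (a * d + b * cnj c), cnj c * \<alpha> - d * cnj \<alpha> + \<beta>,
       s + t + Im ((cnj c * \<alpha> - d * cnj \<alpha>) * cnj \<beta>))"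
  by (simp add: jacobi_group_def su_mat_mult matrix_inv_su_mat assms)

lemma jacobi_carrier [simp]: "(g, \<alpha>, t) \<in> carrier jacobi_group \<longleftrightarrow> g \<in> SU11"
  by (simp add: jacobi_group_def)

lemma jacobi_carrierE:
  assumes "h \<in> carrier jacobi_group"
  obtains a b \<alpha> t where "h = (su_mat a b, \<alpha>, t)" "su_pair a b"
  using assms by (auto simp: jacobi_group_def SU11_iff)

lemma jacobi_one: "\<one>\<^bsub>jacobi_group\<^esub> = (su_mat 1 0, 0, 0)"
  by (simp add: jacobi_group_def su_mat_one)

lemma Im_eq_cnj: "complex_of_real (Im z) = (z - cnj z) / (2 * \<i>)"
  by (simp add: complex_eq_iff)

text \<open>Apart from the additivity of the twist, the point is the third coordinate: Im (\<delta>
  cnj \<beta>) is a symplectic form on the plane, and SU(1,1) preserves it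
  (\<open>form\<close>).\<close>

lemma jacobi_mult_assoc:
  assumes "x \<in> carrier jacobi_group" "y \<in> carrier jacobi_group" "z \<in> carrier jacobi_group"
  shows "x \<otimes>\<^bsub>jacobi_group\<^esub> y \<otimes>\<^bsub>jacobi_group\<^esub> z = x \<otimes>\<^bsub>jacobi_group\<^esub> (y \<otimes>\<^bsub>jacobi_group\<^esub> z)"
proof -
  obtain a b \<alpha> r where x: "x = (su_mat a b, \<alpha>, r)" "su_pair a b"
    using assms by (elim jacobi_carrierE)
  obtain c d \<beta> s where y: "y = (su_mat c d, \<beta>, s)" "su_pair c d"
    using assms by (elim jacobi_carrierE)
  obtain e f \<gamma> t where z: "z = (su_mat e f, \<gamma>, t)" "su_pair e f"
    using assms by (elim jacobi_carrierE)
  define \<delta> where "\<delta> = cnj c * \<alpha> - d * cnj \<alpha>"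
  have ef: "e * cnj e = 1 + f * cnj f"
    using z(2) by (simp add: su_pair_def algebra_simps)
  have form: "Im ((cnj e * \<delta> - f * cnj \<delta>) * cnj (cnj e * \<beta> - f * cnj \<beta>)) = Im (\<delta> * cnj \<beta>)"
  proof -
    have "Im ((cnj e * \<delta> - f * cnj \<delta>) * cnj (cnj e * \<beta> - f * cnj \<beta>))
      = ((cmod e)\<^sup>2 - (cmod f)\<^sup>2) * Im (\<delta> * cnj \<beta>)"
      unfolding cmod_power2 by (simp add: algebra_simps power2_eq_square)
    then show ?thesis using z(2) by (simp add: su_pair_cmod)
  qed
  have 1: "cnj e * (\<delta> + \<beta>) - f * cnj (\<delta> + \<beta>) = (cnj e * \<delta> - f * cnj \<delta>) + (cnj e * \<beta> - f * cnj \<beta>)"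
    by (simp add: algebra_simps)
  have 2: "cnj (c * e + d * cnj f) * \<alpha> - (c * f + d * cnj e) * cnj \<alpha> = cnj e * \<delta> - f * cnj \<delta>"
    by (simp add: \<delta>_def algebra_simps)
  show ?thesis
    unfolding x(1) y(1) z(1)
    apply (subst jacobi_mult[OF y(2)], subst jacobi_mult[OF z(2)], subst jacobi_mult[OF z(2)])
    apply (subst jacobi_mult[OF su_pair_mult[OF y(2) z(2)]])
    unfolding \<delta>_def[symmetric] 1 2
    using form by (simp add: su_mat_eq_iff algebra_simps)
qed

lemma jacobi_left_inverse:
  assumes "su_pair a b"
  shows "(su_mat (cnj a) (- b), - (a * \<alpha> + b * cnj \<alpha>), - t) \<otimes>\<^bsub>jacobi_group\<^esub> (su_mat a b, \<alpha>, t)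
    = \<one>\<^bsub>jacobi_group\<^esub>"
proof -
  have ab: "a * cnj a = 1 + b * cnj b"
    using assms by (simp add: su_pair_def algebra_simps)
  have "cnj a * (- (a * \<alpha> + b * cnj \<alpha>)) - b * cnj (- (a * \<alpha> + b * cnj \<alpha>))
      = - (a * cnj a - b * cnj b) * \<alpha>"
    by (simp add: algebra_simps)
  also have "\<dots> = - \<alpha>"
    using assms by (simp only: su_pair_def) simp
  finally have 1: "cnj a * (- (a * \<alpha> + b * cnj \<alpha>)) - b * cnj (- (a * \<alpha> + b * cnj \<alpha>)) = - \<alpha>" .
  show ?thesis
    unfolding jacobi_mult[OF assms] 1 jacobi_one
    using ab by (simp add: su_mat_eq_iff algebra_simps)
qed

lemma jacobi_group: "group jacobi_group"
proof (rule groupI)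
  show "x \<otimes>\<^bsub>jacobi_group\<^esub> y \<in> carrier jacobi_group"
    if "x \<in> carrier jacobi_group" "y \<in> carrier jacobi_group" for x y
    using that by (elim jacobi_carrierE) (simp add: jacobi_mult su_pair_mult)
  show "\<one>\<^bsub>jacobi_group\<^esub> \<in> carrier jacobi_group"
    by (simp add: jacobi_one)
  show "\<one>\<^bsub>jacobi_group\<^esub> \<otimes>\<^bsub>jacobi_group\<^esub> x = x" if "x \<in> carrier jacobi_group" for x
    using that by (elim jacobi_carrierE) (simp add: jacobi_one jacobi_mult)
  show "\<exists>y\<in>carrier jacobi_group. y \<otimes>\<^bsub>jacobi_group\<^esub> x = \<one>\<^bsub>jacobi_group\<^esub>" 
    if x: "x \<in> carrier jacobi_group" for x
    using x jacobi_left_inverse su_pair_inv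
    by (elim jacobi_carrierE) (metis jacobi_carrier su_mat_in_SU11)
qed (rule jacobi_mult_assoc)

lemma jacobi_inv:
  assumes "su_pair a b"
  shows "inv\<^bsub>jacobi_group\<^esub> (su_mat a b, \<alpha>, t) = (su_mat (cnj a) (- b), - (a * \<alpha> + b * cnj \<alpha>), - t)"
  using assms
  by (intro group.inv_equality[OF jacobi_group] jacobi_left_inverse) (auto simp: su_pair_inv)

section \<open>The Moebius action and its automorphy factor\<close>

definition su_den :: "complex \<Rightarrow> complex \<Rightarrow> complex \<Rightarrow> complex" where
  "su_den a b w = cnj b * w + cnj a"

text \<open>A zero would give |a| = |b| |w| <= |b|, against |a|^2 = 1 + |b|^2.\<close>

lemma su_den_nonzero:
  assumes "su_pair a b" "cmod w < 1"
  shows "su_den a b w \<noteq> 0"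
proof
  assume "su_den a b w = 0"
  then have "cnj a = - (cnj b * w)"
    by (simp add: su_den_def eq_neg_iff_add_eq_0 add.commute)
  then have "cmod a = cmod b * cmod w"
    by (metis complex_mod_cnj norm_minus_cancel norm_mult)
  then have "cmod a \<le> cmod b"
    using assms(2) by (simp add: mult_left_le)
  then have "(cmod a)\<^sup>2 \<le> (cmod b)\<^sup>2"
    by (simp only: power_mono norm_ge_zero)
  then show False
    using assms(1) by (simp add: su_pair_cmod del: power_mono_iff)
qed

lemma jacobi_act_su_mat:
  "jacobi_act (su_mat a b, \<alpha>, t) (z, w)
    = ((\<alpha> - cnj \<alpha> * w + z) / su_den a b w, (a * w + b) / su_den a b w)"
  by (simp add: su_den_def)

declare jacobi_act.simps [simp del]

text \<open>The matrix sends (w, 1) to (\<open>a * w + b\<close>, \<open>su_den a b w\<close>) and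
  preserves the hermitian form of signature (1, 1); dividing by the two second coordinates gives the
  equation.\<close>

lemma moebius_kernel:
  assumes "su_pair a b" "su_den a b w \<noteq> 0" "su_den a b v \<noteq> 0"
  shows "1 - (a * w + b) / su_den a b w * cnj ((a * v + b) / su_den a b v)
    = (1 - w * cnj v) / (su_den a b w * cnj (su_den a b v))"
proof -
  have 1: "(a * w + b) / su_den a b w * cnj ((a * v + b) / su_den a b v)
    = (a * w + b) * (cnj a * cnj v + cnj b) / (su_den a b w * cnj (su_den a b v))"
    by simp
  have "su_den a b w * cnj (su_den a b v) - (a * w + b) * (cnj a * cnj v + cnj b)
    = (a * cnj a - b * cnj b) * (1 - w * cnj v)"
    by (simp add: su_den_def algebra_simps)
  then have 2: "su_den a b w * cnj (su_den a b v) - (a * w + b) * (cnj a * cnj v + cnj b) = 1 - w * cnj v"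
    using assms(1) by (simp add: su_pair_def)
  have "su_den a b w * cnj (su_den a b v) \<noteq> 0"
    using assms by simp
  then show ?thesis
    unfolding 1 2[symmetric] by (simp add: diff_divide_distrib)
qed

lemma moebius_norm:
  assumes "su_pair a b" "cmod w < 1"
  shows "1 - (cmod ((a * w + b) / su_den a b w))\<^sup>2 = (1 - (cmod w)\<^sup>2) / (cmod (su_den a b w))\<^sup>2"
proof -
  have "complex_of_real (1 - (cmod ((a * w + b) / su_den a b w))\<^sup>2)
     = complex_of_real ((1 - (cmod w)\<^sup>2) / (cmod (su_den a b w))\<^sup>2)"
    unfolding of_real_diff of_real_divide complex_norm_square of_real_1
    using moebius_kernel[OF assms(1) su_den_nonzero[OF assms] su_den_nonzero[OF assms]] by simp
  then show ?thesis
    using of_real_eq_iff by blast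
qed

lemma moebius_in_disk:
  assumes "su_pair a b" "cmod w < 1"
  shows "cmod ((a * w + b) / su_den a b w) < 1"
proof -
  have "(cmod w)\<^sup>2 < 1"
    using assms(2) by (simp add: abs_square_less_1)
  then have "1 - (cmod ((a * w + b) / su_den a b w))\<^sup>2 > 0"
    unfolding moebius_norm[OF assms] using su_den_nonzero[OF assms] by simp
  then show ?thesis
    by (simp add: abs_square_less_1)
qed

lemma jacobi_disk_iff [simp]: "(z, w) \<in> jacobi_disk \<longleftrightarrow> cmod w < 1"
  by (simp add: jacobi_disk_def)

lemma jacobi_act_in_disk:
  assumes "h \<in> carrier jacobi_group" "x \<in> jacobi_disk"
  shows "jacobi_act h x \<in> jacobi_disk"
  using assms
  by (cases x) (auto elim!: jacobi_carrierE simp: jacobi_act_su_mat moebius_in_disk simp del: norm_divide)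

text \<open>The closed form of \<open>\<lambda>\<close>, in which the terms that are not holomorphic have cancelled.\<close>

definition jacobi_mult_factor :: "nat \<Rightarrow> complex \<Rightarrow> complex \<Rightarrow> complex \<Rightarrow> complex \<Rightarrow> complex \<Rightarrow> complex" where
  "jacobi_mult_factor n a b \<alpha> z w = inverse (su_den a b w ^ n)
     * exp (- \<alpha> * cnj \<alpha> / 2 + (cnj \<alpha>)\<^sup>2 * w / 2 - z * cnj \<alpha>
            - cnj b * (\<alpha> - cnj \<alpha> * w + z)\<^sup>2 / (2 * su_den a b w))"

lemma powr_neg_double:
  assumes "2 * k = real n" "x \<noteq> 0"
  shows "x powr (- complex_of_real (2 * k)) = inverse (x ^ n)"
  unfolding assms(1) using assms(2) by (simp add: powr_minus)

text \<open>Everything is expressed by \<alpha>0 instead of z: inverting its definition gives z =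
  \<alpha>0 - w cnj \<alpha>0 (\<open>z\<close>), and the numerator of z1 becomes \<alpha>1 - w cnj
  \<alpha>1 (\<open>N\<close>). Up to one fraction the exponent is then polynomial in \<alpha>,
  \<alpha>0, w and conjugates, and \<open>quad\<close> is the cancellation.\<close>

lemma jacobi_lambda_eq:
  assumes k: "2 * k = real n" and ab: "su_pair a b" and w: "cmod w < 1"
  shows "jacobi_lambda k (su_mat a b) \<alpha> (z, w) = jacobi_mult_factor n a b \<alpha> z w"
proof -
  define \<alpha>0 where "\<alpha>0 = (z + cnj z * w) / (1 - w * cnj w)"
  define \<alpha>1 where "\<alpha>1 = \<alpha> + \<alpha>0"
  define j where "j = su_den a b w"
  have j: "j \<noteq> 0"
    using su_den_nonzero[OF ab w] by (simp add: j_def)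
  have "1 - w * cnj w = of_real (1 - (cmod w)\<^sup>2)"
    by (simp only: complex_norm_square of_real_diff of_real_1)
  moreover have "(cmod w)\<^sup>2 < 1"
    using w by (simp add: abs_square_less_1)
  ultimately have nz: "1 - w * cnj w \<noteq> 0"
    by (metis eq_iff_diff_eq_0 less_irrefl of_real_eq_0_iff)
  have nz': "1 - cnj w * w \<noteq> 0"
    using nz by (simp add: mult.commute)
  have \<alpha>0c: "cnj \<alpha>0 = (cnj z + z * cnj w) / (1 - w * cnj w)"
    by (simp add: \<alpha>0_def mult.commute)
  have z: "z = \<alpha>0 - w * cnj \<alpha>0"
  proof -
    have "\<alpha>0 - w * cnj \<alpha>0 = ((z + cnj z * w) - w * (cnj z + z * cnj w)) / (1 - w * cnj w)"
      unfolding \<alpha>0c unfolding \<alpha>0_def by (simp add: diff_divide_distrib)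
    also have "(z + cnj z * w) - w * (cnj z + z * cnj w) = z * (1 - w * cnj w)"
      by (simp add: algebra_simps)
    finally show ?thesis
      using nz by simp
  qed
  have N: "\<alpha> - cnj \<alpha> * w + z = \<alpha>1 - w * cnj \<alpha>1"
    unfolding \<alpha>1_def by (subst z) (simp add: algebra_simps)
  \<comment> \<open>Split into a multiple of \<open>j\<close> and a multiple of the numerator, so
    that division by \<open>j\<close> leaves a single fraction.\<close>
  have \<alpha>2: "cnj (a * \<alpha>1 + b * cnj \<alpha>1) = j * cnj \<alpha>1 + cnj b * (\<alpha>1 - w * cnj \<alpha>1)"
    by (simp add: j_def su_den_def algebra_simps)
  have fraction: "(\<alpha>1 - w * cnj \<alpha>1) / j / 2 * cnj (a * \<alpha>1 + b * cnj \<alpha>1)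
      = (\<alpha>1 - w * cnj \<alpha>1) * cnj \<alpha>1 / 2 + cnj b * (\<alpha>1 - w * cnj \<alpha>1)\<^sup>2 / (2 * j)"
    unfolding \<alpha>2 using j by (simp add: field_simps power2_eq_square)
  have phase: "\<i> * of_real (Im (\<alpha>1 * cnj \<alpha>0)) = (\<alpha> * cnj \<alpha>0 - cnj \<alpha> * \<alpha>0) / 2"
    unfolding Im_eq_cnj \<alpha>1_def by (simp add: field_simps)
  have quad: "z / 2 * cnj \<alpha>0 - (\<alpha>1 - w * cnj \<alpha>1) * cnj \<alpha>1 / 2 + (\<alpha> * cnj \<alpha>0 - cnj \<alpha> * \<alpha>0) / 2
      = - \<alpha> * cnj \<alpha> / 2 + (cnj \<alpha>)\<^sup>2 * w / 2 - z * cnj \<alpha>"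
    unfolding \<alpha>1_def by (subst (1 2) z) (simp add: field_simps power2_eq_square)
  have e: "z / 2 * cnj \<alpha>0 - (\<alpha>1 - w * cnj \<alpha>1) / j / 2 * cnj (a * \<alpha>1 + b * cnj \<alpha>1)
      + \<i> * of_real (Im (\<alpha>1 * cnj \<alpha>0))
      = - \<alpha> * cnj \<alpha> / 2 + (cnj \<alpha>)\<^sup>2 * w / 2 - z * cnj \<alpha>
            - cnj b * (\<alpha>1 - w * cnj \<alpha>1)\<^sup>2 / (2 * j)"
    unfolding fraction phase using quad by (simp add: algebra_simps)
  have "jacobi_lambda k (su_mat a b) \<alpha> (z, w) = j powr (- of_real (2 * k))
      * exp (z / 2 * cnj \<alpha>0 - (\<alpha>1 - w * cnj \<alpha>1) / j / 2 * cnj (a * \<alpha>1 + b * cnj \<alpha>1))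
      * exp (\<i> * of_real (Im (\<alpha>1 * cnj \<alpha>0)))"
    by (simp only: jacobi_lambda.simps Let_def su_mat_nth jacobi_act_su_mat fst_conv N[symmetric]
        \<alpha>0_def[symmetric] \<alpha>1_def[symmetric] j_def[symmetric])
       (simp add: j_def su_den_def add.commute)
  then show ?thesis
    unfolding mult.assoc exp_add[symmetric] e powr_neg_double[OF k j]
    by (simp add: jacobi_mult_factor_def N j_def)
qed

declare jacobi_lambda.simps [simp del]

lemma jacobi_mult_factor_nonzero:
  assumes "su_pair a b" "cmod w < 1"
  shows "jacobi_mult_factor n a b \<alpha> z w \<noteq> 0"
  using su_den_nonzero[OF assms] by (simp add: jacobi_mult_factor_def)

lemma jacobi_cocycle_eq:
  assumes "2 * k = real n" "su_pair a b" "cmod w < 1"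
  shows "jacobi_cocycle k (su_mat a b, \<alpha>, t) (z, w)
    = inverse (exp (\<i> * of_real t) * jacobi_mult_factor n a b \<alpha> z w)"
  by (simp add: jacobi_lambda_eq[OF assms])

declare jacobi_cocycle.simps [simp del]

lemma jacobi_cocycle_nonzero:
  assumes "2 * k = real n" "h \<in> carrier jacobi_group" "x \<in> jacobi_disk"
  shows "jacobi_cocycle k h x \<noteq> 0"
  using assms
  by (cases x) (auto elim!: jacobi_carrierE simp: jacobi_cocycle_eq jacobi_mult_factor_nonzero)

section \<open>The cocycle identity\<close>

lemma su_den_mult:
  assumes "su_den c d w \<noteq> 0"
  shows "su_den a b ((c * w + d) / su_den c d w)
    = su_den (a * c + b * cnj d) (a * d + b * cnj c) w / su_den c d w"
proof -
  have "cnj b * (c * w + d) + cnj a * su_den c d w = su_den (a * c + b * cnj d) (a * d + b * cnj c) w"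
    by (simp add: su_den_def algebra_simps)
  with assms show ?thesis
    by (simp add: su_den_def[of a b] field_simps)
qed

text \<open>On the level of the group: translating by g.\<gamma> after g is the same as translating
  by \<gamma> before g, where g.\<gamma> = c \<gamma> + d cnj \<gamma>.\<close>

lemma shift_act:
  assumes "su_pair c d" "su_den c d w \<noteq> 0"
  shows "(c * \<gamma> + d * cnj \<gamma>) - cnj (c * \<gamma> + d * cnj \<gamma>) * ((c * w + d) / su_den c d w)
    = (\<gamma> - cnj \<gamma> * w) / su_den c d w"
proof -
  have "(c * \<gamma> + d * cnj \<gamma>) * su_den c d w - cnj (c * \<gamma> + d * cnj \<gamma>) * (c * w + d)
      = (c * cnj c - d * cnj d) * (\<gamma> - cnj \<gamma> * w)"
    by (simp add: su_den_def algebra_simps)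
  then have "(c * \<gamma> + d * cnj \<gamma>) * su_den c d w - cnj (c * \<gamma> + d * cnj \<gamma>) * (c * w + d)
      = \<gamma> - cnj \<gamma> * w"
    using assms(1) by (simp add: su_pair_def)
  then show ?thesis
    using assms(2) by (simp add: field_simps)
qed

lemma su_twist_inverse:
  assumes "su_pair c d"
  shows "c * (cnj c * \<alpha> - d * cnj \<alpha>) + d * cnj (cnj c * \<alpha> - d * cnj \<alpha>) = \<alpha>"
proof -
  have "c * (cnj c * \<alpha> - d * cnj \<alpha>) + d * cnj (cnj c * \<alpha> - d * cnj \<alpha>) = (c * cnj c - d * cnj d) * \<alpha>"
    by (simp add: algebra_simps)
  then show ?thesis
    using assms by (simp add: su_pair_def)
qed

lemma jacobi_act_mult:
  assumes "h1 \<in> carrier jacobi_group" "h2 \<in> carrier jacobi_group" "x \<in> jacobi_disk"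
  shows "jacobi_act (h1 \<otimes>\<^bsub>jacobi_group\<^esub> h2) x = jacobi_act h1 (jacobi_act h2 x)"
proof -
  obtain a b \<alpha> s where h1: "h1 = (su_mat a b, \<alpha>, s)" "su_pair a b"
    using assms by (elim jacobi_carrierE)
  obtain c d \<beta> t where h2: "h2 = (su_mat c d, \<beta>, t)" "su_pair c d"
    using assms by (elim jacobi_carrierE)
  obtain z w where x: "x = (z, w)" and w: "cmod w < 1"
    using assms(3) by (cases x) auto
  have j: "su_den c d w \<noteq> 0"
    by (rule su_den_nonzero[OF h2(2) w])
  define \<gamma> where "\<gamma> = cnj c * \<alpha> - d * cnj \<alpha>"
  have \<alpha>: "\<alpha> = c * \<gamma> + d * cnj \<gamma>"
    using su_twist_inverse[OF h2(2)] by (simp add: \<gamma>_def)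
  have 1: "\<alpha> - cnj \<alpha> * ((c * w + d) / su_den c d w) + (\<beta> - cnj \<beta> * w + z) / su_den c d w
      = ((\<gamma> + \<beta>) - cnj (\<gamma> + \<beta>) * w + z) / su_den c d w"
    unfolding \<alpha> shift_act[OF h2(2) j] by (simp add: diff_divide_distrib add_divide_distrib algebra_simps)
  have 2: "a * ((c * w + d) / su_den c d w) + b
      = ((a * c + b * cnj d) * w + (a * d + b * cnj c)) / su_den c d w"
    using j by (simp add: su_den_def field_simps)
  show ?thesis
    unfolding h1 h2 x jacobi_mult[OF h2(2)] jacobi_act_su_mat su_den_mult[OF j] 1 2 \<gamma>_def[symmetric]
    using j by simp
qed

text \<open>Here \<gamma> is the inverse of the second matrix applied to \<alpha>, as in the group
  law, and the phase is the central coordinate which that law produces. The quadratic fractions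
  combine by \<open>bl\<close>, a form of the determinant condition; what remains has the single
  denominator \<open>j\<close> and is the polynomial identity \<open>poly\<close>.\<close>

lemma jacobi_mult_factor_mult:
  assumes ab: "su_pair a b" and cd: "su_pair c d" and w: "cmod w < 1"
    and zw: "z' = (\<beta> - cnj \<beta> * w + z) / su_den c d w" "w' = (c * w + d) / su_den c d w"
    and \<alpha>: "\<alpha> = c * \<gamma> + d * cnj \<gamma>"
  shows "jacobi_mult_factor n a b \<alpha> z' w' * jacobi_mult_factor n c d \<beta> z w
    = exp (\<i> * of_real (Im (\<gamma> * cnj \<beta>)))
      * jacobi_mult_factor n (a * c + b * cnj d) (a * d + b * cnj c) (\<gamma> + \<beta>) z w"
proof -
  define j where "j = su_den c d w"
  define l where "l = su_den (a * c + b * cnj d) (a * d + b * cnj c) w"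
  define N where "N = (\<gamma> + \<beta>) - cnj (\<gamma> + \<beta>) * w + z"
  define M where "M = \<beta> - cnj \<beta> * w + z"
  have j: "j \<noteq> 0" and l: "l \<noteq> 0"
    by (simp_all add: j_def l_def su_den_nonzero ab cd w su_pair_mult)
  have NM: "N = \<gamma> - cnj \<gamma> * w + M"
    by (simp add: N_def M_def algebra_simps)
  have den: "su_den a b w' = l / j"
    using j unfolding zw j_def l_def by (rule su_den_mult)
  have num: "\<alpha> - cnj \<alpha> * w' + z' = N / j"
    using shift_act[OF cd j[unfolded j_def], of \<gamma>]
    unfolding zw \<alpha> j_def[symmetric] NM M_def[symmetric] by (simp add: add_divide_distrib)
  have bl: "cnj b + cnj d * l = cnj (a * d + b * cnj c) * j"
  proof -
    have "cnj b * (c * cnj c - d * cnj d) + cnj d * l = cnj (a * d + b * cnj c) * j"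
      by (simp add: l_def j_def su_den_def algebra_simps)
    then show ?thesis
      using cd by (simp add: su_pair_def)
  qed
  \<comment> \<open>Partial fractions: the denominator \<open>l\<close> of the product is separated
    from the denominator \<open>j\<close> of the inner factor.\<close>
  have frac: "cnj b * (N / j)\<^sup>2 / (2 * (l / j)) = cnj (a * d + b * cnj c) * N\<^sup>2 / (2 * l) - cnj d * N\<^sup>2 / (2 * j)"
  proof -
    have 1: "cnj b = cnj (a * d + b * cnj c) * j - cnj d * l"
      using bl by (simp add: algebra_simps)
    have "(B * j - D * l) * (N / j)\<^sup>2 / (2 * (l / j)) = B * N\<^sup>2 / (2 * l) - D * N\<^sup>2 / (2 * j)" for B D
      using j l by (simp add: field_simps power2_eq_square)
    then show ?thesis
      by (subst 1)
  qed
  have jw: "cnj d * w + cnj c = j"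
    by (simp add: j_def su_den_def)
  have poly: "- \<alpha> * cnj \<alpha> * j + (cnj \<alpha>)\<^sup>2 * (c * w + d) - 2 * M * cnj \<alpha> + cnj d * N\<^sup>2 - cnj d * M\<^sup>2
      = (- \<gamma> * cnj \<gamma> + (cnj \<gamma>)\<^sup>2 * w - 2 * M * cnj \<gamma>) * j"
  proof -
    have 1: "- \<alpha> * j + cnj \<alpha> * (c * w + d) = - (\<gamma> - cnj \<gamma> * w)"
      using shift_act[OF cd j[unfolded j_def], of \<gamma>] j
      unfolding \<alpha>[symmetric] j_def[symmetric] by (simp add: field_simps)
    have 2: "cnj \<alpha> = cnj \<gamma> * j + cnj d * (\<gamma> - cnj \<gamma> * w)"
      unfolding \<alpha> jw[symmetric] by (simp add: algebra_simps)
    have "- \<alpha> * cnj \<alpha> * j + (cnj \<alpha>)\<^sup>2 * (c * w + d) = cnj \<alpha> * (- \<alpha> * j + cnj \<alpha> * (c * w + d))"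
      by (simp add: algebra_simps power2_eq_square)
    also have "\<dots> = - cnj \<alpha> * (\<gamma> - cnj \<gamma> * w)"
      unfolding 1 by (simp add: algebra_simps)
    finally have 3: "- \<alpha> * cnj \<alpha> * j + (cnj \<alpha>)\<^sup>2 * (c * w + d) = - cnj \<alpha> * (\<gamma> - cnj \<gamma> * w)" .
    show ?thesis
      unfolding 3 unfolding 2 NM by (simp add: algebra_simps power2_eq_square)
  qed
  have E: "- \<alpha> * cnj \<alpha> / 2 + (cnj \<alpha>)\<^sup>2 * w' / 2 - z' * cnj \<alpha> - cnj b * (N / j)\<^sup>2 / (2 * (l / j))
      + (- \<beta> * cnj \<beta> / 2 + (cnj \<beta>)\<^sup>2 * w / 2 - z * cnj \<beta> - cnj d * M\<^sup>2 / (2 * j))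
      = \<i> * of_real (Im (\<gamma> * cnj \<beta>)) +
        (- (\<gamma> + \<beta>) * cnj (\<gamma> + \<beta>) / 2 + (cnj (\<gamma> + \<beta>))\<^sup>2 * w / 2 - z * cnj (\<gamma> + \<beta>)
         - cnj (a * d + b * cnj c) * N\<^sup>2 / (2 * l))"
  proof -
    have "- \<alpha> * cnj \<alpha> / 2 + (cnj \<alpha>)\<^sup>2 * w' / 2 - z' * cnj \<alpha> + cnj d * N\<^sup>2 / (2 * j) - cnj d * M\<^sup>2 / (2 * j)
      = (- \<alpha> * cnj \<alpha> * j + (cnj \<alpha>)\<^sup>2 * (c * w + d) - 2 * M * cnj \<alpha> + cnj d * N\<^sup>2 - cnj d * M\<^sup>2) / (2 * j)"
      unfolding zw j_def[symmetric] M_def[symmetric] using j by (simp add: field_simps)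
    also have "\<dots> = (- \<gamma> * cnj \<gamma> + (cnj \<gamma>)\<^sup>2 * w - 2 * M * cnj \<gamma>) / 2"
      unfolding poly using j by simp
    finally have "- \<alpha> * cnj \<alpha> / 2 + (cnj \<alpha>)\<^sup>2 * w' / 2 - z' * cnj \<alpha> + cnj d * N\<^sup>2 / (2 * j) - cnj d * M\<^sup>2 / (2 * j)
        = (- \<gamma> * cnj \<gamma> + (cnj \<gamma>)\<^sup>2 * w - 2 * M * cnj \<gamma>) / 2" .
    moreover have "A + p - q = B \<Longrightarrow> A = B - p + q" for A p q B :: complex
      by (simp add: algebra_simps)
    ultimately have 1: "- \<alpha> * cnj \<alpha> / 2 + (cnj \<alpha>)\<^sup>2 * w' / 2 - z' * cnj \<alpha>
        = (- \<gamma> * cnj \<gamma> + (cnj \<gamma>)\<^sup>2 * w - 2 * M * cnj \<gamma>) / 2 - cnj d * N\<^sup>2 / (2 * j) + cnj d * M\<^sup>2 / (2 * j)"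
      by blast
    have 2: "\<i> * of_real (Im (\<gamma> * cnj \<beta>)) = (\<gamma> * cnj \<beta> - cnj \<gamma> * \<beta>) / 2"
      unfolding Im_eq_cnj by (simp add: field_simps)
    show ?thesis
      unfolding 1 2 frac M_def by (simp add: field_simps power2_eq_square)
  qed
  have "jacobi_mult_factor n a b \<alpha> z' w' * jacobi_mult_factor n c d \<beta> z w
     = inverse ((l / j) ^ n) * inverse (j ^ n)
       * (exp (- \<alpha> * cnj \<alpha> / 2 + (cnj \<alpha>)\<^sup>2 * w' / 2 - z' * cnj \<alpha> - cnj b * (N / j)\<^sup>2 / (2 * (l / j)))
       * exp (- \<beta> * cnj \<beta> / 2 + (cnj \<beta>)\<^sup>2 * w / 2 - z * cnj \<beta> - cnj d * M\<^sup>2 / (2 * j)))"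
    unfolding jacobi_mult_factor_def den num j_def[symmetric] M_def[symmetric] by (simp only: ac_simps)
  also have "inverse ((l / j) ^ n) * inverse (j ^ n) = inverse (l ^ n)"
    using j l by (simp add: field_simps)
  finally have "jacobi_mult_factor n a b \<alpha> z' w' * jacobi_mult_factor n c d \<beta> z w
     = inverse (l ^ n) * (exp (\<i> * of_real (Im (\<gamma> * cnj \<beta>))) *
        exp (- (\<gamma> + \<beta>) * cnj (\<gamma> + \<beta>) / 2 + (cnj (\<gamma> + \<beta>))\<^sup>2 * w / 2 - z * cnj (\<gamma> + \<beta>)
         - cnj (a * d + b * cnj c) * N\<^sup>2 / (2 * l)))"
    unfolding exp_add[symmetric] E .
  then show ?thesis
    unfolding jacobi_mult_factor_def l_def[symmetric] N_def[symmetric]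
    by (simp only: mult.left_commute)
qed

lemma jacobi_cocycle_mult:
  assumes k: "2 * k = real n" and h: "h1 \<in> carrier jacobi_group" "h2 \<in> carrier jacobi_group" "x \<in> jacobi_disk"
  shows "jacobi_cocycle k (h1 \<otimes>\<^bsub>jacobi_group\<^esub> h2) x
    = jacobi_cocycle k h1 (jacobi_act h2 x) * jacobi_cocycle k h2 x"
proof -
  obtain a b \<alpha> s where h1: "h1 = (su_mat a b, \<alpha>, s)" "su_pair a b"
    using h by (elim jacobi_carrierE)
  obtain c d \<beta> t where h2: "h2 = (su_mat c d, \<beta>, t)" "su_pair c d"
    using h by (elim jacobi_carrierE)
  obtain z w where x: "x = (z, w)" and w: "cmod w < 1"
    using h(3) by (cases x) auto
  define \<gamma> where "\<gamma> = cnj c * \<alpha> - d * cnj \<alpha>"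
  have \<alpha>: "\<alpha> = c * \<gamma> + d * cnj \<gamma>"
    using su_twist_inverse[OF h2(2)] by (simp add: \<gamma>_def)
  note J = jacobi_cocycle_eq[OF k]
  have e: "exp (\<i> * of_real (s + t + Im (\<gamma> * cnj \<beta>)))
      = exp (\<i> * of_real s) * exp (\<i> * of_real t) * exp (\<i> * of_real (Im (\<gamma> * cnj \<beta>)))"
    by (simp only: of_real_add distrib_left exp_add)
  show ?thesis
    unfolding h1 h2 x jacobi_mult[OF h2(2)] jacobi_act_su_mat \<gamma>_def[symmetric]
    unfolding J[OF h1(2) moebius_in_disk[OF h2(2) w]] J[OF h2(2) w]
      J[OF su_pair_mult[OF h1(2) h2(2)] w] e inverse_mult_distrib[symmetric] mult.assoc
      jacobi_mult_factor_mult[OF h1(2) h2(2) w refl refl \<alpha>, of n \<beta> z, symmetric]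
    by (simp only: ac_simps)
qed

section \<open>Covariance of the kernel and transitivity of the action\<close>

lemma one_minus_nonzero:
  fixes w v :: complex
  assumes "cmod w < 1" "cmod v < 1"
  shows "1 - w * cnj v \<noteq> 0"
proof
  assume "1 - w * cnj v = 0"
  then have "cmod w * cmod v = 1"
    by (metis complex_mod_cnj eq_iff_diff_eq_0 norm_mult norm_one)
  moreover have "cmod w * cmod v \<le> cmod w"
    using assms by (simp add: mult_left_le)
  ultimately show False
    using assms by simp
qed

lemma jacobi_kernel_eq:
  assumes "2 * k = real n" "cmod w < 1" "cmod v < 1"
  shows "jacobi_kernel k (z, w) (y, v) = inverse ((1 - w * cnj v) ^ n)
    * exp ((2 * cnj y * z + z\<^sup>2 * cnj v + (cnj y)\<^sup>2 * w) / (2 * (1 - w * cnj v)))"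
  unfolding jacobi_kernel.simps powr_neg_double[OF assms(1) one_minus_nonzero[OF assms(2,3)]] ..

declare jacobi_kernel.simps [simp del]

text \<open>\<open>M\<close> is the conjugated numerator of the second point. Substituting
  \<open>b1\<close> and \<open>b2\<close> splits the exponent at the image points into a part over
  \<open>e\<close> and two automorphy fractions (\<open>fr\<close>), which cancel those of the
  factors; \<open>poly\<close> accounts for the translation.\<close>

lemma jacobi_kernel_factor:
  assumes ab: "su_pair a b" and w: "cmod w < 1" and v: "cmod v < 1" and k: "2 * k = real n"
  shows "jacobi_mult_factor n a b \<alpha> z w * cnj (jacobi_mult_factor n a b \<alpha> y v)
    * jacobi_kernel k (jacobi_act (su_mat a b, \<alpha>, s) (z, w)) (jacobi_act (su_mat a b, \<alpha>, s) (y, v))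
    = jacobi_kernel k (z, w) (y, v)"
proof -
  define j where "j = su_den a b w"
  define l where "l = cnj (su_den a b v)"
  define N where "N = \<alpha> - cnj \<alpha> * w + z"
  define M where "M = cnj \<alpha> - \<alpha> * cnj v + cnj y"
  define e where "e = 1 - w * cnj v"
  have j: "j \<noteq> 0" and l: "l \<noteq> 0" and e: "e \<noteq> 0"
    using su_den_nonzero[OF ab w] su_den_nonzero[OF ab v] one_minus_nonzero[OF w v]
    by (simp_all add: j_def l_def e_def)
  have M: "cnj (\<alpha> - cnj \<alpha> * v + y) = M"
    by (simp add: M_def)
  have e': "1 - (a * w + b) / j * cnj ((a * v + b) / su_den a b v) = e / (j * l)"
    using moebius_kernel[OF ab] j l by (simp add: j_def l_def e_def)
  have c: "cnj ((a * v + b) / su_den a b v) = (cnj a * cnj v + cnj b) / l"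
      "cnj ((\<alpha> - cnj \<alpha> * v + y) / su_den a b v) = M / l"
    by (simp_all add: l_def M_def)
  have det: "a * cnj a - b * cnj b = 1"
    using ab by (simp add: su_pair_def)
  have b1: "(cnj a * cnj v + cnj b) = cnj b * e + cnj v * j"
    by (simp add: e_def j_def su_den_def algebra_simps)
  have b2: "a * w + b = b * e + w * l"
    by (simp add: e_def l_def su_den_def algebra_simps)
  have fr: "(2 * (M / l) * (N / j) + (N / j)\<^sup>2 * ((cnj a * cnj v + cnj b) / l) + (M / l)\<^sup>2 * ((a * w + b) / j))
      / (2 * (e / (j * l)))
    = (2 * M * N + N\<^sup>2 * cnj v + M\<^sup>2 * w) / (2 * e) + cnj b * N\<^sup>2 / (2 * j) + b * M\<^sup>2 / (2 * l)"
    unfolding b1 b2 using j l e by (simp add: field_simps power2_eq_square)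
  have poly: "2 * M * N + N\<^sup>2 * cnj v + M\<^sup>2 * w
     = (2 * cnj y * z + z\<^sup>2 * cnj v + (cnj y)\<^sup>2 * w)
       - 2 * e * (- \<alpha> * cnj \<alpha> / 2 + (cnj \<alpha>)\<^sup>2 * w / 2 - z * cnj \<alpha> + (- \<alpha> * cnj \<alpha> / 2 + \<alpha>\<^sup>2 * cnj v / 2 - cnj y * \<alpha>))"
    by (simp add: M_def N_def e_def field_simps power2_eq_square)
  have E: "(- \<alpha> * cnj \<alpha> / 2 + (cnj \<alpha>)\<^sup>2 * w / 2 - z * cnj \<alpha> - cnj b * N\<^sup>2 / (2 * j))
      + (- cnj \<alpha> * \<alpha> / 2 + \<alpha>\<^sup>2 * cnj v / 2 - cnj y * \<alpha> - b * M\<^sup>2 / (2 * l))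
      + (2 * (M / l) * (N / j) + (N / j)\<^sup>2 * ((cnj a * cnj v + cnj b) / l) + (M / l)\<^sup>2 * ((a * w + b) / j))
      / (2 * (e / (j * l)))
    = (2 * cnj y * z + z\<^sup>2 * cnj v + (cnj y)\<^sup>2 * w) / (2 * e)"
    unfolding fr poly using e by (simp add: diff_divide_distrib)
  have f1: "jacobi_mult_factor n a b \<alpha> z w = inverse (j ^ n) * exp (- \<alpha> * cnj \<alpha> / 2 + (cnj \<alpha>)\<^sup>2 * w / 2 - z * cnj \<alpha> - cnj b * N\<^sup>2 / (2 * j))"
    by (simp add: jacobi_mult_factor_def j_def N_def)
  have f2: "cnj (jacobi_mult_factor n a b \<alpha> y v) = inverse (l ^ n) * exp (- cnj \<alpha> * \<alpha> / 2 + \<alpha>\<^sup>2 * cnj v / 2 - cnj y * \<alpha> - b * M\<^sup>2 / (2 * l))"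
    by (simp add: jacobi_mult_factor_def l_def exp_cnj M_def)
  have f3: "jacobi_kernel k (jacobi_act (su_mat a b, \<alpha>, s) (z, w)) (jacobi_act (su_mat a b, \<alpha>, s) (y, v))
    = inverse ((e / (j * l)) ^ n) * exp ((2 * (M / l) * (N / j) + (N / j)\<^sup>2 * ((cnj a * cnj v + cnj b) / l) + (M / l)\<^sup>2 * ((a * w + b) / j))
      / (2 * (e / (j * l))))"
    unfolding jacobi_act_su_mat jacobi_kernel_eq[OF k moebius_in_disk[OF ab w] moebius_in_disk[OF ab v]]
    unfolding j_def[symmetric] e' N_def[symmetric] unfolding c ..
  have p: "inverse (j ^ n) * (inverse (l ^ n) * inverse ((e / (j * l)) ^ n)) = inverse (e ^ n)"
    using j l e by (simp add: field_simps)
  have rearr: "inverse (j ^ n) * x1 * (inverse (l ^ n) * x2) * (inverse ((e / (j * l)) ^ n) * x3)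
     = inverse (j ^ n) * (inverse (l ^ n) * inverse ((e / (j * l)) ^ n)) * (x1 * x2 * x3)" for x1 x2 x3
    by (simp only: ac_simps)
  show ?thesis
    unfolding f1 f2 f3 rearr p exp_add[symmetric] E jacobi_kernel_eq[OF k w v] e_def[symmetric] ..
qed

lemma jacobi_kernel_act:
  assumes k: "2 * k = real n" and h: "h \<in> carrier jacobi_group" "x \<in> jacobi_disk" "y \<in> jacobi_disk"
  shows "jacobi_kernel k (jacobi_act h x) (jacobi_act h y)
    = jacobi_cocycle k h x * jacobi_kernel k x y * cnj (jacobi_cocycle k h y)"
proof -
  obtain a b \<alpha> s where h1: "h = (su_mat a b, \<alpha>, s)" "su_pair a b"
    using h by (elim jacobi_carrierE)
  obtain z w where x: "x = (z, w)" and w: "cmod w < 1"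
    using h by (cases x) auto
  obtain z' v where y: "y = (z', v)" and v: "cmod v < 1"
    using h by (cases y) auto
  \<comment> \<open>The central phase is unimodular and meets its own conjugate.\<close>
  have phase: "exp (\<i> * of_real s) * cnj (exp (\<i> * of_real s)) = 1"
    by (simp add: exp_cnj exp_minus)
  show ?thesis
    unfolding h1 x y jacobi_cocycle_eq[OF k h1(2) w] jacobi_cocycle_eq[OF k h1(2) v]
      jacobi_kernel_factor[OF h1(2) w v k, where s = s and \<alpha> = \<alpha>, symmetric]
    using jacobi_mult_factor_nonzero[OF h1(2) w, of n \<alpha> z] jacobi_mult_factor_nonzero[OF h1(2) v, of n \<alpha> z'] phase
    by (simp add: field_simps)
qed

lemma jacobi_kernel_sym:
  assumes k: "2 * k = real n" and "x \<in> jacobi_disk" "y \<in> jacobi_disk"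
  shows "jacobi_kernel k y x = cnj (jacobi_kernel k x y)"
  using assms by (cases x, cases y) (simp add: jacobi_kernel_eq exp_cnj algebra_simps)

lemma jacobi_kernel_zero:
  assumes k: "2 * k = real n" and "x \<in> jacobi_disk"
  shows "jacobi_kernel k x (0, 0) = 1"
  using assms by (cases x) (simp add: jacobi_kernel_eq)

text \<open>At the origin the denominator is cnj a = \<open>r\<close>, so b = w r and \<alpha> = z r
  hit the target; \<open>r\<close> is then fixed by the determinant condition.\<close>

lemma jacobi_transitive:
  assumes "x \<in> jacobi_disk"
  obtains h where "h \<in> carrier jacobi_group" "jacobi_act h (0, 0) = x"
proof -
  obtain z w where x: "x = (z, w)" and w: "cmod w < 1"
    using assms by (cases x) auto
  define r where "r = 1 / sqrt (1 - (cmod w)\<^sup>2)"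
  have w2: "(cmod w)\<^sup>2 < 1"
    using w by (simp add: abs_square_less_1)
  have r: "r > 0"
    using w2 by (simp add: r_def)
  have r2: "r\<^sup>2 * (1 - (cmod w)\<^sup>2) = 1"
    using w2 by (simp add: r_def power_divide)
  have "su_pair (of_real r) (w * of_real r)"
    using r2 r by (simp add: su_pair_cmod norm_mult power_mult_distrib algebra_simps)
  then show thesis
    using r by (intro that[of "(su_mat (of_real r) (w * of_real r), z * of_real r, 0)"])
      (auto simp: jacobi_act_su_mat su_den_def x)
qed

section \<open>The invariant measure\<close>

text \<open>The change of variables theorem speaks of \<open>real^'n\<close> and of the determinant
  of a matrix; this identification carries it to the complex plane.\<close>

definition complex_of_vec :: "real^2 \<Rightarrow> complex" where
  "complex_of_vec v = Complex (v $ 1) (v $ 2)"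

definition vec_of_complex :: "complex \<Rightarrow> real^2" where
  "vec_of_complex z = vector [Re z, Im z]"

lemma complex_of_vec_inverse [simp]: "vec_of_complex (complex_of_vec v) = v"
  by (simp add: complex_of_vec_def vec_of_complex_def vec_eq_iff forall_2)

lemma vec_of_complex_inverse [simp]: "complex_of_vec (vec_of_complex z) = z"
  by (simp add: complex_of_vec_def vec_of_complex_def complex_eq_iff)

lemma linear_complex_of_vec: "linear complex_of_vec"
  by (rule linearI) (simp_all add: complex_of_vec_def complex_eq_iff)

lemma linear_vec_of_complex: "linear vec_of_complex"
  by (rule linearI) (simp_all add: vec_of_complex_def vec_eq_iff forall_2)

lemma measurable_complex_of_vec [measurable]: "complex_of_vec \<in> borel_measurable borel"
  by (intro borel_measurable_continuous_onI linear_continuous_on linear_conv_bounded_linear[THEN iffD1] linear_complex_of_vec)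

lemma prod_Basis_real2: "(\<Prod>b\<in>Basis. f b) = f (axis 1 1) * f (axis 2 (1::real) :: real^2)"
proof -
  have Basis: "(Basis :: (real^2) set) = {axis 1 1, axis 2 1}"
    unfolding Basis_vec_def UNIV_2 by auto
  have "axis 1 1 \<noteq> (axis 2 1 :: real^2)"
    by (simp add: axis_eq_axis)
  then show ?thesis
    unfolding Basis by (subst prod.insert) auto
qed

lemma distr_lborel_complex_of_vec: "distr lborel borel complex_of_vec = lborel"
proof (rule lborel_eqI[symmetric])
  fix l u :: complex
  assume lu: "\<And>b. b \<in> Basis \<Longrightarrow> l \<bullet> b \<le> u \<bullet> b"
  have le: "vec_of_complex l \<bullet> b \<le> vec_of_complex u \<bullet> b" if "b \<in> Basis" for b
    using that lu[of 1] lu[of \<i>] unfolding Basis_vec_def UNIV_2 Basis_complex_def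
    by (auto simp: inner_axis vec_of_complex_def)
  have "complex_of_vec -` box l u = box (vec_of_complex l) (vec_of_complex u)"
    by (auto simp: complex_of_vec_def vec_of_complex_def in_box_complex_iff mem_box_cart forall_2)
  then have "emeasure (distr lborel borel complex_of_vec) (box l u)
      = emeasure lborel (box (vec_of_complex l) (vec_of_complex u))"
    by (simp add: emeasure_distr)
  also have "\<dots> = (\<Prod>b\<in>Basis. (u - l) \<bullet> b)"
    using le by (simp add: emeasure_lborel_box prod_Basis_real2 inner_axis vec_of_complex_def Basis_complex_def inner_diff_left)
  finally show "emeasure (distr lborel borel complex_of_vec) (box l u) = ennreal (\<Prod>b\<in>Basis. (u - l) \<bullet> b)" .
qed simp

lemma det_matrix_complex_mult:
  "det (matrix (\<lambda>h. vec_of_complex (c * complex_of_vec h))) = (cmod c)\<^sup>2"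
  unfolding cmod_power2
  by (simp add: det_2 matrix_def vec_of_complex_def complex_of_vec_def axis_def power2_eq_square)

text \<open>The area formula: multiplication by f' has the real Jacobian determinant |f'|^2.
  Boundedness gives the image finite measure, as the change of variables theorem requires.\<close>

lemma emeasure_holomorphic_image:
  fixes f f' :: "complex \<Rightarrow> complex"
  assumes E: "E \<in> sets borel" and fE: "f ` E \<in> sets borel" "bounded (f ` E)"
    and f': "\<And>z. z \<in> E \<Longrightarrow> (f has_field_derivative f' z) (at z)"
    and inj: "inj_on f E" and [measurable]: "f' \<in> borel_measurable borel"
  shows "emeasure lborel (f ` E) = (\<integral>\<^sup>+z. ennreal ((cmod (f' z))\<^sup>2) * indicator E z \<partial>lborel)"
proof -
  define E' where "E' = complex_of_vec -` E"
  define F where "F = (\<lambda>v. vec_of_complex (f (complex_of_vec v)))"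
  define F' where "F' = (\<lambda>v h. vec_of_complex (f' (complex_of_vec v) * complex_of_vec h))"
  note [measurable] = E fE(1)
  have E': "E' \<in> sets borel"
    using measurable_sets[OF measurable_complex_of_vec E] by (simp add: E'_def)
  have FE': "F ` E' = complex_of_vec -` (f ` E)"
  proof
    show "complex_of_vec -` (f ` E) \<subseteq> F ` E'"
    proof
      fix v assume "v \<in> complex_of_vec -` (f ` E)"
      then obtain z where z: "z \<in> E" "complex_of_vec v = f z"
        by auto
      have "v = F (vec_of_complex z)"
        unfolding F_def vec_of_complex_inverse z(2)[symmetric] complex_of_vec_inverse ..
      moreover have "vec_of_complex z \<in> E'"
        unfolding E'_def vimage_eq vec_of_complex_inverse by fact
      ultimately show "v \<in> F ` E'"
        by blast
    qed
  qed (auto simp: F_def E'_def)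
  have FE'b: "F ` E' \<in> sets borel"
    unfolding FE' using measurable_sets[OF measurable_complex_of_vec fE(1)] by simp
  have bl: "bounded_linear vec_of_complex" "bounded_linear complex_of_vec"
    using linear_conv_bounded_linear linear_vec_of_complex linear_complex_of_vec by blast+
  have der: "(F has_derivative F' v) (at v within E')" if "v \<in> E'" for v
  proof -
    have "(f has_derivative (*) (f' (complex_of_vec v))) (at (complex_of_vec v))"
      using f' that by (simp add: E'_def has_field_derivative_def)
    from has_derivative_compose[OF bounded_linear.has_derivative[OF bl(2) has_derivative_ident] this]
    have "((\<lambda>v. f (complex_of_vec v)) has_derivative (\<lambda>h. f' (complex_of_vec v) * complex_of_vec h)) (at v within E')"
      by simp
    from bounded_linear.has_derivative[OF bl(1) this] show ?thesis
      by (simp add: F_def F'_def)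
  qed
  have injF: "inj_on F E'"
  proof (rule inj_onI)
    fix u v assume uv: "u \<in> E'" "v \<in> E'" "F u = F v"
    then have "f (complex_of_vec u) = f (complex_of_vec v)"
      unfolding F_def by (metis vec_of_complex_inverse)
    then have "complex_of_vec u = complex_of_vec v"
      using inj uv by (simp add: E'_def inj_on_eq_iff)
    then show "u = v"
      by (metis complex_of_vec_inverse)
  qed
  have bF: "bounded (F ` E')"
  proof -
    have "F ` E' \<subseteq> vec_of_complex ` (f ` E)"
      by (auto simp: F_def E'_def)
    then show ?thesis
      using bounded_linear_image[OF fE(2) bl(1)] bounded_subset by blast
  qed
  have lm: "F ` E' \<in> lmeasurable"
    using bounded_set_imp_lmeasurable[OF bF] FE'b by (simp add: sets_completionI_sets)
  define m where "m = measure lebesgue (F ` E')"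
  have "((\<lambda>x. \<bar>det (matrix (F' x))\<bar>) has_integral m) E'"
    using has_measure_differentiable_image[of E' F F' m] E' der injF lm m_def
    by (simp add: sets_completionI_sets)
  then have hi: "((\<lambda>x. (cmod (f' (complex_of_vec x)))\<^sup>2) has_integral m) E'"
    by (simp add: F'_def det_matrix_complex_mult)
  have "emeasure lborel (f ` E) = emeasure (distr lborel borel complex_of_vec) (f ` E)"
    by (simp only: distr_lborel_complex_of_vec)
  also have "\<dots> = emeasure lborel (F ` E')"
    by (simp add: emeasure_distr FE')
  also have "\<dots> = emeasure lebesgue (F ` E')"
    using FE'b by simp
  also have "\<dots> = ennreal m"
    using lm by (simp add: m_def emeasure_eq_measure2)
  also have "\<dots> = (\<integral>\<^sup>+v. ennreal ((cmod (f' (complex_of_vec v)))\<^sup>2) * indicator E' v \<partial>lborel)"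
    using nn_integral_has_integral_lebesgue'[OF _ hi] by simp
  also have "\<dots> = (\<integral>\<^sup>+z. ennreal ((cmod (f' z))\<^sup>2) * indicator E z \<partial>distr lborel borel complex_of_vec)"
    by (subst nn_integral_distr) (auto intro!: nn_integral_cong simp: E'_def indicator_def)
  finally show ?thesis
    by (simp only: distr_lborel_complex_of_vec)
qed

text \<open>Lebesgue measure is determined by its values on boxes, and a box is the image of its
  preimage under the affine map, to which the area formula applies.\<close>

lemma nn_integral_complex_affine:
  fixes c d :: complex and g :: "complex \<Rightarrow> ennreal"
  assumes c: "c \<noteq> 0" and [measurable]: "g \<in> borel_measurable borel"
  shows "(\<integral>\<^sup>+z. g z \<partial>lborel) = ennreal ((cmod c)\<^sup>2) * (\<integral>\<^sup>+z. g (c * z + d) \<partial>lborel)"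
proof -
  have "lborel = density (distr lborel borel (\<lambda>z. c * z + d)) (\<lambda>_. ennreal ((cmod c)\<^sup>2))"
  proof (rule lborel_eqI)
    fix l u :: complex
    assume lu: "\<And>b. b \<in> Basis \<Longrightarrow> l \<bullet> b \<le> u \<bullet> b"
    define E where "E = (\<lambda>z. c * z + d) -` box l u"
    have E: "E \<in> sets borel"
      unfolding E_def by (rule measurable_sets_borel[of _ borel]) auto
    have im: "(\<lambda>z. c * z + d) ` E = box l u"
    proof
      show "box l u \<subseteq> (\<lambda>z. c * z + d) ` E"
      proof
        fix y assume "y \<in> box l u"
        then show "y \<in> (\<lambda>z. c * z + d) ` E"
          using c by (intro image_eqI[of _ _ "(y - d) / c"]) (auto simp: E_def)
      qed
    qed (auto simp: E_def)
    have "emeasure lborel (box l u) = (\<integral>\<^sup>+z. ennreal ((cmod c)\<^sup>2) * indicator E z \<partial>lborel)"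
      unfolding im[symmetric]
      by (rule emeasure_holomorphic_image) (use E c im in \<open>auto simp: inj_on_def intro!: derivative_eq_intros\<close>)
    also have "\<dots> = ennreal ((cmod c)\<^sup>2) * emeasure lborel E"
      using E by (simp add: nn_integral_cmult)
    finally show "emeasure (density (distr lborel borel (\<lambda>z. c * z + d)) (\<lambda>_. ennreal ((cmod c)\<^sup>2))) (box l u)
        = ennreal (\<Prod>b\<in>Basis. (u - l) \<bullet> b)"
      using lu by (simp add: emeasure_density nn_integral_cmult emeasure_distr E_def)
  qed simp
  then have "(\<integral>\<^sup>+z. g z \<partial>lborel) = (\<integral>\<^sup>+z. g z \<partial>density (distr lborel borel (\<lambda>z. c * z + d)) (\<lambda>_. ennreal ((cmod c)\<^sup>2)))"
    by simp
  also have "\<dots> = ennreal ((cmod c)\<^sup>2) * (\<integral>\<^sup>+z. g (c * z + d) \<partial>lborel)"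
    by (simp add: nn_integral_density nn_integral_distr nn_integral_cmult)
  finally show ?thesis .
qed

section \<open>Moebius maps as changes of variables in the unit disk\<close>

lemma moebius_inverse:
  assumes ab: "su_pair a b" and w: "cmod w < 1"
  shows "(a * ((cnj a * w - b) / su_den (cnj a) (- b) w) + b) / su_den a b ((cnj a * w - b) / su_den (cnj a) (- b) w) = w"
proof -
  have p: "su_pair (cnj a) (- b)"
    by (rule su_pair_inv[OF ab])
  have n: "su_den (cnj a) (- b) w \<noteq> 0"
    by (rule su_den_nonzero[OF p w])
  have 1: "su_den a b ((cnj a * w - b) / su_den (cnj a) (- b) w) = 1 / su_den (cnj a) (- b) w"
    using su_den_mult[OF n, of a b] ab by (simp add: su_den_def su_pair_def algebra_simps)
  have "a * (cnj a * w - b) + b * su_den (cnj a) (- b) w = (a * cnj a - b * cnj b) * w"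
    by (simp add: su_den_def algebra_simps)
  also have "\<dots> = w"
    using ab by (simp only: su_pair_def) simp
  finally have "a * (cnj a * w - b) + b * su_den (cnj a) (- b) w = w" .
  then have 2: "a * ((cnj a * w - b) / su_den (cnj a) (- b) w) + b = w / su_den (cnj a) (- b) w"
    using n by (metis add_divide_distrib nonzero_mult_div_cancel_right times_divide_eq_right)
  show ?thesis
    unfolding 1 2 using n by simp
qed

lemma moebius_deriv:
  assumes "su_pair a b" "cmod w < 1"
  shows "((\<lambda>w. (a * w + b) / su_den a b w) has_field_derivative 1 / (su_den a b w)\<^sup>2) (at w)"
proof -
  have "a * su_den a b w - (a * w + b) * cnj b = 1"
    using assms(1) by (simp add: su_den_def su_pair_def algebra_simps)
  moreover have "su_den a b w \<noteq> 0"
    using su_den_nonzero assms .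
  ultimately show ?thesis
    unfolding su_den_def by (auto intro!: derivative_eq_intros simp: power2_eq_square)
qed

lemma moebius_inj_on:
  assumes ab: "su_pair a b"
  shows "inj_on (\<lambda>w. (a * w + b) / su_den a b w) (ball 0 1)"
proof (rule inj_on_inverseI)
  fix w :: complex assume "w \<in> ball 0 1"
  then show "(\<lambda>w. (cnj a * w - b) / su_den (cnj a) (- b) w) ((a * w + b) / su_den a b w) = w"
    using moebius_inverse[OF su_pair_inv[OF ab], of w] by simp
qed

lemma measurable_moebius [measurable]:
  "(\<lambda>w. (a * w + b) / su_den a b w) \<in> borel_measurable borel" "su_den a b \<in> borel_measurable borel"
  unfolding su_den_def by measurable

text \<open>The derivative is the inverse square of \<open>su_den\<close>, so the area density is
  the inverse fourth power of its modulus. The two measures are compared on Borel sets first and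
  then integrated against \<open>g\<close>.\<close>

lemma nn_integral_moebius:
  fixes g :: "complex \<Rightarrow> ennreal"
  assumes ab: "su_pair a b" and [measurable]: "g \<in> borel_measurable borel"
  shows "(\<integral>\<^sup>+w\<in>ball 0 1. g ((a * w + b) / su_den a b w) * ennreal (1 / cmod (su_den a b w) ^ 4) \<partial>lborel)
    = (\<integral>\<^sup>+w\<in>ball 0 1. g w \<partial>lborel)"
proof -
  define m where "m = (\<lambda>w. (a * w + b) / su_den a b w)"
  define M1 where "M1 = distr (density lborel (\<lambda>w. ennreal (1 / cmod (su_den a b w) ^ 4) * indicator (ball 0 1) w)) borel m"
  define M2 where "M2 = density lborel (indicator (ball (0::complex) 1))"
  have [measurable]: "m \<in> borel_measurable borel"
    unfolding m_def by measurable
  have [measurable]: "ball (0::complex) 1 \<in> sets borel"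
    by simp
  have "M1 = M2"
  proof (rule measure_eqI)
    fix A assume "A \<in> sets M1"
    then have A[measurable]: "A \<in> sets borel"
      by (simp add: M1_def)
    define E where "E = ball 0 1 \<inter> m -` A"
    have mA[measurable]: "m -` A \<in> sets borel"
      by (rule measurable_sets_borel[OF _ A]) measurable
    have E[measurable]: "E \<in> sets borel"
      unfolding E_def by measurable
    have im: "m ` E = ball 0 1 \<inter> A"
    proof
      show "ball 0 1 \<inter> A \<subseteq> m ` E"
      proof
        fix w assume w: "w \<in> ball 0 1 \<inter> A"
        have "m ((cnj a * w - b) / su_den (cnj a) (- b) w) = w"
          using moebius_inverse[OF ab] w by (simp add: m_def)
        moreover have "(cnj a * w - b) / su_den (cnj a) (- b) w \<in> ball 0 1"
          using moebius_in_disk[OF su_pair_inv[OF ab], of w] w by simp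
        ultimately show "w \<in> m ` E"
          using w by (intro image_eqI[of _ _ "(cnj a * w - b) / su_den (cnj a) (- b) w"]) (auto simp: E_def)
      qed
    qed (use moebius_in_disk[OF ab] in \<open>auto simp: E_def m_def\<close>)
    have "emeasure lborel (m ` E) = (\<integral>\<^sup>+w. ennreal ((cmod (1 / (su_den a b w)\<^sup>2))\<^sup>2) * indicator E w \<partial>lborel)"
    proof (rule emeasure_holomorphic_image)
      show "m ` E \<in> sets borel" "bounded (m ` E)"
        unfolding im by (auto intro: bounded_subset[OF bounded_ball])
      show "inj_on m E"
        using moebius_inj_on[OF ab] unfolding m_def E_def by (rule inj_on_subset) auto
      show "(m has_field_derivative 1 / (su_den a b z)\<^sup>2) (at z)" if "z \<in> E" for z
        using moebius_deriv[OF ab, of z] that by (simp add: m_def E_def)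
    qed (use E in auto)
    moreover have "(cmod (1 / (su_den a b w)\<^sup>2))\<^sup>2 = 1 / cmod (su_den a b w) ^ 4" for w
      by (simp add: norm_divide norm_power power_divide flip: power_mult)
    ultimately have "emeasure lborel (ball 0 1 \<inter> A) = (\<integral>\<^sup>+w. ennreal (1 / cmod (su_den a b w) ^ 4) * indicator E w \<partial>lborel)"
      unfolding im by simp
    moreover have "emeasure M1 A = (\<integral>\<^sup>+w. ennreal (1 / cmod (su_den a b w) ^ 4) * indicator E w \<partial>lborel)"
      unfolding M1_def E_def
      by (subst emeasure_distr; (subst emeasure_density)?) (simp_all add: indicator_inter_arith mult.assoc)
    moreover have "emeasure M2 A = emeasure lborel (ball 0 1 \<inter> A)"
      unfolding M2_def by (subst emeasure_density) (simp_all flip: indicator_inter_arith)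
    ultimately show "emeasure M1 A = emeasure M2 A"
      by simp
  qed (simp add: M1_def M2_def)
  have "(\<integral>\<^sup>+w. g w \<partial>M1) = (\<integral>\<^sup>+w\<in>ball 0 1. g (m w) * ennreal (1 / cmod (su_den a b w) ^ 4) \<partial>lborel)"
    by (simp add: M1_def nn_integral_distr nn_integral_density ac_simps)
  moreover have "(\<integral>\<^sup>+w. g w \<partial>M2) = (\<integral>\<^sup>+w\<in>ball 0 1. g w \<partial>lborel)"
    by (simp add: M2_def nn_integral_density ac_simps)
  ultimately show ?thesis
    using \<open>M1 = M2\<close> by (simp add: m_def)
qed

section \<open>The invariant measure of the Jacobi disk\<close>

definition jacobi_measure :: "(complex \<times> complex) measure" where
  "jacobi_measure = density lborel (\<lambda>x. ennreal (1 / (1 - (cmod (snd x))\<^sup>2) ^ 3) * indicator jacobi_disk x)"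

lemma sets_jacobi_measure [simp, measurable_cong]: "sets jacobi_measure = sets borel"
  and space_jacobi_measure [simp]: "space jacobi_measure = UNIV"
  by (simp_all add: jacobi_measure_def)

lemma measurable_fst_snd_borel [measurable]:
  "fst \<in> borel_measurable (borel :: ('a::topological_space \<times> 'b::topological_space) measure)"
  "snd \<in> borel_measurable (borel :: ('a::topological_space \<times> 'b::topological_space) measure)"
  by (intro borel_measurable_continuous_onI continuous_intros)+

lemma jacobi_disk_open: "open jacobi_disk"
  unfolding jacobi_disk_def by (intro open_Times) auto

lemma jacobi_disk_borel [measurable]: "jacobi_disk \<in> sets borel"
  using jacobi_disk_open by simp

lemma measurable_jacobi_act [measurable]:
  "jacobi_act h \<in> borel_measurable borel"
proof -
  obtain g \<alpha> t where h: "h = (g, \<alpha>, t)"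
    by (cases h)
  have "jacobi_act h = (\<lambda>x. ((\<alpha> - cnj \<alpha> * snd x + fst x) / (cnj (g$1$2) * snd x + cnj (g$1$1)),
      (g$1$1 * snd x + g$1$2) / (cnj (g$1$2) * snd x + cnj (g$1$1))))"
    by (auto simp: h jacobi_act.simps Let_def fun_eq_iff)
  also have "\<dots> \<in> borel \<rightarrow>\<^sub>M borel \<Otimes>\<^sub>M borel"
    by (simp add: borel_prod[symmetric])
  finally show ?thesis
    by (simp add: borel_prod)
qed

lemma nn_integral_jacobi_measure:
  assumes [measurable]: "G \<in> borel_measurable borel"
  shows "(\<integral>\<^sup>+x. G x \<partial>jacobi_measure)
    = (\<integral>\<^sup>+w\<in>ball 0 1. ennreal (1 / (1 - (cmod w)\<^sup>2) ^ 3) * (\<integral>\<^sup>+z. G (z, w) \<partial>lborel) \<partial>lborel)"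
proof -
  have [measurable]: "ball (0::complex) 1 \<in> sets borel"
    by simp
  define H where "H = (\<lambda>x. ennreal (1 / (1 - (cmod (snd x))\<^sup>2) ^ 3) * indicator jacobi_disk x * G x)"
  have H: "H \<in> borel_measurable (lborel \<Otimes>\<^sub>M lborel)"
    unfolding H_def by (simp add: lborel_prod)
  have "(\<integral>\<^sup>+x. G x \<partial>jacobi_measure) = (\<integral>\<^sup>+x. H x \<partial>lborel)"
    unfolding jacobi_measure_def H_def by (subst nn_integral_density) simp_all
  also have "\<dots> = (\<integral>\<^sup>+w. (\<integral>\<^sup>+z. H (z, w) \<partial>lborel) \<partial>lborel)"
    unfolding lborel_prod[symmetric] by (rule lborel_pair.nn_integral_snd[symmetric, OF H])
  also have "\<dots> = (\<integral>\<^sup>+w\<in>ball 0 1. ennreal (1 / (1 - (cmod w)\<^sup>2) ^ 3) * (\<integral>\<^sup>+z. G (z, w) \<partial>lborel) \<partial>lborel)"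
  proof (rule nn_integral_cong)
    fix w :: complex
    have [measurable]: "(\<lambda>z. G (z, w)) \<in> borel_measurable borel"
      by (rule measurable_compose[OF _ assms]) (auto intro!: borel_measurable_continuous_onI continuous_intros)
    have "(\<integral>\<^sup>+z. H (z, w) \<partial>lborel) = (\<integral>\<^sup>+z. (ennreal (1 / (1 - (cmod w)\<^sup>2) ^ 3) * indicator (ball 0 1) w) * G (z, w) \<partial>lborel)"
      by (simp add: H_def jacobi_disk_def indicator_def)
    also have "\<dots> = (ennreal (1 / (1 - (cmod w)\<^sup>2) ^ 3) * indicator (ball 0 1) w) * (\<integral>\<^sup>+z. G (z, w) \<partial>lborel)"
      by (rule nn_integral_cmult) measurable
    finally show "(\<integral>\<^sup>+z. H (z, w) \<partial>lborel)
      = ennreal (1 / (1 - (cmod w)\<^sup>2) ^ 3) * (\<integral>\<^sup>+z. G (z, w) \<partial>lborel) * indicator (ball 0 1) w"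
      by (simp add: ac_simps)
  qed
  finally show ?thesis .
qed

text \<open>For fixed w the action is affine in z with factor 1 / \<open>su_den\<close>, which costs
  |\<open>su_den\<close>|^2; the Moebius map in w costs |\<open>su_den\<close>|^4. By
  \<open>moebius_norm\<close> the exponent 3 of the density absorbs exactly this sixth
  power.\<close>

lemma jacobi_measure_invariant:
  assumes "h \<in> carrier jacobi_group"
  shows "distr jacobi_measure borel (jacobi_act h) = jacobi_measure"
proof -
  obtain a b \<alpha> t where h: "h = (su_mat a b, \<alpha>, t)" and ab: "su_pair a b"
    using assms by (elim jacobi_carrierE)
  have [measurable]: "ball (0::complex) 1 \<in> sets borel"
    by simp
  \<comment> \<open>Invariance is shown for integrals, where the fibre over w can be integrated
    first; indicators give back the measures.\<close>
  have *: "(\<integral>\<^sup>+x. G (jacobi_act h x) \<partial>jacobi_measure) = (\<integral>\<^sup>+x. G x \<partial>jacobi_measure)"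
    if G[measurable]: "G \<in> borel_measurable borel" for G :: "_ \<Rightarrow> ennreal"
  proof -
    define L where "L = (\<lambda>w. ennreal (1 / (1 - (cmod w)\<^sup>2) ^ 3) * (\<integral>\<^sup>+z. G (z, w) \<partial>lborel))"
    have Gp[measurable]: "case_prod (\<lambda>w z. G (z, w)) \<in> borel_measurable (borel \<Otimes>\<^sub>M lborel)"
    proof -
      have "(\<lambda>p. G (snd p, fst p)) \<in> borel_measurable (borel \<Otimes>\<^sub>M borel)"
        by (rule measurable_compose[OF _ G]) (simp add: borel_prod[symmetric])
      then show ?thesis
        by (simp add: case_prod_beta' cong: measurable_cong_sets)
    qed
    have L[measurable]: "L \<in> borel_measurable borel"
      unfolding L_def using lborel.borel_measurable_nn_integral[OF Gp] by measurable
    have Gh: "(\<lambda>x. G (jacobi_act h x)) \<in> borel_measurable borel"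
      by measurable
    have "(\<integral>\<^sup>+x. G (jacobi_act h x) \<partial>jacobi_measure)
      = (\<integral>\<^sup>+w\<in>ball 0 1. ennreal (1 / (1 - (cmod w)\<^sup>2) ^ 3) * (\<integral>\<^sup>+z. G (jacobi_act h (z, w)) \<partial>lborel) \<partial>lborel)"
      by (rule nn_integral_jacobi_measure[OF Gh])
    also have "\<dots> = (\<integral>\<^sup>+w\<in>ball 0 1. L ((a * w + b) / su_den a b w) * ennreal (1 / cmod (su_den a b w) ^ 4) \<partial>lborel)"
    proof (intro nn_integral_cong)
      fix w :: complex
      show "ennreal (1 / (1 - (cmod w)\<^sup>2) ^ 3) * (\<integral>\<^sup>+z. G (jacobi_act h (z, w)) \<partial>lborel) * indicator (ball 0 1) w
        = L ((a * w + b) / su_den a b w) * ennreal (1 / cmod (su_den a b w) ^ 4) * indicator (ball 0 1) w"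
      proof (cases "cmod w < 1")
        case True
        define j where "j = su_den a b w"
        define v where "v = (a * w + b) / su_den a b w"
        have j: "j \<noteq> 0"
          using su_den_nonzero[OF ab True] by (simp add: j_def)
        have Gv[measurable]: "(\<lambda>z. G (z, v)) \<in> borel_measurable borel"
          by (rule measurable_compose[OF _ G]) (auto intro!: borel_measurable_continuous_onI continuous_intros)
        have "(\<integral>\<^sup>+z. G (z, v) \<partial>lborel)
          = ennreal ((cmod (1 / j))\<^sup>2) * (\<integral>\<^sup>+z. G (1 / j * z + (\<alpha> - cnj \<alpha> * w) / j, v) \<partial>lborel)"
          using j by (intro nn_integral_complex_affine) auto
        also have "(\<integral>\<^sup>+z. G (1 / j * z + (\<alpha> - cnj \<alpha> * w) / j, v) \<partial>lborel) = (\<integral>\<^sup>+z. G (jacobi_act h (z, w)) \<partial>lborel)"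
          by (simp add: h jacobi_act_su_mat v_def j_def add_divide_distrib add.commute)
        finally have 1: "(\<integral>\<^sup>+z. G (z, v) \<partial>lborel) = ennreal ((cmod (1 / j))\<^sup>2) * (\<integral>\<^sup>+z. G (jacobi_act h (z, w)) \<partial>lborel)" .
        have p: "1 - (cmod v)\<^sup>2 = (1 - (cmod w)\<^sup>2) / (cmod j)\<^sup>2"
          unfolding v_def j_def by (rule moebius_norm[OF ab True])
        have w1: "0 < 1 - (cmod w)\<^sup>2"
          using True by (simp add: abs_square_less_1)
        have "1 / (x / y\<^sup>2) ^ 3 * (1 / y)\<^sup>2 * (1 / y ^ 4) = 1 / x ^ 3" if "y > 0" "x > 0" for x y :: real
          using that by (simp add: field_simps flip: power_mult power_add)
        from this[of "cmod j" "1 - (cmod w)\<^sup>2"] j w1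
        have 3: "1 / (1 - (cmod v)\<^sup>2) ^ 3 * (cmod (1 / j))\<^sup>2 * (1 / cmod j ^ 4) = 1 / (1 - (cmod w)\<^sup>2) ^ 3"
          unfolding p by (simp add: norm_divide)
        have 2: "ennreal (1 / (1 - (cmod v)\<^sup>2) ^ 3) * ennreal ((cmod (1 / j))\<^sup>2) * ennreal (1 / cmod j ^ 4)
          = ennreal (1 / (1 - (cmod w)\<^sup>2) ^ 3)"
          unfolding 3[symmetric] by (subst ennreal_mult'', simp, subst ennreal_mult'', simp, rule refl)
        show ?thesis
          unfolding v_def[symmetric] unfolding L_def j_def[symmetric] 1 2[symmetric] by (simp only: ac_simps)
      qed simp
    qed
    also have "\<dots> = (\<integral>\<^sup>+w\<in>ball 0 1. L w \<partial>lborel)"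
      by (rule nn_integral_moebius[OF ab L])
    also have "\<dots> = (\<integral>\<^sup>+x. G x \<partial>jacobi_measure)"
      unfolding L_def by (rule nn_integral_jacobi_measure[OF G, symmetric])
    finally show ?thesis .
  qed
  show ?thesis
  proof (rule measure_eqI)
    fix A assume "A \<in> sets (distr jacobi_measure borel (jacobi_act h))"
    then have A[measurable]: "A \<in> sets borel" by simp
    have i: "indicator A \<in> borel_measurable borel"
      by measurable
    have m: "jacobi_act h \<in> measurable jacobi_measure borel"
      by measurable
    have "emeasure (distr jacobi_measure borel (jacobi_act h)) A = (\<integral>\<^sup>+x. indicator A x \<partial>distr jacobi_measure borel (jacobi_act h))"
      using A by simp
    also have "\<dots> = (\<integral>\<^sup>+x. indicator A (jacobi_act h x) \<partial>jacobi_measure)"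
      by (rule nn_integral_distr[OF m]) measurable
    also have "\<dots> = emeasure jacobi_measure A"
      using A by (simp add: *[OF i])
    finally show "emeasure (distr jacobi_measure borel (jacobi_act h)) A = emeasure jacobi_measure A" .
  qed simp
qed

section \<open>The weight\<close>

lemma measurable_cnj [measurable]: "cnj \<in> borel_measurable borel"
  by (intro borel_measurable_continuous_onI continuous_intros)

text \<open>The reciprocal of the kernel on the diagonal, see \<open>kernel_diag\<close>. The factor
  with exponent -3 has moved into \<open>jacobi_measure\<close>, so that this part transforms by the
  cocycle alone.\<close>

definition weight_density :: "real \<Rightarrow> complex \<times> complex \<Rightarrow> real" where
  "weight_density k x = (1 - (cmod (snd x))\<^sup>2) powr (2 * k)
     * exp (- (cmod (fst x))\<^sup>2 / (1 - (cmod (snd x))\<^sup>2)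
            - Re ((fst x)\<^sup>2 * cnj (snd x) + (cnj (fst x))\<^sup>2 * snd x) / (2 * (1 - (cmod (snd x))\<^sup>2)))"

lemma jacobi_weight_eq: "jacobi_weight k x = weight_density k x * (1 / (1 - (cmod (snd x))\<^sup>2) ^ 3)"
  by (cases x) (simp add: weight_density_def)

declare jacobi_weight.simps [simp del]

lemma weight_density_nonneg [simp]: "0 \<le> weight_density k x"
  by (simp add: weight_density_def)

lemma weight_density_pos: "x \<in> jacobi_disk \<Longrightarrow> 0 < weight_density k x"
proof -
  assume "x \<in> jacobi_disk"
  then have "(cmod (snd x))\<^sup>2 < 1"
    by (cases x) (simp add: abs_square_less_1)
  then show ?thesis
    unfolding weight_density_def by (intro mult_pos_pos) simp_all
qed

lemma measurable_weight_density [measurable]: "weight_density k \<in> borel_measurable borel"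
proof -
  have "weight_density k \<in> borel_measurable (borel \<Otimes>\<^sub>M borel)"
    unfolding weight_density_def by measurable
  then show ?thesis
    by (simp add: borel_prod)
qed

section \<open>The total mass of the weight\<close>

lemma distr_lborel_Complex:
  "distr (lborel \<Otimes>\<^sub>M lborel) borel (\<lambda>p. Complex (fst p) (snd p)) = lborel"
proof (rule lborel_eqI[symmetric])
  fix l u :: complex
  assume lu: "\<And>b. b \<in> Basis \<Longrightarrow> l \<bullet> b \<le> u \<bullet> b"
  have le: "Re l \<le> Re u" "Im l \<le> Im u"
    using lu[of 1] lu[of \<i>] by (auto simp: Basis_complex_def)
  have m: "(\<lambda>p. Complex (fst p) (snd p)) \<in> measurable (lborel \<Otimes>\<^sub>M lborel) borel"
    unfolding lborel_prod Complex_eq by measurable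
  have "(\<lambda>p. Complex (fst p) (snd p)) -` box l u = {Re l<..<Re u} \<times> {Im l<..<Im u}"
    by (auto simp: in_box_complex_iff)
  then have "emeasure (distr (lborel \<Otimes>\<^sub>M lborel) borel (\<lambda>p. Complex (fst p) (snd p))) (box l u)
      = emeasure (lborel \<Otimes>\<^sub>M lborel) ({Re l<..<Re u} \<times> {Im l<..<Im u})"
    using m by (simp add: emeasure_distr space_pair_measure)
  also have "\<dots> = ennreal (Re u - Re l) * ennreal (Im u - Im l)"
    using le by (simp add: lborel.emeasure_pair_measure_Times)
  finally show "emeasure (distr (lborel \<Otimes>\<^sub>M lborel) borel (\<lambda>p. Complex (fst p) (snd p))) (box l u)
    = ennreal (\<Prod>b\<in>Basis. (u - l) \<bullet> b)"
    using le by (simp add: Basis_complex_def ennreal_mult)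
qed simp

lemma nn_integral_complex_iterated:
  assumes g: "g \<in> borel_measurable borel"
  shows "(\<integral>\<^sup>+z. g z \<partial>lborel) = (\<integral>\<^sup>+x. (\<integral>\<^sup>+y. g (Complex x y) \<partial>lborel) \<partial>lborel)"
proof -
  have m: "(\<lambda>p. Complex (fst p) (snd p)) \<in> measurable (lborel \<Otimes>\<^sub>M lborel) borel"
    unfolding lborel_prod Complex_eq by measurable
  have "(\<integral>\<^sup>+z. g z \<partial>lborel) = (\<integral>\<^sup>+p. g (Complex (fst p) (snd p)) \<partial>(lborel \<Otimes>\<^sub>M lborel))"
    by (subst distr_lborel_Complex[symmetric]) (rule nn_integral_distr[OF m], use g in simp)
  also have "\<dots> = (\<integral>\<^sup>+x. (\<integral>\<^sup>+y. g (Complex x y) \<partial>lborel) \<partial>lborel)"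
    using lborel.nn_integral_fst[OF measurable_compose[OF m g]] by simp
  finally show ?thesis .
qed

text \<open>Up to normalisation the integrand is the normal density of variance c / 2.\<close>

lemma nn_integral_gaussian:
  assumes c: "c > 0"
  shows "(\<integral>\<^sup>+x. ennreal (exp (- (x\<^sup>2 / c))) \<partial>lborel) = ennreal (sqrt (pi * c))"
proof -
  define \<sigma> where "\<sigma> = sqrt (c / 2)"
  have \<sigma>: "\<sigma> > 0" and \<sigma>2: "2 * \<sigma>\<^sup>2 = c"
    using c by (simp_all add: \<sigma>_def)
  have nd: "normal_density 0 \<sigma> x = 1 / sqrt (pi * c) * exp (- (x\<^sup>2 / c))" for x
    unfolding normal_density_def using \<sigma>2 by (simp add: mult.commute mult.left_commute)
  have "(\<integral>\<^sup>+x. ennreal (normal_density 0 \<sigma> x) \<partial>lborel) = 1"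
    using \<sigma> by (subst nn_integral_eq_integral) (auto simp: integral_normal_density)
  then have "ennreal (sqrt (pi * c)) = ennreal (sqrt (pi * c)) * (\<integral>\<^sup>+x. ennreal (normal_density 0 \<sigma> x) \<partial>lborel)"
    by simp
  also have "\<dots> = (\<integral>\<^sup>+x. ennreal (sqrt (pi * c)) * ennreal (normal_density 0 \<sigma> x) \<partial>lborel)"
    by (rule nn_integral_cmult[symmetric]) simp
  also have "\<dots> = (\<integral>\<^sup>+x. ennreal (exp (- (x\<^sup>2 / c))) \<partial>lborel)"
    using c by (intro nn_integral_cong) (simp add: nd flip: ennreal_mult')
  finally show ?thesis ..
qed

text \<open>Rotating z by half the argument of w replaces w by r = |w| and diagonalises the
  quadratic form. As 1 - r^2 = (1 - r) (1 + r), two independent Gaussians with parameters 1 - r and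
  1 + r remain, and their integrals multiply to pi (1 - r^2)^(1/2).\<close>

lemma nn_integral_weight_fibre:
  assumes w: "cmod w < 1"
  shows "(\<integral>\<^sup>+z. ennreal (weight_density k (z, w)) \<partial>lborel)
    = ennreal (pi * (1 - (cmod w)\<^sup>2) powr (2 * k + 1 / 2))"
proof -
  define r where "r = cmod w"
  define s where "s = 1 - r\<^sup>2"
  define u where "u = cis (Arg w / 2)"
  have s: "s > 0"
    using w by (simp add: s_def r_def abs_square_less_1)
  have r: "0 \<le> r" "r < 1"
    using w by (simp_all add: r_def)
  have sf: "s = (1 - r) * (1 + r)"
    by (simp add: s_def algebra_simps power2_eq_square)
  have u: "u \<noteq> 0" "cmod u = 1"
    by (simp_all add: u_def)
  have uw: "u\<^sup>2 * cnj w = of_real r"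
  proof -
    have "w = of_real r * u\<^sup>2"
    proof -
      have "u\<^sup>2 = cis (Arg w)"
        by (simp add: u_def power2_eq_square cis_mult)
      then show ?thesis
        unfolding r_def by (metis rcis_cmod_Arg rcis_def)
    qed
    moreover have "u\<^sup>2 * cnj (u\<^sup>2) = 1"
      using complex_norm_square[of "u\<^sup>2"] u by (simp add: norm_power)
    ultimately show ?thesis
      by (metis complex_cnj_complex_of_real complex_cnj_mult mult.left_commute mult.right_neutral)
  qed
  have wd: "weight_density k (u * Complex x y, w) = s powr (2 * k) * (exp (- (x\<^sup>2 / (1 - r))) * exp (- (y\<^sup>2 / (1 + r))))" for x y
  proof -
    have 1: "Re (((u * z)\<^sup>2 * cnj w + (cnj (u * z))\<^sup>2 * w)) = 2 * r * Re (z\<^sup>2)" for z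
    proof -
      have a: "(u * z)\<^sup>2 * cnj w = of_real r * z\<^sup>2"
        using uw by (simp add: power_mult_distrib mult.assoc mult.left_commute)
      have b: "(cnj (u * z))\<^sup>2 * w = cnj (of_real r * z\<^sup>2)"
        unfolding a[symmetric] by simp
      show ?thesis
        unfolding a b by (simp only: plus_complex.simps cnj.simps) simp
    qed
    have 2: "(cmod (u * Complex x y))\<^sup>2 = x\<^sup>2 + y\<^sup>2"
      by (simp add: norm_mult u cmod_power2)
    have 3: "Re ((Complex x y)\<^sup>2) = x\<^sup>2 - y\<^sup>2"
      by (simp add: power2_eq_square)
    have "- (x\<^sup>2 + y\<^sup>2) / s - 2 * r * (x\<^sup>2 - y\<^sup>2) / (2 * s) = (- (x\<^sup>2 * (1 + r)) - y\<^sup>2 * (1 - r)) / s"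
      using s by (simp add: field_simps)
    also have "\<dots> = - (x\<^sup>2 / (1 - r)) + - (y\<^sup>2 / (1 + r))"
      unfolding sf using r by (simp add: field_simps)
    finally show ?thesis
      unfolding weight_density_def fst_conv snd_conv 1 2 3 r_def[symmetric] s_def[symmetric] exp_add[symmetric] by simp
  qed
  have m: "(\<lambda>z. ennreal (weight_density k (z, w))) \<in> borel_measurable borel"
    unfolding weight_density_def fst_conv snd_conv by measurable
  have "(\<integral>\<^sup>+z. ennreal (weight_density k (z, w)) \<partial>lborel) = (\<integral>\<^sup>+z. ennreal (weight_density k (u * z, w)) \<partial>lborel)"
    using nn_integral_complex_affine[OF u(1) m, of 0] u(2) by simp
  also have "\<dots> = (\<integral>\<^sup>+x. (\<integral>\<^sup>+y. ennreal (weight_density k (u * Complex x y, w)) \<partial>lborel) \<partial>lborel)"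
    by (rule nn_integral_complex_iterated) (rule measurable_compose[OF _ m], measurable)
  also have "\<dots> = (\<integral>\<^sup>+x. (\<integral>\<^sup>+y. ennreal (s powr (2 * k)) * ennreal (exp (- (x\<^sup>2 / (1 - r)))) * ennreal (exp (- (y\<^sup>2 / (1 + r)))) \<partial>lborel) \<partial>lborel)"
    unfolding wd by (simp add: ennreal_mult' mult.assoc)
  also have "\<dots> = (\<integral>\<^sup>+x. ennreal (s powr (2 * k)) * ennreal (exp (- (x\<^sup>2 / (1 - r)))) * ennreal (sqrt (pi * (1 + r))) \<partial>lborel)"
    using r by (subst nn_integral_cmult) (simp_all add: nn_integral_gaussian)
  also have "\<dots> = ennreal (s powr (2 * k)) * ennreal (sqrt (pi * (1 + r))) * (\<integral>\<^sup>+x. ennreal (exp (- (x\<^sup>2 / (1 - r)))) \<partial>lborel)"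
    by (subst nn_integral_cmult[symmetric]) (simp_all add: ac_simps)
  also have "\<dots> = ennreal (s powr (2 * k)) * ennreal (sqrt (pi * (1 + r))) * ennreal (sqrt (pi * (1 - r)))"
    using r by (simp add: nn_integral_gaussian)
  also have "\<dots> = ennreal (s powr (2 * k) * (sqrt (pi * (1 + r)) * sqrt (pi * (1 - r))))"
    using r by (simp add: ennreal_mult mult.assoc)
  also have "sqrt (pi * (1 + r)) * sqrt (pi * (1 - r)) = pi * s powr (1 / 2)"
  proof -
    have "sqrt (pi * (1 + r)) * sqrt (pi * (1 - r)) = sqrt (pi\<^sup>2 * s)"
      unfolding sf real_sqrt_mult[symmetric] by (simp add: algebra_simps power2_eq_square)
    also have "\<dots> = pi * s powr (1 / 2)"
      using s by (simp add: real_sqrt_mult powr_half_sqrt)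
    finally show ?thesis .
  qed
  also have "s powr (2 * k) * (pi * s powr (1 / 2)) = pi * s powr (2 * k + 1 / 2)"
    by (simp add: powr_add)
  finally show ?thesis
    by (simp add: s_def r_def)
qed

lemma emeasure_complex_ball: "r \<ge> 0 \<Longrightarrow> emeasure lborel (ball (c::complex) r) = ennreal (pi * r\<^sup>2)"
  by (simp add: emeasure_ball unit_ball_vol_2)

lemma emeasure_complex_cball: "r \<ge> 0 \<Longrightarrow> emeasure lborel (cball (c::complex) r) = ennreal (pi * r\<^sup>2)"
  by (simp add: emeasure_cball unit_ball_vol_2)

text \<open>The image of the area under w -> |w|^2 is pi times Lebesgue measure on the unit
  interval. The two finite measures are compared on the rays \<open>{x<..}\<close>: the annulus
  |w|^2 > x has area pi (1 - x).\<close>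

lemma nn_integral_disk_radial:
  fixes g :: "real \<Rightarrow> ennreal"
  assumes [measurable]: "g \<in> borel_measurable borel"
  shows "(\<integral>\<^sup>+w\<in>ball (0::complex) 1. g ((cmod w)\<^sup>2) \<partial>lborel) = ennreal pi * (\<integral>\<^sup>+t\<in>{0..1}. g t \<partial>lborel)"
proof -
  have [measurable]: "ball (0::complex) 1 \<in> sets borel"
    by simp
  define M where "M = distr (density lborel (indicator (ball (0::complex) 1))) borel (\<lambda>w. (cmod w)\<^sup>2)"
  define N where "N = density lborel (\<lambda>t. ennreal pi * indicator {0..1::real} t)"
  have M: "emeasure M {x<..} = emeasure lborel (ball (0::complex) 1 \<inter> {w. x < (cmod w)\<^sup>2})" for x
  proof -
    have "emeasure M {x<..} = emeasure (density lborel (indicator (ball (0::complex) 1))) {w. x < (cmod w)\<^sup>2}"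
      unfolding M_def by (subst emeasure_distr) (auto simp: vimage_def)
    also have "\<dots> = emeasure lborel (ball (0::complex) 1 \<inter> {w. x < (cmod w)\<^sup>2})"
      by (subst emeasure_density) (simp_all flip: indicator_inter_arith)
    finally show ?thesis .
  qed
  have N: "emeasure N {x<..} = ennreal pi * emeasure lborel ({0..1} \<inter> {x<..})" for x
    unfolding N_def
    by (subst emeasure_density) (simp_all add: mult.assoc nn_integral_cmult flip: indicator_inter_arith)
  have eq: "emeasure M {x<..} = emeasure N {x<..}" for x
  proof -
    consider "x < 0" | "0 \<le> x" "x < 1" | "1 \<le> x" by linarith
    then show ?thesis
    proof cases
      case 1
      then have "ball (0::complex) 1 \<inter> {w. x < (cmod w)\<^sup>2} = ball 0 1" "{0..1} \<inter> {x<..} = {0..1}"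
        by (auto intro: less_le_trans[OF _ zero_le_power2])
      then show ?thesis
        unfolding M N by (simp add: emeasure_complex_ball)
    next
      case 2
      have sub: "cball 0 (sqrt x) \<subseteq> ball (0::complex) 1"
      proof -
        have "sqrt x < 1"
          using 2 by simp
        then show ?thesis
          by (meson le_less_trans mem_ball_0 mem_cball_0 subsetI)
      qed
      have "ball (0::complex) 1 \<inter> {w. x < (cmod w)\<^sup>2} = ball 0 1 - cball 0 (sqrt x)"
      proof -
        have "x < (cmod w)\<^sup>2 \<longleftrightarrow> sqrt x < cmod w" for w :: complex
          using real_sqrt_less_iff[of x "(cmod w)\<^sup>2"] by simp
        then show ?thesis
          unfolding set_eq_iff Int_iff Diff_iff mem_Collect_eq by (simp add: not_le)
      qed
      moreover have "emeasure lborel (ball (0::complex) 1 - cball 0 (sqrt x)) = ennreal (pi * (1 - x))"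
      proof -
        have "emeasure lborel (ball (0::complex) 1 - cball 0 (sqrt x))
          = emeasure lborel (ball (0::complex) 1) - emeasure lborel (cball (0::complex) (sqrt x))"
          using 2 sub by (intro emeasure_Diff) (simp_all add: emeasure_complex_cball)
        also have "\<dots> = ennreal pi - ennreal (pi * x)"
          using 2 by (simp add: emeasure_complex_ball emeasure_complex_cball)
        also have "\<dots> = ennreal (pi * (1 - x))"
          using 2 by (simp add: ennreal_minus right_diff_distrib)
        finally show ?thesis .
      qed
      moreover have "{0..1} \<inter> {x<..} = {x<..1}"
        using 2 by auto
      ultimately show ?thesis
        unfolding M N using 2 by (simp add: ennreal_mult)
    next
      case 3
      then have "ball (0::complex) 1 \<inter> {w. x < (cmod w)\<^sup>2} = {}" "{0..1} \<inter> {x<..} = {}"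
      proof -
        have "(cmod w)\<^sup>2 < 1" if "cmod w < 1" for w :: complex
          using that by (simp add: abs_square_less_1)
        then show "ball (0::complex) 1 \<inter> {w. x < (cmod w)\<^sup>2} = {}"
          using 3 by fastforce
      qed auto
      then show ?thesis
        unfolding M N by simp
    qed
  qed
  have "M = N"
  proof (rule measure_eqI_lessThan)
    show "emeasure M {x<..} < \<infinity>" for x
    proof -
      have "emeasure M {x<..} \<le> emeasure lborel (ball (0::complex) 1)"
        unfolding M by (rule emeasure_mono) auto
      then show ?thesis
        by (simp add: emeasure_complex_ball le_less_trans)
    qed
  qed (use eq in \<open>auto simp: M_def N_def\<close>)
  have "(\<integral>\<^sup>+w\<in>ball (0::complex) 1. g ((cmod w)\<^sup>2) \<partial>lborel) = (\<integral>\<^sup>+t. g t \<partial>M)"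
    unfolding M_def by (subst nn_integral_distr, simp, simp, subst nn_integral_density) (simp_all add: ac_simps)
  also have "\<dots> = (\<integral>\<^sup>+t. ennreal pi * (g t * indicator {0..1} t) \<partial>lborel)"
    unfolding \<open>M = N\<close> N_def by (subst nn_integral_density) (simp_all add: ac_simps)
  also have "\<dots> = ennreal pi * (\<integral>\<^sup>+t\<in>{0..1}. g t \<partial>lborel)"
    by (rule nn_integral_cmult) measurable
  finally show ?thesis .
qed

lemma nn_integral_powr_unit:
  assumes p: "p > -1"
  shows "(\<integral>\<^sup>+t\<in>{0..1}. ennreal ((1 - t) powr p) \<partial>lborel) = ennreal (1 / (p + 1))"
proof -
  have 1: "(\<integral>\<^sup>+x. ennreal (x powr p) * indicator {0..1} x \<partial>lborel) = ennreal (1 / (p + 1))"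
    using nn_integral_has_integral_lebesgue'[OF _ has_integral_powr_from_0[OF p, of 1]] by simp
  have "(\<integral>\<^sup>+x. ennreal (x powr p) * indicator {0..1} x \<partial>lborel)
    = ennreal \<bar>- 1\<bar> * (\<integral>\<^sup>+t. ennreal ((1 + - 1 * t) powr p) * indicator {0..1} (1 + - 1 * t) \<partial>lborel)"
    by (rule nn_integral_real_affine) auto
  also have "\<dots> = (\<integral>\<^sup>+t\<in>{0..1}. ennreal ((1 - t) powr p) \<partial>lborel)"
    by (auto intro!: nn_integral_cong simp: indicator_def)
  finally show ?thesis
    using 1 by simp
qed

text \<open>The fibre integral and the density leave the exponent 2k + 1/2 - 3 = 2k - 5/2, which
  exceeds -1 because k >= 1. The integral of (1 - t)^(2k - 5/2) contributes 1 / (2k - 3/2), which is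
  the origin of 4k - 3.\<close>

lemma nn_integral_weight:
  assumes k: "k \<ge> 1"
  shows "(\<integral>\<^sup>+x. ennreal (weight_density k x) \<partial>jacobi_measure) = ennreal (2 * pi\<^sup>2 / (4 * k - 3))"
proof -
  have "(\<integral>\<^sup>+x. ennreal (weight_density k x) \<partial>jacobi_measure)
    = (\<integral>\<^sup>+w\<in>ball 0 1. ennreal (1 / (1 - (cmod w)\<^sup>2) ^ 3) * (\<integral>\<^sup>+z. ennreal (weight_density k (z, w)) \<partial>lborel) \<partial>lborel)"
    by (rule nn_integral_jacobi_measure) measurable
  also have "\<dots> = (\<integral>\<^sup>+w\<in>ball (0::complex) 1. ennreal (pi * (1 - (cmod w)\<^sup>2) powr (2 * k - 5 / 2)) \<partial>lborel)"
  proof (rule nn_integral_cong)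
    fix w :: complex
    show "ennreal (1 / (1 - (cmod w)\<^sup>2) ^ 3) * (\<integral>\<^sup>+z. ennreal (weight_density k (z, w)) \<partial>lborel) * indicator (ball 0 1) w
      = ennreal (pi * (1 - (cmod w)\<^sup>2) powr (2 * k - 5 / 2)) * indicator (ball 0 1) w"
    proof (cases "cmod w < 1")
      case True
      define s where "s = 1 - (cmod w)\<^sup>2"
      have s: "s > 0"
        using True by (simp add: s_def abs_square_less_1)
      have "1 / s ^ 3 = s powr (- 3)"
        using s by (simp add: powr_minus powr_numeral field_simps)
      then have "1 / s ^ 3 * (pi * s powr (2 * k + 1 / 2)) = pi * s powr (2 * k - 5 / 2)"
        by (simp add: powr_add[symmetric])
      then show ?thesis
        unfolding nn_integral_weight_fibre[OF True] s_def[symmetric] using s by (simp flip: ennreal_mult)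
    qed simp
  qed
  also have "\<dots> = ennreal pi * (\<integral>\<^sup>+t\<in>{0..1}. ennreal (pi * (1 - t) powr (2 * k - 5 / 2)) \<partial>lborel)"
    by (rule nn_integral_disk_radial) measurable
  also have "(\<integral>\<^sup>+t\<in>{0..1}. ennreal (pi * (1 - t) powr (2 * k - 5 / 2)) \<partial>lborel)
     = ennreal pi * (\<integral>\<^sup>+t\<in>{0..1}. ennreal ((1 - t) powr (2 * k - 5 / 2)) \<partial>lborel)"
    by (subst nn_integral_cmult[symmetric]) (simp_all add: ennreal_mult' mult.assoc)
  also have "\<dots> = ennreal pi * ennreal (1 / (2 * k - 5 / 2 + 1))"
    using k by (subst nn_integral_powr_unit) auto
  also have "ennreal pi * \<dots> = ennreal (2 * pi\<^sup>2 / (4 * k - 3))"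
    using k by (simp add: field_simps power2_eq_square flip: ennreal_mult)
  finally show ?thesis .
qed

section \<open>Inner product spaces\<close>

text \<open>Kept apart from definiteness, because for \<open>jacobi_ip\<close> definiteness comes
  from the bound on point values, whose proof already uses Cauchy-Schwarz.\<close>

locale semi_inner_space = vector_space scale
  for scale :: "complex \<Rightarrow> 'v::ab_group_add \<Rightarrow> 'v" +
  fixes V :: "'v set" and ip :: "'v \<Rightarrow> 'v \<Rightarrow> complex"
  assumes carrier_subspace: "subspace V"
    and ip_add_right: "\<lbrakk>u \<in> V; v \<in> V; w \<in> V\<rbrakk> \<Longrightarrow> ip u (v + w) = ip u v + ip u w"
    and ip_scale_right: "\<lbrakk>u \<in> V; v \<in> V\<rbrakk> \<Longrightarrow> ip u (scale c v) = c * ip u v"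
    and ip_commute: "\<lbrakk>u \<in> V; v \<in> V\<rbrakk> \<Longrightarrow> ip v u = cnj (ip u v)"
    and ip_nonneg: "v \<in> V \<Longrightarrow> 0 \<le> Re (ip v v)"
begin

definition nrm :: "'v \<Rightarrow> real" where
  "nrm v = sqrt (Re (ip v v))"

lemma V_zero [simp]: "0 \<in> V"
  and V_add [simp]: "\<lbrakk>u \<in> V; v \<in> V\<rbrakk> \<Longrightarrow> u + v \<in> V"
  and V_scale [simp]: "v \<in> V \<Longrightarrow> scale c v \<in> V"
  and V_neg [simp]: "v \<in> V \<Longrightarrow> - v \<in> V"
  and V_diff [simp]: "\<lbrakk>u \<in> V; v \<in> V\<rbrakk> \<Longrightarrow> u - v \<in> V"
  using carrier_subspace subspace_0 subspace_add subspace_scale subspace_neg subspace_diff by auto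

lemma V_sum [simp]: "(\<And>i. i \<in> I \<Longrightarrow> f i \<in> V) \<Longrightarrow> sum f I \<in> V"
  by (rule subspace_sum[OF carrier_subspace])

lemma ip_add_left: "\<lbrakk>u \<in> V; v \<in> V; w \<in> V\<rbrakk> \<Longrightarrow> ip (u + v) w = ip u w + ip v w"
  by (metis V_add complex_cnj_add ip_add_right ip_commute)

lemma ip_scale_left: "\<lbrakk>u \<in> V; v \<in> V\<rbrakk> \<Longrightarrow> ip (scale c u) v = cnj c * ip u v"
  by (metis V_scale complex_cnj_mult ip_commute ip_scale_right)

lemma ip_zero_right [simp]: "u \<in> V \<Longrightarrow> ip u 0 = 0"
  using ip_scale_right[of u 0 0] by simp

lemma ip_zero_left [simp]: "u \<in> V \<Longrightarrow> ip 0 u = 0"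
  using ip_scale_left[of 0 u 0] by simp

lemma ip_minus_right: "\<lbrakk>u \<in> V; v \<in> V\<rbrakk> \<Longrightarrow> ip u (- v) = - ip u v"
  using ip_scale_right[of u v "-1"] by simp

lemma ip_minus_left: "\<lbrakk>u \<in> V; v \<in> V\<rbrakk> \<Longrightarrow> ip (- u) v = - ip u v"
  using ip_scale_left[of u v "-1"] by simp

lemma ip_diff_right: "\<lbrakk>u \<in> V; v \<in> V; w \<in> V\<rbrakk> \<Longrightarrow> ip u (v - w) = ip u v - ip u w"
  using ip_add_right[of u v "- w"] ip_minus_right[of u w] by simp

lemma ip_diff_left: "\<lbrakk>u \<in> V; v \<in> V; w \<in> V\<rbrakk> \<Longrightarrow> ip (u - v) w = ip u w - ip v w"
  using ip_add_left[of u "- v" w] ip_minus_left[of v w] by simp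

lemma ip_sum_right: "\<lbrakk>u \<in> V; \<And>i. i \<in> I \<Longrightarrow> f i \<in> V\<rbrakk> \<Longrightarrow> ip u (sum f I) = (\<Sum>i\<in>I. ip u (f i))"
proof (induction I rule: infinite_finite_induct)
  case (insert i I)
  then show ?case
    by (simp add: ip_add_right)
qed auto

lemma ip_sum_left: "\<lbrakk>u \<in> V; \<And>i. i \<in> I \<Longrightarrow> f i \<in> V\<rbrakk> \<Longrightarrow> ip (sum f I) u = (\<Sum>i\<in>I. ip (f i) u)"
proof (induction I rule: infinite_finite_induct)
  case (insert i I)
  then show ?case
    by (simp add: ip_add_left)
qed auto

lemma ip_self: "v \<in> V \<Longrightarrow> ip v v = of_real ((nrm v)\<^sup>2)"
proof -
  assume v: "v \<in> V"
  then have "Im (ip v v) = 0"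
    using ip_commute[of v v] by (metis cnj.simps(2) equal_neg_zero)
  then show ?thesis
    using ip_nonneg[OF v] by (simp add: nrm_def complex_eq_iff)
qed

lemma nrm_nonneg [simp]: "v \<in> V \<Longrightarrow> 0 \<le> nrm v"
  using ip_nonneg by (simp add: nrm_def)

lemma nrm_sq: "v \<in> V \<Longrightarrow> (nrm v)\<^sup>2 = Re (ip v v)"
  using ip_nonneg by (simp add: nrm_def)

lemma nrm_zero [simp]: "nrm 0 = 0"
  by (simp add: nrm_def)

lemma nrm_scale: "v \<in> V \<Longrightarrow> nrm (scale c v) = cmod c * nrm v"
proof -
  assume v: "v \<in> V"
  have "ip (scale c v) (scale c v) = c * cnj c * ip v v"
    using v by (simp add: ip_scale_left ip_scale_right)
  also have "\<dots> = of_real ((cmod c)\<^sup>2 * (nrm v)\<^sup>2)"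
    using v by (simp only: complex_norm_square[symmetric] ip_self of_real_mult)
  finally have "Re (ip (scale c v) (scale c v)) = (cmod c * nrm v)\<^sup>2"
    by (simp add: power_mult_distrib)
  then show ?thesis
    using v by (simp add: nrm_def[of "scale c v"])
qed

lemma nrm_minus: "v \<in> V \<Longrightarrow> nrm (- v) = nrm v"
  using nrm_scale[of v "-1"] by simp

lemma nrm_diff_commute: "\<lbrakk>u \<in> V; v \<in> V\<rbrakk> \<Longrightarrow> nrm (u - v) = nrm (v - u)"
  using nrm_minus[of "u - v"] by simp

lemma nrm_add_sq: "\<lbrakk>u \<in> V; v \<in> V\<rbrakk> \<Longrightarrow> (nrm (u + v))\<^sup>2 = (nrm u)\<^sup>2 + 2 * Re (ip u v) + (nrm v)\<^sup>2"
proof -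
  assume uv: "u \<in> V" "v \<in> V"
  have "Re (ip v u) = Re (ip u v)"
    using ip_commute[OF uv] by simp
  then show ?thesis
    using uv by (simp add: nrm_sq ip_add_left ip_add_right)
qed

lemma nrm_diff_sq: "\<lbrakk>u \<in> V; v \<in> V\<rbrakk> \<Longrightarrow> (nrm (u - v))\<^sup>2 = (nrm u)\<^sup>2 - 2 * Re (ip u v) + (nrm v)\<^sup>2"
  using nrm_add_sq[of u "- v"] by (simp add: ip_minus_right nrm_minus)

lemma cauchy_schwarz:
  assumes u: "u \<in> V" and v: "v \<in> V"
  shows "cmod (ip u v) \<le> nrm u * nrm v"
proof -
  define p where "p = ip u v"
  \<comment> \<open>The phase of \<open>p\<close> is put into the scalar, so that a real quadratic
    in t remains.\<close>
  have quad: "0 \<le> (nrm u)\<^sup>2 - 2 * t * (cmod p)\<^sup>2 + t\<^sup>2 * (cmod p)\<^sup>2 * (nrm v)\<^sup>2" for t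
  proof -
    have "ip u (scale (of_real t * cnj p) v) = of_real t * (p * cnj p)"
      using u v by (simp add: ip_scale_right p_def)
    then have "Re (ip u (scale (of_real t * cnj p) v)) = t * (cmod p)\<^sup>2"
      by (simp only: complex_norm_square[symmetric] of_real_mult[symmetric] Re_complex_of_real)
    moreover have "(nrm (scale (of_real t * cnj p) v))\<^sup>2 = t\<^sup>2 * (cmod p)\<^sup>2 * (nrm v)\<^sup>2"
      using v by (simp add: nrm_scale norm_mult power_mult_distrib)
    ultimately have "(nrm (u - scale (of_real t * cnj p) v))\<^sup>2
        = (nrm u)\<^sup>2 - 2 * t * (cmod p)\<^sup>2 + t\<^sup>2 * (cmod p)\<^sup>2 * (nrm v)\<^sup>2"
      using u v by (simp add: nrm_diff_sq)
    then show ?thesis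
      by (metis zero_le_power2)
  qed
  have "(cmod p)\<^sup>2 \<le> (nrm u)\<^sup>2 * (nrm v)\<^sup>2"
  proof (cases "nrm v = 0")
    case True
    have "p = 0"
    proof (rule ccontr)
      assume "p \<noteq> 0"
      then have "(cmod p)\<^sup>2 > 0"
        by simp
      then show False
        \<comment> \<open>With \<open>nrm v = 0\<close> the quadratic is affine in t; this t gives
          it the value -1.\<close>
        using quad[of "((nrm u)\<^sup>2 + 1) / (2 * (cmod p)\<^sup>2)"] True by (simp add: field_simps)
    qed
    then show ?thesis
      by simp
  next
    case False
    then have pos: "(nrm v)\<^sup>2 > 0"
      by simp
    define N where "N = (nrm v)\<^sup>2"
    have "(1 / N)\<^sup>2 * (cmod p)\<^sup>2 * N = (cmod p)\<^sup>2 / N"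
      using pos by (simp add: N_def power2_eq_square)
    then have "(cmod p)\<^sup>2 / N \<le> (nrm u)\<^sup>2"
      using quad[of "1 / N"] unfolding N_def[symmetric] by simp
    then show ?thesis
      using pos unfolding N_def by (simp add: pos_divide_le_eq)
  qed
  then have "(cmod p)\<^sup>2 \<le> (nrm u * nrm v)\<^sup>2"
    by (simp add: power_mult_distrib)
  then show ?thesis
    unfolding p_def by (rule power2_le_imp_le) (use u v in simp)
qed

lemma nrm_triangle: 
  assumes u: "u \<in> V" and v: "v \<in> V"
  shows "nrm (u + v) \<le> nrm u + nrm v"
proof (rule power2_le_imp_le)
  have "Re (ip u v) \<le> nrm u * nrm v"
    using cauchy_schwarz[OF u v] complex_Re_le_cmod order.trans by blast
  then show "(nrm (u + v))\<^sup>2 \<le> (nrm u + nrm v)\<^sup>2"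
    using u v by (simp add: nrm_add_sq power2_sum)
qed (use u v in simp)

lemma nrm_triangle_diff: "\<lbrakk>u \<in> V; v \<in> V; w \<in> V\<rbrakk> \<Longrightarrow> nrm (u - w) \<le> nrm (u - v) + nrm (v - w)"
  using nrm_triangle[of "u - v" "v - w"] by simp

lemma nrm_sum: "(\<And>i. i \<in> I \<Longrightarrow> f i \<in> V) \<Longrightarrow> nrm (sum f I) \<le> (\<Sum>i\<in>I. nrm (f i))"
proof (induction I rule: infinite_finite_induct)
  case (insert i I)
  then have "nrm (sum f (insert i I)) \<le> nrm (f i) + nrm (sum f I)"
    by (simp add: nrm_triangle)
  with insert show ?case
    by simp
qed auto

end

section \<open>Definite forms and the topology of the norm\<close>

locale inner_space = semi_inner_space +
  assumes nrm_eq_0: "\<lbrakk>v \<in> V; nrm v = 0\<rbrakk> \<Longrightarrow> v = 0"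
begin

lemma hdist_nrm: "\<lbrakk>u \<in> V; v \<in> V\<rbrakk> \<Longrightarrow> hdist V ip u v = nrm (u - v)"
  by (simp add: hdist_def nrm_def)

lemma metric: "Metric_space V (hdist V ip)"
proof
  fix x y z
  show "0 \<le> hdist V ip x y"
    by (simp add: hdist_def ip_nonneg)
  show "hdist V ip x y = hdist V ip y x"
    using nrm_diff_commute[of x y] by (auto simp: hdist_def nrm_def)
  assume xy: "x \<in> V" "y \<in> V"
  then show "(hdist V ip x y = 0) = (x = y)"
    using nrm_eq_0[of "x - y"] by (auto simp: hdist_nrm)
  assume z: "z \<in> V"
  show "hdist V ip x z \<le> hdist V ip x y + hdist V ip y z"
    using xy z by (simp add: hdist_nrm nrm_triangle_diff)
qed

lemma limitin_iff:
  "limitin (htopology V ip) f l F \<longleftrightarrow> l \<in> V \<and> (\<forall>\<^sub>F x in F. f x \<in> V) \<and> ((\<lambda>x. nrm (f x - l)) \<longlongrightarrow> 0) F"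
proof -
  have "((\<lambda>x. hdist V ip (f x) l) \<longlongrightarrow> 0) F \<longleftrightarrow> ((\<lambda>x. nrm (f x - l)) \<longlongrightarrow> 0) F"
    if "l \<in> V" "\<forall>\<^sub>F x in F. f x \<in> V"
    by (rule tendsto_cong) (use that in \<open>auto elim!: eventually_mono simp: hdist_nrm\<close>)
  then show ?thesis
    unfolding Metric_space.limitin_metric_dist_null[OF metric] by blast
qed

lemma limitin_unique:
  "\<lbrakk>limitin (htopology V ip) f l F; limitin (htopology V ip) f l' F; F \<noteq> bot\<rbrakk> \<Longrightarrow> l = l'"
  by (rule Metric_space.limitin_metric_unique[OF metric])

lemma limitin_add:
  assumes "limitin (htopology V ip) f l F" "limitin (htopology V ip) g m F"
  shows "limitin (htopology V ip) (\<lambda>x. f x + g x) (l + m) F"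
proof -
  have lm: "l \<in> V" "m \<in> V" "\<forall>\<^sub>F x in F. f x \<in> V" "\<forall>\<^sub>F x in F. g x \<in> V"
      "((\<lambda>x. nrm (f x - l)) \<longlongrightarrow> 0) F" "((\<lambda>x. nrm (g x - m)) \<longlongrightarrow> 0) F"
    using assms by (auto simp: limitin_iff)
  have ev: "\<forall>\<^sub>F x in F. f x + g x \<in> V \<and> norm (nrm (f x + g x - (l + m))) \<le> nrm (f x - l) + nrm (g x - m)"
    using lm(3,4)
  proof eventually_elim
    case (elim x)
    then show ?case
      using lm(1,2) nrm_triangle[of "f x - l" "g x - m"] by (simp add: algebra_simps)
  qed
  have "((\<lambda>x. nrm (f x + g x - (l + m))) \<longlongrightarrow> 0) F"
    by (rule Lim_null_comparison[OF _ tendsto_add_zero[OF lm(5,6)]]) (use ev in \<open>auto elim: eventually_mono\<close>)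
  then show ?thesis
    using lm ev by (auto simp: limitin_iff elim: eventually_mono)
qed

lemma limitin_scale:
  assumes "limitin (htopology V ip) f l F"
  shows "limitin (htopology V ip) (\<lambda>x. scale c (f x)) (scale c l) F"
proof -
  have l: "l \<in> V" "\<forall>\<^sub>F x in F. f x \<in> V" "((\<lambda>x. nrm (f x - l)) \<longlongrightarrow> 0) F"
    using assms by (auto simp: limitin_iff)
  have ev: "\<forall>\<^sub>F x in F. nrm (scale c (f x) - scale c l) = cmod c * nrm (f x - l)"
    using l(2) by eventually_elim (use l(1) in \<open>simp add: nrm_scale flip: scale_right_diff_distrib\<close>)
  have "((\<lambda>x. nrm (scale c (f x) - scale c l)) \<longlongrightarrow> 0) F"
    by (subst tendsto_cong[OF ev]) (rule tendsto_mult_right_zero[OF l(3)])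
  then show ?thesis
    using l by (auto simp: limitin_iff elim: eventually_mono)
qed

lemma limitin_ip:
  assumes "limitin (htopology V ip) f l F" "u \<in> V"
  shows "((\<lambda>x. ip u (f x)) \<longlongrightarrow> ip u l) F"
proof -
  have l: "l \<in> V" "\<forall>\<^sub>F x in F. f x \<in> V" "((\<lambda>x. nrm (f x - l)) \<longlongrightarrow> 0) F"
    using assms by (auto simp: limitin_iff)
  have ev: "\<forall>\<^sub>F x in F. norm (ip u (f x) - ip u l) \<le> nrm u * nrm (f x - l)"
    using l(2)
  proof eventually_elim
    case (elim x)
    then show ?case
      using cauchy_schwarz[of u "f x - l"] l(1) assms(2) by (simp add: ip_diff_right)
  qed
  have "((\<lambda>x. ip u (f x) - ip u l) \<longlongrightarrow> 0) F"
    by (rule Lim_null_comparison[OF ev]) (rule tendsto_mult_right_zero[OF l(3)])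
  then show ?thesis
    by (simp add: LIM_zero_iff)
qed

end

section \<open>Hilbert spaces and absolutely convergent series\<close>

context complex_hilbert_space
begin

lemma hilbert_semi_inner: "semi_inner_space scale V ip"
proof (rule semi_inner_space.intro[OF vector_space_axioms], rule semi_inner_space_axioms.intro)
  have "ip 0 0 = 0"
    using ip_scale_right[of 0 0 0] subspace_0[OF carrier_subspace] by simp
  then show "0 \<le> Re (ip v v)" if "v \<in> V" for v
    using ip_pos[OF that] by (cases "v = 0") auto
qed (fact carrier_subspace ip_add_right ip_scale_right ip_commute)+

lemma hilbert_definite:
  assumes "v \<in> V" "semi_inner_space.nrm ip v = 0"
  shows "v = 0"
  using ip_pos[OF assms(1)] assms(2) by (auto simp: semi_inner_space.nrm_def[OF hilbert_semi_inner])

sublocale inner_space scale V ip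
  by (rule inner_space.intro[OF hilbert_semi_inner], rule inner_space_axioms.intro) (rule hilbert_definite)

lemma summable_imp_limitin:
  assumes fV: "\<And>n. f n \<in> V" and sm: "summable (\<lambda>n. nrm (f n))"
  obtains v where "limitin (htopology V ip) (\<lambda>N. \<Sum>n<N. f n) v sequentially"
proof -
  have diff: "nrm ((\<Sum>n<N. f n) - (\<Sum>n<M. f n)) \<le> norm ((\<Sum>n<N. nrm (f n)) - (\<Sum>n<M. nrm (f n)))"
    if "M \<le> N" for M N
  proof -
    have "{..<N} = {..<M} \<union> {M..<N}"
      using that by auto
    then have e: "(\<Sum>n<N. g n) - (\<Sum>n<M. g n) = (\<Sum>n=M..<N. g n)" for g :: "nat \<Rightarrow> 'z::ab_group_add"
      by (metis (no_types, lifting) add_diff_cancel_left' finite_atLeastLessThan finite_lessThan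
          ivl_disj_int_one(2) lessThan_atLeast0 sum.union_disjoint ivl_disj_int_two(3))
    have "nrm (\<Sum>n=M..<N. f n) \<le> (\<Sum>n=M..<N. nrm (f n))"
      using fV by (intro nrm_sum)
    then show ?thesis
      unfolding e by simp
  qed
  have "Cauchy (\<lambda>N. \<Sum>n<N. nrm (f n))"
    using sm by (simp add: summable_iff_convergent convergent_Cauchy)
  then have C: "\<exists>N0. \<forall>m\<ge>N0. \<forall>n\<ge>N0. norm ((\<Sum>n<m. nrm (f n)) - (\<Sum>n<n. nrm (f n))) < e" if "e > 0" for e
    using that by (simp add: Cauchy_def dist_norm)
  have "Metric_space.MCauchy V (hdist V ip) (\<lambda>N. \<Sum>n<N. f n)"
    unfolding Metric_space.MCauchy_def[OF metric]
  proof (intro conjI allI impI)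
    show "range (\<lambda>N. \<Sum>n<N. f n) \<subseteq> V"
      using fV by auto
    fix e :: real assume "e > 0"
    then obtain N0 where N0: "\<And>m n. m \<ge> N0 \<Longrightarrow> n \<ge> N0 \<Longrightarrow> norm ((\<Sum>n<m. nrm (f n)) - (\<Sum>n<n. nrm (f n))) < e"
      using C by meson
    show "\<exists>N. \<forall>n n'. N \<le> n \<longrightarrow> N \<le> n' \<longrightarrow> hdist V ip (\<Sum>n<n. f n) (\<Sum>n<n'. f n) < e"
    proof (intro exI[of _ N0] allI impI)
      fix m n assume mn: "N0 \<le> m" "N0 \<le> n"
      have "nrm ((\<Sum>n<m. f n) - (\<Sum>n<n. f n)) < e"
      proof (cases "n \<le> m")
        case True
        then show ?thesis
          using diff[OF True] N0[OF mn] by linarith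
      next
        case False
        have "nrm ((\<Sum>n<m. f n) - (\<Sum>n<n. f n)) = nrm ((\<Sum>n<n. f n) - (\<Sum>n<m. f n))"
          by (rule nrm_diff_commute) (use fV in auto)
        then show ?thesis
          using diff[of m n] N0[OF mn(2,1)] False by linarith
      qed
      then show "hdist V ip (\<Sum>n<m. f n) (\<Sum>n<n. f n) < e"
        using fV by (simp add: hdist_nrm)
    qed
  qed
  then show thesis
    using complete that unfolding Metric_space.mcomplete_def[OF metric] by blast
qed

end

section \<open>The space of holomorphic functions\<close>

lemma holomorphic2_on_iff:
  "f holomorphic2_on D \<longleftrightarrow>
    (\<forall>x\<in>D. \<exists>p q. (f has_derivative (\<lambda>h. p * fst h + q * snd h)) (at x))"
  by (simp add: holomorphic2_on_def case_prod_beta')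

lemma holomorphic2_onE:
  assumes "f holomorphic2_on D" "x \<in> D"
  obtains p q where "(f has_derivative (\<lambda>h. p * fst h + q * snd h)) (at x)"
  using assms unfolding holomorphic2_on_iff by blast

lemma holomorphic2_on_const: "(\<lambda>_. c) holomorphic2_on D"
  unfolding holomorphic2_on_iff by (auto intro!: exI[of _ 0])

lemma holomorphic2_on_fst: "fst holomorphic2_on D"
  unfolding holomorphic2_on_iff
  by (rule ballI, rule exI[of _ 1], rule exI[of _ 0]) (simp add: bounded_linear_imp_has_derivative[OF bounded_linear_fst])

lemma holomorphic2_on_snd: "snd holomorphic2_on D"
  unfolding holomorphic2_on_iff
  by (rule ballI, rule exI[of _ 0], rule exI[of _ 1]) (simp add: bounded_linear_imp_has_derivative[OF bounded_linear_snd])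

lemma holomorphic2_on_add:
  assumes "f holomorphic2_on D" "g holomorphic2_on D"
  shows "(\<lambda>x. f x + g x) holomorphic2_on D"
  unfolding holomorphic2_on_iff
proof
  fix x assume x: "x \<in> D"
  obtain p q where f: "(f has_derivative (\<lambda>h. p * fst h + q * snd h)) (at x)"
    using assms(1) x by (rule holomorphic2_onE)
  obtain p' q' where g: "(g has_derivative (\<lambda>h. p' * fst h + q' * snd h)) (at x)"
    using assms(2) x by (rule holomorphic2_onE)
  show "\<exists>p q. ((\<lambda>x. f x + g x) has_derivative (\<lambda>h. p * fst h + q * snd h)) (at x)"
    by (rule exI[of _ "p + p'"], rule exI[of _ "q + q'"])
       (use has_derivative_add[OF f g] in \<open>simp add: algebra_simps\<close>)
qed

lemma holomorphic2_on_mult: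
  assumes "f holomorphic2_on D" "g holomorphic2_on D"
  shows "(\<lambda>x. f x * g x) holomorphic2_on D"
  unfolding holomorphic2_on_iff
proof
  fix x assume x: "x \<in> D"
  obtain p q where f: "(f has_derivative (\<lambda>h. p * fst h + q * snd h)) (at x)"
    using assms(1) x by (rule holomorphic2_onE)
  obtain p' q' where g: "(g has_derivative (\<lambda>h. p' * fst h + q' * snd h)) (at x)"
    using assms(2) x by (rule holomorphic2_onE)
  show "\<exists>p q. ((\<lambda>x. f x * g x) has_derivative (\<lambda>h. p * fst h + q * snd h)) (at x)"
    by (rule exI[of _ "f x * p' + p * g x"], rule exI[of _ "f x * q' + q * g x"])
       (use has_derivative_mult[OF f g] in \<open>simp add: algebra_simps\<close>)
qed

lemma holomorphic2_on_compose_scalar: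
  assumes "f holomorphic2_on D" "\<And>x. x \<in> D \<Longrightarrow> g field_differentiable (at (f x))"
  shows "(\<lambda>x. g (f x)) holomorphic2_on D"
  unfolding holomorphic2_on_iff
proof
  fix x assume x: "x \<in> D"
  obtain p q where f: "(f has_derivative (\<lambda>h. p * fst h + q * snd h)) (at x)"
    using assms(1) x by (rule holomorphic2_onE)
  obtain d where "(g has_derivative (*) d) (at (f x))"
    using assms(2)[OF x] by (auto simp: field_differentiable_def has_field_derivative_def)
  from has_derivative_compose[OF f this]
  show "\<exists>p q. ((\<lambda>x. g (f x)) has_derivative (\<lambda>h. p * fst h + q * snd h)) (at x)"
    by (intro exI[of _ "d * p"] exI[of _ "d * q"]) (simp add: algebra_simps)
qed

lemma holomorphic2_on_compose:
  assumes "f holomorphic2_on D'" "\<phi> holomorphic2_on D" "\<psi> holomorphic2_on D"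
    and "\<And>x. x \<in> D \<Longrightarrow> (\<phi> x, \<psi> x) \<in> D'"
  shows "(\<lambda>x. f (\<phi> x, \<psi> x)) holomorphic2_on D"
  unfolding holomorphic2_on_iff
proof
  fix x assume x: "x \<in> D"
  obtain p q where f: "(f has_derivative (\<lambda>h. p * fst h + q * snd h)) (at (\<phi> x, \<psi> x))"
    using assms(1) assms(4)[OF x] by (rule holomorphic2_onE)
  obtain a b where \<phi>: "(\<phi> has_derivative (\<lambda>h. a * fst h + b * snd h)) (at x)"
    using assms(2) x by (rule holomorphic2_onE)
  obtain c d where \<psi>: "(\<psi> has_derivative (\<lambda>h. c * fst h + d * snd h)) (at x)"
    using assms(3) x by (rule holomorphic2_onE)
  from has_derivative_compose[OF has_derivative_Pair[OF \<phi> \<psi>] f]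
  show "\<exists>p q. ((\<lambda>x. f (\<phi> x, \<psi> x)) has_derivative (\<lambda>h. p * fst h + q * snd h)) (at x)"
    by (intro exI[of _ "p * a + q * c"] exI[of _ "p * b + q * d"]) (simp add: algebra_simps)
qed

lemma holomorphic2_on_cong:
  assumes "open D" "\<And>x. x \<in> D \<Longrightarrow> f x = g x" "f holomorphic2_on D"
  shows "g holomorphic2_on D"
  unfolding holomorphic2_on_iff
proof
  fix x assume x: "x \<in> D"
  obtain p q where f: "(f has_derivative (\<lambda>h. p * fst h + q * snd h)) (at x)"
    using assms(3) x by (rule holomorphic2_onE)
  show "\<exists>p q. (g has_derivative (\<lambda>h. p * fst h + q * snd h)) (at x)"
    using has_derivative_transform_within_open[OF f assms(1) x assms(2)] by blast
qed

lemma holomorphic2_on_imp_continuous_on: "f holomorphic2_on D \<Longrightarrow> continuous_on D f"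
  unfolding holomorphic2_on_iff
  by (meson continuous_at_imp_continuous_on has_derivative_continuous)

text \<open>The bridge to Cauchy's theory in one variable, used for circles through a point and for
  coordinate lines.\<close>

lemma holomorphic2_on_curve:
  assumes "f holomorphic2_on D" "(\<phi> t, \<psi> t) \<in> D"
    and "\<phi> field_differentiable at t" "\<psi> field_differentiable at t"
  shows "(\<lambda>t. f (\<phi> t, \<psi> t)) field_differentiable at t"
proof -
  obtain p q where f: "(f has_derivative (\<lambda>h. p * fst h + q * snd h)) (at (\<phi> t, \<psi> t))"
    using assms(1,2) by (rule holomorphic2_onE)
  obtain a where \<phi>: "(\<phi> has_derivative (*) a) (at t)"
    using assms(3) by (auto simp: field_differentiable_def has_field_derivative_def)
  obtain c where \<psi>: "(\<psi> has_derivative (*) c) (at t)"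
    using assms(4) by (auto simp: field_differentiable_def has_field_derivative_def)
  from has_derivative_compose[OF has_derivative_Pair[OF \<phi> \<psi>] f]
  moreover have "(*) (p * a + q * c) = (\<lambda>h. p * (a * h) + q * (c * h))"
    by (simp add: fun_eq_iff algebra_simps)
  ultimately have "((\<lambda>t. f (\<phi> t, \<psi> t)) has_derivative (*) (p * a + q * c)) (at t)"
    by simp
  then show ?thesis
    by (auto simp: field_differentiable_def has_field_derivative_def)
qed

section \<open>Square-integrable functions and convergence in the mean\<close>

lemma integrable_cnj_mult:
  fixes f g :: "'a \<Rightarrow> complex"
  assumes [measurable]: "f \<in> borel_measurable M" "g \<in> borel_measurable M"
    and "integrable M (\<lambda>x. (cmod (f x))\<^sup>2)" "integrable M (\<lambda>x. (cmod (g x))\<^sup>2)"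
  shows "integrable M (\<lambda>x. cnj (f x) * g x)"
proof (rule Bochner_Integration.integrable_bound)
  show "integrable M (\<lambda>x. (cmod (f x))\<^sup>2 + (cmod (g x))\<^sup>2)"
    using assms by simp
  have "a * b \<le> a\<^sup>2 + b\<^sup>2" if "a \<ge> 0" "b \<ge> 0" for a b :: real
    using that sum_squares_bound[of a b] mult_nonneg_nonneg[OF that] by linarith
  then show "AE x in M. norm (cnj (f x) * g x) \<le> norm ((cmod (f x))\<^sup>2 + (cmod (g x))\<^sup>2)"
    by (simp add: norm_mult)
qed measurable

lemma integrable_sq_add:
  fixes f g :: "'a \<Rightarrow> complex"
  assumes [measurable]: "f \<in> borel_measurable M" "g \<in> borel_measurable M"
    and "integrable M (\<lambda>x. (cmod (f x))\<^sup>2)" "integrable M (\<lambda>x. (cmod (g x))\<^sup>2)"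
  shows "integrable M (\<lambda>x. (cmod (f x + g x))\<^sup>2)"
proof (rule Bochner_Integration.integrable_bound)
  show "integrable M (\<lambda>x. 2 * (cmod (f x))\<^sup>2 + 2 * (cmod (g x))\<^sup>2)"
    using assms by simp
  have "(cmod (a + b))\<^sup>2 \<le> 2 * (cmod a)\<^sup>2 + 2 * (cmod b)\<^sup>2" for a b
  proof -
    have "(cmod (a + b))\<^sup>2 \<le> (cmod a + cmod b)\<^sup>2"
      by (simp add: norm_triangle_ineq power_mono)
    then show ?thesis
      using sum_squares_bound[of "cmod a" "cmod b"] by (simp add: power2_sum)
  qed
  then show "AE x in M. norm ((cmod (f x + g x))\<^sup>2) \<le> norm (2 * (cmod (f x))\<^sup>2 + 2 * (cmod (g x))\<^sup>2)"
    by simp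
qed measurable

text \<open>A form of Fatou's lemma that delivers integrability of the limit together with the
  bound. Both completeness and strong continuity rest on it.\<close>

lemma fatou_integrable:
  fixes g :: "'a \<Rightarrow> real"
  assumes m[measurable]: "\<And>n. gn n \<in> borel_measurable M" "g \<in> borel_measurable M"
    and nonneg: "\<And>n x. 0 \<le> gn n x" "\<And>x. 0 \<le> g x"
    and lim: "\<And>x. x \<in> space M \<Longrightarrow> (\<lambda>n. gn n x) \<longlonglongrightarrow> g x"
    and int: "\<And>n. integrable M (gn n)" and le: "\<And>n. integral\<^sup>L M (gn n) \<le> B"
  shows "integrable M g" "integral\<^sup>L M g \<le> B"
proof -
  have B: "0 \<le> B"
    using le[of 0] Bochner_Integration.integral_nonneg[of M "gn 0"] nonneg by (meson order.trans)
  have nn: "(\<integral>\<^sup>+x. ennreal (g x) \<partial>M) \<le> ennreal B"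
  proof -
    have "(\<integral>\<^sup>+x. ennreal (g x) \<partial>M) = (\<integral>\<^sup>+x. liminf (\<lambda>n. ennreal (gn n x)) \<partial>M)"
      by (intro nn_integral_cong lim_imp_Liminf[symmetric] tendsto_ennrealI lim) auto
    also have "\<dots> \<le> liminf (\<lambda>n. \<integral>\<^sup>+x. ennreal (gn n x) \<partial>M)"
      by (rule nn_integral_liminf) measurable
    also have "\<dots> = liminf (\<lambda>n. ennreal (integral\<^sup>L M (gn n)))"
      using int nonneg by (simp add: nn_integral_eq_integral)
    also have "\<dots> \<le> ennreal B"
      using le by (intro Liminf_le) (auto intro!: always_eventually ennreal_leI)
    finally show ?thesis .
  qed
  show "integrable M g"
    by (rule integrableI_nonneg) (use nn nonneg in \<open>auto intro: le_less_trans\<close>)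
  then show "integral\<^sup>L M g \<le> B"
    using nn B nonneg by (simp add: nn_integral_eq_integral)
qed

text \<open>Fatou's lemma for \<open>2|f\<^sub>n|\<^sup>2 + 2|f|\<^sup>2 - |f\<^sub>n - f|\<^sup>2\<close> turns pointwise convergence with
  convergence of norms into convergence in \<open>L\<^sup>2\<close>.\<close>

lemma riesz_convergence:
  fixes f :: "'a \<Rightarrow> complex"
  assumes m[measurable]: "\<And>n. fn n \<in> borel_measurable M" "f \<in> borel_measurable M"
    and lim: "\<And>x. x \<in> space M \<Longrightarrow> (\<lambda>n. fn n x) \<longlonglongrightarrow> f x"
    and int: "\<And>n. integrable M (\<lambda>x. (cmod (fn n x))\<^sup>2)" "integrable M (\<lambda>x. (cmod (f x))\<^sup>2)"
    and norm: "\<And>n. (\<integral>x. (cmod (fn n x))\<^sup>2 \<partial>M) = (\<integral>x. (cmod (f x))\<^sup>2 \<partial>M)"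
  shows "(\<lambda>n. \<integral>x. (cmod (fn n x - f x))\<^sup>2 \<partial>M) \<longlonglongrightarrow> 0"
proof (rule ccontr)
  define a where "a = (\<lambda>n. \<integral>x. (cmod (fn n x - f x))\<^sup>2 \<partial>M)"
  define I where "I = (\<integral>x. (cmod (f x))\<^sup>2 \<partial>M)"
  assume "\<not> a \<longlonglongrightarrow> 0"
  moreover have "a n \<ge> 0" for n
    by (simp add: a_def)
  ultimately obtain e where e: "e > 0" "\<not> (\<forall>\<^sub>F n in sequentially. a n < e)"
    by (auto simp: tendsto_iff)
  from e(2) have inf: "infinite {n. e \<le> a n}"
    unfolding not_eventually not_less frequently_cofinite[symmetric] cofinite_eq_sequentially[symmetric] .
  then obtain r :: "nat \<Rightarrow> nat" where r: "strict_mono r" "\<And>n. e \<le> a (r n)"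
    using infinite_enumerate[OF inf] by auto
  \<comment> \<open>\<open>G n\<close> is nonnegative with integral 4 I - a (r n) <= 4 I - e, while
    its pointwise limit 4 |f|^2 has the integral 4 I; this contradicts Fatou's lemma.\<close>
  define G where "G = (\<lambda>n x. 2 * (cmod (fn (r n) x))\<^sup>2 + 2 * (cmod (f x))\<^sup>2 - (cmod (fn (r n) x - f x))\<^sup>2)"
  have int_diff: "integrable M (\<lambda>x. (cmod (fn n x - f x))\<^sup>2)" for n
    using integrable_sq_add[of "fn n" M "\<lambda>x. - f x"] int by simp
  have G0: "0 \<le> G n x" for n x
  proof -
    have "(cmod (fn (r n) x - f x))\<^sup>2 \<le> (cmod (fn (r n) x) + cmod (f x))\<^sup>2"
      by (simp add: norm_triangle_ineq4 power_mono)
    then show ?thesis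
      using sum_squares_bound[of "cmod (fn (r n) x)" "cmod (f x)"] by (simp add: G_def power2_sum)
  qed
  have Gint: "integrable M (G n)" for n
    unfolding G_def using int int_diff by simp
  have Gval: "integral\<^sup>L M (G n) = 4 * I - a (r n)" for n
    unfolding G_def using int int_diff norm by (simp add: a_def I_def)
  have "integral\<^sup>L M (\<lambda>x. 4 * (cmod (f x))\<^sup>2) \<le> 4 * I - e"
  proof (rule fatou_integrable(2))
    fix x assume "x \<in> space M"
    then have l: "(\<lambda>n. fn (r n) x) \<longlonglongrightarrow> f x"
      using LIMSEQ_subseq_LIMSEQ[OF lim r(1)] by (simp add: o_def)
    have "(\<lambda>n. G n x) \<longlonglongrightarrow> 2 * (cmod (f x))\<^sup>2 + 2 * (cmod (f x))\<^sup>2 - (cmod (f x - f x))\<^sup>2"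
      unfolding G_def by (intro tendsto_intros l)
    then show "(\<lambda>n. G n x) \<longlonglongrightarrow> 4 * (cmod (f x))\<^sup>2"
      by simp
  qed (use G0 Gint Gval r(2) in \<open>simp_all add: G_def\<close>)
  then show False
    using e by (simp add: I_def)
qed

text \<open>With this measure \<open>jacobi_ip\<close> is a multiple of the usual scalar product of
  square-integrable functions. Its mass is finite, so that constants are square integrable.\<close>

definition jacobi_gauss :: "real \<Rightarrow> (complex \<times> complex) measure" where
  "jacobi_gauss k = density jacobi_measure (\<lambda>x. ennreal (weight_density k x))"

lemma sets_jacobi_gauss [simp, measurable_cong]: "sets (jacobi_gauss k) = sets borel"
  and space_jacobi_gauss [simp]: "space (jacobi_gauss k) = UNIV"
  by (simp_all add: jacobi_gauss_def)

lemma AE_jacobi_measure: "AE x in jacobi_measure. x \<in> jacobi_disk"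
  unfolding jacobi_measure_def
  by (subst AE_density) (auto simp: indicator_def)

lemma emeasure_jacobi_gauss:
  "k \<ge> 1 \<Longrightarrow> emeasure (jacobi_gauss k) UNIV = ennreal (2 * pi\<^sup>2 / (4 * k - 3))"
  unfolding jacobi_gauss_def by (subst emeasure_density) (simp_all add: nn_integral_weight)

lemma finite_jacobi_gauss: "k \<ge> 1 \<Longrightarrow> finite_measure (jacobi_gauss k)"
  by (rule finite_measureI) (simp add: emeasure_jacobi_gauss)

text \<open>With the indicator inside \<open>ennreal\<close> the rules for real densities
  apply.\<close>

lemma jacobi_measure_alt:
  "jacobi_measure = density lborel (\<lambda>x. ennreal (1 / (1 - (cmod (snd x))\<^sup>2) ^ 3 * indicator jacobi_disk x))"
  unfolding jacobi_measure_def by (intro arg_cong2[where f = density] refl ext) (simp add: indicator_def)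

lemma disk_density_nonneg: "0 \<le> 1 / (1 - (cmod (snd x))\<^sup>2) ^ 3 * indicator jacobi_disk x"
proof (cases "x \<in> jacobi_disk")
  case True
  then have "(cmod (snd x))\<^sup>2 < 1"
    by (cases x) (simp add: abs_square_less_1)
  then show ?thesis
    by simp
qed simp

lemma set_integrable_jacobi_weight:
  fixes g :: "complex \<times> complex \<Rightarrow> real"
  assumes [measurable]: "g \<in> borel_measurable borel"
  shows "set_integrable lborel jacobi_disk (\<lambda>x. g x * jacobi_weight k x) \<longleftrightarrow> integrable (jacobi_gauss k) g"
proof -
  have "integrable (jacobi_gauss k) g \<longleftrightarrow> integrable jacobi_measure (\<lambda>x. weight_density k x *\<^sub>R g x)"
    unfolding jacobi_gauss_def by (rule integrable_density) auto
  also have "\<dots> \<longleftrightarrow> integrable lborel (\<lambda>x. (1 / (1 - (cmod (snd x))\<^sup>2) ^ 3 * indicator jacobi_disk x) *\<^sub>R (weight_density k x *\<^sub>R g x))"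
    unfolding jacobi_measure_alt by (rule integrable_density, measurable, rule AE_I2, rule disk_density_nonneg)
  also have "\<dots> \<longleftrightarrow> set_integrable lborel jacobi_disk (\<lambda>x. g x * jacobi_weight k x)"
    unfolding set_integrable_def jacobi_weight_eq by (simp add: ac_simps)
  finally show ?thesis ..
qed

lemma set_lebesgue_integral_jacobi_weight:
  fixes g :: "complex \<times> complex \<Rightarrow> complex"
  assumes [measurable]: "g \<in> borel_measurable borel"
  shows "(LINT x:jacobi_disk|lborel. g x * of_real (jacobi_weight k x)) = (\<integral>x. g x \<partial>jacobi_gauss k)"
proof -
  have "(\<integral>x. g x \<partial>jacobi_gauss k) = (\<integral>x. weight_density k x *\<^sub>R g x \<partial>jacobi_measure)"
    unfolding jacobi_gauss_def by (rule integral_density) auto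
  also have "\<dots> = (\<integral>x. (1 / (1 - (cmod (snd x))\<^sup>2) ^ 3 * indicator jacobi_disk x) *\<^sub>R (weight_density k x *\<^sub>R g x) \<partial>lborel)"
    unfolding jacobi_measure_alt by (rule integral_density, measurable, rule AE_I2, rule disk_density_nonneg)
  also have "\<dots> = (LINT x:jacobi_disk|lborel. g x * of_real (jacobi_weight k x))"
    unfolding set_lebesgue_integral_def jacobi_weight_eq
    by (intro Bochner_Integration.integral_cong refl) (simp add: scaleR_conv_of_real ac_simps)
  finally show ?thesis ..
qed

lemma holomorphic2_borel_measurable:
  assumes f: "f holomorphic2_on jacobi_disk" "\<And>x. x \<notin> jacobi_disk \<Longrightarrow> f x = 0"
  shows "f \<in> borel_measurable borel"
proof -
  have "(\<lambda>x. indicator jacobi_disk x *\<^sub>R f x) \<in> borel_measurable borel"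
    by (rule borel_measurable_continuous_on_indicator[OF _ holomorphic2_on_imp_continuous_on[OF f(1)]]) measurable
  moreover have "(\<lambda>x. indicator jacobi_disk x *\<^sub>R f x) = f"
    using f(2) by (auto simp: indicator_def fun_eq_iff)
  ultimately show ?thesis
    by simp
qed

lemma jacobi_space_iff:
  "f \<in> jacobi_space k \<longleftrightarrow> f holomorphic2_on jacobi_disk \<and> (\<forall>x. x \<notin> jacobi_disk \<longrightarrow> f x = 0)
    \<and> integrable (jacobi_gauss k) (\<lambda>x. (cmod (f x))\<^sup>2)"
proof -
  have "set_integrable lborel jacobi_disk (\<lambda>x. (cmod (f x))\<^sup>2 * jacobi_weight k x)
      \<longleftrightarrow> integrable (jacobi_gauss k) (\<lambda>x. (cmod (f x))\<^sup>2)"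
    if "f holomorphic2_on jacobi_disk" "\<forall>x. x \<notin> jacobi_disk \<longrightarrow> f x = 0"
  proof (rule set_integrable_jacobi_weight)
    have [measurable]: "f \<in> borel_measurable borel"
      using holomorphic2_borel_measurable that by blast
    show "(\<lambda>x. (cmod (f x))\<^sup>2) \<in> borel_measurable borel"
      by measurable
  qed
  then show ?thesis
    unfolding jacobi_space_def by blast
qed

lemma jacobi_spaceD:
  assumes "f \<in> jacobi_space k"
  shows "f holomorphic2_on jacobi_disk" "x \<notin> jacobi_disk \<Longrightarrow> f x = 0"
    "f \<in> borel_measurable borel" "integrable (jacobi_gauss k) (\<lambda>x. (cmod (f x))\<^sup>2)"
  using assms holomorphic2_borel_measurable[of f] unfolding jacobi_space_iff by blast+

lemma jacobi_ip_eq: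
  assumes [measurable]: "f \<in> borel_measurable borel" "g \<in> borel_measurable borel"
  shows "jacobi_ip k f g = of_real ((4 * k - 3) / (2 * pi\<^sup>2)) * (\<integral>x. cnj (f x) * g x \<partial>jacobi_gauss k)"
  unfolding jacobi_ip_def by (subst set_lebesgue_integral_jacobi_weight) simp_all

lemma integral_jacobi_ip:
  assumes "f \<in> jacobi_space k" "g \<in> jacobi_space k"
  shows "integrable (jacobi_gauss k) (\<lambda>x. cnj (f x) * g x)"
proof -
  have [measurable]: "f \<in> borel_measurable borel" "g \<in> borel_measurable borel"
    using assms jacobi_spaceD by blast+
  show ?thesis
    by (rule integrable_cnj_mult) (use assms jacobi_spaceD in \<open>auto\<close>)
qed

lemma vector_space_fun: "vector_space (\<lambda>c f x. c * f x :: complex)"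
  by unfold_locales (auto simp: fun_eq_iff algebra_simps)

lemma jacobi_ip_self:
  assumes "f \<in> jacobi_space k"
  shows "jacobi_ip k f f = of_real ((4 * k - 3) / (2 * pi\<^sup>2) * (\<integral>x. (cmod (f x))\<^sup>2 \<partial>jacobi_gauss k))"
proof -
  have m: "f \<in> borel_measurable borel"
    using assms jacobi_spaceD by blast
  have 1: "cnj (f x) * f x = of_real ((cmod (f x))\<^sup>2)" for x
    by (metis complex_norm_square mult.commute)
  show ?thesis
    unfolding jacobi_ip_eq[OF m m] 1 integral_complex_of_real of_real_mult ..
qed

lemma jacobi_semi_inner:
  assumes k: "k \<ge> 1"
  shows "semi_inner_space (\<lambda>c f x. c * f x) (jacobi_space k) (jacobi_ip k)"
proof (rule semi_inner_space.intro[OF vector_space_fun], rule semi_inner_space_axioms.intro)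
  note meas = jacobi_spaceD(3)
  interpret vector_space "\<lambda>c f (x :: complex \<times> complex). c * f x :: complex"
    by (rule vector_space_fun)
  show "subspace (jacobi_space k)"
  proof (rule subspaceI)
    show "0 \<in> jacobi_space k"
      using holomorphic2_on_const[of 0 jacobi_disk] by (simp add: jacobi_space_iff zero_fun_def)
    show "f + g \<in> jacobi_space k" if fg: "f \<in> jacobi_space k" "g \<in> jacobi_space k" for f g
    proof -
      have [measurable]: "f \<in> borel_measurable borel" "g \<in> borel_measurable borel"
        using fg meas by blast+
      have "integrable (jacobi_gauss k) (\<lambda>x. (cmod (f x + g x))\<^sup>2)"
        by (rule integrable_sq_add) (use fg jacobi_spaceD in auto)
      moreover have "(\<lambda>x. f x + g x) holomorphic2_on jacobi_disk"
        using fg jacobi_spaceD holomorphic2_on_add by blast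
      ultimately show ?thesis
        using fg by (simp add: jacobi_space_iff plus_fun_def)
    qed
    show "(\<lambda>x. c * f x) \<in> jacobi_space k" if f: "f \<in> jacobi_space k" for c f
    proof -
      have "(\<lambda>x. c * f x) holomorphic2_on jacobi_disk"
        using holomorphic2_on_mult[OF holomorphic2_on_const jacobi_spaceD(1)[OF f]] .
      then show ?thesis
        using f by (simp add: jacobi_space_iff norm_mult power_mult_distrib)
    qed
  qed
  show "jacobi_ip k u (v + w) = jacobi_ip k u v + jacobi_ip k u w"
    if uvw: "u \<in> jacobi_space k" "v \<in> jacobi_space k" "w \<in> jacobi_space k" for u v w
  proof -
    have [measurable]: "u \<in> borel_measurable borel" "v \<in> borel_measurable borel" "w \<in> borel_measurable borel"
      using uvw meas by blast+
    have [measurable]: "v + w \<in> borel_measurable borel"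
      unfolding plus_fun_def by measurable
    show ?thesis
      using integral_jacobi_ip[OF uvw(1,2)] integral_jacobi_ip[OF uvw(1,3)]
      by (simp add: jacobi_ip_eq distrib_left)
  qed
  show "jacobi_ip k u (\<lambda>x. c * v x) = c * jacobi_ip k u v"
    if uv: "u \<in> jacobi_space k" "v \<in> jacobi_space k" for u v c
  proof -
    have [measurable]: "u \<in> borel_measurable borel" "v \<in> borel_measurable borel"
      using uv meas by blast+
    have "(\<integral>x. cnj (u x) * (c * v x) \<partial>jacobi_gauss k) = c * (\<integral>x. cnj (u x) * v x \<partial>jacobi_gauss k)"
      by (subst integral_mult_right_zero[symmetric]) (simp add: mult.left_commute)
    then show ?thesis
      by (simp add: jacobi_ip_eq)
  qed
  show "jacobi_ip k v u = cnj (jacobi_ip k u v)"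
    if uv: "u \<in> jacobi_space k" "v \<in> jacobi_space k" for u v
  proof -
    have [measurable]: "u \<in> borel_measurable borel" "v \<in> borel_measurable borel"
      using uv meas by blast+
    have "(\<integral>x. cnj (v x) * u x \<partial>jacobi_gauss k) = (\<integral>x. cnj (cnj (u x) * v x) \<partial>jacobi_gauss k)"
      by (simp add: mult.commute)
    also have "\<dots> = cnj (\<integral>x. cnj (u x) * v x \<partial>jacobi_gauss k)"
      by (rule Bochner_Integration.integral_cnj)
    finally show ?thesis
      by (simp add: jacobi_ip_eq)
  qed
  show "0 \<le> Re (jacobi_ip k v v)" if "v \<in> jacobi_space k" for v
    unfolding jacobi_ip_self[OF that] using k by (simp add: integral_nonneg)
qed

section \<open>The representation on the space of holomorphic functions\<close>

lemma holomorphic2_on_power: "f holomorphic2_on D \<Longrightarrow> (\<lambda>x. f x ^ n) holomorphic2_on D"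
  by (rule holomorphic2_on_compose_scalar[of _ _ "\<lambda>u. u ^ n"]) (auto intro!: derivative_intros)

lemma holomorphic2_on_exp: "f holomorphic2_on D \<Longrightarrow> (\<lambda>x. exp (f x)) holomorphic2_on D"
  by (rule holomorphic2_on_compose_scalar) (auto intro!: field_differentiable_within_exp)

lemma holomorphic2_on_inverse:
  "\<lbrakk>f holomorphic2_on D; \<And>x. x \<in> D \<Longrightarrow> f x \<noteq> 0\<rbrakk> \<Longrightarrow> (\<lambda>x. inverse (f x)) holomorphic2_on D"
  by (rule holomorphic2_on_compose_scalar) (auto intro!: derivative_intros)

lemma holomorphic2_on_divide:
  "\<lbrakk>f holomorphic2_on D; g holomorphic2_on D; \<And>x. x \<in> D \<Longrightarrow> g x \<noteq> 0\<rbrakk> \<Longrightarrow> (\<lambda>x. f x / g x) holomorphic2_on D"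
  unfolding divide_inverse by (intro holomorphic2_on_mult holomorphic2_on_inverse)

lemma holomorphic2_on_minus: "f holomorphic2_on D \<Longrightarrow> (\<lambda>x. - f x) holomorphic2_on D"
  using holomorphic2_on_mult[OF holomorphic2_on_const[of "-1"], of f D] by simp

lemma holomorphic2_on_diff:
  "\<lbrakk>f holomorphic2_on D; g holomorphic2_on D\<rbrakk> \<Longrightarrow> (\<lambda>x. f x - g x) holomorphic2_on D"
  using holomorphic2_on_add[of f D "\<lambda>x. - g x"] holomorphic2_on_minus by simp

lemmas holomorphic2_intros = holomorphic2_on_const holomorphic2_on_fst holomorphic2_on_snd
  holomorphic2_on_add holomorphic2_on_diff holomorphic2_on_minus holomorphic2_on_mult
  holomorphic2_on_power holomorphic2_on_exp holomorphic2_on_divide holomorphic2_on_inverse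

lemma holomorphic2_su_den: "(\<lambda>x. su_den a b (snd x)) holomorphic2_on D"
  unfolding su_den_def by (intro holomorphic2_intros)

lemma holomorphic2_mult_factor:
  assumes "su_pair a b"
  shows "(\<lambda>x. jacobi_mult_factor n a b \<alpha> (fst x) (snd x)) holomorphic2_on jacobi_disk"
proof -
  have den: "su_den a b (snd x) \<noteq> 0" if "x \<in> jacobi_disk" for x
    using that su_den_nonzero[OF assms] by (cases x) auto
  show ?thesis
    unfolding jacobi_mult_factor_def
    by (intro holomorphic2_intros holomorphic2_su_den) (simp_all add: den)
qed

lemma holomorphic2_jacobi_kernel:
  assumes k: "2 * k = real n" and y: "y \<in> jacobi_disk"
  shows "(\<lambda>x. jacobi_kernel k x y) holomorphic2_on jacobi_disk"
proof (rule holomorphic2_on_cong[OF jacobi_disk_open])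
  let ?F = "\<lambda>x. inverse ((1 - snd x * cnj (snd y)) ^ n)
    * exp ((2 * cnj (fst y) * fst x + (fst x)\<^sup>2 * cnj (snd y) + (cnj (fst y))\<^sup>2 * snd x) / (2 * (1 - snd x * cnj (snd y))))"
  show "?F x = jacobi_kernel k x y" if "x \<in> jacobi_disk" for x
    using that y by (cases x, cases y) (simp add: jacobi_kernel_eq[OF k])
  have "1 - snd x * cnj (snd y) \<noteq> 0" if "x \<in> jacobi_disk" for x
    using that y one_minus_nonzero[of "snd x" "snd y"] by (cases x, cases y) simp
  then show "?F holomorphic2_on jacobi_disk"
    by (intro holomorphic2_intros) auto
qed

locale half_integer_weight =
  fixes k :: real and n :: nat
  assumes k: "2 * k = real n" and n: "n \<ge> 2"
begin

lemma k_ge: "k \<ge> 1"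
  using k n by (metis (mono_tags) mult_le_cancel_left_pos mult.right_neutral of_nat_le_iff of_nat_numeral zero_less_numeral)

sublocale J: semi_inner_space "\<lambda>c f x. c * f x" "jacobi_space k" "jacobi_ip k"
  by (rule jacobi_semi_inner[OF k_ge])

lemma kernel_diag:
  assumes "x \<in> jacobi_disk"
  shows "jacobi_kernel k x x = of_real (1 / weight_density k x)"
proof -
  obtain z w where x: "x = (z, w)" and w: "cmod w < 1"
    using assms by (cases x) auto
  define s where "s = 1 - (cmod w)\<^sup>2"
  have s: "s > 0"
    using w by (simp add: s_def abs_square_less_1)
  have 1: "1 - w * cnj w = of_real s"
    unfolding s_def by (simp only: of_real_diff of_real_1 complex_norm_square)
  define R where "R = Re (z\<^sup>2 * cnj w + (cnj z)\<^sup>2 * w)"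
  have "z\<^sup>2 * cnj w + (cnj z)\<^sup>2 * w = of_real R"
    unfolding R_def by (simp add: complex_eq_iff power2_eq_square)
  moreover have "2 * cnj z * z = of_real (2 * (cmod z)\<^sup>2)"
    by (simp only: of_real_mult complex_norm_square) simp
  ultimately have 2: "2 * cnj z * z + z\<^sup>2 * cnj w + (cnj z)\<^sup>2 * w = of_real (2 * (cmod z)\<^sup>2 + R)"
    by (simp add: add.assoc)
  have "jacobi_kernel k x x = of_real (inverse (s ^ n) * exp ((2 * (cmod z)\<^sup>2 + R) / (2 * s)))"
    unfolding x jacobi_kernel_eq[OF k w w] 1 2
    by (simp add: exp_of_real[symmetric] del: exp_of_real)
  also have "inverse (s ^ n) * exp ((2 * (cmod z)\<^sup>2 + R) / (2 * s)) = 1 / weight_density k x"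
  proof -
    have "weight_density k x = s ^ n * exp (- (cmod z)\<^sup>2 / s - R / (2 * s))"
      unfolding weight_density_def x fst_conv snd_conv s_def[symmetric] R_def[symmetric]
      using s by (simp add: k powr_realpow)
    also have "- (cmod z)\<^sup>2 / s - R / (2 * s) = - ((2 * (cmod z)\<^sup>2 + R) / (2 * s))"
      using s by (simp add: field_simps)
    finally have wd: "weight_density k x = s ^ n * exp (- ((2 * (cmod z)\<^sup>2 + R) / (2 * s)))" .
    show ?thesis
      unfolding wd by (simp only: exp_minus inverse_mult_distrib inverse_inverse_eq divide_inverse mult_1)
  qed
  finally show ?thesis .
qed

text \<open>The diagonal case of \<open>jacobi_kernel_act\<close>, read through
  \<open>kernel_diag\<close>.\<close>

lemma weight_density_act:
  assumes h: "h \<in> carrier jacobi_group" and x: "x \<in> jacobi_disk"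
  shows "weight_density k (jacobi_act h x) * (cmod (jacobi_cocycle k h x))\<^sup>2 = weight_density k x"
proof -
  have hx: "jacobi_act h x \<in> jacobi_disk"
    by (rule jacobi_act_in_disk[OF h x])
  have "complex_of_real (1 / weight_density k (jacobi_act h x))
    = (jacobi_cocycle k h x * cnj (jacobi_cocycle k h x)) * of_real (1 / weight_density k x)"
    using jacobi_kernel_act[OF k h x x] unfolding kernel_diag[OF x] kernel_diag[OF hx] by (simp only: ac_simps)
  also have "\<dots> = of_real ((cmod (jacobi_cocycle k h x))\<^sup>2 * (1 / weight_density k x))"
    by (simp only: complex_norm_square of_real_mult)
  finally have "1 / weight_density k (jacobi_act h x) = (cmod (jacobi_cocycle k h x))\<^sup>2 * (1 / weight_density k x)"
    by (simp only: of_real_eq_iff)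
  then show ?thesis
    using weight_density_pos[OF x, of k] weight_density_pos[OF hx, of k] by (simp add: field_simps)
qed

section \<open>The operators of the representation and their unitarity\<close>

definition pi_K :: "jacobi \<Rightarrow> (complex \<times> complex \<Rightarrow> complex) \<Rightarrow> complex \<times> complex \<Rightarrow> complex" where
  "pi_K h f x = (if x \<in> jacobi_disk
     then inverse (jacobi_cocycle k (inv\<^bsub>jacobi_group\<^esub> h) x) * f (jacobi_act (inv\<^bsub>jacobi_group\<^esub> h) x) else 0)"

lemma inv_closed: "h \<in> carrier jacobi_group \<Longrightarrow> inv\<^bsub>jacobi_group\<^esub> h \<in> carrier jacobi_group"
  by (rule group.inv_closed[OF jacobi_group])

lemma pi_K_holomorphic:
  assumes h: "h \<in> carrier jacobi_group" and f: "f holomorphic2_on jacobi_disk"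
  shows "pi_K h f holomorphic2_on jacobi_disk"
proof -
  obtain a b \<alpha> t where h': "inv\<^bsub>jacobi_group\<^esub> h = (su_mat a b, \<alpha>, t)" and ab: "su_pair a b"
    using inv_closed[OF h] by (elim jacobi_carrierE)
  have den: "su_den a b (snd x) \<noteq> 0" if "x \<in> jacobi_disk" for x
    using that su_den_nonzero[OF ab] by (cases x) auto
  let ?F = "\<lambda>x. exp (\<i> * of_real t) * jacobi_mult_factor n a b \<alpha> (fst x) (snd x)
      * f ((\<alpha> - cnj \<alpha> * snd x + fst x) / su_den a b (snd x), (a * snd x + b) / su_den a b (snd x))"
  have "?F holomorphic2_on jacobi_disk"
  proof (intro holomorphic2_on_mult holomorphic2_on_const holomorphic2_mult_factor ab)
    show "(\<lambda>x. f ((\<alpha> - cnj \<alpha> * snd x + fst x) / su_den a b (snd x), (a * snd x + b) / su_den a b (snd x)))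
      holomorphic2_on jacobi_disk"
    proof (rule holomorphic2_on_compose[OF f])
      show "((\<alpha> - cnj \<alpha> * snd x + fst x) / su_den a b (snd x), (a * snd x + b) / su_den a b (snd x)) \<in> jacobi_disk"
        if "x \<in> jacobi_disk" for x
        using that moebius_in_disk[OF ab] by (cases x) (simp del: norm_divide)
    qed (intro holomorphic2_intros holomorphic2_su_den den; assumption)+
  qed
  moreover have "?F x = pi_K h f x" if "x \<in> jacobi_disk" for x
    using that by (cases x) (simp add: pi_K_def h' jacobi_cocycle_eq[OF k ab] jacobi_act_su_mat)
  ultimately show ?thesis
    by (intro holomorphic2_on_cong[OF jacobi_disk_open, of ?F "pi_K h f"]) auto
qed

lemma pi_K_outside: "x \<notin> jacobi_disk \<Longrightarrow> pi_K h f x = 0"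
  by (simp add: pi_K_def)

text \<open>The two cocycle factors are compensated by \<open>weight_density_act\<close>, so the
  weighted integrand is a mere composition with the action; the invariance of
  \<open>jacobi_measure\<close> then settles the integrals.\<close>

lemma pi_K_weight:
  assumes h: "h \<in> carrier jacobi_group" and x: "x \<in> jacobi_disk"
  shows "weight_density k x *\<^sub>R (cnj (pi_K h f x) * pi_K h g x)
    = (\<lambda>y. weight_density k y *\<^sub>R (cnj (f y) * g y)) (jacobi_act (inv\<^bsub>jacobi_group\<^esub> h) x)"
proof -
  let ?h = "inv\<^bsub>jacobi_group\<^esub> h"
  define J where "J = jacobi_cocycle k ?h x"
  have J: "J \<noteq> 0"
    using jacobi_cocycle_nonzero[OF k inv_closed[OF h] x] by (simp add: J_def)
  have "cnj (pi_K h f x) * pi_K h g x = inverse (J * cnj J) * (cnj (f (jacobi_act ?h x)) * g (jacobi_act ?h x))"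
    using x by (simp add: pi_K_def J_def)
  also have "J * cnj J = of_real ((cmod J)\<^sup>2)"
    by (simp only: complex_norm_square)
  finally show ?thesis
    using J weight_density_act[OF inv_closed[OF h] x]
    by (simp add: J_def[symmetric] scaleR_conv_of_real) (auto simp: field_simps simp flip: of_real_mult of_real_power)
qed

lemma pi_K_borel:
  assumes "h \<in> carrier jacobi_group" "f holomorphic2_on jacobi_disk"
  shows "pi_K h f \<in> borel_measurable borel"
  by (intro holomorphic2_borel_measurable pi_K_holomorphic assms pi_K_outside)

lemma
  assumes h: "h \<in> carrier jacobi_group" and f: "f \<in> jacobi_space k" and g: "g \<in> jacobi_space k"
  shows pi_K_integrable: "integrable (jacobi_gauss k) (\<lambda>x. cnj (pi_K h f x) * pi_K h g x)"
    and pi_K_integral: "(\<integral>x. cnj (pi_K h f x) * pi_K h g x \<partial>jacobi_gauss k) = (\<integral>x. cnj (f x) * g x \<partial>jacobi_gauss k)"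
proof -
  have m[measurable]: "f \<in> borel_measurable borel" "g \<in> borel_measurable borel"
      "pi_K h f \<in> borel_measurable borel" "pi_K h g \<in> borel_measurable borel"
    using f g jacobi_spaceD pi_K_borel[OF h] by blast+
  let ?G = "\<lambda>y. weight_density k y *\<^sub>R (cnj (f y) * g y)"
  let ?a = "jacobi_act (inv\<^bsub>jacobi_group\<^esub> h)"
  have mu: "distr jacobi_measure borel ?a = jacobi_measure"
    by (rule jacobi_measure_invariant[OF inv_closed[OF h]])
  have a: "?a \<in> measurable jacobi_measure borel"
    by measurable
  have G: "?G \<in> borel_measurable borel"
    by measurable
  have AE: "AE x in jacobi_measure. weight_density k x *\<^sub>R (cnj (pi_K h f x) * pi_K h g x) = ?G (?a x)"
    using AE_jacobi_measure by eventually_elim (rule pi_K_weight[OF h])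
  have M1: "(\<lambda>x. weight_density k x *\<^sub>R (cnj (pi_K h f x) * pi_K h g x)) \<in> borel_measurable jacobi_measure"
    by measurable
  have M2: "(\<lambda>x. ?G (?a x)) \<in> borel_measurable jacobi_measure"
    using measurable_compose[OF a G] .
  have 1: "integrable (jacobi_gauss k) (\<lambda>x. cnj (u x) * v x) \<longleftrightarrow> integrable jacobi_measure (\<lambda>x. weight_density k x *\<^sub>R (cnj (u x) * v x))"
    if "u \<in> borel_measurable borel" "v \<in> borel_measurable borel" for u v :: "_ \<Rightarrow> complex"
    unfolding jacobi_gauss_def by (rule integrable_density) (use that in auto)
  have 2: "(\<integral>x. cnj (u x) * v x \<partial>jacobi_gauss k) = (\<integral>x. weight_density k x *\<^sub>R (cnj (u x) * v x) \<partial>jacobi_measure)"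
    if "u \<in> borel_measurable borel" "v \<in> borel_measurable borel" for u v :: "_ \<Rightarrow> complex"
    unfolding jacobi_gauss_def by (rule integral_density) (use that in auto)
  have "integrable jacobi_measure ?G"
    using integral_jacobi_ip[OF f g] 1[OF m(1,2)] by simp
  then have "integrable jacobi_measure (\<lambda>x. ?G (?a x))"
    using integrable_distr_eq[OF a G] by (simp add: mu)
  then show "integrable (jacobi_gauss k) (\<lambda>x. cnj (pi_K h f x) * pi_K h g x)"
    unfolding 1[OF m(3,4)] using integrable_cong_AE[OF M1 M2 AE] by simp
  have "(\<integral>x. cnj (pi_K h f x) * pi_K h g x \<partial>jacobi_gauss k) = (\<integral>x. ?G (?a x) \<partial>jacobi_measure)"
    unfolding 2[OF m(3,4)] by (rule integral_cong_AE[OF M1 M2 AE])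
  also have "\<dots> = (\<integral>x. ?G x \<partial>jacobi_measure)"
    using integral_distr[OF a G] by (simp add: mu)
  finally show "(\<integral>x. cnj (pi_K h f x) * pi_K h g x \<partial>jacobi_gauss k) = (\<integral>x. cnj (f x) * g x \<partial>jacobi_gauss k)"
    unfolding 2[OF m(1,2)] .
qed

lemma pi_K_closed:
  assumes h: "h \<in> carrier jacobi_group" and f: "f \<in> jacobi_space k"
  shows "pi_K h f \<in> jacobi_space k"
proof -
  have "cnj (pi_K h f x) * pi_K h f x = of_real ((cmod (pi_K h f x))\<^sup>2)" for x
    by (metis complex_norm_square mult.commute)
  then have "integrable (jacobi_gauss k) (\<lambda>x. complex_of_real ((cmod (pi_K h f x))\<^sup>2))"
    using pi_K_integrable[OF h f f] by simp
  then have "integrable (jacobi_gauss k) (\<lambda>x. (cmod (pi_K h f x))\<^sup>2)"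
    using integrable_Re by fastforce
  then show ?thesis
    using pi_K_holomorphic[OF h jacobi_spaceD(1)[OF f]] pi_K_outside by (simp add: jacobi_space_iff)
qed

lemma pi_K_unitary:
  assumes h: "h \<in> carrier jacobi_group" and f: "f \<in> jacobi_space k" and g: "g \<in> jacobi_space k"
  shows "jacobi_ip k (pi_K h f) (pi_K h g) = jacobi_ip k f g"
  unfolding jacobi_ip_eq[OF jacobi_spaceD(3)[OF pi_K_closed[OF h f]] jacobi_spaceD(3)[OF pi_K_closed[OF h g]]]
    jacobi_ip_eq[OF jacobi_spaceD(3)[OF f] jacobi_spaceD(3)[OF g]] pi_K_integral[OF assms] ..

lemma cocycle_one: "x \<in> jacobi_disk \<Longrightarrow> jacobi_cocycle k \<one>\<^bsub>jacobi_group\<^esub> x = 1"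
  by (cases x) (simp add: jacobi_one jacobi_cocycle_eq[OF k] jacobi_mult_factor_def su_den_def)

lemma act_one: "x \<in> jacobi_disk \<Longrightarrow> jacobi_act \<one>\<^bsub>jacobi_group\<^esub> x = x"
  by (cases x) (simp add: jacobi_one jacobi_act_su_mat su_den_def)

lemma pi_K_one: "f \<in> jacobi_space k \<Longrightarrow> pi_K \<one>\<^bsub>jacobi_group\<^esub> f = f"
  using jacobi_spaceD(2)
  by (auto simp: pi_K_def fun_eq_iff cocycle_one act_one group.is_monoid[OF jacobi_group] monoid.inv_one)

lemma pi_K_mult:
  assumes h: "h1 \<in> carrier jacobi_group" "h2 \<in> carrier jacobi_group"
  shows "pi_K (h1 \<otimes>\<^bsub>jacobi_group\<^esub> h2) f = pi_K h1 (pi_K h2 f)"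
proof
  fix x
  let ?i = "\<lambda>h. inv\<^bsub>jacobi_group\<^esub> h"
  have inv: "?i (h1 \<otimes>\<^bsub>jacobi_group\<^esub> h2) = ?i h2 \<otimes>\<^bsub>jacobi_group\<^esub> ?i h1"
    using h by (rule group.inv_mult_group[OF jacobi_group])
  show "pi_K (h1 \<otimes>\<^bsub>jacobi_group\<^esub> h2) f x = pi_K h1 (pi_K h2 f) x"
    using jacobi_act_in_disk[OF inv_closed[OF h(1)], of x]
      jacobi_cocycle_mult[OF k inv_closed[OF h(2)] inv_closed[OF h(1)], of x]
      jacobi_act_mult[OF inv_closed[OF h(2)] inv_closed[OF h(1)], of x]
    by (simp add: pi_K_def inv)
qed

end

section \<open>Rotations and the mean value property\<close>

lemma circle_mean_value:
  assumes g: "g holomorphic_on cball 0 1"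
  shows "((\<lambda>t. g (exp (2 * of_real pi * \<i> * of_real t))) has_integral g 0) {0..1}"
proof -
  have "((\<lambda>u. g u / (u - 0)) has_contour_integral (2 * of_real pi * \<i> * g 0)) (circlepath 0 1)"
    by (rule Cauchy_integral_circlepath_simple[OF g]) simp
  then have "((\<lambda>t. g (circlepath 0 1 t) / circlepath 0 1 t * vector_derivative (circlepath 0 1) (at t))
      has_integral (2 * of_real pi * \<i> * g 0)) {0..1}"
    by (simp add: has_contour_integral)
  then have "((\<lambda>t. (2 * of_real pi * \<i>) * g (exp (2 * of_real pi * \<i> * of_real t)))
      has_integral ((2 * of_real pi * \<i>) * g 0)) {0..1}"
    unfolding vector_derivative_circlepath by (simp add: circlepath mult.assoc mult.left_commute)
  from has_integral_mult_right[OF this, of "1 / (2 * of_real pi * \<i>)"] show ?thesis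
    by simp
qed

context half_integer_weight
begin

definition rot :: "real \<Rightarrow> complex \<times> complex \<Rightarrow> complex \<times> complex" where
  "rot t x = (exp (2 * of_real pi * \<i> * of_real t) * fst x, (exp (2 * of_real pi * \<i> * of_real t))\<^sup>2 * snd x)"

lemma rot_disk [simp]: "rot t x \<in> jacobi_disk \<longleftrightarrow> x \<in> jacobi_disk"
  by (cases x) (simp add: rot_def norm_mult norm_power norm_exp_eq_Re)

text \<open>The circle extends to the holomorphic curve u -> (u z, u^2 w) over the closed unit disk,
  which stays in the domain and passes through the origin at u = 0.\<close>

lemma rot_mean:
  assumes f: "f holomorphic2_on jacobi_disk" and x: "x \<in> jacobi_disk"
  shows "((\<lambda>t. f (rot t x)) has_integral f (0, 0)) {0..1}"
proof -
  obtain z w where xe: "x = (z, w)" and w: "cmod w < 1"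
    using x by (cases x) auto
  have "(\<lambda>u. f (u * z, u\<^sup>2 * w)) holomorphic_on cball 0 1"
  proof -
    have "(\<lambda>u. f (u * z, u\<^sup>2 * w)) field_differentiable at u" if "u \<in> cball 0 1" for u
    proof (rule holomorphic2_on_curve[OF f])
      have "cmod u ^ 2 * cmod w \<le> cmod w"
        using that by (simp add: mult_left_le_one_le power_le_one)
      then show "(u * z, u\<^sup>2 * w) \<in> jacobi_disk"
        using w by (simp add: norm_mult norm_power)
    qed (auto intro!: derivative_intros)
    then show ?thesis
      by (meson field_differentiable_at_within holomorphic_on_def)
  qed
  from circle_mean_value[OF this] show ?thesis
    by (simp add: rot_def xe)
qed

lemma rot_invariant: "distr (jacobi_gauss k) borel (rot t) = jacobi_gauss k"
proof -
  define a where "a = exp (2 * of_real pi * \<i> * of_real t)"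
  have a: "cmod a = 1"
    by (simp add: a_def norm_exp_eq_Re)
  then have aa: "a * cnj a = 1"
    by (metis complex_norm_square of_real_1 one_power2)
  have "cnj a * a = 1"
    using aa by (simp add: mult.commute)
  then have ab: "su_pair a 0" and ca: "a \<noteq> 0" "inverse (cnj a) = a"
    using aa inverse_unique by (auto simp: su_pair_def)
  \<comment> \<open>Since 1 / cnj a = a, the diagonal matrix with first entry \<open>a\<close>
    multiplies z by a and w by a^2.\<close>
  have r: "rot t = jacobi_act (su_mat a 0, 0, 0)"
  proof
    fix x
    have "y / cnj a = a * y" for y
      unfolding divide_inverse ca(2) by (rule mult.commute)
    moreover have "rot t x = (a * fst x, a\<^sup>2 * snd x)"
      by (simp add: rot_def a_def)
    ultimately show "rot t x = jacobi_act (su_mat a 0, 0, 0) x"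
      by (cases x) (simp add: jacobi_act_su_mat su_den_def power2_eq_square mult.assoc)
  qed
  have W: "weight_density k (rot t x) = weight_density k x" for x
  proof -
    have 1: "(a * z)\<^sup>2 * cnj (a\<^sup>2 * w) = z\<^sup>2 * cnj w" for z w
    proof -
      have "(a * z)\<^sup>2 * cnj (a\<^sup>2 * w) = (a * cnj a)\<^sup>2 * (z\<^sup>2 * cnj w)"
        by (simp add: power2_eq_square)
      then show ?thesis
        by (simp add: aa)
    qed
    have 2: "(cnj (a * z))\<^sup>2 * (a\<^sup>2 * w) = (cnj z)\<^sup>2 * w" for z w
    proof -
      have "(cnj (a * z))\<^sup>2 * (a\<^sup>2 * w) = (a * cnj a)\<^sup>2 * ((cnj z)\<^sup>2 * w)"
        by (simp add: power2_eq_square)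
      then show ?thesis
        by (simp add: aa)
    qed
    show ?thesis
      unfolding weight_density_def rot_def a_def[symmetric] fst_conv snd_conv 1 2
      by (simp add: norm_mult norm_power a)
  qed
  have m: "rot t \<in> measurable jacobi_measure borel"
    unfolding r by measurable
  have mu: "distr jacobi_measure borel (rot t) = jacobi_measure"
    unfolding r by (rule jacobi_measure_invariant) (simp add: ab)
  have "jacobi_gauss k = density (distr jacobi_measure borel (rot t)) (\<lambda>x. ennreal (weight_density k x))"
    by (simp add: mu jacobi_gauss_def)
  also have "\<dots> = distr (density jacobi_measure (\<lambda>x. ennreal (weight_density k (rot t x)))) borel (rot t)"
    by (rule density_distr[OF _ m]) measurable
  finally show ?thesis
    by (simp add: W jacobi_gauss_def)
qed

text \<open>Average over the rotations and exchange the integrals: integration over t gives f (0, 0)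
  by the mean value property, integration over x does not see t by invariance. The constant is the
  total mass.\<close>

lemma integral_jacobi_gauss:
  assumes f: "f \<in> jacobi_space k"
  shows "(\<integral>x. f x \<partial>jacobi_gauss k) = of_real (2 * pi\<^sup>2 / (4 * k - 3)) * f (0, 0)"
proof -
  note hol = jacobi_spaceD(1)[OF f] and out = jacobi_spaceD(2)[OF f]
  have fm[measurable]: "f \<in> borel_measurable borel"
    by (rule jacobi_spaceD(3)[OF f])
  interpret fin: finite_measure "jacobi_gauss k"
    by (rule finite_jacobi_gauss[OF k_ge])
  define I where "I = restrict_space lborel {0..1::real}"
  interpret I: finite_measure I
    by (rule finite_measureI) (simp add: I_def emeasure_restrict_space space_restrict_space)
  interpret pair_sigma_finite I "jacobi_gauss k" ..
  have emI: "measure I (space I) = 1"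
    by (simp add: I_def measure_restrict_space)
  \<comment> \<open>On a finite measure square integrability implies integrability, by |f| <= 1 +
    |f|^2.\<close>
  have int: "integrable (jacobi_gauss k) f"
  proof (rule Bochner_Integration.integrable_bound)
    show "integrable (jacobi_gauss k) (\<lambda>x. 1 + (cmod (f x))\<^sup>2)"
      using jacobi_spaceD(4)[OF f] by simp
    have "a \<le> 1 + a\<^sup>2" for a :: real
    proof -
      have "2 * a \<le> a\<^sup>2 + 1"
        using sum_squares_bound[of a 1] by simp
      then show ?thesis
        using zero_le_power2[of a] by linarith
    qed
    then show "AE x in jacobi_gauss k. norm (f x) \<le> norm (1 + (cmod (f x))\<^sup>2)"
      by simp
  qed measurable
  have rotm: "(\<lambda>p. rot (fst p) (snd p)) \<in> borel_measurable borel"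
    unfolding rot_def by (intro borel_measurable_continuous_onI continuous_intros)
  have rotI: "(\<lambda>p. f (rot (fst p) (snd p))) \<in> borel_measurable (I \<Otimes>\<^sub>M jacobi_gauss k)"
  proof -
    have "(\<lambda>p. f (rot (fst p) (snd p))) \<in> borel_measurable (borel \<Otimes>\<^sub>M borel)"
      unfolding borel_prod by (rule measurable_compose[OF rotm fm])
    moreover have "(\<lambda>p. p) \<in> measurable (I \<Otimes>\<^sub>M jacobi_gauss k) (borel \<Otimes>\<^sub>M borel)"
    proof -
      have "fst \<in> measurable (I \<Otimes>\<^sub>M jacobi_gauss k) borel"
        unfolding I_def by (rule measurable_compose[OF measurable_fst]) (simp add: measurable_restrict_space1)
      moreover have "snd \<in> measurable (I \<Otimes>\<^sub>M jacobi_gauss k) borel"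
        by measurable
      ultimately show ?thesis
        by (subst measurable_pair_iff) (simp add: o_def)
    qed
    ultimately show ?thesis
      using measurable_compose by blast
  qed
  have rt: "rot t \<in> measurable (jacobi_gauss k) borel" for t
    unfolding rot_def by (simp add: borel_prod[symmetric] cong: measurable_cong_sets) 
  have inner: "(\<integral>x. g (rot t x) \<partial>jacobi_gauss k) = (\<integral>x. g x \<partial>jacobi_gauss k)"
      "integrable (jacobi_gauss k) (\<lambda>x. g (rot t x)) \<longleftrightarrow> integrable (jacobi_gauss k) g"
    if "g \<in> borel_measurable borel" for t and g :: "_ \<Rightarrow> 'z::{banach, second_countable_topology}"
    using integral_distr[OF rt that] integrable_distr_eq[OF rt that] by (simp_all add: rot_invariant)
  have norm_inner: "(\<integral>y. norm (f (rot x y)) \<partial>jacobi_gauss k) = (\<integral>y. norm (f y) \<partial>jacobi_gauss k)" for x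
    by (rule inner(1)[of "\<lambda>y. norm (f y)"]) measurable
  have "integrable (I \<Otimes>\<^sub>M jacobi_gauss k) (\<lambda>p. f (rot (fst p) (snd p)))"
    by (rule Fubini_integrable[OF rotI]) (use inner(2)[OF fm] int in \<open>simp_all add: norm_inner\<close>)
  then have "integrable (I \<Otimes>\<^sub>M jacobi_gauss k) (case_prod (\<lambda>t x. f (rot t x)))"
    by (simp add: case_prod_beta')
  from Fubini_integral[OF this]
  have "(\<integral>x. (\<integral>t. f (rot t x) \<partial>I) \<partial>jacobi_gauss k) = (\<integral>t. (\<integral>x. f (rot t x) \<partial>jacobi_gauss k) \<partial>I)" .
  also have "\<dots> = (\<integral>x. f x \<partial>jacobi_gauss k)"
    unfolding inner(1)[OF fm] by (simp add: emI)
  also have "(\<integral>x. (\<integral>t. f (rot t x) \<partial>I) \<partial>jacobi_gauss k) = (\<integral>x. f (0, 0) \<partial>jacobi_gauss k)"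
  proof (rule integral_cong_AE)
    have "(\<integral>t. f (rot t x) \<partial>I) = f (0, 0)" if x: "x \<in> jacobi_disk" for x
    proof -
      have "continuous_on {0..1} (\<lambda>t. f (rot t x))"
      proof (rule continuous_on_compose2[OF holomorphic2_on_imp_continuous_on[OF hol]])
        show "continuous_on {0..1} (\<lambda>t. rot t x)"
          unfolding rot_def by (intro continuous_intros)
        show "(\<lambda>t. rot t x) ` {0..1} \<subseteq> jacobi_disk"
          using x by auto
      qed
      then have si: "set_integrable lborel {0..1} (\<lambda>t. f (rot t x))"
        by (rule borel_integrable_atLeastAtMost')
      have "(\<integral>t. f (rot t x) \<partial>I) = (LINT t:{0..1}|lborel. f (rot t x))"
        unfolding I_def set_lebesgue_integral_def by (rule integral_restrict_space) simp
      also have "\<dots> = integral {0..1} (\<lambda>t. f (rot t x))"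
        by (rule set_borel_integral_eq_integral(2)[OF si])
      also have "\<dots> = f (0, 0)"
        using rot_mean[OF hol x] by (rule integral_unique)
      finally show ?thesis .
    qed
    moreover have "AE x in jacobi_gauss k. x \<in> jacobi_disk"
      unfolding jacobi_gauss_def by (subst AE_density) (use AE_jacobi_measure in \<open>auto elim: eventually_mono\<close>)
    ultimately show "AE x in jacobi_gauss k. (\<integral>t. f (rot t x) \<partial>I) = f (0, 0)"
      by (auto elim: eventually_mono)
    have "(\<lambda>p. f (rot (snd p) (fst p))) \<in> borel_measurable (jacobi_gauss k \<Otimes>\<^sub>M I)"
      using measurable_compose[OF measurable_pair_swap' rotI] by (simp add: case_prod_beta')
    then show "(\<lambda>x. \<integral>t. f (rot t x) \<partial>I) \<in> borel_measurable (jacobi_gauss k)"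
      by (intro I.borel_measurable_lebesgue_integral) (simp add: case_prod_beta')
  qed simp
  also have "\<dots> = of_real (2 * pi\<^sup>2 / (4 * k - 3)) * f (0, 0)"
    using emeasure_jacobi_gauss[OF k_ge] k_ge by (simp add: measure_def scaleR_conv_of_real)
  finally show ?thesis ..
qed

end

text \<open>Cauchy's inequality for the first derivative along each coordinate line through the
  centre.\<close>

lemma holomorphic2_derivative_bound:
  fixes g :: "complex \<times> complex \<Rightarrow> complex"
  assumes g: "g holomorphic2_on D" and r: "r > 0" and sub: "cball x r \<subseteq> D"
    and bound: "\<And>y. y \<in> cball x r \<Longrightarrow> cmod (g y) \<le> B"
    and der: "(g has_derivative (\<lambda>h. p * fst h + q * snd h)) (at x)"
  shows "cmod p \<le> B / r" "cmod q \<le> B / r"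
proof -
  \<comment> \<open>The direction (a, b) stands for (1, 0) and (0, 1), so that one argument serves
    both partial derivatives.\<close>
  have key: "cmod d \<le> B / r"
    if der_u: "((\<lambda>t. g (x + (t * a, t * b))) has_field_derivative d) (at 0)"
      and unit: "cmod a + cmod b = 1" "a = 0 \<or> b = 0" for a b d
  proof -
    have mem: "x + (t * a, t * b) \<in> cball x r" if "cmod t \<le> r" for t
      using that unit by (auto simp: dist_norm norm_Pair norm_mult)
    have fd: "(\<lambda>t. g (x + (t * a, t * b))) field_differentiable at t" if "cmod t \<le> r" for t
    proof -
      have "(\<lambda>t. g (fst x + t * a, snd x + t * b)) field_differentiable at t"
      proof (rule holomorphic2_on_curve[OF g])
        show "(fst x + t * a, snd x + t * b) \<in> D"
          using mem[OF that] sub by (cases x) auto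
      qed (auto intro!: derivative_intros)
      then show ?thesis
        by (cases x) simp
    qed
    have hol: "(\<lambda>t. g (x + (t * a, t * b))) holomorphic_on cball 0 r"
      using fd by (auto simp: holomorphic_on_def intro: field_differentiable_at_within)
    have "norm ((deriv ^^ 1) (\<lambda>t. g (x + (t * a, t * b))) 0) \<le> fact 1 * B / r ^ 1"
    proof (rule Cauchy_inequality)
      show "(\<lambda>t. g (x + (t * a, t * b))) holomorphic_on ball 0 r"
        using hol by (rule holomorphic_on_subset) auto
      show "continuous_on (cball 0 r) (\<lambda>t. g (x + (t * a, t * b)))"
        using hol by (rule holomorphic_on_imp_continuous_on)
      show "cmod (g (x + (t * a, t * b))) \<le> B" if "cmod (0 - t) = r" for t
        using that by (intro bound mem) simp
    qed (use r in simp)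
    then show ?thesis
      using DERIV_imp_deriv[OF der_u] by simp
  qed
  have comp: "((\<lambda>t. g (x + (t * a, t * b))) has_field_derivative (p * a + q * b)) (at 0)" for a b
  proof -
    have lin: "((\<lambda>t. x + (t * a, t * b)) has_derivative (\<lambda>t. (t * a, t * b))) (at 0)"
      by (auto intro!: derivative_eq_intros)
    have der': "(g has_derivative (\<lambda>h. p * fst h + q * snd h)) (at (x + (0 * a, 0 * b)))"
      using der by (simp flip: zero_prod_def)
    have "((\<lambda>t. g (x + (t * a, t * b))) has_derivative (\<lambda>t. p * (t * a) + q * (t * b))) (at 0)"
      using has_derivative_compose[OF lin der'] by simp
    moreover have "(\<lambda>t. p * (t * a) + q * (t * b)) = (*) (p * a + q * b)"
      by (simp add: fun_eq_iff algebra_simps)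
    ultimately show ?thesis
      by (simp add: has_field_derivative_def)
  qed
  show "cmod p \<le> B / r"
    using key[of 1 0 p] comp[of 1 0] by simp
  show "cmod q \<le> B / r"
    using key[of 0 1 q] comp[of 0 1] by simp
qed

context half_integer_weight
begin

section \<open>The reproducing property\<close>

definition kfun :: "complex \<times> complex \<Rightarrow> complex \<times> complex \<Rightarrow> complex" where
  "kfun y = (\<lambda>x. if x \<in> jacobi_disk then jacobi_kernel k x y else 0)"

lemma kfun_holomorphic: "y \<in> jacobi_disk \<Longrightarrow> kfun y holomorphic2_on jacobi_disk"
  by (rule holomorphic2_on_cong[OF jacobi_disk_open _ holomorphic2_jacobi_kernel[OF k]]) (simp_all add: kfun_def)

lemma kfun_zero: "kfun (0, 0) = indicator jacobi_disk"
  by (auto simp: kfun_def fun_eq_iff jacobi_kernel_zero[OF k] simp del: jacobi_disk_iff)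

lemma kfun_zero_in: "kfun (0, 0) \<in> jacobi_space k"
proof -
  interpret finite_measure "jacobi_gauss k"
    by (rule finite_jacobi_gauss[OF k_ge])
  have m: "kfun (0, 0) \<in> borel_measurable borel"
    unfolding kfun_zero by measurable
  have "integrable (jacobi_gauss k) (\<lambda>x. (cmod (kfun (0, 0) x))\<^sup>2)"
    by (rule integrable_const_bound[where B = 1]) (use m in \<open>auto simp: kfun_zero indicator_def\<close>)
  then show ?thesis
    using kfun_holomorphic[of "(0, 0)"] by (simp add: jacobi_space_iff kfun_def)
qed

lemma reproducing_zero:
  assumes f: "f \<in> jacobi_space k"
  shows "jacobi_ip k (kfun (0, 0)) f = f (0, 0)"
proof -
  have "cnj (kfun (0, 0) x) * f x = f x" for x
    using jacobi_spaceD(2)[OF f, of x] by (auto simp: kfun_zero indicator_def)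
  then have "jacobi_ip k (kfun (0, 0)) f = of_real ((4 * k - 3) / (2 * pi\<^sup>2)) * (of_real (2 * pi\<^sup>2 / (4 * k - 3)) * f (0, 0))"
    unfolding jacobi_ip_eq[OF jacobi_spaceD(3)[OF kfun_zero_in] jacobi_spaceD(3)[OF f]]
    by (simp only: integral_jacobi_gauss[OF f])
  also have "\<dots> = of_real ((4 * k - 3) / (2 * pi\<^sup>2) * (2 * pi\<^sup>2 / (4 * k - 3))) * f (0, 0)"
    by (simp only: of_real_mult mult.assoc)
  also have "(4 * k - 3) / (2 * pi\<^sup>2) * (2 * pi\<^sup>2 / (4 * k - 3)) = 1"
    using k_ge by simp
  finally show ?thesis
    by simp
qed

lemma zero_in_disk: "(0, 0) \<in> jacobi_disk"
  by simp

text \<open>Covariance of the kernel with one point at the origin. It makes every kernel function a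
  multiple of a translate of \<open>kfun (0, 0)\<close>, so that membership and reproduction reduce
  to that function.\<close>

lemma kfun_act:
  assumes h: "h \<in> carrier jacobi_group"
  shows "kfun (jacobi_act h (0, 0)) = (\<lambda>x. cnj (jacobi_cocycle k h (0, 0)) * pi_K h (kfun (0, 0)) x)"
proof
  fix x
  let ?i = "inv\<^bsub>jacobi_group\<^esub> h"
  show "kfun (jacobi_act h (0, 0)) x = cnj (jacobi_cocycle k h (0, 0)) * pi_K h (kfun (0, 0)) x"
  proof (cases "x \<in> jacobi_disk")
    case True
    have ix: "jacobi_act ?i x \<in> jacobi_disk"
      by (rule jacobi_act_in_disk[OF inv_closed[OF h] True])
    have hi: "h \<otimes>\<^bsub>jacobi_group\<^esub> ?i = \<one>\<^bsub>jacobi_group\<^esub>"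
      by (rule group.r_inv[OF jacobi_group h])
    have x: "jacobi_act h (jacobi_act ?i x) = x"
      using jacobi_act_mult[OF h inv_closed[OF h] True] by (simp add: hi act_one True)
    have "jacobi_cocycle k h (jacobi_act ?i x) * jacobi_cocycle k ?i x = 1"
      using jacobi_cocycle_mult[OF k h inv_closed[OF h] True] by (simp add: hi cocycle_one True)
    then have c: "jacobi_cocycle k h (jacobi_act ?i x) = inverse (jacobi_cocycle k ?i x)"
      by (metis inverse_unique mult.commute)
    show ?thesis
      using jacobi_kernel_act[OF k h ix zero_in_disk] True ix
      unfolding x c by (simp add: kfun_def pi_K_def jacobi_kernel_zero[OF k] del: jacobi_disk_iff)
  qed (simp add: kfun_def pi_K_def)
qed

lemma kfun_in:
  assumes "y \<in> jacobi_disk"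
  shows "kfun y \<in> jacobi_space k"
proof -
  obtain h where h: "h \<in> carrier jacobi_group" and y: "jacobi_act h (0, 0) = y"
    using jacobi_transitive[OF assms] .
  show ?thesis
    unfolding y[symmetric] kfun_act[OF h] by (rule J.V_scale[OF pi_K_closed[OF h kfun_zero_in]])
qed

lemma reproducing:
  assumes y: "y \<in> jacobi_disk" and f: "f \<in> jacobi_space k"
  shows "jacobi_ip k (kfun y) f = f y"
proof -
  obtain h where h: "h \<in> carrier jacobi_group" and hy: "jacobi_act h (0, 0) = y"
    using jacobi_transitive[OF y] .
  let ?i = "inv\<^bsub>jacobi_group\<^esub> h"
  note i = inv_closed[OF h]
  have "jacobi_ip k (kfun y) f = jacobi_cocycle k h (0, 0) * jacobi_ip k (pi_K h (kfun (0, 0))) f"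
    unfolding hy[symmetric] kfun_act[OF h]
    using J.ip_scale_left[OF pi_K_closed[OF h kfun_zero_in] f] by simp
  also have "f = pi_K h (pi_K ?i f)"
    using pi_K_mult[OF h i] pi_K_one[OF f] group.r_inv[OF jacobi_group h] by simp
  then have "jacobi_ip k (pi_K h (kfun (0, 0))) f = jacobi_ip k (kfun (0, 0)) (pi_K ?i f)"
    using pi_K_unitary[OF h kfun_zero_in pi_K_closed[OF i f]] by simp
  also have "\<dots> = pi_K ?i f (0, 0)"
    by (rule reproducing_zero[OF pi_K_closed[OF i f]])
  also have "\<dots> = inverse (jacobi_cocycle k h (0, 0)) * f y"
    using group.inv_inv[OF jacobi_group h] by (simp add: pi_K_def hy)
  finally show ?thesis
    using jacobi_cocycle_nonzero[OF k h zero_in_disk] by simp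
qed

lemma point_bound:
  assumes y: "y \<in> jacobi_disk" and f: "f \<in> jacobi_space k"
  shows "cmod (f y) \<le> sqrt (1 / weight_density k y) * J.nrm f"
proof -
  have "jacobi_ip k (kfun y) (kfun y) = of_real (1 / weight_density k y)"
    unfolding reproducing[OF y kfun_in[OF y]] using y kernel_diag[OF y] by (simp add: kfun_def)
  then have "J.nrm (kfun y) = sqrt (1 / weight_density k y)"
    unfolding J.nrm_def by simp
  then show ?thesis
    using J.cauchy_schwarz[OF kfun_in[OF y] f] unfolding reproducing[OF y f] by simp
qed

sublocale J: inner_space "\<lambda>c f x. c * f x" "jacobi_space k" "jacobi_ip k"
proof (rule inner_space.intro[OF J.semi_inner_space_axioms], rule inner_space_axioms.intro)
  fix v assume v: "v \<in> jacobi_space k" "J.nrm v = 0"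
  have "v y = 0" for y
    using point_bound[OF _ v(1), of y] v(2) jacobi_spaceD(2)[OF v(1), of y] by (cases "y \<in> jacobi_disk") auto
  then show "v = 0"
    by (simp add: fun_eq_iff)
qed

lemma nrm_sq_integral:
  assumes "f \<in> jacobi_space k"
  shows "(J.nrm f)\<^sup>2 = (4 * k - 3) / (2 * pi\<^sup>2) * (\<integral>x. (cmod (f x))\<^sup>2 \<partial>jacobi_gauss k)"
  unfolding J.nrm_sq[OF assms] jacobi_ip_self[OF assms] by simp

section \<open>Completeness\<close>

lemma continuous_weight_density: "continuous_on jacobi_disk (weight_density k)"
proof -
  have nz: "1 - (cmod (snd x))\<^sup>2 \<noteq> 0" if "x \<in> jacobi_disk" for x
  proof -
    have "(cmod (snd x))\<^sup>2 < 1"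
      using that by (cases x) (simp add: abs_square_less_1)
    then show ?thesis
      by simp
  qed
  then show ?thesis
    unfolding weight_density_def by (intro continuous_intros) auto
qed

text \<open>The factor in \<open>point_bound\<close> is continuous in the point, hence bounded on
  compact sets.\<close>

lemma uniform_point_bound:
  assumes S: "compact S" "S \<subseteq> jacobi_disk"
  obtains M where "M > 0" "\<And>f y. f \<in> jacobi_space k \<Longrightarrow> y \<in> S \<Longrightarrow> cmod (f y) \<le> M * J.nrm f"
proof -
  have "continuous_on S (\<lambda>y. sqrt (1 / weight_density k y))"
  proof -
    have "weight_density k y \<noteq> 0" if "y \<in> S" for y
      using S(2) that weight_density_pos[of y k] by fastforce
    then show ?thesis
      using S(2) by (intro continuous_intros continuous_on_subset[OF continuous_weight_density]) auto
  qed
  then have "bounded ((\<lambda>y. sqrt (1 / weight_density k y)) ` S)"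
    using S(1) compact_continuous_image compact_imp_bounded by blast
  then obtain M where M: "M > 0" "\<And>y. y \<in> S \<Longrightarrow> sqrt (1 / weight_density k y) \<le> M"
    unfolding bounded_pos by fastforce
  show thesis
  proof (rule that[OF M(1)])
    fix f y assume f: "f \<in> jacobi_space k" and y: "y \<in> S"
    have "cmod (f y) \<le> sqrt (1 / weight_density k y) * J.nrm f"
      using point_bound f y S(2) by blast
    also have "\<dots> \<le> M * J.nrm f"
      by (rule mult_right_mono[OF M(2)[OF y] J.nrm_nonneg[OF f]])
    finally show "cmod (f y) \<le> M * J.nrm f" .
  qed
qed

text \<open>Locally the norm dominates the values and, by Cauchy's inequality, also the partial
  derivatives. These are therefore uniformly Cauchy near each point, and limit and derivative may be
  exchanged.\<close>

lemma cauchy_limit_holomorphic: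
  assumes \<sigma>: "\<And>n. \<sigma> n \<in> jacobi_space k"
    and C: "\<And>e. e > 0 \<Longrightarrow> \<exists>N. \<forall>m\<ge>N. \<forall>n\<ge>N. J.nrm (\<sigma> m - \<sigma> n) < e"
    and lim: "\<And>x. (\<lambda>n. \<sigma> n x) \<longlonglongrightarrow> f x"
  shows "f holomorphic2_on jacobi_disk"
  unfolding holomorphic2_on_iff
proof
  fix x0 assume x0: "x0 \<in> jacobi_disk"
  obtain R where R: "R > 0" "cball x0 R \<subseteq> jacobi_disk"
    using open_contains_cball[of jacobi_disk] jacobi_disk_open x0 by blast
  \<comment> \<open>With half the radius, the ball of radius \<open>r\<close> around any point of
    the small ball still lies where the uniform bound holds.\<close>
  define r where "r = R / 2"
  have r: "r > 0"
    using R(1) by (simp add: r_def)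
  obtain M where M: "M > 0" "\<And>f y. f \<in> jacobi_space k \<Longrightarrow> y \<in> cball x0 R \<Longrightarrow> cmod (f y) \<le> M * J.nrm f"
    using uniform_point_bound[OF compact_cball R(2)] by blast
  have "\<forall>n x. \<exists>p q. x \<in> jacobi_disk \<longrightarrow> (\<sigma> n has_derivative (\<lambda>h. p * fst h + q * snd h)) (at x)"
    using jacobi_spaceD(1)[OF \<sigma>] unfolding holomorphic2_on_iff by blast
  then obtain P Q where PQ: "\<And>n x. x \<in> jacobi_disk \<Longrightarrow> (\<sigma> n has_derivative (\<lambda>h. P n x * fst h + Q n x * snd h)) (at x)"
    by metis
  define S where "S = ball x0 r"
  have cb: "cball x r \<subseteq> cball x0 R" if "x \<in> S" for x
  proof
    fix y assume "y \<in> cball x r"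
    then show "y \<in> cball x0 R"
      using that dist_triangle[of x0 y x] by (simp add: S_def r_def)
  qed
  have SD: "x \<in> jacobi_disk" if "x \<in> S" for x
    using cb[OF that] R(2) r by (meson centre_in_cball less_imp_le subsetD)
  have diff_bound: "cmod (P m x - P n x) \<le> M * J.nrm (\<sigma> m - \<sigma> n) / r" "cmod (Q m x - Q n x) \<le> M * J.nrm (\<sigma> m - \<sigma> n) / r"
    if x: "x \<in> S" for m n x
  proof -
    have V: "\<sigma> m - \<sigma> n \<in> jacobi_space k"
      by (rule J.V_diff[OF \<sigma> \<sigma>])
    have der: "((\<sigma> m - \<sigma> n) has_derivative (\<lambda>h. (P m x - P n x) * fst h + (Q m x - Q n x) * snd h)) (at x)"
      using has_derivative_diff[OF PQ[OF SD[OF x], of m] PQ[OF SD[OF x], of n]]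
      unfolding fun_diff_def by (simp add: algebra_simps)
    have sub: "cball x r \<subseteq> jacobi_disk"
      using cb[OF x] R(2) by blast
    have bd: "cmod ((\<sigma> m - \<sigma> n) y) \<le> M * J.nrm (\<sigma> m - \<sigma> n)" if "y \<in> cball x r" for y
      using M(2)[OF V] cb[OF x] that by blast
    show "cmod (P m x - P n x) \<le> M * J.nrm (\<sigma> m - \<sigma> n) / r" "cmod (Q m x - Q n x) \<le> M * J.nrm (\<sigma> m - \<sigma> n) / r"
      using holomorphic2_derivative_bound[OF jacobi_spaceD(1)[OF V] r sub bd der] by blast+
  qed
  have unif: "\<exists>N. \<forall>m\<ge>N. \<forall>n\<ge>N. \<forall>x\<in>S. cmod (P m x - P n x) \<le> e \<and> cmod (Q m x - Q n x) \<le> e" if e: "e > 0" for e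
  proof -
    have "e * r / M > 0"
      using e r M(1) by simp
    then obtain N where N: "\<And>m n. m \<ge> N \<Longrightarrow> n \<ge> N \<Longrightarrow> J.nrm (\<sigma> m - \<sigma> n) < e * r / M"
      using C by meson
    have "M * J.nrm (\<sigma> m - \<sigma> n) / r \<le> e" if "m \<ge> N" "n \<ge> N" for m n
      using N[OF that] r M(1) by (simp add: field_simps)
    then show ?thesis
      using diff_bound by (meson order.trans)
  qed
  have conv: "convergent (\<lambda>n. P n x)" "convergent (\<lambda>n. Q n x)" if x: "x \<in> S" for x
  proof -
    have "\<exists>N. \<forall>m\<ge>N. \<forall>n\<ge>N. dist (P m x) (P n x) < e \<and> dist (Q m x) (Q n x) < e" if e: "e > 0" for e
    proof -
      obtain N where "\<forall>m\<ge>N. \<forall>n\<ge>N. \<forall>x\<in>S. cmod (P m x - P n x) \<le> e / 2 \<and> cmod (Q m x - Q n x) \<le> e / 2"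
        using unif[of "e / 2"] e by auto
      then show ?thesis
        using x e by (intro exI[of _ N]) (force simp: dist_norm)
    qed
    then have "Cauchy (\<lambda>n. P n x)" "Cauchy (\<lambda>n. Q n x)"
      unfolding Cauchy_def by meson+
    then show "convergent (\<lambda>n. P n x)" "convergent (\<lambda>n. Q n x)"
      by (simp_all add: Cauchy_convergent)
  qed
  define PL where "PL x = lim (\<lambda>n. P n x)" for x
  define QL where "QL x = lim (\<lambda>n. Q n x)" for x
  have limPQ: "(\<lambda>n. P n x) \<longlonglongrightarrow> PL x" "(\<lambda>n. Q n x) \<longlonglongrightarrow> QL x" if "x \<in> S" for x
    using conv[OF that] by (simp_all add: PL_def QL_def convergent_LIMSEQ_iff)
  have unifL: "\<exists>N. \<forall>n\<ge>N. \<forall>x\<in>S. cmod (P n x - PL x) \<le> e \<and> cmod (Q n x - QL x) \<le> e" if e: "e > 0" for e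
  proof -
    obtain N where N: "\<And>m n x. m \<ge> N \<Longrightarrow> n \<ge> N \<Longrightarrow> x \<in> S \<Longrightarrow> cmod (P m x - P n x) \<le> e \<and> cmod (Q m x - Q n x) \<le> e"
      using unif[OF e] by meson
    have "cmod (P n x - PL x) \<le> e \<and> cmod (Q n x - QL x) \<le> e" if nx: "n \<ge> N" "x \<in> S" for n x
    proof
      show "cmod (P n x - PL x) \<le> e"
        by (rule Lim_bounded[OF tendsto_norm[OF tendsto_diff[OF tendsto_const limPQ(1)[OF nx(2)]]], of N])
           (use N nx in auto)
      show "cmod (Q n x - QL x) \<le> e"
        by (rule Lim_bounded[OF tendsto_norm[OF tendsto_diff[OF tendsto_const limPQ(2)[OF nx(2)]]], of N])
           (use N nx in auto)
    qed
    then show ?thesis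
      by blast
  qed
  have "\<exists>g. \<forall>x\<in>S. (\<lambda>n. \<sigma> n x) \<longlonglongrightarrow> g x \<and> (g has_derivative (\<lambda>h. PL x * fst h + QL x * snd h)) (at x within S)"
  proof (rule has_derivative_sequence)
    show "convex S"
      by (simp add: S_def)
    show "(\<sigma> n has_derivative (\<lambda>h. P n x * fst h + Q n x * snd h)) (at x within S)" if "x \<in> S" for n x
      using PQ[OF SD[OF that]] by (rule has_derivative_at_withinI)
    show "x0 \<in> S" "(\<lambda>n. \<sigma> n x0) \<longlonglongrightarrow> f x0"
      using r lim by (simp_all add: S_def)
    fix e :: real assume e: "e > 0"
    obtain N where N: "\<And>n x. n \<ge> N \<Longrightarrow> x \<in> S \<Longrightarrow> cmod (P n x - PL x) \<le> e / 2 \<and> cmod (Q n x - QL x) \<le> e / 2"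
      using unifL[of "e / 2"] e by auto
    show "\<forall>\<^sub>F n in sequentially. \<forall>x\<in>S. \<forall>h. norm (P n x * fst h + Q n x * snd h - (PL x * fst h + QL x * snd h)) \<le> e * norm h"
    proof (rule eventually_sequentiallyI, intro ballI allI)
      fix n x and h :: "complex \<times> complex" assume nx: "n \<ge> N" "x \<in> S"
      have "P n x * fst h + Q n x * snd h - (PL x * fst h + QL x * snd h) = (P n x - PL x) * fst h + (Q n x - QL x) * snd h"
        by (simp add: algebra_simps)
      also have "norm \<dots> \<le> cmod (P n x - PL x) * cmod (fst h) + cmod (Q n x - QL x) * cmod (snd h)"
        by (metis norm_mult norm_triangle_ineq)
      also have "\<dots> \<le> e / 2 * norm h + e / 2 * norm h"
        using N[OF nx] e norm_fst_le[of "fst h" "snd h"] norm_snd_le[of "snd h" "fst h"]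
        by (intro add_mono mult_mono) auto
      finally show "norm (P n x * fst h + Q n x * snd h - (PL x * fst h + QL x * snd h)) \<le> e * norm h"
        by simp
    qed
  qed
  then obtain g where g: "\<And>x. x \<in> S \<Longrightarrow> (\<lambda>n. \<sigma> n x) \<longlonglongrightarrow> g x"
      "\<And>x. x \<in> S \<Longrightarrow> (g has_derivative (\<lambda>h. PL x * fst h + QL x * snd h)) (at x within S)"
    by blast
  have x0S: "x0 \<in> S" and S: "open S"
    using r by (simp_all add: S_def)
  have "(g has_derivative (\<lambda>h. PL x0 * fst h + QL x0 * snd h)) (at x0)"
    using g(2)[OF x0S] by (simp add: at_within_open[OF x0S S])
  moreover have "g x = f x" if "x \<in> S" for x
    using LIMSEQ_unique[OF g(1)[OF that] lim] .
  ultimately have "(f has_derivative (\<lambda>h. PL x0 * fst h + QL x0 * snd h)) (at x0)"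
    using has_derivative_transform_within_open[OF _ S x0S] by blast
  then show "\<exists>p q. (f has_derivative (\<lambda>h. p * fst h + q * snd h)) (at x0)"
    by blast
qed

lemma jacobi_mcomplete: "Metric_space.mcomplete (jacobi_space k) (hdist (jacobi_space k) (jacobi_ip k))"
  unfolding Metric_space.mcomplete_def[OF J.metric]
proof (intro allI impI)
  fix \<sigma> assume "Metric_space.MCauchy (jacobi_space k) (hdist (jacobi_space k) (jacobi_ip k)) \<sigma>"
  then have \<sigma>: "\<And>n. \<sigma> n \<in> jacobi_space k"
    and C0: "\<And>e. e > 0 \<Longrightarrow> \<exists>N. \<forall>m n. N \<le> m \<longrightarrow> N \<le> n \<longrightarrow> hdist (jacobi_space k) (jacobi_ip k) (\<sigma> m) (\<sigma> n) < e"
    unfolding Metric_space.MCauchy_def[OF J.metric] by auto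
  have C: "\<exists>N. \<forall>m\<ge>N. \<forall>n\<ge>N. J.nrm (\<sigma> m - \<sigma> n) < e" if "e > 0" for e
    using C0[OF that] J.hdist_nrm[OF \<sigma> \<sigma>] by (metis (no_types))
  have conv: "convergent (\<lambda>n. \<sigma> n x)" for x
  proof (cases "x \<in> jacobi_disk")
    case True
    obtain M where M: "M > 0" "\<And>f y. f \<in> jacobi_space k \<Longrightarrow> y \<in> {x} \<Longrightarrow> cmod (f y) \<le> M * J.nrm f"
      by (rule uniform_point_bound[of "{x}"]) (use True in auto)
    have "Cauchy (\<lambda>n. \<sigma> n x)"
    proof (rule metric_CauchyI)
      fix e :: real assume "e > 0"
      then have "e / M > 0"
        using M(1) by simp
      then obtain N where N: "\<And>m n. m \<ge> N \<Longrightarrow> n \<ge> N \<Longrightarrow> J.nrm (\<sigma> m - \<sigma> n) < e / M"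
        using C by meson
      have "dist (\<sigma> m x) (\<sigma> n x) < e" if "m \<ge> N" "n \<ge> N" for m n
      proof -
        have "dist (\<sigma> m x) (\<sigma> n x) \<le> M * J.nrm (\<sigma> m - \<sigma> n)"
          using M(2)[OF J.V_diff[OF \<sigma> \<sigma>], of x m n] by (simp add: dist_norm)
        also have "\<dots> < e"
          using N[OF that] M(1) by (simp add: field_simps)
        finally show ?thesis .
      qed
      then show "\<exists>N. \<forall>m\<ge>N. \<forall>n\<ge>N. dist (\<sigma> m x) (\<sigma> n x) < e"
        by blast
    qed
    then show ?thesis
      by (rule Cauchy_convergent)
  next
    case False
    then show ?thesis
      using jacobi_spaceD(2)[OF \<sigma>] by (simp add: convergent_const)
  qed
  define f where "f x = lim (\<lambda>n. \<sigma> n x)" for x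
  have lim: "(\<lambda>n. \<sigma> n x) \<longlonglongrightarrow> f x" for x
    using conv by (simp add: f_def convergent_LIMSEQ_iff)
  have hol: "f holomorphic2_on jacobi_disk"
    by (rule cauchy_limit_holomorphic[OF \<sigma> C lim])
  have out: "f x = 0" if "x \<notin> jacobi_disk" for x
    using lim[of x] jacobi_spaceD(2)[OF \<sigma> that] by (simp add: LIMSEQ_const_iff)
  have fm[measurable]: "f \<in> borel_measurable borel"
    by (rule holomorphic2_borel_measurable[OF hol out])
  have sm[measurable]: "\<And>n. \<sigma> n \<in> borel_measurable borel"
    using jacobi_spaceD(3)[OF \<sigma>] .
  define \<Lambda> where "\<Lambda> = (4 * k - 3) / (2 * pi\<^sup>2)"
  have \<Lambda>: "\<Lambda> > 0"
    using k_ge by (simp add: \<Lambda>_def)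
  \<comment> \<open>Fatou's lemma for \<sigma> (m + N) - \<sigma> n as m grows. It yields membership
    of the difference and the norm estimate at once, before \<open>f\<close> itself is known to lie
    in the space.\<close>
  have tail: "f - \<sigma> n \<in> jacobi_space k \<and> J.nrm (f - \<sigma> n) \<le> e"
    if e: "e > 0" and N: "\<And>m. m \<ge> N \<Longrightarrow> J.nrm (\<sigma> m - \<sigma> n) < e" for e n N
  proof -
    have V: "\<sigma> m - \<sigma> n \<in> jacobi_space k" for m
      by (rule J.V_diff[OF \<sigma> \<sigma>])
    have I: "integrable (jacobi_gauss k) (\<lambda>x. (cmod (\<sigma> m x - \<sigma> n x))\<^sup>2)" for m
      using jacobi_spaceD(4)[OF V[of m]] by simp
    have le: "(\<integral>x. (cmod (\<sigma> (m + N) x - \<sigma> n x))\<^sup>2 \<partial>jacobi_gauss k) \<le> e\<^sup>2 / \<Lambda>" for m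
    proof -
      have "\<Lambda> * (\<integral>x. (cmod (\<sigma> (m + N) x - \<sigma> n x))\<^sup>2 \<partial>jacobi_gauss k) = (J.nrm (\<sigma> (m + N) - \<sigma> n))\<^sup>2"
        using nrm_sq_integral[OF V[of "m + N"]] by (simp add: \<Lambda>_def)
      also have "\<dots> \<le> e\<^sup>2"
        using N[of "m + N"] J.nrm_nonneg[OF V] by (intro power_mono) auto
      finally show ?thesis
        using \<Lambda> by (simp add: field_simps)
    qed
    have l: "(\<lambda>m. (cmod (\<sigma> (m + N) x - \<sigma> n x))\<^sup>2) \<longlonglongrightarrow> (cmod (f x - \<sigma> n x))\<^sup>2" for x
      by (intro tendsto_intros LIMSEQ_ignore_initial_segment lim)
    have fat: "integrable (jacobi_gauss k) (\<lambda>x. (cmod (f x - \<sigma> n x))\<^sup>2)"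
        "(\<integral>x. (cmod (f x - \<sigma> n x))\<^sup>2 \<partial>jacobi_gauss k) \<le> e\<^sup>2 / \<Lambda>"
      by (rule fatou_integrable[where gn = "\<lambda>m x. (cmod (\<sigma> (m + N) x - \<sigma> n x))\<^sup>2", OF _ _ _ _ l I le]; simp)+
    have mem: "f - \<sigma> n \<in> jacobi_space k"
      using fat(1) holomorphic2_on_diff[OF hol jacobi_spaceD(1)[OF \<sigma>]] out jacobi_spaceD(2)[OF \<sigma>]
      by (simp add: jacobi_space_iff fun_diff_def)
    have "(J.nrm (f - \<sigma> n))\<^sup>2 = \<Lambda> * (\<integral>x. (cmod (f x - \<sigma> n x))\<^sup>2 \<partial>jacobi_gauss k)"
      using nrm_sq_integral[OF mem] by (simp add: \<Lambda>_def)
    also have "\<dots> \<le> e\<^sup>2"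
      using fat(2) \<Lambda> by (simp add: field_simps)
    finally have "J.nrm (f - \<sigma> n) \<le> e"
      by (rule power2_le_imp_le) (use e in simp)
    with mem show ?thesis ..
  qed
  have fV: "f \<in> jacobi_space k"
  proof -
    obtain N where "\<And>m n. m \<ge> N \<Longrightarrow> n \<ge> N \<Longrightarrow> J.nrm (\<sigma> m - \<sigma> n) < 1"
      using C[of 1] by auto
    then have "f - \<sigma> N \<in> jacobi_space k"
      using tail[of 1 N N] by simp
    then show ?thesis
      using J.V_add[OF _ \<sigma>[of N], of "f - \<sigma> N"] by simp
  qed
  have "(\<lambda>n. J.nrm (\<sigma> n - f)) \<longlonglongrightarrow> 0"
  proof (rule LIMSEQ_I)
    fix e :: real assume e: "e > 0"
    then obtain N where N: "\<And>m n. m \<ge> N \<Longrightarrow> n \<ge> N \<Longrightarrow> J.nrm (\<sigma> m - \<sigma> n) < e / 2"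
      using C[of "e / 2"] by auto
    have "norm (J.nrm (\<sigma> n - f) - 0) < e" if "n \<ge> N" for n
    proof -
      have "J.nrm (f - \<sigma> n) \<le> e / 2"
        using tail[of "e / 2" N n] N that e by simp
      then show ?thesis
        using e J.nrm_diff_commute[OF fV \<sigma>[of n]] J.nrm_nonneg[OF J.V_diff[OF \<sigma>[of n] fV]] by simp
    qed
    then show "\<exists>N. \<forall>n\<ge>N. norm (J.nrm (\<sigma> n - f) - 0) < e"
      by blast
  qed
  then show "\<exists>x. limitin (htopology (jacobi_space k) (jacobi_ip k)) \<sigma> x sequentially"
    unfolding J.limitin_iff using fV \<sigma> by auto
qed

lemma jacobi_hilbert: "complex_hilbert_space (\<lambda>c f x. c * f x) (jacobi_space k) (jacobi_ip k)"
proof (rule complex_hilbert_space.intro[OF vector_space_fun], rule complex_hilbert_space_axioms.intro)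
  show "0 < Re (jacobi_ip k v v)" if "v \<in> jacobi_space k" "v \<noteq> 0" for v
    using J.nrm_eq_0[OF that(1)] that J.ip_nonneg[OF that(1)] by (auto simp: J.nrm_def)
qed (fact J.carrier_subspace J.ip_add_right J.ip_scale_right J.ip_commute jacobi_mcomplete)+

lemma jacobi_rkhs:
  "reproducing_kernel_hilbert_space jacobi_disk (jacobi_kernel k) (jacobi_space k) (jacobi_ip k)"
  unfolding reproducing_kernel_hilbert_space_def kfun_def[symmetric]
  using jacobi_hilbert jacobi_spaceD(2) kfun_in reproducing by blast

lemma jacobi_positive_definite:
  "positive_definite_holomorphic_kernel jacobi_disk (jacobi_kernel k)"
  unfolding positive_definite_holomorphic_kernel_def
proof (intro conjI ballI allI impI)
  show "(\<lambda>x. jacobi_kernel k x y) holomorphic2_on jacobi_disk" if "y \<in> jacobi_disk" for y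
    by (rule holomorphic2_jacobi_kernel[OF k that])
  show "jacobi_kernel k y x = cnj (jacobi_kernel k x y)" if "x \<in> jacobi_disk" "y \<in> jacobi_disk" for x y
    by (rule jacobi_kernel_sym[OF k that])
  fix F :: "(complex \<times> complex) set" and c :: "complex \<times> complex \<Rightarrow> complex"
  assume F: "finite F \<and> F \<subseteq> jacobi_disk"
  \<comment> \<open>The double sum is the scalar product of this vector with itself; the
    coefficients are conjugated because \<open>jacobi_ip\<close> is antilinear in its first
    argument.\<close>
  define v where "v = (\<Sum>x\<in>F. (\<lambda>y. cnj (c x) * kfun x y))"
  have V: "(\<lambda>y. cnj (c x) * kfun x y) \<in> jacobi_space k" if "x \<in> F" for x
    using F that kfun_in J.V_scale by blast
  have v: "v \<in> jacobi_space k"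
    unfolding v_def using V by (rule J.V_sum)
  have "jacobi_ip k v v = (\<Sum>x\<in>F. \<Sum>y\<in>F. jacobi_ip k (\<lambda>z. cnj (c x) * kfun x z) (\<lambda>z. cnj (c y) * kfun y z))"
  proof -
    have "jacobi_ip k v v = (\<Sum>x\<in>F. jacobi_ip k (\<lambda>z. cnj (c x) * kfun x z) v)"
      by (subst (1) v_def) (rule J.ip_sum_left[OF v V])
    also have "\<dots> = (\<Sum>x\<in>F. \<Sum>y\<in>F. jacobi_ip k (\<lambda>z. cnj (c x) * kfun x z) (\<lambda>z. cnj (c y) * kfun y z))"
      by (rule sum.cong[OF refl], subst v_def, rule J.ip_sum_right[OF V V])
    finally show ?thesis .
  qed
  also have "\<dots> = (\<Sum>x\<in>F. \<Sum>y\<in>F. c x * cnj (c y) * jacobi_kernel k x y)"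
  proof (intro sum.cong refl)
    fix x y assume xy: "x \<in> F" "y \<in> F"
    then have D: "x \<in> jacobi_disk" "y \<in> jacobi_disk"
      using F by auto
    have "jacobi_ip k (\<lambda>z. cnj (c x) * kfun x z) (\<lambda>z. cnj (c y) * kfun y z) = c x * (cnj (c y) * jacobi_ip k (kfun x) (kfun y))"
      using J.ip_scale_left[OF kfun_in[OF D(1)] J.V_scale[OF kfun_in[OF D(2)]]] J.ip_scale_right[OF kfun_in[OF D(1)] kfun_in[OF D(2)]]
      by simp
    moreover have "jacobi_ip k (kfun x) (kfun y) = jacobi_kernel k x y"
      using reproducing[OF D(1) kfun_in[OF D(2)]] D(1) by (simp add: kfun_def[of y])
    ultimately show "jacobi_ip k (\<lambda>z. cnj (c x) * kfun x z) (\<lambda>z. cnj (c y) * kfun y z) = c x * cnj (c y) * jacobi_kernel k x y"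
      by (simp only: mult.assoc)
  qed
  finally show "(\<Sum>x\<in>F. \<Sum>y\<in>F. c x * cnj (c y) * jacobi_kernel k x y) \<in> \<real>\<^sub>\<ge>\<^sub>0"
    using J.ip_self[OF v] by (metis nonneg_Reals_of_real_iff zero_le_power2)
qed

end

section \<open>Strong continuity of the representation\<close>

lemma tendsto_su_den:
  assumes "(a \<longlongrightarrow> a0) F" "(b \<longlongrightarrow> b0) F"
  shows "((\<lambda>x. su_den (a x) (b x) w) \<longlongrightarrow> su_den a0 b0 w) F"
  unfolding su_den_def by (intro tendsto_intros assms)

lemma tendsto_mult_factor:
  assumes "(a \<longlongrightarrow> a0) F" "(b \<longlongrightarrow> b0) F" "(\<alpha> \<longlongrightarrow> \<alpha>0) F" "su_den a0 b0 w \<noteq> 0"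
  shows "((\<lambda>x. jacobi_mult_factor n (a x) (b x) (\<alpha> x) z w) \<longlongrightarrow> jacobi_mult_factor n a0 b0 \<alpha>0 z w) F"
  unfolding jacobi_mult_factor_def by (intro tendsto_intros tendsto_su_den assms) (use assms(4) in simp_all)

context half_integer_weight
begin

lemma pi_K_formula:
  assumes "su_pair a b" "cmod w < 1"
  shows "pi_K (su_mat a b, \<alpha>, t) f (z, w) = exp (- (\<i> * of_real t))
    * jacobi_mult_factor n (cnj a) (- b) (- (a * \<alpha> + b * cnj \<alpha>)) z w
    * f ((- (a * \<alpha> + b * cnj \<alpha>) - cnj (- (a * \<alpha> + b * cnj \<alpha>)) * w + z) / su_den (cnj a) (- b) w,
         (cnj a * w + - b) / su_den (cnj a) (- b) w)"
  using assms(2)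
  by (simp add: pi_K_def jacobi_inv[OF assms(1)] jacobi_cocycle_eq[OF k su_pair_inv[OF assms(1)] assms(2)] jacobi_act_su_mat)

text \<open>Every ingredient of \<open>pi_K_formula\<close> is continuous in the entries of the
  group element, and the limit of the arguments of \<open>f\<close> lies in the open domain, where
  \<open>f\<close> is continuous.\<close>

lemma pi_K_pointwise:
  assumes h: "\<And>i. h i \<in> carrier jacobi_group" "h0 \<in> carrier jacobi_group" "h \<longlonglongrightarrow> h0"
    and f: "f \<in> jacobi_space k"
  shows "(\<lambda>i. pi_K (h i) f x) \<longlonglongrightarrow> pi_K h0 f x"
proof (cases "x \<in> jacobi_disk")
  case True
  obtain z w where x: "x = (z, w)" and w: "cmod w < 1"
    using True by (cases x) auto
  define a where "a h = fst h $ 1 $ 1" for h :: jacobi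
  define b where "b h = fst h $ 1 $ 2" for h :: jacobi
  define \<alpha> where "\<alpha> h = - (a h * fst (snd h) + b h * cnj (fst (snd h)))" for h :: jacobi
  have form: "h = (su_mat (a h) (b h), fst (snd h), snd (snd h)) \<and> su_pair (a h) (b h)" if "h \<in> carrier jacobi_group" for h
    using that by (elim jacobi_carrierE) (simp add: a_def b_def)
  have F: "pi_K h f x = exp (- (\<i> * of_real (snd (snd h)))) * jacobi_mult_factor n (cnj (a h)) (- b h) (\<alpha> h) z w
    * f ((\<alpha> h - cnj (\<alpha> h) * w + z) / su_den (cnj (a h)) (- b h) w, (cnj (a h) * w + - b h) / su_den (cnj (a h)) (- b h) w)"
    if "h \<in> carrier jacobi_group" for h
    using pi_K_formula[of "a h" "b h" w "fst (snd h)" "snd (snd h)" f z] form[OF that] w unfolding x \<alpha>_def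
    by (metis)
  have su0: "su_pair (cnj (a h0)) (- b h0)"
    using form[OF h(2)] su_pair_inv by blast
  have den: "su_den (cnj (a h0)) (- b h0) w \<noteq> 0"
    by (rule su_den_nonzero[OF su0 w])
  have lims: "(\<lambda>i. a (h i)) \<longlonglongrightarrow> a h0" "(\<lambda>i. b (h i)) \<longlonglongrightarrow> b h0"
    "(\<lambda>i. snd (snd (h i))) \<longlonglongrightarrow> snd (snd h0)" "(\<lambda>i. fst (snd (h i))) \<longlonglongrightarrow> fst (snd h0)"
    unfolding a_def b_def by (intro tendsto_intros h(3))+
  have lim\<alpha>: "(\<lambda>i. \<alpha> (h i)) \<longlonglongrightarrow> \<alpha> h0"
    unfolding \<alpha>_def by (intro tendsto_intros lims)
  note lim_den = tendsto_su_den[OF tendsto_cnj[OF lims(1)] tendsto_minus[OF lims(2)], of w]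
  have arg: "(\<lambda>i. ((\<alpha> (h i) - cnj (\<alpha> (h i)) * w + z) / su_den (cnj (a (h i))) (- b (h i)) w,
        (cnj (a (h i)) * w + - b (h i)) / su_den (cnj (a (h i))) (- b (h i)) w))
    \<longlonglongrightarrow> ((\<alpha> h0 - cnj (\<alpha> h0) * w + z) / su_den (cnj (a h0)) (- b h0) w,
        (cnj (a h0) * w + - b h0) / su_den (cnj (a h0)) (- b h0) w)"
    by (intro tendsto_intros lims lim\<alpha> lim_den den)
  have in_disk: "((\<alpha> h0 - cnj (\<alpha> h0) * w + z) / su_den (cnj (a h0)) (- b h0) w,
        (cnj (a h0) * w + - b h0) / su_den (cnj (a h0)) (- b h0) w) \<in> jacobi_disk"
    using moebius_in_disk[OF su0 w] by simp
  have "isCont f ((\<alpha> h0 - cnj (\<alpha> h0) * w + z) / su_den (cnj (a h0)) (- b h0) w,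
        (cnj (a h0) * w + - b h0) / su_den (cnj (a h0)) (- b h0) w)"
    using holomorphic2_on_imp_continuous_on[OF jacobi_spaceD(1)[OF f]] in_disk jacobi_disk_open
    by (simp add: continuous_on_eq_continuous_at)
  from isCont_tendsto_compose[OF this arg]
  have "(\<lambda>i. exp (- (\<i> * of_real (snd (snd (h i))))) * jacobi_mult_factor n (cnj (a (h i))) (- b (h i)) (\<alpha> (h i)) z w
    * f ((\<alpha> (h i) - cnj (\<alpha> (h i)) * w + z) / su_den (cnj (a (h i))) (- b (h i)) w,
        (cnj (a (h i)) * w + - b (h i)) / su_den (cnj (a (h i))) (- b (h i)) w))
    \<longlonglongrightarrow> exp (- (\<i> * of_real (snd (snd h0)))) * jacobi_mult_factor n (cnj (a h0)) (- b h0) (\<alpha> h0) z w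
    * f ((\<alpha> h0 - cnj (\<alpha> h0) * w + z) / su_den (cnj (a h0)) (- b h0) w, (cnj (a h0) * w + - b h0) / su_den (cnj (a h0)) (- b h0) w)"
    by (intro tendsto_mult tendsto_mult_factor tendsto_intros lims lim\<alpha> den)
  then show ?thesis
    by (simp only: F[OF h(1)] F[OF h(2)])
qed (simp add: pi_K_outside)

lemma pi_K_nrm:
  assumes "h \<in> carrier jacobi_group" "f \<in> jacobi_space k"
  shows "J.nrm (pi_K h f) = J.nrm f"
  by (simp add: J.nrm_def pi_K_unitary[OF assms(1,2,2)])

lemma pi_K_sq_integral:
  assumes "h \<in> carrier jacobi_group" "f \<in> jacobi_space k"
  shows "(\<integral>x. (cmod (pi_K h f x))\<^sup>2 \<partial>jacobi_gauss k) = (\<integral>x. (cmod (f x))\<^sup>2 \<partial>jacobi_gauss k)"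
  using pi_K_nrm[OF assms] nrm_sq_integral[OF pi_K_closed[OF assms]] nrm_sq_integral[OF assms(2)] k_ge by simp

text \<open>By unitarity the norms are constant, so \<open>riesz_convergence\<close> upgrades
  pointwise convergence.\<close>

lemma pi_K_strongly_continuous:
  assumes h: "\<And>i. h i \<in> carrier jacobi_group" "h0 \<in> carrier jacobi_group" "h \<longlonglongrightarrow> h0"
    and f: "f \<in> jacobi_space k"
  shows "(\<lambda>i. J.nrm (pi_K (h i) f - pi_K h0 f)) \<longlonglongrightarrow> 0"
proof -
  note V = pi_K_closed[OF h(1) f] and V0 = pi_K_closed[OF h(2) f]
  have "(\<lambda>i. \<integral>x. (cmod (pi_K (h i) f x - pi_K h0 f x))\<^sup>2 \<partial>jacobi_gauss k) \<longlonglongrightarrow> 0"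
  proof (rule riesz_convergence)
    show "(\<integral>x. (cmod (pi_K (h i) f x))\<^sup>2 \<partial>jacobi_gauss k) = (\<integral>x. (cmod (pi_K h0 f x))\<^sup>2 \<partial>jacobi_gauss k)" for i
      by (simp add: pi_K_sq_integral[OF h(1) f] pi_K_sq_integral[OF h(2) f])
  qed (use jacobi_spaceD(3,4)[OF V] jacobi_spaceD(3,4)[OF V0] pi_K_pointwise[OF h f] in
      \<open>simp_all cong: measurable_cong_sets\<close>)
  from tendsto_mult_right_zero[OF this, of "(4 * k - 3) / (2 * pi\<^sup>2)"]
  have "(\<lambda>i. (J.nrm (pi_K (h i) f - pi_K h0 f))\<^sup>2) \<longlonglongrightarrow> 0"
    using nrm_sq_integral[OF J.V_diff[OF V V0]] by simp
  from tendsto_real_sqrt[OF this] show ?thesis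
    using J.nrm_nonneg[OF J.V_diff[OF V V0]] by simp
qed

lemma pi_K_continuous_map:
  assumes f: "f \<in> jacobi_space k"
  shows "continuous_map (top_of_set (carrier jacobi_group)) (htopology (jacobi_space k) (jacobi_ip k)) (\<lambda>h. pi_K h f)"
  unfolding Metric_space.continuous_map_to_metric[OF J.metric]
proof (intro ballI allI impI)
  fix h0 and e :: real
  assume "h0 \<in> topspace (top_of_set (carrier jacobi_group))" and e: "e > 0"
  then have h0: "h0 \<in> carrier jacobi_group"
    by simp
  \<comment> \<open>The topology of the group is metric, so a failure of continuity would show along
    a sequence at distances below 1 / (i + 1).\<close>
  have "\<exists>d>0. \<forall>h\<in>carrier jacobi_group. dist h h0 < d \<longrightarrow> J.nrm (pi_K h f - pi_K h0 f) < e"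
  proof (rule ccontr)
    assume "\<not> ?thesis"
    then have "\<forall>i. \<exists>h. h \<in> carrier jacobi_group \<and> dist h h0 < inverse (real (Suc i)) \<and> \<not> J.nrm (pi_K h f - pi_K h0 f) < e"
      by (metis inverse_positive_iff_positive of_nat_0_less_iff zero_less_Suc)
    then obtain h where h: "\<And>i. h i \<in> carrier jacobi_group" "\<And>i. dist (h i) h0 < inverse (real (Suc i))"
        "\<And>i. \<not> J.nrm (pi_K (h i) f - pi_K h0 f) < e"
      by metis
    have "(\<lambda>i. dist (h i) h0) \<longlonglongrightarrow> 0"
      by (rule tendsto_sandwich[OF _ _ tendsto_const LIMSEQ_inverse_real_of_nat])
         (use h(2) in \<open>auto intro!: always_eventually simp: less_imp_le\<close>)
    then have "h \<longlonglongrightarrow> h0"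
      by (rule tendsto_dist_iff[THEN iffD2])
    from order_tendstoD(2)[OF pi_K_strongly_continuous[OF h(1) h0 this f] e] h(3)
    show False
      by simp
  qed
  then obtain d where d: "d > 0" "\<And>h. h \<in> carrier jacobi_group \<Longrightarrow> dist h h0 < d \<Longrightarrow> J.nrm (pi_K h f - pi_K h0 f) < e"
    by blast
  show "\<exists>U. openin (top_of_set (carrier jacobi_group)) U \<and> h0 \<in> U \<and>
      (\<forall>h\<in>U. pi_K h f \<in> Metric_space.mball (jacobi_space k) (hdist (jacobi_space k) (jacobi_ip k)) (pi_K h0 f) e)"
  proof (intro exI[of _ "carrier jacobi_group \<inter> ball h0 d"] conjI ballI)
    show "openin (top_of_set (carrier jacobi_group)) (carrier jacobi_group \<inter> ball h0 d)"
      by (simp add: openin_open_Int)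
    fix h assume h: "h \<in> carrier jacobi_group \<inter> ball h0 d"
    then have hc: "h \<in> carrier jacobi_group" and hd: "dist h h0 < d"
      by (simp_all add: dist_commute)
    have "hdist (jacobi_space k) (jacobi_ip k) (pi_K h0 f) (pi_K h f) < e"
      unfolding J.hdist_nrm[OF pi_K_closed[OF h0 f] pi_K_closed[OF hc f]]
        J.nrm_diff_commute[OF pi_K_closed[OF h0 f] pi_K_closed[OF hc f]]
      by (rule d(2)[OF hc hd])
    then show "pi_K h f \<in> Metric_space.mball (jacobi_space k) (hdist (jacobi_space k) (jacobi_ip k)) (pi_K h0 f) e"
      using pi_K_closed[OF h0 f] pi_K_closed[OF hc f] by (simp only: Metric_space.in_mball[OF J.metric] simp_thms)
  qed (use h0 d(1) in auto)
qed

lemma pi_K_rep: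
  "continuous_unitary_rep (\<lambda>c f x. c * f x) (jacobi_space k) (jacobi_ip k) jacobi_group pi_K"
proof (rule continuous_unitary_rep.intro[OF jacobi_hilbert jacobi_group], rule continuous_unitary_rep_axioms.intro)
  show "pi_K h (u + v) = pi_K h u + pi_K h v" for h u v
    by (auto simp: pi_K_def fun_eq_iff algebra_simps)
  show "pi_K h (\<lambda>x. c * v x) = (\<lambda>x. c * pi_K h v x)" for h v c
    by (auto simp: pi_K_def fun_eq_iff)
  show "pi_K (h1 \<otimes>\<^bsub>jacobi_group\<^esub> h2) v = pi_K h1 (pi_K h2 v)"
    if "h1 \<in> carrier jacobi_group" "h2 \<in> carrier jacobi_group" for h1 h2 v
    by (rule pi_K_mult[OF that])
qed (fact pi_K_closed pi_K_unitary pi_K_one pi_K_continuous_map)+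

end

text \<open>Translations commute only up to the centre: the product of those by i t and 1 has the
  central coordinate Im (i t) = t, and the third one undoes the translation without adding to it.
  Hence the elements with vanishing last coordinate generate the group.\<close>

lemma jacobi_decompose:
  assumes ab: "su_pair a b"
  shows "(su_mat a b, \<alpha>, t) = (su_mat a b, \<alpha>, 0) \<otimes>\<^bsub>jacobi_group\<^esub>
    ((su_mat 1 0, \<i> * of_real t, 0) \<otimes>\<^bsub>jacobi_group\<^esub> (su_mat 1 0, 1, 0) \<otimes>\<^bsub>jacobi_group\<^esub>
     (su_mat 1 0, - (\<i> * of_real t + 1), 0))"
proof -
  have "Im ((\<i> * of_real t + 1) * cnj (- (\<i> * of_real t + 1))) = 0"
    by (simp add: algebra_simps)
  then show ?thesis
    by (simp add: jacobi_mult)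
qed

lemma rep_determined:
  assumes r1: "continuous_unitary_rep sc V ip jacobi_group rep1"
    and r2: "continuous_unitary_rep sc V ip jacobi_group rep2"
    and eq: "\<And>a b \<alpha> v. su_pair a b \<Longrightarrow> v \<in> V \<Longrightarrow> rep1 (su_mat a b, \<alpha>, 0) v = rep2 (su_mat a b, \<alpha>, 0) v"
    and h: "h \<in> carrier jacobi_group" and v: "v \<in> V"
  shows "rep1 h v = rep2 h v"
proof -
  interpret r1: continuous_unitary_rep sc V ip jacobi_group rep1 by fact
  interpret r2: continuous_unitary_rep sc V ip jacobi_group rep2 by fact
  obtain a b \<alpha> t where h': "h = (su_mat a b, \<alpha>, t)" and ab: "su_pair a b"
    using h by (elim jacobi_carrierE)
  let ?h1 = "(su_mat a b, \<alpha>, 0) :: jacobi" and ?h2 = "(su_mat 1 0, \<i> * of_real t, 0) :: jacobi"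
    and ?h3 = "(su_mat 1 0, 1, 0) :: jacobi" and ?h4 = "(su_mat 1 0, - (\<i> * of_real t + 1), 0) :: jacobi"
  have c: "?h1 \<in> carrier jacobi_group" "?h2 \<in> carrier jacobi_group" "?h3 \<in> carrier jacobi_group" "?h4 \<in> carrier jacobi_group"
    using ab by auto
  have e1: "rep1 h v = rep1 ?h1 (rep1 ?h2 (rep1 ?h3 (rep1 ?h4 v)))"
    unfolding h' jacobi_decompose[OF ab, of \<alpha> t] using c v by (simp only: r1.rep_mult r1.m_closed r1.rep_closed)
  have e2: "rep2 h v = rep2 ?h1 (rep2 ?h2 (rep2 ?h3 (rep2 ?h4 v)))"
    unfolding h' jacobi_decompose[OF ab, of \<alpha> t] using c v by (simp only: r2.rep_mult r1.m_closed r2.rep_closed)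
  show ?thesis
    unfolding e1 e2 using c v ab by (simp add: eq r2.rep_closed)
qed

section \<open>Double power series\<close>

text \<open>Terms are grouped by total degree because the N-th term of the exponential series for
  \<open>ev\<close> is homogeneous of degree N.\<close>

definition dterm :: "(nat \<Rightarrow> nat \<Rightarrow> complex) \<Rightarrow> nat \<Rightarrow> complex \<times> complex \<Rightarrow> complex" where
  "dterm c N x = (\<Sum>m\<le>N. c m (N - m) * (fst x ^ m * snd x ^ (N - m)))"

definition dps :: "(nat \<Rightarrow> nat \<Rightarrow> complex) \<Rightarrow> complex \<times> complex \<Rightarrow> complex" where
  "dps c x = (\<Sum>N. dterm c N x)"

text \<open>The growth condition for convergence on the plane times the unit disk: any radius in the
  first variable, any radius below 1 in the second. Boundedness suffices, since slightly larger
  radii bring in a geometric factor.\<close>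

definition polydisc_bounded :: "(nat \<Rightarrow> nat \<Rightarrow> real) \<Rightarrow> bool" where
  "polydisc_bounded b \<longleftrightarrow> (\<forall>R r. 0 < R \<longrightarrow> 0 < r \<longrightarrow> r < 1 \<longrightarrow> (\<exists>C. \<forall>m n. b m n * (R ^ m * r ^ n) \<le> C))"

abbreviation adm :: "(nat \<Rightarrow> nat \<Rightarrow> complex) \<Rightarrow> bool" where
  "adm c \<equiv> polydisc_bounded (\<lambda>m n. cmod (c m n))"

lemma polydisc_bounded_mono:
  assumes "polydisc_bounded b" "\<And>m n. b' m n \<le> K * b m n" "K \<ge> 0"
  shows "polydisc_bounded b'"
  unfolding polydisc_bounded_def
proof (intro allI impI)
  fix R r :: real assume Rr: "0 < R" "0 < r" "r < 1"
  obtain C where C: "\<And>m n. b m n * (R ^ m * r ^ n) \<le> C"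
    using assms(1) Rr unfolding polydisc_bounded_def by blast
  have "b' m n * (R ^ m * r ^ n) \<le> K * C" for m n
  proof -
    have "b' m n * (R ^ m * r ^ n) \<le> K * b m n * (R ^ m * r ^ n)"
      using assms(2) Rr by (intro mult_right_mono) auto
    also have "\<dots> = K * (b m n * (R ^ m * r ^ n))"
      by simp
    also have "\<dots> \<le> K * C"
      using C assms(3) by (rule mult_left_mono)
    finally show ?thesis .
  qed
  then show "\<exists>C. \<forall>m n. b' m n * (R ^ m * r ^ n) \<le> C"
    by blast
qed

lemma adm_add:
  assumes "adm c" "adm d"
  shows "adm (\<lambda>m n. c m n + d m n)"
  unfolding polydisc_bounded_def
proof (intro allI impI)
  fix R r :: real assume Rr: "0 < R" "0 < r" "r < 1"
  obtain C where C: "\<And>m n. cmod (c m n) * (R ^ m * r ^ n) \<le> C"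
    using assms(1) Rr unfolding polydisc_bounded_def by blast
  obtain D where D: "\<And>m n. cmod (d m n) * (R ^ m * r ^ n) \<le> D"
    using assms(2) Rr unfolding polydisc_bounded_def by blast
  have "cmod (c m n + d m n) * (R ^ m * r ^ n) \<le> C + D" for m n
  proof -
    have "cmod (c m n + d m n) * (R ^ m * r ^ n) \<le> (cmod (c m n) + cmod (d m n)) * (R ^ m * r ^ n)"
      using Rr by (intro mult_right_mono norm_triangle_ineq) auto
    then show ?thesis
      using C[of m n] D[of m n] by (simp add: distrib_right)
  qed
  then show "\<exists>C. \<forall>m n. cmod (c m n + d m n) * (R ^ m * r ^ n) \<le> C"
    by blast
qed

lemma adm_cmult: "adm c \<Longrightarrow> adm (\<lambda>m n. a * c m n)"
  by (erule polydisc_bounded_mono[where K = "cmod a"]) (simp_all add: norm_mult)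

text \<open>In terms of coefficients, \<open>shift\<close> is multiplication by a variable and \<open>pd\<close> a partial derivative.\<close>

definition shift1 :: "(nat \<Rightarrow> nat \<Rightarrow> complex) \<Rightarrow> nat \<Rightarrow> nat \<Rightarrow> complex" where
  "shift1 c m n = (case m of 0 \<Rightarrow> 0 | Suc i \<Rightarrow> c i n)"

definition shift2 :: "(nat \<Rightarrow> nat \<Rightarrow> complex) \<Rightarrow> nat \<Rightarrow> nat \<Rightarrow> complex" where
  "shift2 c m n = (case n of 0 \<Rightarrow> 0 | Suc j \<Rightarrow> c m j)"

definition pd1 :: "(nat \<Rightarrow> nat \<Rightarrow> complex) \<Rightarrow> nat \<Rightarrow> nat \<Rightarrow> complex" where
  "pd1 c m n = of_nat (Suc m) * c (Suc m) n"

definition pd2 :: "(nat \<Rightarrow> nat \<Rightarrow> complex) \<Rightarrow> nat \<Rightarrow> nat \<Rightarrow> complex" where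
  "pd2 c m n = of_nat (Suc n) * c m (Suc n)"

lemma adm_shift1:
  assumes "adm c"
  shows "adm (shift1 c)"
  unfolding polydisc_bounded_def
proof (intro allI impI)
  fix R r :: real assume Rr: "0 < R" "0 < r" "r < 1"
  obtain C where C: "\<And>m n. cmod (c m n) * (R ^ m * r ^ n) \<le> C"
    using assms(1) Rr unfolding polydisc_bounded_def by blast
  have C0: "0 \<le> C"
    using order.trans[OF norm_ge_zero[of "c 0 0"], of C] C[of 0 0] by simp
  have "cmod (shift1 c m n) * (R ^ m * r ^ n) \<le> R * C" for m n
  proof (cases m)
    case (Suc i)
    then show ?thesis
      using mult_left_mono[OF C[of i n], of R] Rr by (simp add: shift1_def ac_simps)
  qed (use C0 Rr in \<open>simp add: shift1_def\<close>)
  then show "\<exists>C. \<forall>m n. cmod (shift1 c m n) * (R ^ m * r ^ n) \<le> C"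
    by blast
qed

lemma adm_shift2:
  assumes "adm c"
  shows "adm (shift2 c)"
  unfolding polydisc_bounded_def
proof (intro allI impI)
  fix R r :: real assume Rr: "0 < R" "0 < r" "r < 1"
  obtain C where C: "\<And>m n. cmod (c m n) * (R ^ m * r ^ n) \<le> C"
    using assms(1) Rr unfolding polydisc_bounded_def by blast
  have C0: "0 \<le> C"
    using order.trans[OF norm_ge_zero[of "c 0 0"], of C] C[of 0 0] by simp
  have "cmod (shift2 c m n) * (R ^ m * r ^ n) \<le> r * C" for m n
  proof (cases n)
    case (Suc i)
    then show ?thesis
      using mult_left_mono[OF C[of m i], of r] Rr by (simp add: shift2_def ac_simps)
  qed (use C0 Rr in \<open>simp add: shift2_def\<close>)
  then show "\<exists>C. \<forall>m n. cmod (shift2 c m n) * (R ^ m * r ^ n) \<le> C"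
    by blast
qed

text \<open>The linear factor is what differentiating a power produces; a slightly larger radius
  absorbs it.\<close>

lemma linear_geometric_bounded:
  fixes q :: real
  assumes "0 \<le> q" "q < 1"
  obtains B where "0 \<le> B" "\<And>n. real (Suc n) * q ^ n \<le> B"
proof -
  have "(\<lambda>n. real n * q ^ n) \<longlonglongrightarrow> 0"
    using assms by (intro powser_times_n_limit_0) auto
  then have "Bseq (\<lambda>n. real n * q ^ n)"
    by (intro convergent_imp_Bseq convergentI)
  then obtain K where K: "\<And>n. norm (real n * q ^ n) \<le> K"
    by (metis BseqE)
  show thesis
  proof (rule that[of "K + 1"])
    show "0 \<le> K + 1"
      using K[of 0] by simp
    show "real (Suc n) * q ^ n \<le> K + 1" for n
      using K[of n] assms power_le_one[of q n] by (simp add: distrib_right)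
  qed
qed

lemma adm_pd1:
  assumes "adm c"
  shows "adm (pd1 c)"
  unfolding polydisc_bounded_def
proof (intro allI impI)
  fix R r :: real assume Rr: "0 < R" "0 < r" "r < 1"
  \<comment> \<open>The radius 2 R leaves (1/2)^m to absorb the factor m + 1 of the
    derivative.\<close>
  obtain C where C: "\<And>m n. cmod (c m n) * ((2 * R) ^ m * r ^ n) \<le> C"
    using assms(1) Rr unfolding polydisc_bounded_def by (metis mult_pos_pos zero_less_numeral)
  obtain B where B: "0 \<le> B" "\<And>m. real (Suc m) * (1 / 2) ^ m \<le> B"
    using linear_geometric_bounded[of "1 / 2"] by auto
  have C0: "0 \<le> C"
    using order.trans[OF norm_ge_zero[of "c 0 0"], of C] C[of 0 0] by simp
  have "cmod (pd1 c m n) * (R ^ m * r ^ n) \<le> B * (C / (2 * R))" for m n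
  proof -
    have "cmod (pd1 c m n) * (R ^ m * r ^ n)
        = (real (Suc m) * (1 / 2) ^ m) * (cmod (c (Suc m) n) * ((2 * R) ^ Suc m * r ^ n) / (2 * R))"
      using Rr unfolding pd1_def norm_mult norm_of_nat by (simp add: power_mult_distrib power_divide)
    also have "\<dots> \<le> B * (C / (2 * R))"
      using B C[of "Suc m" n] C0 Rr by (intro mult_mono divide_right_mono) auto
    finally show ?thesis .
  qed
  then show "\<exists>C. \<forall>m n. cmod (pd1 c m n) * (R ^ m * r ^ n) \<le> C"
    by blast
qed

lemma adm_pd2:
  assumes "adm c"
  shows "adm (pd2 c)"
  unfolding polydisc_bounded_def
proof (intro allI impI)
  fix R r :: real assume Rr: "0 < R" "0 < r" "r < 1"
  \<comment> \<open>The second radius must stay below 1, so it moves half way towards 1; (r / s)^n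
    absorbs n + 1.\<close>
  define s where "s = (1 + r) / 2"
  have s: "0 < s" "s < 1" "r < s"
    using Rr by (simp_all add: s_def)
  obtain C where C: "\<And>m n. cmod (c m n) * (R ^ m * s ^ n) \<le> C"
    using assms(1) Rr s unfolding polydisc_bounded_def by blast
  obtain B where B: "0 \<le> B" "\<And>n. real (Suc n) * (r / s) ^ n \<le> B"
    using linear_geometric_bounded[of "r / s"] Rr s by auto
  have C0: "0 \<le> C"
    using order.trans[OF norm_ge_zero[of "c 0 0"], of C] C[of 0 0] by simp
  have "cmod (pd2 c m n) * (R ^ m * r ^ n) \<le> B * (C / s)" for m n
  proof -
    have "cmod (pd2 c m n) * (R ^ m * r ^ n)
        = (real (Suc n) * (r / s) ^ n) * (cmod (c m (Suc n)) * (R ^ m * s ^ Suc n) / s)"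
      using s unfolding pd2_def norm_mult norm_of_nat by (simp add: power_divide)
    also have "\<dots> \<le> B * (C / s)"
      using B C[of m "Suc n"] C0 s Rr by (intro mult_mono divide_right_mono) auto
    finally show ?thesis .
  qed
  then show "\<exists>C. \<forall>m n. cmod (pd2 c m n) * (R ^ m * r ^ n) \<le> C"
    by blast
qed

text \<open>With \<rho> = W / r < 1 the radii Z / \<rho> and W / \<rho> = r are still allowed, so
  each of the N + 1 terms of degree N is at most a constant times \<rho>^N.\<close>

lemma polydisc_bounded_diagonal:
  assumes b: "polydisc_bounded b" and Z: "0 < Z" and W: "0 < W" "W < 1"
  obtains C \<rho> where "0 < \<rho>" "\<rho> < 1" "\<And>N. (\<Sum>m\<le>N. b m (N - m) * (Z ^ m * W ^ (N - m))) \<le> C * (real (Suc N) * \<rho> ^ N)"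
proof -
  define r where "r = (1 + W) / 2"
  define \<rho> where "\<rho> = W / r"
  have r: "0 < r" "r < 1" "W < r"
    using W by (simp_all add: r_def)
  have \<rho>: "0 < \<rho>" "\<rho> < 1"
    using r W by (simp_all add: \<rho>_def)
  obtain C where C: "\<And>m n. b m n * ((Z / \<rho>) ^ m * r ^ n) \<le> C"
    using b r \<rho> Z unfolding polydisc_bounded_def by (metis divide_pos_pos)
  have "(\<Sum>m\<le>N. b m (N - m) * (Z ^ m * W ^ (N - m))) \<le> C * (real (Suc N) * \<rho> ^ N)" for N
  proof -
    have "(\<Sum>m\<le>N. b m (N - m) * (Z ^ m * W ^ (N - m))) \<le> (\<Sum>m\<le>N. C * \<rho> ^ N)"
    proof (rule sum_mono)
      fix m assume m: "m \<in> {..N}"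
      have Wr: "W = \<rho> * r"
        using r by (simp add: \<rho>_def)
      have Zr: "Z = \<rho> * (Z / \<rho>)"
        using \<rho> by simp
      have "Z ^ m * W ^ (N - m) = \<rho> ^ (m + (N - m)) * ((Z / \<rho>) ^ m * r ^ (N - m))"
        unfolding power_add by (subst Zr, subst Wr, unfold power_mult_distrib) simp
      then have "b m (N - m) * (Z ^ m * W ^ (N - m)) = \<rho> ^ N * (b m (N - m) * ((Z / \<rho>) ^ m * r ^ (N - m)))"
        using m by simp
      also have "\<dots> \<le> \<rho> ^ N * C"
        using C \<rho> by (intro mult_left_mono) auto
      finally show "b m (N - m) * (Z ^ m * W ^ (N - m)) \<le> C * \<rho> ^ N"
        by (simp add: mult.commute)
    qed
    also have "\<dots> = C * (real (Suc N) * \<rho> ^ N)"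
      by simp
    finally show ?thesis .
  qed
  with \<rho> show thesis
    using that by blast
qed

lemma summable_linear_geometric:
  fixes \<rho> :: real
  assumes "0 < \<rho>" "\<rho> < 1"
  shows "summable (\<lambda>N. C * (real (Suc N) * \<rho> ^ N))"
proof -
  have "summable (\<lambda>N. of_nat (Suc N) * 1 * \<rho> ^ N)"
    using termdiff_converges[of \<rho> 1 "\<lambda>_. 1"] assms by (simp add: diffs_def summable_geometric)
  then show ?thesis
    by (intro summable_mult) simp
qed

lemma dterm_bound:
  assumes "cmod (fst x) \<le> Z" "cmod (snd x) \<le> W"
  shows "cmod (dterm c N x) \<le> (\<Sum>m\<le>N. cmod (c m (N - m)) * (Z ^ m * W ^ (N - m)))"
  unfolding dterm_def
proof (rule sum_norm_le)
  have "0 \<le> Z" "0 \<le> W"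
    using assms norm_ge_zero order.trans by blast+
  fix m assume "m \<in> {..N}"
  show "cmod (c m (N - m) * (fst x ^ m * snd x ^ (N - m))) \<le> cmod (c m (N - m)) * (Z ^ m * W ^ (N - m))"
    unfolding norm_mult norm_power using assms \<open>0 \<le> Z\<close> \<open>0 \<le> W\<close>
    by (intro mult_mono power_mono order.refl) auto
qed

lemma dps_uniform:
  assumes "adm c" "0 < Z" "0 < W" "W < 1"
  shows "uniform_limit (ball 0 Z \<times> ball 0 W) (\<lambda>n x. \<Sum>N<n. dterm c N x) (dps c) sequentially"
proof -
  obtain C \<rho> where \<rho>: "0 < \<rho>" "\<rho> < 1"
    and C: "\<And>N. (\<Sum>m\<le>N. cmod (c m (N - m)) * (Z ^ m * W ^ (N - m))) \<le> C * (real (Suc N) * \<rho> ^ N)"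
    using polydisc_bounded_diagonal[OF assms] by metis
  show ?thesis
    unfolding dps_def
  proof (rule Weierstrass_m_test[OF _ summable_linear_geometric[OF \<rho>, of C]])
    fix N x assume "x \<in> ball (0::complex) Z \<times> ball (0::complex) W"
    then have "cmod (fst x) \<le> Z" "cmod (snd x) \<le> W"
      by auto
    from dterm_bound[OF this, of c N] C[of N]
    show "norm (dterm c N x) \<le> C * (real (Suc N) * \<rho> ^ N)"
      by linarith
  qed
qed

lemma disk_polydisc:
  assumes "x \<in> jacobi_disk"
  obtains Z W where "0 < Z" "0 < W" "W < 1" "x \<in> ball 0 Z \<times> ball 0 W"
proof -
  obtain z w where x: "x = (z, w)" and w: "cmod w < 1"
    using assms by (cases x) auto
  have "x \<in> ball 0 (cmod z + 1) \<times> ball 0 ((1 + cmod w) / 2)"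
    using w by (simp add: x)
  moreover have "0 < cmod z + 1" "0 < (1 + cmod w) / 2" "(1 + cmod w) / 2 < 1"
    using w by (simp_all add: add_pos_nonneg add_nonneg_pos)
  ultimately show thesis
    using that by blast
qed

lemma dps_sums:
  assumes "adm c" "x \<in> jacobi_disk"
  shows "(\<lambda>N. dterm c N x) sums dps c x"
proof -
  obtain Z W where ZW: "0 < Z" "0 < W" "W < 1" and x: "x \<in> ball 0 Z \<times> ball 0 W"
    using disk_polydisc[OF assms(2)] .
  show ?thesis
    unfolding sums_def by (rule tendsto_uniform_limitI[OF dps_uniform[OF assms(1) ZW] x])
qed

lemma dps_add:
  assumes "adm c" "adm d" "x \<in> jacobi_disk"
  shows "dps (\<lambda>m n. c m n + d m n) x = dps c x + dps d x"
proof -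
  have "dterm (\<lambda>m n. c m n + d m n) N x = dterm c N x + dterm d N x" for N
    by (simp add: dterm_def sum.distrib distrib_right)
  then show ?thesis
    using sums_add[OF dps_sums[OF assms(1,3)] dps_sums[OF assms(2,3)]] by (simp add: dps_def sums_iff)
qed

lemma dps_cmult:
  assumes "adm c" "x \<in> jacobi_disk"
  shows "dps (\<lambda>m n. a * c m n) x = a * dps c x"
proof -
  have "dterm (\<lambda>m n. a * c m n) N x = a * dterm c N x" for N
    by (simp add: dterm_def sum_distrib_left mult.assoc)
  then show ?thesis
    using sums_mult[OF dps_sums[OF assms], of a] by (simp add: dps_def sums_iff)
qed

lemma dps_shift1:
  assumes "adm c" "x \<in> jacobi_disk"
  shows "dps (shift1 c) x = fst x * dps c x"
proof -
  have "dterm (shift1 c) (Suc N) x = fst x * dterm c N x" for N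
    unfolding dterm_def by (subst sum.atMost_Suc_shift) (simp add: shift1_def sum_distrib_left ac_simps)
  then have "(\<lambda>N. dterm (shift1 c) (Suc N) x) sums (fst x * dps c x)"
    using sums_mult[OF dps_sums[OF assms], of "fst x"] by simp
  moreover have "dterm (shift1 c) 0 x = 0"
    by (simp add: dterm_def shift1_def)
  ultimately have "(\<lambda>N. dterm (shift1 c) N x) sums (fst x * dps c x)"
    using sums_Suc_iff[of "\<lambda>N. dterm (shift1 c) N x" "fst x * dps c x"] by simp
  then show ?thesis
    by (simp add: dps_def sums_iff)
qed

lemma dterm_swap: "dterm c N (z, w) = dterm (\<lambda>m n. c n m) N (w, z)"
  unfolding dterm_def
  by (rule sum.reindex_bij_witness[of _ "\<lambda>m. N - m" "\<lambda>m. N - m"]) (auto simp: ac_simps)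

lemma dps_shift2:
  assumes "adm c" "x \<in> jacobi_disk"
  shows "dps (shift2 c) x = snd x * dps c x"
proof -
  obtain z w where x: "x = (z, w)"
    by (cases x)
  have "dterm (shift2 c) (Suc N) x = snd x * dterm c N x" for N
    unfolding x dterm_swap[of _ _ z w] snd_conv
    unfolding dterm_def by (subst sum.atMost_Suc_shift) (simp add: shift2_def sum_distrib_left ac_simps)
  then have "(\<lambda>N. dterm (shift2 c) (Suc N) x) sums (snd x * dps c x)"
    using sums_mult[OF dps_sums[OF assms], of "snd x"] by simp
  moreover have "dterm (shift2 c) 0 x = 0"
    by (simp add: dterm_def shift2_def)
  ultimately have "(\<lambda>N. dterm (shift2 c) N x) sums (snd x * dps c x)"
    using sums_Suc_iff[of "\<lambda>N. dterm (shift2 c) N x" "snd x * dps c x"] by simp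
  then show ?thesis
    by (simp add: dps_def sums_iff)
qed

text \<open>Differentiation lowers the total degree by one, hence the shifted index and the value 0
  for N = 0.\<close>

lemma dterm_has_derivative:
  "((\<lambda>x. dterm c N x) has_derivative
    (\<lambda>h. (case N of 0 \<Rightarrow> 0 | Suc M \<Rightarrow> dterm (pd1 c) M x * fst h + dterm (pd2 c) M x * snd h))) (at x within S)"
proof -
  have "((\<lambda>x. dterm c N x) has_derivative
      (\<lambda>h. \<Sum>m\<le>N. c m (N - m) * (fst x ^ m * (of_nat (N - m) * (snd h * snd x ^ (N - m - 1)))
        + of_nat m * (fst h * fst x ^ (m - 1)) * snd x ^ (N - m)))) (at x within S)"
    unfolding dterm_def by (auto intro!: derivative_eq_intros simp: fun_eq_iff mult.assoc)
  moreover have "(\<Sum>m\<le>N. c m (N - m) * (fst x ^ m * (of_nat (N - m) * (snd h * snd x ^ (N - m - 1)))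
        + of_nat m * (fst h * fst x ^ (m - 1)) * snd x ^ (N - m)))
      = (case N of 0 \<Rightarrow> 0 | Suc M \<Rightarrow> dterm (pd1 c) M x * fst h + dterm (pd2 c) M x * snd h)" for h
  proof (cases N)
    case (Suc M)
    have 1: "(\<Sum>m\<le>Suc M. c m (Suc M - m) * (of_nat m * (fst h * fst x ^ (m - 1)) * snd x ^ (Suc M - m)))
       = dterm (pd1 c) M x * fst h"
      unfolding dterm_def
      by (subst sum.atMost_Suc_shift) (simp add: pd1_def sum_distrib_left sum_distrib_right ac_simps)
    have "(\<Sum>m\<le>Suc M. c m (Suc M - m) * (fst x ^ m * (of_nat (Suc M - m) * (snd h * snd x ^ (Suc M - m - 1)))))
       = (\<Sum>m\<le>M. c m (Suc M - m) * (fst x ^ m * (of_nat (Suc M - m) * (snd h * snd x ^ (Suc M - m - 1)))))"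
      by simp
    also have "\<dots> = dterm (pd2 c) M x * snd h"
      unfolding dterm_def sum_distrib_right
      by (intro sum.cong refl) (simp add: pd2_def Suc_diff_le ac_simps)
    finally show ?thesis
      unfolding Suc using 1 by (simp only: distrib_left sum.distrib nat.case) simp
  qed simp
  ultimately show ?thesis
    by (simp only:)
qed

text \<open>Termwise differentiation: the series of both partial derivatives converge uniformly on a
  polydisc around the point.\<close>

lemma dps_has_derivative:
  assumes c: "adm c" and x: "x \<in> jacobi_disk"
  shows "(dps c has_derivative (\<lambda>h. dps (pd1 c) x * fst h + dps (pd2 c) x * snd h)) (at x)"
proof -
  obtain Z W where ZW: "0 < Z" "0 < W" "W < 1" and xS: "x \<in> ball 0 Z \<times> ball 0 W"
    using disk_polydisc[OF x] .
  define S where "S = ball (0::complex) Z \<times> ball (0::complex) W"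
  have SD: "y \<in> jacobi_disk" if "y \<in> S" for y
    using that ZW by (cases y) (simp add: S_def)
  have "\<exists>g. \<forall>y\<in>S. (\<lambda>N. dterm c N y) sums g y \<and>
      (g has_derivative (\<lambda>h. dps (pd1 c) y * fst h + dps (pd2 c) y * snd h)) (at y within S)"
  proof (rule has_derivative_series)
    show "convex S"
      unfolding S_def by (intro convex_Times convex_ball)
    show "(dterm c N has_derivative
      (\<lambda>h. (case N of 0 \<Rightarrow> 0 | Suc M \<Rightarrow> dterm (pd1 c) M y * fst h + dterm (pd2 c) M y * snd h))) (at y within S)" for N y
      by (rule dterm_has_derivative)
    show "x \<in> S"
      using xS by (simp add: S_def)
    show "(\<lambda>N. dterm c N x) sums dps c x"
      by (rule dps_sums[OF c x])
    fix e :: real assume e: "e > 0"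
    have "\<forall>\<^sub>F n in sequentially. \<forall>y\<in>S. dist (\<Sum>N<n. dterm (pd1 c) N y) (dps (pd1 c) y) < e / 2"
      using dps_uniform[OF adm_pd1[OF c] ZW] half_gt_zero[OF e] unfolding S_def uniform_limit_iff by blast
    moreover have "\<forall>\<^sub>F n in sequentially. \<forall>y\<in>S. dist (\<Sum>N<n. dterm (pd2 c) N y) (dps (pd2 c) y) < e / 2"
      using dps_uniform[OF adm_pd2[OF c] ZW] half_gt_zero[OF e] unfolding S_def uniform_limit_iff by blast
    ultimately have "\<forall>\<^sub>F n in sequentially. \<forall>y\<in>S. dist (\<Sum>N<n. dterm (pd1 c) N y) (dps (pd1 c) y) < e / 2
        \<and> dist (\<Sum>N<n. dterm (pd2 c) N y) (dps (pd2 c) y) < e / 2"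
      by eventually_elim auto
    then obtain n0 where n0: "\<And>n y. n \<ge> n0 \<Longrightarrow> y \<in> S \<Longrightarrow> dist (\<Sum>N<n. dterm (pd1 c) N y) (dps (pd1 c) y) < e / 2
        \<and> dist (\<Sum>N<n. dterm (pd2 c) N y) (dps (pd2 c) y) < e / 2"
      unfolding eventually_sequentially by blast
    show "\<forall>\<^sub>F n in sequentially. \<forall>y\<in>S. \<forall>h. norm ((\<Sum>i<n. (case i of 0 \<Rightarrow> 0 | Suc M \<Rightarrow>
        dterm (pd1 c) M y * fst h + dterm (pd2 c) M y * snd h)) - (dps (pd1 c) y * fst h + dps (pd2 c) y * snd h)) \<le> e * norm h"
    \<comment> \<open>The first n derivatives add up to the first n - 1 terms of the derived series,
      so one more term is taken.\<close>
    proof (rule eventually_sequentiallyI[of "Suc n0"], intro ballI allI)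
      fix n y and h :: "complex \<times> complex"
      assume n: "Suc n0 \<le> n" and y: "y \<in> S"
      then obtain M where M: "n = Suc M" "n0 \<le> M"
        by (cases n) auto
      define P where "P = (\<Sum>N<M. dterm (pd1 c) N y) - dps (pd1 c) y"
      define Q where "Q = (\<Sum>N<M. dterm (pd2 c) N y) - dps (pd2 c) y"
      have PQ: "cmod P \<le> e / 2" "cmod Q \<le> e / 2"
        using n0[OF M(2) y] by (simp_all add: P_def Q_def dist_norm)
      have "(\<Sum>i<n. (case i of 0 \<Rightarrow> 0 | Suc M \<Rightarrow> dterm (pd1 c) M y * fst h + dterm (pd2 c) M y * snd h))
          = (\<Sum>N<M. dterm (pd1 c) N y) * fst h + (\<Sum>N<M. dterm (pd2 c) N y) * snd h"
        unfolding M(1) by (subst sum.lessThan_Suc_shift) (simp add: sum.distrib sum_distrib_right)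
      then have "(\<Sum>i<n. (case i of 0 \<Rightarrow> 0 | Suc M \<Rightarrow> dterm (pd1 c) M y * fst h + dterm (pd2 c) M y * snd h))
          - (dps (pd1 c) y * fst h + dps (pd2 c) y * snd h) = P * fst h + Q * snd h"
        by (simp add: P_def Q_def algebra_simps)
      also have "norm \<dots> \<le> cmod P * cmod (fst h) + cmod Q * cmod (snd h)"
        by (metis norm_mult norm_triangle_ineq)
      also have "\<dots> \<le> e / 2 * norm h + e / 2 * norm h"
        using PQ e norm_fst_le[of "fst h" "snd h"] norm_snd_le[of "snd h" "fst h"] by (intro add_mono mult_mono) auto
      finally show "norm ((\<Sum>i<n. (case i of 0 \<Rightarrow> 0 | Suc M \<Rightarrow> dterm (pd1 c) M y * fst h + dterm (pd2 c) M y * snd h))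
          - (dps (pd1 c) y * fst h + dps (pd2 c) y * snd h)) \<le> e * norm h"
        by simp
    qed
  qed
  then obtain g where g: "\<And>y. y \<in> S \<Longrightarrow> (\<lambda>N. dterm c N y) sums g y"
      "\<And>y. y \<in> S \<Longrightarrow> (g has_derivative (\<lambda>h. dps (pd1 c) y * fst h + dps (pd2 c) y * snd h)) (at y within S)"
    by blast
  have S: "open S" "x \<in> S"
    using xS by (simp_all add: S_def open_Times)
  have "(g has_derivative (\<lambda>h. dps (pd1 c) x * fst h + dps (pd2 c) x * snd h)) (at x)"
    using g(2)[OF S(2)] by (simp add: at_within_open[OF S(2,1)])
  moreover have "g y = dps c y" if "y \<in> S" for y
    using sums_unique2[OF g(1)[OF that] dps_sums[OF c SD[OF that]]] .
  ultimately show ?thesis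
    using has_derivative_transform_within_open[OF _ S] by blast
qed

lemma dps_curve:
  assumes c: "adm c" and x: "(\<phi> t, \<psi> t) \<in> jacobi_disk"
    and der: "(\<phi> has_field_derivative p) (at t)" "(\<psi> has_field_derivative q) (at t)"
  shows "((\<lambda>t. dps c (\<phi> t, \<psi> t)) has_field_derivative
    (dps (pd1 c) (\<phi> t, \<psi> t) * p + dps (pd2 c) (\<phi> t, \<psi> t) * q)) (at t)"
proof -
  have "((\<lambda>t. (\<phi> t, \<psi> t)) has_derivative (\<lambda>h. (p * h, q * h))) (at t)"
    using der by (intro has_derivative_Pair) (simp_all add: has_field_derivative_def)
  from has_derivative_compose[OF this dps_has_derivative[OF c x]]
  have "((\<lambda>t. dps c (\<phi> t, \<psi> t)) has_derivative
    (\<lambda>h. dps (pd1 c) (\<phi> t, \<psi> t) * (p * h) + dps (pd2 c) (\<phi> t, \<psi> t) * (q * h))) (at t)"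
    by simp
  moreover have "(\<lambda>h. dps (pd1 c) (\<phi> t, \<psi> t) * (p * h) + dps (pd2 c) (\<phi> t, \<psi> t) * (q * h))
    = (*) (dps (pd1 c) (\<phi> t, \<psi> t) * p + dps (pd2 c) (\<phi> t, \<psi> t) * q)"
    by (simp add: fun_eq_iff algebra_simps)
  ultimately show ?thesis
    by (simp add: has_field_derivative_def)
qed

section \<open>Smooth vectors and one-parameter subgroups\<close>

context continuous_unitary_rep
begin

lemma smooth_in_V: "v \<in> smooth_vectors \<Longrightarrow> v \<in> V"
  unfolding smooth_vectors_def by blast

text \<open>Limits are unique, so \<open>w\<close> is the derivative found inside the invariant
  set.\<close>

lemma smooth_derivative:
  assumes "v \<in> smooth_vectors" "one_parameter_subgroup \<gamma>" "rep_deriv \<gamma> v w"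
  shows "w \<in> smooth_vectors"
proof -
  obtain S where S: "S \<subseteq> V" "v \<in> S" "\<forall>v\<in>S. \<forall>\<gamma>. one_parameter_subgroup \<gamma> \<longrightarrow> (\<exists>w\<in>S. rep_deriv \<gamma> v w)"
    using assms(1) unfolding smooth_vectors_def by blast
  then obtain w' where w': "w' \<in> S" "rep_deriv \<gamma> v w'"
    using assms(2) by blast
  have "w = w'"
    using assms(3) w'(2) unfolding rep_deriv_def by (rule limitin_unique) simp
  then show ?thesis
    using w'(1) S unfolding smooth_vectors_def by blast
qed

lemma smooth_derivative_ex:
  assumes "v \<in> smooth_vectors" "one_parameter_subgroup \<gamma>"
  obtains w where "w \<in> smooth_vectors" "rep_deriv \<gamma> v w"
  using assms unfolding smooth_vectors_def by blast

text \<open>\<open>smooth_vectors\<close> is the largest set of vectors closed under all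
  derivatives; this is its coinduction rule.\<close>

lemma smooth_coinduct:
  assumes "S \<subseteq> V" "\<And>v \<gamma>. v \<in> S \<Longrightarrow> one_parameter_subgroup \<gamma> \<Longrightarrow> \<exists>w\<in>S. rep_deriv \<gamma> v w"
  shows "S \<subseteq> smooth_vectors"
  using assms unfolding smooth_vectors_def by blast

lemma rep_neg: "h \<in> carrier G \<Longrightarrow> v \<in> V \<Longrightarrow> rep h (- v) = - rep h v"
  using rep_scale[of h v "-1"] by simp

lemma rep_diff: "h \<in> carrier G \<Longrightarrow> u \<in> V \<Longrightarrow> v \<in> V \<Longrightarrow> rep h (u - v) = rep h u - rep h v"
  using rep_add[of h u "- v"] rep_neg[of h v] by simp

lemma rep_nrm: "h \<in> carrier G \<Longrightarrow> v \<in> V \<Longrightarrow> nrm (rep h v) = nrm v"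
  by (simp add: nrm_def rep_unitary)

lemma one_parameter_carrier: "one_parameter_subgroup \<gamma> \<Longrightarrow> \<gamma> s \<in> carrier G"
  unfolding one_parameter_subgroup_def by blast

lemma rep_deriv_add:
  assumes \<gamma>: "one_parameter_subgroup \<gamma>" and V: "u \<in> V" "v \<in> V"
    and d: "rep_deriv \<gamma> u u'" "rep_deriv \<gamma> v v'"
  shows "rep_deriv \<gamma> (u + v) (u' + v')"
proof -
  have "scale (of_real (inverse s)) (rep (\<gamma> s) (u + v) - (u + v))
      = scale (of_real (inverse s)) (rep (\<gamma> s) u - u) + scale (of_real (inverse s)) (rep (\<gamma> s) v - v)" for s
    using V one_parameter_carrier[OF \<gamma>] by (simp add: rep_add algebra_simps flip: scale_right_distrib)
  then show ?thesis
    using limitin_add[OF d[unfolded rep_deriv_def]] unfolding rep_deriv_def by simp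
qed

lemma rep_deriv_scale:
  assumes \<gamma>: "one_parameter_subgroup \<gamma>" and V: "u \<in> V" and d: "rep_deriv \<gamma> u u'"
  shows "rep_deriv \<gamma> (scale c u) (scale c u')"
proof -
  have "scale (of_real (inverse s)) (rep (\<gamma> s) (scale c u) - scale c u)
      = scale c (scale (of_real (inverse s)) (rep (\<gamma> s) u - u))" for s
    using V one_parameter_carrier[OF \<gamma>]
    by (simp add: rep_scale mult.commute flip: scale_right_diff_distrib)
  then show ?thesis
    using limitin_scale[OF d[unfolded rep_deriv_def], of c] unfolding rep_deriv_def by simp
qed

lemma smooth_add:
  assumes "u \<in> smooth_vectors" "v \<in> smooth_vectors"
  shows "u + v \<in> smooth_vectors"
proof -
  have "{u + v | u v. u \<in> smooth_vectors \<and> v \<in> smooth_vectors} \<subseteq> smooth_vectors"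
  proof (rule smooth_coinduct)
    show "{u + v | u v. u \<in> smooth_vectors \<and> v \<in> smooth_vectors} \<subseteq> V"
      using smooth_in_V by auto
    fix x \<gamma> assume x: "x \<in> {u + v | u v. u \<in> smooth_vectors \<and> v \<in> smooth_vectors}" and \<gamma>: "one_parameter_subgroup \<gamma>"
    then obtain u v where uv: "x = u + v" "u \<in> smooth_vectors" "v \<in> smooth_vectors"
      by blast
    obtain u' where u': "u' \<in> smooth_vectors" "rep_deriv \<gamma> u u'"
      using smooth_derivative_ex[OF uv(2) \<gamma>] .
    obtain v' where v': "v' \<in> smooth_vectors" "rep_deriv \<gamma> v v'"
      using smooth_derivative_ex[OF uv(3) \<gamma>] .
    show "\<exists>w\<in>{u + v | u v. u \<in> smooth_vectors \<and> v \<in> smooth_vectors}. rep_deriv \<gamma> x w"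
      using rep_deriv_add[OF \<gamma> smooth_in_V[OF uv(2)] smooth_in_V[OF uv(3)] u'(2) v'(2)] u'(1) v'(1) uv(1) by blast
  qed
  then show ?thesis
    using assms by blast
qed

lemma smooth_scale:
  assumes "u \<in> smooth_vectors"
  shows "scale c u \<in> smooth_vectors"
proof -
  have "scale c ` smooth_vectors \<subseteq> smooth_vectors"
  proof (rule smooth_coinduct)
    show "scale c ` smooth_vectors \<subseteq> V"
      using smooth_in_V by auto
    fix x \<gamma> assume x: "x \<in> scale c ` smooth_vectors" and \<gamma>: "one_parameter_subgroup \<gamma>"
    then obtain u where u: "x = scale c u" "u \<in> smooth_vectors"
      by blast
    obtain u' where u': "u' \<in> smooth_vectors" "rep_deriv \<gamma> u u'"
      using smooth_derivative_ex[OF u(2) \<gamma>] .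
    show "\<exists>w\<in>scale c ` smooth_vectors. rep_deriv \<gamma> x w"
      using rep_deriv_scale[OF \<gamma> smooth_in_V[OF u(2)] u'(2)] u'(1) u(1) by blast
  qed
  then show ?thesis
    using assms by blast
qed

lemma smooth_neg: "v \<in> smooth_vectors \<Longrightarrow> - v \<in> smooth_vectors"
  using smooth_scale[of v "-1"] by simp

lemma smooth_diff: "u \<in> smooth_vectors \<Longrightarrow> v \<in> smooth_vectors \<Longrightarrow> u - v \<in> smooth_vectors"
  using smooth_add[of u "- v"] smooth_neg by simp

text \<open>The derivative of \<open>rep h v\<close> along \<open>\<gamma>\<close> is \<open>rep h\<close> applied to that of \<open>v\<close> along \<open>h\<^sup>-\<^sup>1 \<gamma> h\<close>.\<close>

lemma smooth_rep:
  assumes conj: "\<And>h \<gamma>. h \<in> carrier G \<Longrightarrow> one_parameter_subgroup \<gamma> \<Longrightarrow>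
      one_parameter_subgroup (\<lambda>s. inv h \<otimes> \<gamma> s \<otimes> h)"
    and h: "h \<in> carrier G" and v: "v \<in> smooth_vectors"
  shows "rep h v \<in> smooth_vectors"
proof -
  have "rep h ` smooth_vectors \<subseteq> smooth_vectors"
  proof (rule smooth_coinduct)
    show "rep h ` smooth_vectors \<subseteq> V"
      using smooth_in_V h rep_closed by blast
    fix x \<gamma> assume x: "x \<in> rep h ` smooth_vectors" and \<gamma>: "one_parameter_subgroup \<gamma>"
    then obtain u where u: "x = rep h u" "u \<in> smooth_vectors"
      by blast
    note uV = smooth_in_V[OF u(2)]
    obtain u' where u': "u' \<in> smooth_vectors" "rep_deriv (\<lambda>s. inv h \<otimes> \<gamma> s \<otimes> h) u u'"
      using smooth_derivative_ex[OF u(2) conj[OF h \<gamma>]] .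
    have u'V: "u' \<in> V"
      using u'(1) smooth_in_V by blast
    have g: "\<gamma> s \<in> carrier G" for s
      by (rule one_parameter_carrier[OF \<gamma>])
    have c: "inv h \<otimes> \<gamma> s \<otimes> h \<in> carrier G" for s
      using g h by simp
    have e: "rep (\<gamma> s) (rep h u) = rep h (rep (inv h \<otimes> \<gamma> s \<otimes> h) u)" for s
    proof -
      have "h \<otimes> (inv h \<otimes> \<gamma> s \<otimes> h) = \<gamma> s \<otimes> h"
        using g h by (simp add: m_assoc[symmetric])
      then show ?thesis
        using rep_mult[OF h c[of s] uV] rep_mult[OF g[of s] h uV] by simp
    qed
    have q: "scale (of_real (inverse s)) (rep (\<gamma> s) x - x) - rep h u'
        = rep h (scale (of_real (inverse s)) (rep (inv h \<otimes> \<gamma> s \<otimes> h) u - u) - u')" for s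
      unfolding u(1) e using h c uV u'V by (simp add: rep_diff rep_scale rep_closed)
    have lim: "((\<lambda>s. nrm (scale (of_real (inverse s)) (rep (inv h \<otimes> \<gamma> s \<otimes> h) u - u) - u')) \<longlongrightarrow> 0) (at 0)"
      using u'(2) unfolding rep_deriv_def limitin_iff by blast
    have "rep_deriv \<gamma> x (rep h u')"
      unfolding rep_deriv_def limitin_iff q
    proof (intro conjI always_eventually allI)
      show "rep h u' \<in> V"
        using h u'V rep_closed by blast
      show "scale (of_real (inverse s)) (rep (\<gamma> s) x - x) \<in> V" for s
        using h g uV by (simp add: u(1) rep_closed)
      show "((\<lambda>s. nrm (rep h (scale (of_real (inverse s)) (rep (inv h \<otimes> \<gamma> s \<otimes> h) u - u) - u'))) \<longlongrightarrow> 0) (at 0)"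
        using lim h c uV u'V by (simp add: rep_nrm rep_closed)
    qed
    then show "\<exists>w\<in>rep h ` smooth_vectors. rep_deriv \<gamma> x w"
      using u'(1) by blast
  qed
  then show ?thesis
    using v by blast
qed

end

section \<open>One-parameter subgroups of the Jacobi group\<close>

lemma continuous_on_su_mat:
  assumes "continuous_on S a" "continuous_on S b"
  shows "continuous_on S (\<lambda>x. su_mat (a x) (b x))"
proof -
  have "su_mat (a x) (b x) = (\<chi> i j. if i = 1 then (if j = 1 then a x else b x) else (if j = 1 then cnj (b x) else cnj (a x)))" for x
    by (simp add: vec_eq_iff forall_2)
  moreover have "continuous_on S (\<lambda>x. (\<chi> i j. if i = 1 then (if j = 1 then a x else b x) else (if j = 1 then cnj (b x) else cnj (a x))) :: complex^2^2)"
  proof (intro continuous_on_vec_lambda)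
    fix i j :: 2
    show "continuous_on S (\<lambda>x. if i = 1 then (if j = 1 then a x else b x) else (if j = 1 then cnj (b x) else cnj (a x)))"
      using assms by (cases "i = 1"; cases "j = 1") (simp_all add: continuous_on_cnj)
  qed
  ultimately show ?thesis
    by simp
qed

lemma jacobi_conj_continuous:
  fixes \<gamma> :: "real \<Rightarrow> jacobi"
  assumes \<gamma>: "continuous_on UNIV \<gamma>" "\<And>s. \<gamma> s \<in> carrier jacobi_group" and h: "h \<in> carrier jacobi_group" "h' \<in> carrier jacobi_group"
  shows "continuous_on UNIV (\<lambda>s. h \<otimes>\<^bsub>jacobi_group\<^esub> \<gamma> s \<otimes>\<^bsub>jacobi_group\<^esub> h')"
proof -
  obtain a b \<alpha> r where h1: "h = (su_mat a b, \<alpha>, r)" and ab: "su_pair a b"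
    using h(1) by (elim jacobi_carrierE)
  obtain c d \<beta> t where h2: "h' = (su_mat c d, \<beta>, t)" and cd: "su_pair c d"
    using h(2) by (elim jacobi_carrierE)
  define p where "p s = fst (\<gamma> s) $ 1 $ 1" for s
  define q where "q s = fst (\<gamma> s) $ 1 $ 2" for s
  define \<delta> where "\<delta> s = fst (snd (\<gamma> s))" for s
  define u where "u s = snd (snd (\<gamma> s))" for s
  have g: "\<gamma> s = (su_mat (p s) (q s), \<delta> s, u s) \<and> su_pair (p s) (q s)" for s
    using \<gamma>(2)[of s] by (elim jacobi_carrierE) (simp add: p_def q_def \<delta>_def u_def)
  have c: "continuous_on UNIV p" "continuous_on UNIV q" "continuous_on UNIV \<delta>" "continuous_on UNIV u"
    unfolding p_def q_def \<delta>_def u_def using \<gamma>(1)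
    by (auto intro!: continuous_on_fst continuous_on_snd continuous_on_component)
  have pq: "su_pair (p s) (q s)" for s
    using g by blast
  have eq: "h \<otimes>\<^bsub>jacobi_group\<^esub> \<gamma> s = (su_mat (a * p s + b * cnj (q s)) (a * q s + b * cnj (p s)),
        cnj (p s) * \<alpha> - q s * cnj \<alpha> + \<delta> s, r + u s + Im ((cnj (p s) * \<alpha> - q s * cnj \<alpha>) * cnj (\<delta> s)))" for s
    using jacobi_mult[OF pq] g[of s] h1 by metis
  show ?thesis
    unfolding eq h2 jacobi_mult[OF cd]
    by (intro continuous_on_Pair continuous_on_su_mat continuous_intros c)
qed

text \<open>Discharges the hypothesis of \<open>smooth_rep\<close>.\<close>

lemma jacobi_one_parameter_conj:
  assumes "continuous_unitary_rep sc V ip jacobi_group rep" "h \<in> carrier jacobi_group"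
    and \<gamma>: "continuous_unitary_rep.one_parameter_subgroup jacobi_group \<gamma>"
  shows "continuous_unitary_rep.one_parameter_subgroup jacobi_group
    (\<lambda>s. inv\<^bsub>jacobi_group\<^esub> h \<otimes>\<^bsub>jacobi_group\<^esub> \<gamma> s \<otimes>\<^bsub>jacobi_group\<^esub> h)"
proof -
  interpret continuous_unitary_rep sc V ip jacobi_group rep by fact
  have g: "\<gamma> s \<in> carrier jacobi_group" "\<gamma> (s + t) = \<gamma> s \<otimes>\<^bsub>jacobi_group\<^esub> \<gamma> t" "continuous_on UNIV \<gamma>" for s t
    using \<gamma> unfolding one_parameter_subgroup_def by auto
  show ?thesis
    unfolding one_parameter_subgroup_def
  proof (intro conjI allI)
    show "continuous_on UNIV (\<lambda>s. inv\<^bsub>jacobi_group\<^esub> h \<otimes>\<^bsub>jacobi_group\<^esub> \<gamma> s \<otimes>\<^bsub>jacobi_group\<^esub> h)"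
      using jacobi_conj_continuous[OF g(3,1) inv_closed[OF assms(2)] assms(2)] .
    show "range (\<lambda>s. inv\<^bsub>jacobi_group\<^esub> h \<otimes>\<^bsub>jacobi_group\<^esub> \<gamma> s \<otimes>\<^bsub>jacobi_group\<^esub> h) \<subseteq> carrier jacobi_group"
      using g(1) assms(2) by auto
    fix s t
    have "h \<otimes>\<^bsub>jacobi_group\<^esub> (inv\<^bsub>jacobi_group\<^esub> h \<otimes>\<^bsub>jacobi_group\<^esub> (\<gamma> t \<otimes>\<^bsub>jacobi_group\<^esub> h)) = \<gamma> t \<otimes>\<^bsub>jacobi_group\<^esub> h"
      using g(1) assms(2) by (simp add: m_assoc[symmetric])
    then show "inv\<^bsub>jacobi_group\<^esub> h \<otimes>\<^bsub>jacobi_group\<^esub> \<gamma> (s + t) \<otimes>\<^bsub>jacobi_group\<^esub> h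
      = inv\<^bsub>jacobi_group\<^esub> h \<otimes>\<^bsub>jacobi_group\<^esub> \<gamma> s \<otimes>\<^bsub>jacobi_group\<^esub> h \<otimes>\<^bsub>jacobi_group\<^esub> (inv\<^bsub>jacobi_group\<^esub> h \<otimes>\<^bsub>jacobi_group\<^esub> \<gamma> t \<otimes>\<^bsub>jacobi_group\<^esub> h)"
      using g assms(2) by (simp add: m_assoc)
  qed
qed

lemma matrix_power_su11_diag:
  "(((**) (s *\<^sub>R su11_alg \<theta> 0)) ^^ n) (mat 1) = su_mat ((\<i> * of_real (s * \<theta>)) ^ n) 0"
proof (induction n)
  case 0
  show ?case
    by (simp add: su_mat_one)
next
  case (Suc n)
  have X: "s *\<^sub>R su11_alg \<theta> 0 = su_mat (\<i> * of_real (s * \<theta>)) 0"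
    by (simp add: su11_alg_def vec_eq_iff forall_2 complex_eq_iff)
  show ?case
    unfolding funpow.simps o_apply Suc unfolding X by (simp add: su_mat_mult)
qed

lemma sums_matrix2:
  fixes f :: "nat \<Rightarrow> complex^2^2"
  assumes "(\<lambda>n. f n $ 1 $ 1) sums a" "(\<lambda>n. f n $ 1 $ 2) sums b" "(\<lambda>n. f n $ 2 $ 1) sums c" "(\<lambda>n. f n $ 2 $ 2) sums d"
  shows "f sums vector [vector [a, b], vector [c, d]]"
  unfolding sums_def
proof (intro vec_tendstoI)
  fix i j :: 2
  show "(\<lambda>n. (\<Sum>k<n. f k) $ i $ j) \<longlonglongrightarrow> vector [vector [a, b], vector [c, d]] $ i $ j"
    using assms exhaust_2[of i] exhaust_2[of j] unfolding sums_def by auto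
qed

lemma mat_exp_diag: "mat_exp (s *\<^sub>R su11_alg \<theta> 0) = su_mat (cis (s * \<theta>)) 0"
proof -
  have e: "(\<lambda>n. (1 / fact n) *\<^sub>R z ^ n) sums exp z" for z :: complex
    using exp_converges[of z] by (simp add: inverse_eq_divide)
  have "(\<lambda>n. (1 / fact n) *\<^sub>R (((**) (s *\<^sub>R su11_alg \<theta> 0)) ^^ n) (mat 1))
      sums vector [vector [exp (\<i> * of_real (s * \<theta>)), 0], vector [0, exp (- \<i> * of_real (s * \<theta>))]]"
    unfolding matrix_power_su11_diag by (rule sums_matrix2) (use e[of "\<i> * of_real (s * \<theta>)"] e[of "- (\<i> * of_real (s * \<theta>))"] in simp_all)
  moreover have "vector [vector [exp (\<i> * of_real (s * \<theta>)), 0], vector [0, exp (- \<i> * of_real (s * \<theta>))]] = su_mat (cis (s * \<theta>)) 0"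
    by (simp add: su_mat_def cis_conv_exp exp_cnj)
  ultimately show ?thesis
    unfolding mat_exp_def by (simp add: sums_iff)
qed

text \<open>For unimodular \<zeta> the generator squares to s^2 times the identity. So the powers
  alternate, and the exponential splits into the series of cosh and sinh.\<close>

lemma matrix_power_su11_boost:
  assumes \<zeta>: "\<zeta> * cnj \<zeta> = 1"
  shows "(((**) (s *\<^sub>R su11_alg 0 \<zeta>)) ^^ n) (mat 1)
    = (if even n then su_mat (of_real (s ^ n)) 0 else su_mat 0 (of_real (s ^ n) * \<zeta>))"
proof (induction n)
  case 0
  show ?case
    by (simp add: su_mat_one)
next
  case (Suc n)
  have X: "s *\<^sub>R su11_alg 0 \<zeta> = su_mat 0 (of_real s * \<zeta>)"
    by (simp add: su11_alg_def vec_eq_iff forall_2 complex_eq_iff)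
  show ?case
  proof (cases "even n")
    case True
    then show ?thesis
      using Suc by (simp add: X su_mat_mult ac_simps)
  next
    case False
    have "of_real s * \<zeta> * (of_real s ^ n * cnj \<zeta>) = of_real s * of_real s ^ n * (\<zeta> * cnj \<zeta>)"
      by (simp only: ac_simps)
    then have "of_real s * \<zeta> * (of_real s ^ n * cnj \<zeta>) = of_real s * of_real s ^ n"
      unfolding \<zeta> by simp
    then show ?thesis
      using False Suc by (simp add: X su_mat_mult su_mat_eq_iff)
  qed
qed

lemma mat_exp_boost:
  assumes \<zeta>: "\<zeta> * cnj \<zeta> = 1"
  shows "mat_exp (s *\<^sub>R su11_alg 0 \<zeta>) = su_mat (of_real (cosh s)) (of_real (sinh s) * \<zeta>)"
proof -
  define c where "c = (\<lambda>n. complex_of_real (if even n then s ^ n / fact n else 0))"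
  define d where "d = (\<lambda>n. complex_of_real (if even n then 0 else s ^ n / fact n))"
  have c: "c sums of_real (cosh s)"
  proof -
    have "(\<lambda>n. if even n then s ^ n / fact n else 0) sums cosh s"
    proof -
      have "(\<lambda>n. if even n then s ^ n / fact n else 0) = (\<lambda>n. if even n then s ^ n /\<^sub>R fact n else 0)"
        by (auto simp: fun_eq_iff field_simps)
      then show ?thesis
        using cosh_converges[of s] by simp
    qed
    then show ?thesis
      unfolding c_def by (simp only: sums_of_real_iff)
  qed
  have d: "d sums of_real (sinh s)"
  proof -
    have "(\<lambda>n. if even n then 0 else s ^ n / fact n) sums sinh s"
    proof -
      have "(\<lambda>n. if even n then 0 else s ^ n / fact n) = (\<lambda>n. if even n then 0 else s ^ n /\<^sub>R fact n)"
        by (auto simp: fun_eq_iff field_simps)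
      then show ?thesis
        using sinh_converges[of s] by simp
    qed
    then show ?thesis
      unfolding d_def by (simp only: sums_of_real_iff)
  qed
  have t: "(1 / fact n) *\<^sub>R (((**) (s *\<^sub>R su11_alg 0 \<zeta>)) ^^ n) (mat 1) = su_mat (c n) (d n * \<zeta>)" for n
    unfolding matrix_power_su11_boost[OF \<zeta>]
    by (simp add: c_def d_def vec_eq_iff forall_2 complex_eq_iff)
  have "(\<lambda>n. su_mat (c n) (d n * \<zeta>)) sums vector [vector [of_real (cosh s), of_real (sinh s) * \<zeta>],
      vector [of_real (sinh s) * cnj \<zeta>, of_real (cosh s)]]"
  proof (rule sums_matrix2)
    have "cnj (d n) = d n" "cnj (c n) = c n" for n
      by (simp_all add: c_def d_def)
    then show "(\<lambda>n. su_mat (c n) (d n * \<zeta>) $ 2 $ 1) sums (of_real (sinh s) * cnj \<zeta>)"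
      "(\<lambda>n. su_mat (c n) (d n * \<zeta>) $ 2 $ 2) sums of_real (cosh s)"
      using c sums_mult2[OF d, of "cnj \<zeta>"] by simp_all
  qed (use c sums_mult2[OF d, of \<zeta>] in simp_all)
  moreover have "vector [vector [of_real (cosh s), of_real (sinh s) * \<zeta>],
      vector [of_real (sinh s) * cnj \<zeta>, of_real (cosh s)]] = su_mat (of_real (cosh s)) (of_real (sinh s) * \<zeta>)"
    by (simp add: su_mat_def)
  ultimately show ?thesis
    unfolding mat_exp_def t by (simp add: sums_iff)
qed

definition orbit_D :: "complex \<Rightarrow> real \<Rightarrow> jacobi" where
  "orbit_D \<alpha> s = (mat 1, of_real s * \<alpha>, 0)"

definition orbit_S :: "real \<Rightarrow> complex \<Rightarrow> real \<Rightarrow> jacobi" where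
  "orbit_S \<theta> \<zeta> s = (mat_exp (s *\<^sub>R su11_alg \<theta> \<zeta>), 0, 0)"

lemma orbit_D_eq: "orbit_D \<alpha> s = (su_mat 1 0, of_real s * \<alpha>, 0)"
  by (simp add: orbit_D_def su_mat_one)

lemma orbit_S_rot: "orbit_S \<theta> 0 s = (su_mat (cis (s * \<theta>)) 0, 0, 0)"
  by (simp add: orbit_S_def mat_exp_diag)

lemma orbit_S_boost: "\<zeta> * cnj \<zeta> = 1 \<Longrightarrow> orbit_S 0 \<zeta> s = (su_mat (of_real (cosh s)) (of_real (sinh s) * \<zeta>), 0, 0)"
  by (simp add: orbit_S_def mat_exp_boost)

lemma su_pair_rot: "su_pair (cis t) 0"
  by (simp add: su_pair_cmod)

lemma su_pair_boost:
  assumes "\<zeta> * cnj \<zeta> = 1"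
  shows "su_pair (of_real (cosh s)) (of_real (sinh s) * \<zeta>)"
proof -
  have "of_real (sinh s) * \<zeta> * cnj (of_real (sinh s) * \<zeta>) = of_real ((sinh s)\<^sup>2) * (\<zeta> * cnj \<zeta>)"
    by (simp add: power2_eq_square)
  then have "of_real (cosh s) * cnj (of_real (cosh s)) - of_real (sinh s) * \<zeta> * cnj (of_real (sinh s) * \<zeta>)
      = complex_of_real ((cosh s)\<^sup>2 - (sinh s)\<^sup>2)"
    using assms by (simp add: power2_eq_square)
  then show ?thesis
    unfolding su_pair_def by (simp add: hyperbolic_pythagoras)
qed

lemma jacobi_one_parameter:
  assumes "continuous_unitary_rep sc V ip jacobi_group rep"
  shows "continuous_unitary_rep.one_parameter_subgroup jacobi_group (orbit_D \<alpha>)"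
    and "continuous_unitary_rep.one_parameter_subgroup jacobi_group (orbit_S \<theta> 0)"
    and "\<zeta> * cnj \<zeta> = 1 \<Longrightarrow> continuous_unitary_rep.one_parameter_subgroup jacobi_group (orbit_S 0 \<zeta>)"
proof -
  interpret continuous_unitary_rep sc V ip jacobi_group rep by fact
  show "one_parameter_subgroup (orbit_D \<alpha>)"
    unfolding one_parameter_subgroup_def
  proof (intro conjI allI)
    show "continuous_on UNIV (orbit_D \<alpha>)"
      unfolding orbit_D_def by (intro continuous_intros)
    show "orbit_D \<alpha> (s + t) = orbit_D \<alpha> s \<otimes>\<^bsub>jacobi_group\<^esub> orbit_D \<alpha> t" for s t
      by (simp add: orbit_D_eq jacobi_mult algebra_simps)
  qed (auto simp: orbit_D_eq)
  show "one_parameter_subgroup (orbit_S \<theta> 0)"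
    unfolding one_parameter_subgroup_def orbit_S_rot
  proof (intro conjI allI)
    show "continuous_on UNIV (\<lambda>s. (su_mat (cis (s * \<theta>)) 0, 0 :: complex, 0 :: real))"
      by (intro continuous_on_Pair continuous_on_su_mat continuous_intros)
    show "(su_mat (cis ((s + t) * \<theta>)) 0, 0, 0) = (su_mat (cis (s * \<theta>)) 0, 0, 0) \<otimes>\<^bsub>jacobi_group\<^esub> (su_mat (cis (t * \<theta>)) 0, 0, 0)" for s t
      by (simp add: jacobi_mult su_pair_rot cis_mult distrib_right)
  qed (auto simp: su_pair_rot)
  show "one_parameter_subgroup (orbit_S 0 \<zeta>)" if \<zeta>: "\<zeta> * cnj \<zeta> = 1"
    unfolding one_parameter_subgroup_def orbit_S_boost[OF \<zeta>]
  proof (intro conjI allI)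
    show "continuous_on UNIV (\<lambda>s. (su_mat (of_real (cosh s)) (of_real (sinh s) * \<zeta>), 0 :: complex, 0 :: real))"
      by (intro continuous_on_Pair continuous_on_su_mat continuous_intros)
    fix s t
    have "of_real (sinh s) * \<zeta> * cnj (of_real (sinh t) * \<zeta>) = of_real (sinh s * sinh t) * (\<zeta> * cnj \<zeta>)"
      by simp
    then have "of_real (sinh s) * \<zeta> * cnj (of_real (sinh t) * \<zeta>) = complex_of_real (sinh s * sinh t)"
      using \<zeta> by simp
    then have 1: "of_real (sinh s) * \<zeta> * cnj (of_real (sinh t) * \<zeta>) = complex_of_real (sinh s * sinh t)" .
    show "(su_mat (of_real (cosh (s + t))) (of_real (sinh (s + t)) * \<zeta>), 0, 0)
      = (su_mat (of_real (cosh s)) (of_real (sinh s) * \<zeta>), 0, 0) \<otimes>\<^bsub>jacobi_group\<^esub> (su_mat (of_real (cosh t)) (of_real (sinh t) * \<zeta>), 0, 0)"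
      unfolding jacobi_mult[OF su_pair_boost[OF \<zeta>]] 1 by (simp add: cosh_add sinh_add su_mat_eq_iff algebra_simps)
  qed (auto simp: su_pair_boost[OF \<zeta>])
qed

section \<open>Lowest weight representations\<close>

text \<open>The products are the coefficients of the binomial series of (1 - s)^(-p), whose radius
  of convergence is 1; the ratio test gives convergence and hence bounded terms.\<close>

lemma mult_powers_bounded:
  fixes p s :: real
  assumes p: "p > 0" and s: "0 < s" "s < 1"
  shows "\<exists>C. \<forall>n. (\<Prod>i<n. (p + real i) / (real i + 1)) * s ^ n \<le> C"
proof -
  define f where "f = (\<lambda>n. (\<Prod>i<n. (p + real i) / (real i + 1)) * s ^ n)"
  define c where "c = (1 + s) / 2"
  have c: "c < 1" "s < c"
    using s by (simp_all add: c_def)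
  \<comment> \<open>From this index on the ratio (p + n) s / (n + 1) of successive terms is at most
    c.\<close>
  obtain N :: nat where N: "p * s / (c - s) < real N"
    using reals_Archimedean2 by blast
  have pos: "0 < f n" for n
    using p s by (auto simp: f_def intro!: mult_pos_pos prod_pos divide_pos_pos)
  have "summable f"
  proof (rule summable_ratio_test[OF c(1)])
    fix n assume n: "N \<le> n"
    have "p * s < real N * (c - s)"
      using N c by (simp add: pos_divide_less_eq)
    also have "\<dots> \<le> real n * (c - s)"
      using n c by (intro mult_right_mono) auto
    finally have "(p + real n) * s \<le> c * (real n + 1)"
      using c s by (simp add: algebra_simps)
    then have "(p + real n) / (real n + 1) * s \<le> c"
      by (simp add: field_simps)
    then have "f n * ((p + real n) / (real n + 1) * s) \<le> f n * c"
      using pos[of n] by (intro mult_left_mono) auto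
    then show "norm (f (Suc n)) \<le> c * norm (f n)"
      using pos[of n] pos[of "Suc n"] by (simp add: f_def ac_simps)
  qed
  then have "f \<longlonglongrightarrow> 0"
    by (rule summable_LIMSEQ_zero)
  then obtain K where "\<And>n. norm (f n) \<le> K"
    using convergent_imp_Bseq[OF convergentI] BseqE by metis
  then have "f n \<le> K" for n
    using abs_le_D1 by (metis real_norm_def)
  then show ?thesis
    unfolding f_def by blast
qed

context jacobi_lowest_weight_rep
begin

abbreviation "sm \<equiv> smooth_vectors"

lemma rep_axioms: "continuous_unitary_rep scale V ip jacobi_group rep"
  by unfold_locales

lemma smV [simp]: "v \<in> sm \<Longrightarrow> v \<in> V"
  by (rule smooth_in_V)

lemma sm_closed [simp]:
  "u \<in> sm \<Longrightarrow> v \<in> sm \<Longrightarrow> u + v \<in> sm" "v \<in> sm \<Longrightarrow> scale c v \<in> sm"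
  "u \<in> sm \<Longrightarrow> v \<in> sm \<Longrightarrow> u - v \<in> sm"
  by (simp_all add: smooth_add smooth_scale smooth_diff)

lemma one_parameter_D: "one_parameter_subgroup (orbit_D \<alpha>)"
  and one_parameter_rot: "one_parameter_subgroup (orbit_S \<theta> 0)"
  and one_parameter_boost: "\<zeta> * cnj \<zeta> = 1 \<Longrightarrow> one_parameter_subgroup (orbit_S 0 \<zeta>)"
  by (rule jacobi_one_parameter[OF rep_axioms]; assumption?)+

lemma D_deriv: "v \<in> sm \<Longrightarrow> rep_deriv (orbit_D \<alpha>) v (scale \<alpha> (A' v) - scale (cnj \<alpha>) (A v))"
  unfolding orbit_D_def by (rule deriv_D)

lemma S_deriv: "v \<in> sm \<Longrightarrow> rep_deriv (orbit_S \<theta> \<zeta>) v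
    (scale (2 * \<i> * of_real \<theta>) (K0 v) + scale \<zeta> (Kp v) - scale (cnj \<zeta>) (Km v))"
  unfolding orbit_S_def by (rule deriv_S)

text \<open>Derivatives in the directions 1 and i show a difference and i times a sum; each of the
  two operators is a complex combination of these.\<close>

lemma smooth_components:
  assumes "p - q \<in> sm" "scale \<i> p + scale \<i> q \<in> sm"
  shows "p \<in> sm" "q \<in> sm"
proof -
  have e: "scale (- \<i>) (scale \<i> p + scale \<i> q) = p + q"
    by (simp add: scale_right_distrib)
  have pq: "p + q \<in> sm"
    using sm_closed(2)[OF assms(2), of "- \<i>"] unfolding e .
  have "scale (1 / 2) ((p + q) + (p - q)) = scale (1 / 2) (scale 2 p)"
    by (simp add: scale_left_distrib[of 1 1, simplified])
  then have "p = scale (1 / 2) ((p + q) + (p - q))"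
    by simp
  then show p: "p \<in> sm"
    using sm_closed(2)[OF sm_closed(1)[OF pq assms(1)], of "1 / 2"] by simp
  have "q = p - (p - q)"
    by simp
  then show "q \<in> sm"
    using sm_closed(3)[OF p assms(1)] by simp
qed

lemma A_sm [simp]: "v \<in> sm \<Longrightarrow> A v \<in> sm" and A'_sm [simp]: "v \<in> sm \<Longrightarrow> A' v \<in> sm"
proof -
  assume v: "v \<in> sm"
  have "A' v - A v \<in> sm"
    using smooth_derivative[OF v one_parameter_D D_deriv[OF v, of 1]] by simp
  moreover have "scale \<i> (A' v) + scale \<i> (A v) \<in> sm"
    using smooth_derivative[OF v one_parameter_D D_deriv[OF v, of \<i>]] by simp
  ultimately show "A v \<in> sm" "A' v \<in> sm"
    using smooth_components by blast+
qed

lemma Kp_sm [simp]: "v \<in> sm \<Longrightarrow> Kp v \<in> sm" and Km_sm [simp]: "v \<in> sm \<Longrightarrow> Km v \<in> sm"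
proof -
  assume v: "v \<in> sm"
  have "Kp v - Km v \<in> sm"
    using smooth_derivative[OF v one_parameter_boost S_deriv[OF v, of 0 1]] by simp
  moreover have "scale \<i> (Kp v) + scale \<i> (Km v) \<in> sm"
    using smooth_derivative[OF v one_parameter_boost S_deriv[OF v, of 0 \<i>]] by simp
  ultimately show "Kp v \<in> sm" "Km v \<in> sm"
    using smooth_components by blast+
qed

lemma K0_sm [simp]: "v \<in> sm \<Longrightarrow> K0 v \<in> sm"
proof -
  assume v: "v \<in> sm"
  have "scale (2 * \<i>) (K0 v) \<in> sm"
    using smooth_derivative[OF v one_parameter_rot S_deriv[OF v, of 1 0]] by simp
  then have "scale (1 / (2 * \<i>)) (scale (2 * \<i>) (K0 v)) \<in> sm"
    by (rule sm_closed)
  then show "K0 v \<in> sm"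
    by simp
qed

text \<open>An operator with an adjoint on \<open>sm\<close> is linear there: the defect of
  linearity lies in \<open>sm\<close> and is orthogonal to all of \<open>sm\<close>, hence to
  itself.\<close>

lemma adjoint_linear:
  assumes T: "\<And>v. v \<in> sm \<Longrightarrow> T v \<in> sm" and T': "\<And>v. v \<in> sm \<Longrightarrow> T' v \<in> sm"
    and adj: "\<And>u v. u \<in> sm \<Longrightarrow> v \<in> sm \<Longrightarrow> ip (T u) v = ip u (T' v)"
    and uv: "u \<in> sm" "v \<in> sm"
  shows "T (u + v) = T u + T v" "T (scale c u) = scale c (T u)"
proof -
  have zero: "w = 0" if "w \<in> sm" "ip w w = 0" for w
    using that ip_pos[of w] by fastforce
  have "ip (T (u + v) - (T u + T v)) y = 0" if y: "y \<in> sm" for y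
    using uv y T T' by (simp add: ip_diff_left ip_add_left adj)
  then have "T (u + v) - (T u + T v) = 0"
    using uv T by (intro zero) auto
  then show "T (u + v) = T u + T v"
    by simp
  have "ip (T (scale c u) - scale c (T u)) y = 0" if y: "y \<in> sm" for y
    using uv y T T' by (simp add: ip_diff_left ip_scale_left adj)
  then have "T (scale c u) - scale c (T u) = 0"
    using uv T by (intro zero) auto
  then show "T (scale c u) = scale c (T u)"
    by simp
qed

lemma adj_A': "u \<in> sm \<Longrightarrow> v \<in> sm \<Longrightarrow> ip (A u) v = ip u (A' v)"
  by (metis adj_A ip_commute smV A_sm A'_sm)

lemma adj_Km: "u \<in> sm \<Longrightarrow> v \<in> sm \<Longrightarrow> ip (Km u) v = ip u (Kp v)"
  by (metis adj_K ip_commute smV Km_sm Kp_sm)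

lemma linear_add:
  assumes "u \<in> sm" "v \<in> sm"
  shows "A (u + v) = A u + A v" "A' (u + v) = A' u + A' v" "Kp (u + v) = Kp u + Kp v"
    "Km (u + v) = Km u + Km v" "K0 (u + v) = K0 u + K0 v"
proof -
  show "A (u + v) = A u + A v"
    by (rule adjoint_linear(1)[of A A', OF A_sm A'_sm adj_A' assms])
  show "A' (u + v) = A' u + A' v"
    by (rule adjoint_linear(1)[of A' A, OF A'_sm A_sm adj_A assms])
  show "Kp (u + v) = Kp u + Kp v"
    by (rule adjoint_linear(1)[of Kp Km, OF Kp_sm Km_sm adj_K assms])
  show "Km (u + v) = Km u + Km v"
    by (rule adjoint_linear(1)[of Km Kp, OF Km_sm Kp_sm adj_Km assms])
  show "K0 (u + v) = K0 u + K0 v"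
    by (rule adjoint_linear(1)[of K0 K0, OF K0_sm K0_sm adj_K0 assms])
qed

lemma linear_scale:
  assumes "u \<in> sm"
  shows "A (scale c u) = scale c (A u)" "A' (scale c u) = scale c (A' u)" "Kp (scale c u) = scale c (Kp u)"
    "Km (scale c u) = scale c (Km u)" "K0 (scale c u) = scale c (K0 u)"
proof -
  show "A (scale c u) = scale c (A u)"
    by (rule adjoint_linear(2)[of A A', OF A_sm A'_sm adj_A' assms assms])
  show "A' (scale c u) = scale c (A' u)"
    by (rule adjoint_linear(2)[of A' A, OF A'_sm A_sm adj_A assms assms])
  show "Kp (scale c u) = scale c (Kp u)"
    by (rule adjoint_linear(2)[of Kp Km, OF Kp_sm Km_sm adj_K assms assms])
  show "Km (scale c u) = scale c (Km u)"
    by (rule adjoint_linear(2)[of Km Kp, OF Km_sm Kp_sm adj_Km assms assms])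
  show "K0 (scale c u) = scale c (K0 u)"
    by (rule adjoint_linear(2)[of K0 K0, OF K0_sm K0_sm adj_K0 assms assms])
qed

lemmas linear_ops = linear_add linear_scale

lemma zero_sm [simp]: "0 \<in> sm"
  using sm_closed(2)[OF e0_smooth, of 0] by simp

lemma ops_zero: "A 0 = 0" "A' 0 = 0" "Kp 0 = 0" "Km 0 = 0" "K0 0 = 0"
  using linear_scale[OF e0_smooth, of 0] by simp_all

text \<open>\<open>(a\<^sup>+)\<^sup>m K\<^sub>+\<^sup>n e\<^sub>0 / (m! n!)\<close> is the coefficient of \<open>z\<^sup>m w\<^sup>n\<close> in the coherent vector.\<close>

fun ladder :: "nat \<Rightarrow> nat \<Rightarrow> 'v" where
  "ladder 0 0 = e0"
| "ladder 0 (Suc n) = scale (1 / of_nat (Suc n)) (Kp (ladder 0 n))"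
| "ladder (Suc m) n = scale (1 / of_nat (Suc m)) (A' (ladder m n))"

lemma ladder_sm [simp]: "ladder m n \<in> sm"
  by (induction m n rule: ladder.induct) (simp_all add: e0_smooth)

lemma nat_cancel: "(1 + of_nat m :: complex) \<noteq> 0"
  by (metis of_nat_Suc of_nat_neq_0)

lemma A'_ladder: "A' (ladder m n) = scale (of_nat (Suc m)) (ladder (Suc m) n)"
  using nat_cancel[of m] by simp

lemma Kp_ladder: "Kp (ladder m n) = scale (of_nat (Suc n)) (ladder m (Suc n))"
proof (induction m)
  case 0
  show ?case
    using nat_cancel[of n] by simp
next
  case (Suc m)
  have "Kp (A' (ladder m n)) = A' (Kp (ladder m n))"
    using comm_Kp_A'[OF ladder_sm, of m n] by simp
  then show ?case
    using Suc by (simp add: linear_ops mult.commute del: ladder.simps(2) add: ladder.simps(3))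
qed

text \<open>Ladder vectors with a lowered index, extended by 0 at the boundary, so that the formulas
  below hold for all indices; on coefficients they become \<open>shift1\<close> and
  \<open>shift2\<close>.\<close>

definition up1 :: "nat \<Rightarrow> nat \<Rightarrow> 'v" where
  "up1 m n = (case m of 0 \<Rightarrow> 0 | Suc i \<Rightarrow> ladder i n)"

definition up2 :: "nat \<Rightarrow> nat \<Rightarrow> 'v" where
  "up2 m n = (case n of 0 \<Rightarrow> 0 | Suc j \<Rightarrow> ladder m j)"

lemma up_sm [simp]: "up1 m n \<in> sm" "up2 m n \<in> sm"
  by (simp_all add: up1_def up2_def split: nat.split)

lemma A'_up1: "A' (up1 m n) = scale (of_nat m) (ladder m n)"
  by (cases m) (simp_all add: up1_def ops_zero A'_ladder del: ladder.simps)

lemma A'_up2: "A' (up2 m n) = scale (of_nat (Suc m)) (up2 (Suc m) n)"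
  by (cases n) (simp_all add: up2_def ops_zero A'_ladder del: ladder.simps)

lemma Kp_up2: "Kp (up2 m n) = scale (of_nat n) (ladder m n)"
  by (cases n) (simp_all add: up2_def ops_zero Kp_ladder del: ladder.simps)

text \<open>The operator a either removes a factor of (a^+)^m, by [a, a^+] = 1, or turns a K_+ into
  an a^+, by [a, K_+] = a^+.\<close>

lemma A_ladder: "A (ladder m n) = up1 m n + scale (of_nat (Suc m)) (up2 (Suc m) n)"
proof (induction m)
  case 0
  show ?case
  proof (induction n)
    case 0
    then show ?case
      by (simp add: A_e0 up1_def up2_def)
  next
    case (Suc n)
    have "A (Kp (ladder 0 n)) = Kp (A (ladder 0 n)) + A' (ladder 0 n)"
      using comm_A_Kp[OF ladder_sm, of 0 n] by (simp add: algebra_simps)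
    also have "A (ladder 0 n) = up2 1 n"
      using Suc by (simp add: up1_def)
    also have "Kp (up2 1 n) + A' (ladder 0 n) = scale (of_nat (Suc n)) (ladder 1 n)"
      unfolding Kp_up2 A'_ladder by (simp add: scale_left_distrib add.commute del: ladder.simps)
    finally show ?case
      using nat_cancel[of n] by (simp add: linear_ops up1_def up2_def)
  qed
next
  case (Suc m)
  have "A (A' (ladder m n)) = A' (A (ladder m n)) + ladder m n"
    using comm_A_A'[OF ladder_sm, of m n] by (simp add: algebra_simps)
  also have "A' (A (ladder m n)) = scale (of_nat m) (ladder m n) + scale (of_nat (Suc m) * of_nat (Suc (Suc m))) (up2 (Suc (Suc m)) n)"
    unfolding Suc by (simp add: linear_ops A'_up1 A'_up2 del: ladder.simps)
  also have "scale (of_nat m) (ladder m n) + scale (of_nat (Suc m) * of_nat (Suc (Suc m))) (up2 (Suc (Suc m)) n) + ladder m n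
      = scale (of_nat (Suc m)) (ladder m n + scale (of_nat (Suc (Suc m))) (up2 (Suc (Suc m)) n))"
  proof -
    have "scale (of_nat (Suc m)) (ladder m n) = scale (of_nat m) (ladder m n) + ladder m n"
      by (simp add: scale_left_distrib add.commute del: ladder.simps)
    then show ?thesis
      unfolding scale_right_distrib scale_scale by (simp only: ac_simps)
  qed
  finally have "A (A' (ladder m n)) = scale (of_nat (Suc m)) (ladder m n + scale (of_nat (Suc (Suc m))) (up2 (Suc (Suc m)) n))" .
  then show ?case
    using nat_cancel[of m] by (simp add: linear_ops up1_def del: ladder.simps(1,2))
qed

text \<open>Each a^+ raises the weight by 1/2 and each K_+ by 1.\<close>

lemma K0_ladder: "K0 (ladder m n) = scale (of_real k + of_nat m / 2 + of_nat n) (ladder m n)"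
proof (induction m)
  case 0
  show ?case
  proof (induction n)
    case 0
    then show ?case
      by (simp add: K0_e0)
  next
    case (Suc n)
    have "K0 (Kp (ladder 0 n)) = Kp (K0 (ladder 0 n)) + Kp (ladder 0 n)"
      using comm_K0_Kp[OF ladder_sm, of 0 n] by (simp add: algebra_simps)
    also have "\<dots> = scale (of_real k + of_nat n + 1) (Kp (ladder 0 n))"
      using Suc by (simp add: linear_ops scale_left_distrib)
    finally show ?case
      by (simp add: linear_ops mult.commute add.commute)
  qed
next
  case (Suc m)
  have "K0 (A' (ladder m n)) = A' (K0 (ladder m n)) + scale (1 / 2) (A' (ladder m n))"
    using comm_K0_A'[OF ladder_sm, of m n] by (simp add: algebra_simps)
  also have "\<dots> = scale (of_real k + of_nat m / 2 + of_nat n + 1 / 2) (A' (ladder m n))"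
    unfolding Suc by (simp add: linear_ops scale_left_distrib del: ladder.simps)
  also have "of_real k + of_nat m / 2 + of_nat n + 1 / 2 = (of_real k + of_nat (Suc m) / 2 + of_nat n :: complex)"
    by (simp add: add_divide_distrib)
  finally show ?case
    by (simp add: linear_ops mult.commute del: ladder.simps(1,2))
qed

definition upp :: "nat \<Rightarrow> nat \<Rightarrow> 'v" where
  "upp m n = (case m of 0 \<Rightarrow> 0 | Suc i \<Rightarrow> up1 i n)"

lemma upp_sm [simp]: "upp m n \<in> sm"
  by (simp add: upp_def split: nat.split)

lemma A'_upp: "A' (upp m n) = scale (of_nat m - 1) (up1 m n)"
  by (cases m) (simp_all add: upp_def ops_zero A'_up1 up1_def[of 0] del: ladder.simps, simp add: up1_def)

text \<open>On K_+^n \<open>e0\<close> the operator K_- gives the factor 2k + n - 1 of the discrete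
  series. Moving K_- past (a^+)^m leaves m (a^+)^(m-1) a, which contributes the summand m, and m (m
  - 1) / 2 times (a^+)^(m-2), which on the normalised vectors is the term with 1/2.\<close>

lemma Km_ladder: "Km (ladder m n) = scale (2 * of_real k + of_nat n - 1 + of_nat m) (up2 m n) + scale (1 / 2) (upp m n)"
proof (induction m)
  case 0
  show ?case
  proof (induction n)
    case 0
    then show ?case
      by (simp add: Km_e0 up2_def upp_def)
  next
    case (Suc n)
    have "Km (Kp (ladder 0 n)) = Kp (Km (ladder 0 n)) + scale 2 (K0 (ladder 0 n))"
      using comm_Km_Kp[OF ladder_sm, of 0 n] by (simp add: algebra_simps)
    also have "Km (ladder 0 n) = scale (2 * of_real k + of_nat n - 1) (up2 0 n)"
      using Suc by (simp add: upp_def)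
    also have "Kp (scale (2 * of_real k + of_nat n - 1) (up2 0 n)) + scale 2 (K0 (ladder 0 n))
       = scale ((2 * of_real k + of_nat n - 1) * of_nat n + 2 * (of_real k + of_nat n)) (ladder 0 n)"
      unfolding linear_scale(3)[OF up_sm(2)] Kp_up2 K0_ladder
      by (simp add: scale_left_distrib scale_right_distrib del: ladder.simps)
    also have "(2 * of_real k + of_nat n - 1) * of_nat n + 2 * (of_real k + of_nat n) = of_nat (Suc n) * (2 * of_real k + of_nat n :: complex)"
      by (simp add: algebra_simps)
    finally show ?case
      using nat_cancel[of n] by (simp add: linear_ops upp_def up2_def)
  qed
next
  case (Suc m)
  define q where "q = 2 * of_real k + of_nat n - 1 + (of_nat m :: complex)"
  have "Km (A' (ladder m n)) = A' (Km (ladder m n)) + A (ladder m n)"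
    using comm_Km_A'[OF ladder_sm, of m n] by (simp add: algebra_simps)
  also have "A' (Km (ladder m n)) = scale (q * of_nat (Suc m)) (up2 (Suc m) n) + scale ((of_nat m - 1) / 2) (up1 m n)"
    unfolding Suc q_def[symmetric] by (simp add: linear_ops A'_up2 A'_upp del: ladder.simps)
  also have "scale (q * of_nat (Suc m)) (up2 (Suc m) n) + scale ((of_nat m - 1) / 2) (up1 m n) + A (ladder m n)
      = scale (of_nat (Suc m) * (q + 1)) (up2 (Suc m) n) + scale (of_nat (Suc m) * (1 / 2)) (up1 m n)"
  proof -
    have "scale (of_nat (Suc m) * (q + 1)) x = scale (q * of_nat (Suc m)) x + scale (of_nat (Suc m)) x" for x
      by (simp only: scale_left_distrib[symmetric]) (simp add: algebra_simps)
    moreover have "scale (of_nat (Suc m) * (1 / 2)) x = scale ((of_nat m - 1) / 2) x + x" for x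
    proof -
      have "scale ((of_nat m - 1) / 2) x + x = scale ((of_nat m - 1) / 2 + 1) x"
        by (simp add: scale_left_distrib)
      also have "(of_nat m - 1) / 2 + 1 = of_nat (Suc m) * (1 / 2 :: complex)"
        by (simp add: field_simps)
      finally show ?thesis ..
    qed
    ultimately show ?thesis
      unfolding A_ladder by (simp only: ac_simps)
  qed
  finally have "Km (ladder (Suc m) n) = scale (1 / of_nat (Suc m)) (scale (of_nat (Suc m) * (q + 1)) (up2 (Suc m) n) + scale (of_nat (Suc m) * (1 / 2)) (up1 m n))"
    by (simp only: ladder.simps linear_scale(4)[OF A'_sm[OF ladder_sm]])
  also have "\<dots> = scale (q + 1) (up2 (Suc m) n) + scale (1 / 2) (up1 m n)"
    using nat_cancel[of m] by (simp add: scale_right_distrib)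
  finally show ?case
    by (simp add: q_def upp_def algebra_simps del: ladder.simps)
qed

lemma A_pow_linear:
  assumes "u \<in> sm" "v \<in> sm"
  shows "(A ^^ N) (u + v) = (A ^^ N) u + (A ^^ N) v \<and> (A ^^ N) (scale c u) = scale c ((A ^^ N) u)
    \<and> (A ^^ N) u \<in> sm \<and> (A ^^ N) v \<in> sm"
  using assms by (induction N) (simp_all add: linear_ops)

lemma A_pow_zero: "(A ^^ N) 0 = 0"
  by (induction N) (simp_all add: ops_zero)

text \<open>If a^+ has degree 1 and K_+ degree 2, then a lowers the degree m + 2n by one.\<close>

lemma A_pow_ladder: "N = m + 2 * n \<Longrightarrow> (A ^^ Suc N) (ladder m n) = 0"
proof (induction N arbitrary: m n)
  case 0
  then show ?case
    by (simp add: A_e0)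
next
  case (Suc N)
  have 1: "(A ^^ Suc N) (up1 m n) = 0"
  proof (cases m)
    case 0
    then show ?thesis
      using A_pow_zero[of "Suc N"] by (simp add: up1_def)
  next
    case (Suc i)
    then show ?thesis
      using Suc.IH[of i n] Suc.prems by (simp add: up1_def)
  qed
  have 2: "(A ^^ Suc N) (up2 (Suc m) n) = 0"
  proof (cases n)
    case 0
    then show ?thesis
      using A_pow_zero[of "Suc N"] by (simp add: up2_def)
  next
    case (Suc j)
    then show ?thesis
      using Suc.IH[of "Suc m" j] Suc.prems by (simp add: up2_def)
  qed
  have "(A ^^ Suc (Suc N)) (ladder m n) = (A ^^ Suc N) (A (ladder m n))"
    by (simp only: funpow_Suc_right o_apply)
  also have "\<dots> = 0"
    unfolding A_ladder using 1 2 A_pow_linear[of "up1 m n" "scale (of_nat (Suc m)) (up2 (Suc m) n)" "Suc N"]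
      A_pow_linear[of "up2 (Suc m) n" "up2 (Suc m) n" "Suc N" "of_nat (Suc m)"] by simp
  finally show ?case .
qed

section \<open>Norms of the ladder vectors\<close>

lemma A'_nrm_eq: "v \<in> sm \<Longrightarrow> (nrm (A' v))\<^sup>2 = (nrm (A v))\<^sup>2 + (nrm v)\<^sup>2"
proof -
  assume v: "v \<in> sm"
  have "ip (A' v) (A' v) = ip v (A (A' v))"
    using v by (simp add: adj_A)
  also have "A (A' v) = A' (A v) + v"
    using comm_A_A'[OF v] by (simp add: algebra_simps)
  also have "ip v (A' (A v) + v) = ip (A v) (A v) + ip v v"
    using v by (simp add: ip_add_right adj_A')
  finally show ?thesis
    using v by (simp add: nrm_sq)
qed

text \<open>On such vectors a^+ a behaves like a number operator with largest eigenvalue N. In the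
  step to N + 1, with u = A v, induction and \<open>A'_nrm_eq\<close> give |a^+ u|^2 <= (N + 1)
  |u|^2, and Cauchy-Schwarz for |u|^2 = (a^+ u, v) does the rest.\<close>

lemma A_nrm_le: "v \<in> sm \<Longrightarrow> (A ^^ Suc N) v = 0 \<Longrightarrow> (nrm (A v))\<^sup>2 \<le> real N * (nrm v)\<^sup>2"
proof (induction N arbitrary: v)
  case 0
  then show ?case
    by simp
next
  case (Suc N)
  define u where "u = A v"
  have u: "u \<in> sm"
    using Suc.prems by (simp add: u_def)
  have "(A ^^ Suc N) u = 0"
    using Suc.prems(2) unfolding u_def funpow_Suc_right[of "Suc N"] o_apply .
  then have "(nrm (A u))\<^sup>2 \<le> real N * (nrm u)\<^sup>2"
    by (rule Suc.IH[OF u])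
  then have a: "(nrm (A' u))\<^sup>2 \<le> real (Suc N) * (nrm u)\<^sup>2"
    using A'_nrm_eq[OF u] by (simp add: distrib_right)
  have "ip u u = ip (A' u) v"
    using Suc.prems u adj_A[OF u, of v] by (simp add: u_def)
  then have "(nrm u)\<^sup>2 = cmod (ip (A' u) v)"
    using ip_self[of u] u by (metis abs_power2 norm_of_real smV)
  also have "\<dots> \<le> nrm (A' u) * nrm v"
    using cauchy_schwarz u Suc.prems by simp
  finally have "((nrm u)\<^sup>2)\<^sup>2 \<le> (nrm (A' u) * nrm v)\<^sup>2"
    by (rule power_mono) simp
  also have "\<dots> \<le> (real (Suc N) * (nrm u)\<^sup>2) * (nrm v)\<^sup>2"
    unfolding power_mult_distrib using a by (rule mult_right_mono) simp
  finally have b: "(nrm u)\<^sup>2 * (nrm u)\<^sup>2 \<le> (nrm u)\<^sup>2 * (real (Suc N) * (nrm v)\<^sup>2)"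
    by (simp add: power2_eq_square ac_simps)
  show ?case
  proof (cases "(nrm u)\<^sup>2 = 0")
    case True
    then show ?thesis
      by (simp add: u_def)
  next
    case False
    then have "(nrm u)\<^sup>2 > 0"
      by simp
    then show ?thesis
      using b by (simp only: mult_le_cancel_left_pos u_def)
  qed
qed

lemma A'_ladder_nrm_le: "(nrm (ladder (Suc m) n))\<^sup>2 \<le> real (m + 2 * n + 1) / (real (Suc m))\<^sup>2 * (nrm (ladder m n))\<^sup>2"
proof -
  have "(nrm (A' (ladder m n)))\<^sup>2 \<le> real (m + 2 * n) * (nrm (ladder m n))\<^sup>2 + (nrm (ladder m n))\<^sup>2"
    using A'_nrm_eq[OF ladder_sm, of m n] A_nrm_le[OF ladder_sm A_pow_ladder[OF refl], of m n] by linarith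
  then have 1: "(nrm (A' (ladder m n)))\<^sup>2 \<le> real (m + 2 * n + 1) * (nrm (ladder m n))\<^sup>2"
    by (simp add: distrib_right)
  have "(nrm (ladder (Suc m) n))\<^sup>2 = (nrm (A' (ladder m n)))\<^sup>2 / (real (Suc m))\<^sup>2"
    by (simp add: nrm_scale norm_divide power_mult_distrib power_divide del: of_nat_Suc ladder.simps(1,2))
  then show ?thesis
    using 1 by (simp add: divide_right_mono)
qed

text \<open>Iterate \<open>A'_ladder_nrm_le\<close>: the product of (2n + i + 1) / (i + 1)^2 over i
  < m is the binomial coefficient divided by m!.\<close>

lemma ladder_nrm_le: "(nrm (ladder m n))\<^sup>2 \<le> real ((2 * n + m) choose m) / fact m * (nrm (ladder 0 n))\<^sup>2"
proof (induction m)
  case (Suc m)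
  have c: "real (Suc m) * real ((2 * n + Suc m) choose (Suc m)) = real (2 * n + m + 1) * real ((2 * n + m) choose m)"
  proof -
    have "real (Suc (2 * n + m)) * real ((2 * n + m) choose m) = real (Suc (2 * n + m) choose Suc m) * real (Suc m)"
      by (simp only: of_nat_mult[symmetric] Suc_times_binomial_eq)
    then show ?thesis
      by (simp add: ac_simps)
  qed
  have "(nrm (ladder (Suc m) n))\<^sup>2 \<le> real (m + 2 * n + 1) / (real (Suc m))\<^sup>2 * (nrm (ladder m n))\<^sup>2"
    by (rule A'_ladder_nrm_le)
  also have "\<dots> \<le> real (m + 2 * n + 1) / (real (Suc m))\<^sup>2 * (real ((2 * n + m) choose m) / fact m * (nrm (ladder 0 n))\<^sup>2)"
    by (intro mult_left_mono Suc) simp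
  also have "\<dots> = (real (2 * n + m + 1) * real ((2 * n + m) choose m)) / ((real (Suc m))\<^sup>2 * fact m) * (nrm (ladder 0 n))\<^sup>2"
    by (simp add: ac_simps)
  also have "\<dots> = real ((2 * n + Suc m) choose (Suc m)) / fact (Suc m) * (nrm (ladder 0 n))\<^sup>2"
    unfolding c[symmetric] by (simp add: power2_eq_square)
  finally show ?case .
qed simp

text \<open>The norms of the discrete series of SU(1,1), the coefficients of (1 - x)^(-2k).\<close>

lemma ladder0_nrm:
  "(nrm (ladder 0 n))\<^sup>2 = (\<Prod>i<n. (2 * k + real i) / (real i + 1))"
proof (induction n)
  case 0
  have "complex_of_real ((nrm e0)\<^sup>2) = 1"
    using ip_self[OF smV[OF e0_smooth]] e0_normalized by simp
  then show ?case
    by (simp only: of_real_eq_1_iff ladder.simps lessThan_0 prod.empty)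
next
  case (Suc n)
  have "ip (ladder 0 (Suc n)) (ladder 0 (Suc n)) = (1 / of_nat (Suc n)) * ip (Kp (ladder 0 n)) (ladder 0 (Suc n))"
    by (subst (1) ladder.simps(2), subst ip_scale_left) (simp_all del: ladder.simps)
  also have "ip (Kp (ladder 0 n)) (ladder 0 (Suc n)) = ip (ladder 0 n) (Km (ladder 0 (Suc n)))"
    by (rule adj_K) simp_all
  also have "Km (ladder 0 (Suc n)) = scale (2 * of_real k + of_nat n) (ladder 0 n)"
    unfolding Km_ladder by (simp add: up2_def upp_def)
  also have "ip (ladder 0 n) (scale (2 * of_real k + of_nat n) (ladder 0 n)) = (2 * of_real k + of_nat n) * of_real ((nrm (ladder 0 n))\<^sup>2)"
    by (simp add: ip_scale_right ip_self del: ladder.simps)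
  finally have "complex_of_real ((nrm (ladder 0 (Suc n)))\<^sup>2) = of_real ((2 * k + real n) / (real n + 1) * (nrm (ladder 0 n))\<^sup>2)"
    by (simp add: ip_self add.commute del: ladder.simps)
  then have "(nrm (ladder 0 (Suc n)))\<^sup>2 = (2 * k + real n) / (real n + 1) * (nrm (ladder 0 n))\<^sup>2"
    by (simp only: of_real_eq_iff)
  then show ?case
    unfolding Suc by simp
qed

text \<open>The binomial coefficient is traded for geometric factors: with q = 1 + \<delta> the
  binomial theorem bounds it by q^(2n + m) / \<delta>^m. The powers with exponent m are swallowed by
  1 / m!, and q < 1 / r keeps s = (q r)^2 below 1, as \<open>mult_powers_bounded\<close>
  demands.\<close>

lemma ladder_bounded:
  assumes k: "k > 0"
  shows "polydisc_bounded (\<lambda>m n. nrm (ladder m n))"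
  unfolding polydisc_bounded_def
proof (intro allI impI)
  fix R r :: real assume Rr: "0 < R" "0 < r" "r < 1"
  define q where "q = (1 / r + 1) / 2"
  define \<delta> where "\<delta> = q - 1"
  have "1 / r > 1"
    using Rr by simp
  then have q: "q > 1" "q < 1 / r"
    by (simp_all add: q_def)
  have \<delta>: "\<delta> > 0" "1 + \<delta> = q"
    using q by (simp_all add: \<delta>_def)
  define s where "s = (q * r)\<^sup>2"
  have qr: "0 < q * r" "q * r < 1"
    using q Rr by (simp_all add: field_simps)
  then have s: "0 < s" "s < 1"
    using q Rr by (simp_all add: s_def power_less_one_iff)
  obtain C where C: "\<And>n. (\<Prod>i<n. (2 * k + real i) / (real i + 1)) * s ^ n \<le> C"
    using mult_powers_bounded[of "2 * k" s] k s by auto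
  define Q where "Q = q * R\<^sup>2 / \<delta>"
  have Q: "Q > 0"
    using q \<delta> Rr by (simp add: Q_def)
  have C0: "C \<ge> 0"
    using C[of 0] by simp
  have "(nrm (ladder m n) * (R ^ m * r ^ n))\<^sup>2 \<le> exp Q * C" for m n
  proof -
    have binom: "real ((2 * n + m) choose m) * \<delta> ^ m \<le> q ^ (2 * n + m)"
    proof -
      have "real ((2 * n + m) choose m) * \<delta> ^ m * 1 ^ (2 * n + m - m) \<le> (\<Sum>i\<le>2 * n + m. real ((2 * n + m) choose i) * \<delta> ^ i * 1 ^ (2 * n + m - i))"
        using \<delta> by (intro member_le_sum) auto
      also have "\<dots> = (\<delta> + 1) ^ (2 * n + m)"
        by (rule binomial_ring[symmetric])
      finally show ?thesis
        using \<delta>(2) by (simp add: add.commute)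
    qed
    have expQ: "Q ^ m / fact m \<le> exp Q"
    proof -
      have "(\<Sum>i\<in>{m}. Q ^ i /\<^sub>R fact i) \<le> (\<Sum>i. Q ^ i /\<^sub>R fact i)"
        by (rule sum_le_suminf[OF summable_exp_generic]) (use Q in auto)
      then show ?thesis
        by (simp add: exp_def field_simps)
    qed
    have "(nrm (ladder m n) * (R ^ m * r ^ n))\<^sup>2 = (nrm (ladder m n))\<^sup>2 * ((R\<^sup>2) ^ m * (r\<^sup>2) ^ n)"
      by (simp add: power_mult_distrib power_mult[symmetric] mult.commute)
    also have "\<dots> \<le> (real ((2 * n + m) choose m) / fact m * (nrm (ladder 0 n))\<^sup>2) * ((R\<^sup>2) ^ m * (r\<^sup>2) ^ n)"
      using ladder_nrm_le Rr by (intro mult_right_mono) auto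
    also have "\<dots> \<le> (q ^ (2 * n + m) / \<delta> ^ m / fact m * (nrm (ladder 0 n))\<^sup>2) * ((R\<^sup>2) ^ m * (r\<^sup>2) ^ n)"
    proof -
      have "real ((2 * n + m) choose m) \<le> q ^ (2 * n + m) / \<delta> ^ m"
        using binom \<delta> by (simp add: pos_le_divide_eq)
      then show ?thesis
        using Rr by (intro mult_right_mono divide_right_mono) auto
    qed
    also have "\<dots> = (Q ^ m / fact m) * ((nrm (ladder 0 n))\<^sup>2 * s ^ n)"
      by (simp add: Q_def s_def power_add power_mult power_mult_distrib power_divide)
    also have "\<dots> \<le> exp Q * C"
      using expQ C[of n] Q s unfolding ladder0_nrm[symmetric] by (intro mult_mono) auto
    finally show ?thesis .
  qed
  then have "nrm (ladder m n) * (R ^ m * r ^ n) \<le> sqrt (exp Q * C)" for m n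
    by (rule real_le_rsqrt)
  then show "\<exists>C. \<forall>m n. nrm (ladder m n) * (R ^ m * r ^ n) \<le> C"
    by blast
qed

end

locale half_lowest_weight = jacobi_lowest_weight_rep scale V ip rep k A A' K0 Kp Km e0
  for scale :: "complex \<Rightarrow> 'v::ab_group_add \<Rightarrow> 'v" and V ip rep k A A' K0 Kp Km e0 +
  fixes d :: nat
  assumes kd: "2 * k = real d" and d: "d \<ge> 2"
begin

lemma k_pos: "k > 0"
  using kd d by simp

lemma weight: "half_integer_weight k d"
  by (rule half_integer_weight.intro[OF kd d])

section \<open>Coherent vectors and the holomorphic functions they define\<close>

definition cterm :: "nat \<Rightarrow> complex \<times> complex \<Rightarrow> 'v" where
  "cterm N x = (\<Sum>m\<le>N. scale (fst x ^ m * snd x ^ (N - m)) (ladder m (N - m)))"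

lemma sum_sm: "(\<And>i. i \<in> I \<Longrightarrow> f i \<in> sm) \<Longrightarrow> sum f I \<in> sm"
  by (induction I rule: infinite_finite_induct) simp_all

lemma cterm_sm [simp]: "cterm N x \<in> sm"
  unfolding cterm_def by (rule sum_sm) simp

lemma additive_sum:
  assumes "\<And>u v. u \<in> sm \<Longrightarrow> v \<in> sm \<Longrightarrow> T (u + v) = T u + T v" "T 0 = 0" "\<And>i. i \<in> I \<Longrightarrow> f i \<in> sm"
  shows "T (sum f I) = (\<Sum>i\<in>I. T (f i))"
  using assms(3)
proof (induction I rule: infinite_finite_induct)
  case (insert i I)
  then have "T (f i + sum f I) = T (f i) + T (sum f I)"
    by (intro assms(1) sum_sm) auto
  with insert show ?case
    by simp
qed (simp_all add: assms(2))

text \<open>In degree N + 1 the operator z a^+ produces the term with index m with weight m, and w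
  K_+ produces it with weight N + 1 - m; together N + 1. This is the recursion of the exponential
  series.\<close>

lemma cterm_step:
  "scale (fst x) (A' (cterm N x)) + scale (snd x) (Kp (cterm N x)) = scale (of_nat (Suc N)) (cterm (Suc N) x)"
proof -
  define g where "g m = scale (fst x ^ m * snd x ^ (Suc N - m)) (ladder m (Suc N - m))" for m
  have "A' (cterm N x) = (\<Sum>m\<le>N. A' (scale (fst x ^ m * snd x ^ (N - m)) (ladder m (N - m))))"
    unfolding cterm_def by (rule additive_sum) (simp_all add: linear_add ops_zero)
  also have "\<dots> = (\<Sum>m\<le>N. scale (fst x ^ m * snd x ^ (N - m) * of_nat (Suc m)) (ladder (Suc m) (N - m)))"
    by (rule sum.cong[OF refl]) (simp add: linear_scale A'_ladder del: ladder.simps of_nat_Suc)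
  finally have "scale (fst x) (A' (cterm N x)) = (\<Sum>m\<le>N. scale (of_nat (Suc m)) (g (Suc m)))"
    by (simp add: scale_sum_right g_def ac_simps del: ladder.simps of_nat_Suc)
  also have "\<dots> = (\<Sum>m\<le>Suc N. scale (of_nat m) (g m))"
    by (subst sum.atMost_Suc_shift) simp
  finally have 1: "scale (fst x) (A' (cterm N x)) = (\<Sum>m\<le>Suc N. scale (of_nat m) (g m))" .
  have "Kp (cterm N x) = (\<Sum>m\<le>N. Kp (scale (fst x ^ m * snd x ^ (N - m)) (ladder m (N - m))))"
    unfolding cterm_def by (rule additive_sum) (simp_all add: linear_add ops_zero)
  also have "\<dots> = (\<Sum>m\<le>N. scale (fst x ^ m * snd x ^ (N - m) * of_nat (Suc (N - m))) (ladder m (Suc (N - m))))"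
    by (rule sum.cong[OF refl]) (simp add: linear_scale Kp_ladder del: ladder.simps of_nat_Suc)
  finally have "scale (snd x) (Kp (cterm N x)) = (\<Sum>m\<le>N. scale (of_nat (Suc N - m)) (g m))"
    by (simp add: scale_sum_right g_def Suc_diff_le ac_simps del: ladder.simps of_nat_Suc)
  also have "\<dots> = (\<Sum>m\<le>Suc N. scale (of_nat (Suc N - m)) (g m))"
    by simp
  finally have 2: "scale (snd x) (Kp (cterm N x)) = (\<Sum>m\<le>Suc N. scale (of_nat (Suc N - m)) (g m))" .
  have "scale (fst x) (A' (cterm N x)) + scale (snd x) (Kp (cterm N x)) = (\<Sum>m\<le>Suc N. scale (of_nat (Suc N)) (g m))"
    unfolding 1 2 sum.distrib[symmetric]
    by (intro sum.cong refl) (simp add: scale_left_distrib[symmetric] of_nat_diff)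
  then show ?thesis
    by (simp only: scale_sum_right cterm_def g_def)
qed

lemma exp_series_cterm:
  "scale (1 / fact N) (((\<lambda>u. scale z (A' u) + scale w (Kp u)) ^^ N) e0) = cterm N (z, w)"
proof (induction N)
  case 0
  show ?case
    by (simp add: cterm_def)
next
  case (Suc N)
  define X where "X = (\<lambda>u. scale z (A' u) + scale w (Kp u))"
  have X: "(X ^^ M) e0 \<in> sm" for M
    by (induction M) (simp_all add: X_def e0_smooth)
  have "(X ^^ N) e0 = scale (fact N) (cterm N (z, w))"
    unfolding Suc[folded X_def, symmetric] by simp
  then have "(X ^^ Suc N) e0 = X (scale (fact N) (cterm N (z, w)))"
    by simp
  also have "\<dots> = scale (fact N) (scale z (A' (cterm N (z, w))) + scale w (Kp (cterm N (z, w))))"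
    by (simp add: X_def linear_scale scale_right_distrib mult.commute)
  also have "\<dots> = scale (fact N * of_nat (Suc N)) (cterm (Suc N) (z, w))"
    using cterm_step[of "(z, w)" N] by (simp del: of_nat_Suc)
  also have "fact N * of_nat (Suc N) = (fact (Suc N) :: complex)"
    by (simp add: mult.commute)
  finally show ?case
    unfolding X_def[symmetric] by (simp del: fact_Suc)
qed

lemma summable_cterm:
  assumes "x \<in> jacobi_disk"
  shows "summable (\<lambda>N. nrm (cterm N x))"
proof -
  obtain Z W where ZW: "0 < Z" "0 < W" "W < 1" and x: "x \<in> ball 0 Z \<times> ball 0 W"
    using disk_polydisc[OF assms] .
  obtain C \<rho> where \<rho>: "0 < \<rho>" "\<rho> < 1"
    and C: "\<And>N. (\<Sum>m\<le>N. nrm (ladder m (N - m)) * (Z ^ m * W ^ (N - m))) \<le> C * (real (Suc N) * \<rho> ^ N)"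
    using polydisc_bounded_diagonal[OF ladder_bounded[OF k_pos] ZW] by metis
  have le: "nrm (cterm N x) \<le> C * (real (Suc N) * \<rho> ^ N)" for N
  proof -
    have "nrm (cterm N x) \<le> (\<Sum>m\<le>N. nrm (scale (fst x ^ m * snd x ^ (N - m)) (ladder m (N - m))))"
      unfolding cterm_def by (rule nrm_sum) simp
    also have "\<dots> \<le> (\<Sum>m\<le>N. nrm (ladder m (N - m)) * (Z ^ m * W ^ (N - m)))"
    proof (rule sum_mono)
      fix m
      have "cmod (fst x) \<le> Z" "cmod (snd x) \<le> W"
        using x by auto
      then have "cmod (fst x) ^ m * cmod (snd x) ^ (N - m) \<le> Z ^ m * W ^ (N - m)"
        using ZW by (intro mult_mono power_mono) auto
      from mult_left_mono[OF this nrm_nonneg[OF smV[OF ladder_sm]]] show "nrm (scale (fst x ^ m * snd x ^ (N - m)) (ladder m (N - m))) \<le> nrm (ladder m (N - m)) * (Z ^ m * W ^ (N - m))"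
        by (simp add: nrm_scale norm_mult norm_power mult.commute del: ladder.simps)
    qed
    also note C
    finally show ?thesis .
  qed
  show ?thesis
    by (rule summable_comparison_test'[OF summable_linear_geometric[OF \<rho>, of C]]) (use le in \<open>simp del: of_nat_Suc\<close>)
qed

definition ev :: "complex \<times> complex \<Rightarrow> 'v" where
  "ev x = (SOME v. limitin (htopology V ip) (\<lambda>N. \<Sum>n<N. cterm n x) v sequentially)"

lemma ev_limit:
  assumes "x \<in> jacobi_disk"
  shows "limitin (htopology V ip) (\<lambda>N. \<Sum>n<N. cterm n x) (ev x) sequentially"
proof -
  obtain v where "limitin (htopology V ip) (\<lambda>N. \<Sum>n<N. cterm n x) v sequentially"
    by (rule summable_imp_limitin[of "\<lambda>n. cterm n x"]) (use summable_cterm[OF assms] in simp_all)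
  then show ?thesis
    unfolding ev_def by (rule someI)
qed

lemma ev_coherent: "x \<in> jacobi_disk \<Longrightarrow> coherent_vector scale V ip A' Kp e0 x (ev x)"
  using ev_limit by (cases x) (simp add: exp_series_cterm del: jacobi_disk_iff)

lemma ev_V [simp]: "x \<in> jacobi_disk \<Longrightarrow> ev x \<in> V"
  using ev_limit limitin_iff by blast

text \<open>Taylor coefficients of x -> (u, e_x), a holomorphic function because the scalar product
  is linear in its second argument.\<close>

definition cf :: "'v \<Rightarrow> nat \<Rightarrow> nat \<Rightarrow> complex" where
  "cf u m n = ip u (ladder m n)"

lemma adm_cf:
  assumes "u \<in> V"
  shows "adm (cf u)"
  by (rule polydisc_bounded_mono[OF ladder_bounded[OF k_pos], of _ "nrm u"])
     (use assms cauchy_schwarz[OF assms smV[OF ladder_sm]] in \<open>simp_all add: cf_def\<close>)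

lemma ip_ev:
  assumes u: "u \<in> V" and x: "x \<in> jacobi_disk"
  shows "ip u (ev x) = dps (cf u) x"
proof -
  have "ip u (cterm N x) = dterm (cf u) N x" for N
  proof -
    have "ip u (cterm N x) = (\<Sum>m\<le>N. ip u (scale (fst x ^ m * snd x ^ (N - m)) (ladder m (N - m))))"
      unfolding cterm_def by (rule ip_sum_right[OF u]) simp
    also have "\<dots> = (\<Sum>m\<le>N. cf u m (N - m) * (fst x ^ m * snd x ^ (N - m)))"
      by (rule sum.cong[OF refl]) (simp add: ip_scale_right[OF u] cf_def mult.commute del: ladder.simps)
    finally show ?thesis
      by (simp only: dterm_def)
  qed
  then have "ip u (\<Sum>n<N. cterm n x) = (\<Sum>n<N. dterm (cf u) n x)" for N
    using u by (simp add: ip_sum_right)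
  then have "(\<lambda>N. \<Sum>n<N. dterm (cf u) n x) \<longlonglongrightarrow> ip u (ev x)"
    using limitin_ip[OF ev_limit[OF x] u] by simp
  moreover have "(\<lambda>N. \<Sum>n<N. dterm (cf u) n x) \<longlonglongrightarrow> dps (cf u) x"
    using dps_sums[OF adm_cf[OF u] x] by (simp add: sums_def)
  ultimately show ?thesis
    by (rule LIMSEQ_unique)
qed

lemma ip_up:
  assumes "u \<in> V"
  shows "ip u (up1 m n) = shift1 (cf u) m n" "ip u (up2 m n) = shift2 (cf u) m n"
    "ip u (upp m n) = shift1 (shift1 (cf u)) m n"
  using assms by (auto simp: up1_def up2_def upp_def shift1_def shift2_def cf_def split: nat.split)

text \<open>On power series \<open>cA\<close>, \<open>cKm\<close> and \<open>cK0\<close> are the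
  operators z + w d/dz, then 2 k w + z^2 / 2 + z w d/dz + w^2 d/dw, and k + (z / 2) d/dz + w d/dw.
  They act on coefficients because that is where the ladder formulas give matrix elements.\<close>

definition cA :: "(nat \<Rightarrow> nat \<Rightarrow> complex) \<Rightarrow> nat \<Rightarrow> nat \<Rightarrow> complex" where
  "cA c = (\<lambda>m n. shift1 c m n + shift2 (pd1 c) m n)"

definition cKm :: "(nat \<Rightarrow> nat \<Rightarrow> complex) \<Rightarrow> nat \<Rightarrow> nat \<Rightarrow> complex" where
  "cKm c = (\<lambda>m n. (2 * of_real k * shift2 c m n + shift2 (shift1 (pd1 c)) m n)
     + (shift2 (shift2 (pd2 c)) m n + 1 / 2 * shift1 (shift1 c) m n))"

definition cK0 :: "(nat \<Rightarrow> nat \<Rightarrow> complex) \<Rightarrow> nat \<Rightarrow> nat \<Rightarrow> complex" where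
  "cK0 c = (\<lambda>m n. of_real k * c m n + (1 / 2 * shift1 (pd1 c) m n + shift2 (pd2 c) m n))"

lemma ip_A_ladder: "u \<in> V \<Longrightarrow> ip u (A (ladder m n)) = cA (cf u) m n"
  unfolding A_ladder
  by (simp add: ip_add_right ip_scale_right ip_up cA_def del: of_nat_Suc) (simp add: shift2_def pd1_def split: nat.split)

lemma ip_Km_ladder: "u \<in> V \<Longrightarrow> ip u (Km (ladder m n)) = cKm (cf u) m n"
  unfolding Km_ladder
  by (simp add: ip_add_right ip_scale_right ip_up cKm_def)
     (simp add: shift1_def shift2_def pd1_def pd2_def algebra_simps split: nat.split)

lemma ip_K0_ladder: "u \<in> V \<Longrightarrow> ip u (K0 (ladder m n)) = cK0 (cf u) m n"
  unfolding K0_ladder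
  by (simp add: ip_scale_right cK0_def del: ladder.simps)
     (simp add: shift1_def shift2_def pd1_def pd2_def cf_def algebra_simps del: ladder.simps split: nat.split)

lemma ip_A'_ladder: "u \<in> V \<Longrightarrow> ip u (A' (ladder m n)) = pd1 (cf u) m n"
  unfolding A'_ladder by (simp add: ip_scale_right pd1_def cf_def del: ladder.simps of_nat_Suc)

lemma ip_Kp_ladder: "u \<in> V \<Longrightarrow> ip u (Kp (ladder m n)) = pd2 (cf u) m n"
  unfolding Kp_ladder by (simp add: ip_scale_right pd2_def cf_def del: ladder.simps of_nat_Suc)

lemma dps_cA:
  assumes "adm c" "x \<in> jacobi_disk"
  shows "dps (cA c) x = fst x * dps c x + snd x * dps (pd1 c) x"
  unfolding cA_def using assms by (simp add: dps_add dps_shift1 dps_shift2 adm_shift1 adm_shift2 adm_pd1 del: jacobi_disk_iff)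

lemma dps_cKm:
  assumes "adm c" "x \<in> jacobi_disk"
  shows "dps (cKm c) x = (2 * of_real k * snd x + (fst x)\<^sup>2 / 2) * dps c x
    + fst x * snd x * dps (pd1 c) x + (snd x)\<^sup>2 * dps (pd2 c) x"
  unfolding cKm_def using assms
  by (simp only: dps_add dps_cmult dps_shift1 dps_shift2 adm_shift1 adm_shift2 adm_pd1 adm_pd2 adm_add adm_cmult)
     (simp add: algebra_simps power2_eq_square)

lemma dps_cK0:
  assumes "adm c" "x \<in> jacobi_disk"
  shows "dps (cK0 c) x = of_real k * dps c x + (fst x / 2 * dps (pd1 c) x + snd x * dps (pd2 c) x)"
  unfolding cK0_def using assms
  by (simp only: dps_add dps_cmult dps_shift1 dps_shift2 adm_shift1 adm_shift2 adm_pd1 adm_pd2 adm_add adm_cmult)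
     simp

text \<open>The adjoint moves each operator to the ladder vectors; so a and K_- become the two
  partial derivatives.\<close>

lemma cf_ops:
  assumes "u \<in> sm"
  shows "cf (A u) = pd1 (cf u)" "cf (Km u) = pd2 (cf u)" "cf (A' u) = cA (cf u)"
    "cf (Kp u) = cKm (cf u)" "cf (K0 u) = cK0 (cf u)"
proof -
  note V = smV[OF assms]
  show "cf (A u) = pd1 (cf u)"
    unfolding fun_eq_iff cf_def[of "A u"] adj_A'[OF assms ladder_sm] ip_A'_ladder[OF V] by simp
  show "cf (Km u) = pd2 (cf u)"
    unfolding fun_eq_iff cf_def[of "Km u"] adj_Km[OF assms ladder_sm] ip_Kp_ladder[OF V] by simp
  show "cf (A' u) = cA (cf u)"
    unfolding fun_eq_iff cf_def[of "A' u"] adj_A[OF assms ladder_sm] ip_A_ladder[OF V] by simp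
  show "cf (Kp u) = cKm (cf u)"
    unfolding fun_eq_iff cf_def[of "Kp u"] adj_K[OF assms ladder_sm] ip_Km_ladder[OF V] by simp
  show "cf (K0 u) = cK0 (cf u)"
    unfolding fun_eq_iff cf_def[of "K0 u"] adj_K0[OF assms ladder_sm] ip_K0_ladder[OF V] by simp
qed

lemma ip_ops_ev:
  assumes u: "u \<in> sm" and x: "x \<in> jacobi_disk"
  shows "ip (A u) (ev x) = dps (pd1 (cf u)) x" "ip (Km u) (ev x) = dps (pd2 (cf u)) x"
    "ip (A' u) (ev x) = fst x * dps (cf u) x + snd x * dps (pd1 (cf u)) x"
    "ip (Kp u) (ev x) = (2 * of_real k * snd x + (fst x)\<^sup>2 / 2) * dps (cf u) x
      + fst x * snd x * dps (pd1 (cf u)) x + (snd x)\<^sup>2 * dps (pd2 (cf u)) x"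
    "ip (K0 u) (ev x) = of_real k * dps (cf u) x + (fst x / 2 * dps (pd1 (cf u)) x + snd x * dps (pd2 (cf u)) x)"
  using ip_ev[OF smV[OF A_sm[OF u]] x] ip_ev[OF smV[OF Km_sm[OF u]] x] ip_ev[OF smV[OF A'_sm[OF u]] x]
    ip_ev[OF smV[OF Kp_sm[OF u]] x] ip_ev[OF smV[OF K0_sm[OF u]] x]
  unfolding cf_ops[OF u] dps_cA[OF adm_cf[OF smV[OF u]] x] dps_cKm[OF adm_cf[OF smV[OF u]] x]
    dps_cK0[OF adm_cf[OF smV[OF u]] x] by (simp_all only:)

lemma ip_ev_swap: "u \<in> V \<Longrightarrow> x \<in> jacobi_disk \<Longrightarrow> ip (ev x) u = cnj (ip u (ev x))"
  by (rule ip_commute) simp_all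

text \<open>The coefficients of \<open>x \<mapsto> (e\<^sub>y, e\<^sub>x)\<close> satisfy the recursions that encode
  \<open>(a e\<^sub>y, e\<^sub>x) = (e\<^sub>y, a\<^sup>+ e\<^sub>x)\<close> and \<open>(K\<^sub>- e\<^sub>y, e\<^sub>x) = (e\<^sub>y, K\<^sub>+ e\<^sub>x)\<close>.\<close>

lemma coherent_pd:
  assumes y: "y \<in> jacobi_disk"
  defines "c \<equiv> cf (ev y)"
  shows "pd1 c = (\<lambda>m n. cnj (fst y) * c m n + cnj (snd y) * cA c m n)"
    and "pd2 c = (\<lambda>m n. (2 * of_real k * cnj (snd y) + (cnj (fst y))\<^sup>2 / 2) * c m n
      + (cnj (fst y) * cnj (snd y) * cA c m n + (cnj (snd y))\<^sup>2 * cKm c m n))"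
proof -
  note V = ev_V[OF y]
  have t: "cnj (dps (cf (ladder m n)) y) = c m n" for m n
    unfolding c_def cf_def[of "ev y"] ip_ev_swap[OF smV[OF ladder_sm] y] ip_ev[OF smV[OF ladder_sm] y] ..
  have At: "cnj (dps (pd1 (cf (ladder m n))) y) = cA c m n" for m n
    unfolding c_def ip_A_ladder[OF V, symmetric] ip_ev_swap[OF smV[OF A_sm[OF ladder_sm]] y] ip_ops_ev[OF ladder_sm y] ..
  have Kt: "cnj (dps (pd2 (cf (ladder m n))) y) = cKm c m n" for m n
    unfolding c_def ip_Km_ladder[OF V, symmetric] ip_ev_swap[OF smV[OF Km_sm[OF ladder_sm]] y] ip_ops_ev[OF ladder_sm y] ..
  show "pd1 c = (\<lambda>m n. cnj (fst y) * c m n + cnj (snd y) * cA c m n)"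
  proof (intro ext)
    fix m n
    have "pd1 c m n = cnj (ip (A' (ladder m n)) (ev y))"
      unfolding c_def ip_A'_ladder[OF V, symmetric] by (rule ip_ev_swap[OF smV[OF A'_sm[OF ladder_sm]] y])
    then show "pd1 c m n = cnj (fst y) * c m n + cnj (snd y) * cA c m n"
      unfolding ip_ops_ev[OF ladder_sm y] by (simp add: t At)
  qed
  show "pd2 c = (\<lambda>m n. (2 * of_real k * cnj (snd y) + (cnj (fst y))\<^sup>2 / 2) * c m n
      + (cnj (fst y) * cnj (snd y) * cA c m n + (cnj (snd y))\<^sup>2 * cKm c m n))"
  proof (intro ext)
    fix m n
    have "pd2 c m n = cnj (ip (Kp (ladder m n)) (ev y))"
      unfolding c_def ip_Kp_ladder[OF V, symmetric] by (rule ip_ev_swap[OF smV[OF Kp_sm[OF ladder_sm]] y])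
    then show "pd2 c m n = (2 * of_real k * cnj (snd y) + (cnj (fst y))\<^sup>2 / 2) * c m n
      + (cnj (fst y) * cnj (snd y) * cA c m n + (cnj (snd y))\<^sup>2 * cKm c m n)"
      unfolding ip_ops_ev[OF ladder_sm y] by (simp add: t At Kt)
  qed
qed

lemma adm_cA: "adm c \<Longrightarrow> adm (cA c)"
  unfolding cA_def by (intro adm_add adm_shift1 adm_shift2 adm_pd1)

lemma adm_cKm: "adm c \<Longrightarrow> adm (cKm c)"
  unfolding cKm_def by (intro adm_add adm_cmult adm_shift1 adm_shift2 adm_pd1 adm_pd2)

text \<open>Summed up, the recursions are two linear equations for the partial derivatives E1 and E2
  of E. The first contains E1 alone; in the second E2 carries the factor 1 - s^2, of which 1 + s is
  cancelled at the end since |s| < 1.\<close>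

lemma coherent_pde:
  assumes y: "y \<in> jacobi_disk" and x: "x \<in> jacobi_disk"
  defines "c \<equiv> cf (ev y)" and "s \<equiv> cnj (snd y) * snd x" and "p \<equiv> cnj (fst y) + cnj (snd y) * fst x"
  shows "(1 - s) * dps (pd1 c) x = p * dps c x"
    and "2 * (1 - s)\<^sup>2 * dps (pd2 c) x = (4 * of_real k * cnj (snd y) * (1 - s) + p\<^sup>2) * dps c x"
proof -
  define E E1 E2 where "E = dps c x" and "E1 = dps (pd1 c) x" and "E2 = dps (pd2 c) x"
  have ad: "adm c"
    unfolding c_def by (rule adm_cf[OF ev_V[OF y]])
  have A: "dps (cA c) x = fst x * E + snd x * E1"
    unfolding E_def E1_def by (rule dps_cA[OF ad x])
  have K: "dps (cKm c) x = (2 * of_real k * snd x + (fst x)\<^sup>2 / 2) * E + fst x * snd x * E1 + (snd x)\<^sup>2 * E2"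
    unfolding E_def E1_def E2_def by (rule dps_cKm[OF ad x])
  have e1: "E1 = cnj (fst y) * E + cnj (snd y) * (fst x * E + snd x * E1)"
  proof -
    have "E1 = dps (\<lambda>m n. cnj (fst y) * c m n + cnj (snd y) * cA c m n) x"
      unfolding E1_def c_def coherent_pd(1)[OF y] ..
    then show ?thesis
      using ad x by (simp add: dps_add dps_cmult adm_cmult adm_cA A E_def[symmetric] del: jacobi_disk_iff)
  qed
  have e2: "E2 = (2 * of_real k * cnj (snd y) + (cnj (fst y))\<^sup>2 / 2) * E
      + (cnj (fst y) * cnj (snd y) * (fst x * E + snd x * E1)
      + (cnj (snd y))\<^sup>2 * ((2 * of_real k * snd x + (fst x)\<^sup>2 / 2) * E + fst x * snd x * E1 + (snd x)\<^sup>2 * E2))"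
  proof -
    have "E2 = dps (\<lambda>m n. (2 * of_real k * cnj (snd y) + (cnj (fst y))\<^sup>2 / 2) * c m n
      + (cnj (fst y) * cnj (snd y) * cA c m n + (cnj (snd y))\<^sup>2 * cKm c m n)) x"
      unfolding E2_def c_def coherent_pd(2)[OF y] ..
    then show ?thesis
      using ad x
      by (simp only: dps_add dps_cmult adm_add adm_cmult adm_cA adm_cKm A K E_def[symmetric])
  qed
  have r1: "(1 - s) * E1 = p * E"
    using e1 by (simp add: s_def p_def algebra_simps)
  then show "(1 - s) * dps (pd1 c) x = p * dps c x"
    by (simp only: E_def E1_def)
  have s1: "1 + s \<noteq> 0"
    using one_minus_nonzero[of "- snd x" "snd y"] x y by (cases x, cases y) (simp add: s_def mult.commute)
  have "2 * (1 - s) * (1 + s) * E2 = (4 * of_real k * cnj (snd y) * (1 + s) + p\<^sup>2) * E + 2 * s * p * E1"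
  proof -
    have "2 * (1 - s) * (1 + s) * E2 = 2 * (E2 - (cnj (snd y))\<^sup>2 * ((snd x)\<^sup>2 * E2))"
      by (simp add: s_def algebra_simps power2_eq_square)
    also have "\<dots> = 2 * ((2 * of_real k * cnj (snd y) + (cnj (fst y))\<^sup>2 / 2) * E
      + (cnj (fst y) * cnj (snd y) * (fst x * E + snd x * E1)
      + (cnj (snd y))\<^sup>2 * ((2 * of_real k * snd x + (fst x)\<^sup>2 / 2) * E + fst x * snd x * E1)))"
      by (subst (1) e2) (simp add: algebra_simps)
    also have "\<dots> = (4 * of_real k * cnj (snd y) * (1 + s) + p\<^sup>2) * E + 2 * s * p * E1"
      by (simp add: s_def p_def algebra_simps power2_eq_square)
    finally show ?thesis .
  qed
  note H = this
  \<comment> \<open>Multiplication by 1 - s makes \<open>r1\<close> applicable to the term with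
    E1.\<close>
  have "(1 + s) * (2 * (1 - s)\<^sup>2 * E2) = (1 - s) * (2 * (1 - s) * (1 + s) * E2)"
    by (simp add: power2_eq_square algebra_simps)
  also have "\<dots> = (1 - s) * ((4 * of_real k * cnj (snd y) * (1 + s) + p\<^sup>2) * E) + 2 * s * p * ((1 - s) * E1)"
    unfolding H by (simp add: algebra_simps)
  also have "\<dots> = (1 + s) * ((4 * of_real k * cnj (snd y) * (1 - s) + p\<^sup>2) * E)"
    unfolding r1 by (simp add: power2_eq_square algebra_simps)
  finally show "2 * (1 - s)\<^sup>2 * dps (pd2 c) x = (4 * of_real k * cnj (snd y) * (1 - s) + p\<^sup>2) * dps c x"
    using s1 by (simp only: mult_cancel_left simp_thms E_def E2_def)
qed

section \<open>Scalar products of coherent vectors\<close>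

lemma cf_e0: "cf e0 m n = (if m = 0 \<and> n = 0 then 1 else 0)"
proof -
  have 1: "cf e0 (Suc i) n = 0" for i n
    using adj_A'[OF e0_smooth ladder_sm, of i n] by (simp add: cf_def A_e0 ip_scale_right e0_smooth)
  have 2: "cf e0 0 (Suc j) = 0" for j
    using adj_Km[OF e0_smooth ladder_sm, of 0 j] by (simp add: cf_def Km_e0 ip_scale_right e0_smooth)
  show ?thesis
    using 1 2 e0_normalized by (cases m; cases n) (simp_all add: cf_def)
qed

lemma ip_e0_ev:
  assumes x: "x \<in> jacobi_disk"
  shows "ip e0 (ev x) = 1"
proof -
  have "dterm (cf e0) N x = (if N = 0 then 1 else 0)" for N
  proof -
    have "dterm (cf e0) N x = (\<Sum>m\<le>N. if m = 0 then (if N = 0 then 1 else 0) else 0)"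
      unfolding dterm_def by (intro sum.cong refl) (auto simp: cf_e0)
    then show ?thesis
      by (simp add: sum.delta)
  qed
  then have "dps (cf e0) x = (\<Sum>N. if N = 0 then 1 else 0)"
    by (simp add: dps_def)
  also have "\<dots> = 1"
    using suminf_finite[of "{0}" "\<lambda>N::nat. if N = 0 then 1 else (0::complex)"] by simp
  finally show ?thesis
    using ip_ev[OF smV[OF e0_smooth] x] by simp
qed

lemma dps_zero: "dps c (0, 0) = c 0 0"
proof -
  have "dterm c N (0, 0) = (if N = 0 then c 0 0 else 0)" for N
  proof (cases N)
    case (Suc M)
    have 0: "c m (N - m) * (0 ^ m * 0 ^ (N - m)) = 0" if "m \<in> {..N}" for m
      using Suc that by (cases m) auto
    have "dterm c N (0, 0) = 0"
      unfolding dterm_def fst_conv snd_conv by (intro sum.neutral ballI 0)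
    then show ?thesis
      using Suc by simp
  qed (simp add: dterm_def)
  then show ?thesis
    using suminf_finite[of "{0}" "\<lambda>N::nat. if N = 0 then c 0 0 else (0::complex)"] by (simp add: dps_def)
qed

text \<open>Restriction to the ray t -> (t z, t w) turns the two equations of
  \<open>coherent_pde\<close> into one ordinary differential equation. It says that
  \<open>G\<close>, the quotient of E by the expected kernel, is constant; at t = 0 it is the scalar
  product of e_y with \<open>e0\<close>, which is 1.\<close>

lemma ip_ev_ev:
  assumes y: "y \<in> jacobi_disk" and x: "x \<in> jacobi_disk"
  shows "ip (ev y) (ev x) = jacobi_kernel k x y"
proof -
  obtain z w where xe: "x = (z, w)" and w: "cmod w < 1"
    using x by (cases x) auto
  define c where "c = cf (ev y)"
  define \<eta> where "\<eta> = cnj (fst y)"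
  define \<omega> where "\<omega> = cnj (snd y)"
  have \<omega>: "cmod \<omega> < 1"
    using y by (cases y) (simp add: \<omega>_def)
  have ad: "adm c"
    unfolding c_def by (rule adm_cf[OF ev_V[OF y]])
  define Q where "Q t = (2 * \<eta> * (t * z) + \<omega> * (t * z)\<^sup>2 + \<eta>\<^sup>2 * (t * w)) / (2 * (1 - \<omega> * (t * w)))" for t
  define G where "G t = dps c (t * z, t * w) * (exp (- Q t) * (1 - \<omega> * (t * w)) ^ d)" for t
  have disk: "(t * z, t * w) \<in> jacobi_disk" and nz: "1 - \<omega> * (t * w) \<noteq> 0" if "t \<in> cball 0 1" for t
  proof -
    have tw: "cmod (t * w) < 1"
      using that w mult_mono[of "cmod t" 1 "cmod w" "cmod w"] by (simp add: norm_mult)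
    then show "(t * z, t * w) \<in> jacobi_disk"
      by simp
    show "1 - \<omega> * (t * w) \<noteq> 0"
      using one_minus_nonzero[OF tw, of "cnj \<omega>"] \<omega> by (simp add: mult.commute)
  qed
  have G0: "(G has_field_derivative 0) (at t within cball 0 1)" if t: "t \<in> cball 0 1" for t
  proof -
    define s where "s = \<omega> * (t * w)"
    define p where "p = \<eta> + \<omega> * (t * z)"
    define E E1 E2 where "E = dps c (t * z, t * w)" and "E1 = dps (pd1 c) (t * z, t * w)" and "E2 = dps (pd2 c) (t * z, t * w)"
    have s: "1 - s \<noteq> 0"
      using nz[OF t] by (simp add: s_def)
    have p1: "(1 - s) * E1 = p * E"
      using coherent_pde(1)[OF y disk[OF t]] by (simp add: s_def p_def \<eta>_def \<omega>_def E_def E1_def c_def)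
    have p2: "2 * (1 - s)\<^sup>2 * E2 = (4 * of_real k * \<omega> * (1 - s) + p\<^sup>2) * E"
      using coherent_pde(2)[OF y disk[OF t]] by (simp add: s_def p_def \<eta>_def \<omega>_def E_def E2_def c_def)
    have dE: "((\<lambda>t. dps c (t * z, t * w)) has_field_derivative (E1 * z + E2 * w)) (at t)"
      unfolding E1_def E2_def
      by (rule dps_curve[where \<phi>="\<lambda>t. t * z" and \<psi>="\<lambda>t. t * w", OF ad disk[OF t]])
         (auto intro!: derivative_eq_intros)
    define N where "N = 2 * \<eta> * (t * z) + \<omega> * (t * z)\<^sup>2 + \<eta>\<^sup>2 * (t * w)"
    define N' where "N' = 2 * \<eta> * z + 2 * \<omega> * t * z\<^sup>2 + \<eta>\<^sup>2 * w"
    have dN: "((\<lambda>t. 2 * \<eta> * (t * z) + \<omega> * (t * z)\<^sup>2 + \<eta>\<^sup>2 * (t * w)) has_field_derivative N') (at t)"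
      unfolding N'_def by (auto intro!: derivative_eq_intros simp: power2_eq_square algebra_simps)
    have dM: "((\<lambda>t. 2 * (1 - \<omega> * (t * w))) has_field_derivative (- 2 * \<omega> * w)) (at t)"
      by (auto intro!: derivative_eq_intros)
    define Q' where "Q' = (N' * (2 * (1 - s)) - N * (- 2 * \<omega> * w)) / (2 * (1 - s) * (2 * (1 - s)))"
    have dQ: "(Q has_field_derivative Q') (at t)"
      unfolding Q_def[abs_def] Q'_def s_def N_def by (rule DERIV_divide[OF dN dM]) (use nz[OF t] in simp)
    have dP: "((\<lambda>t. (1 - \<omega> * (t * w)) ^ d) has_field_derivative (of_nat d * (1 - s) ^ (d - 1) * (- \<omega> * w))) (at t)"
      unfolding s_def by (auto intro!: derivative_eq_intros)
    have pw: "(1 - s) ^ d = (1 - s) * (1 - s) ^ (d - 1)"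
      using d by (cases d) auto
    have "(G has_field_derivative (E1 * z + E2 * w) * (exp (- Q t) * (1 - s) ^ d)
        + (exp (- Q t) * (- Q') * (1 - s) ^ d + of_nat d * (1 - s) ^ (d - 1) * (- \<omega> * w) * exp (- Q t)) * E) (at t)"
      unfolding G_def[abs_def]
      using DERIV_mult[OF dE DERIV_mult[OF DERIV_chain2[OF DERIV_exp DERIV_minus[OF dQ]] dP]]
      by (simp add: E_def s_def)
    moreover have "(E1 * z + E2 * w) * (exp (- Q t) * (1 - s) ^ d)
        + (exp (- Q t) * (- Q') * (1 - s) ^ d + of_nat d * (1 - s) ^ (d - 1) * (- \<omega> * w) * exp (- Q t)) * E
      = exp (- Q t) * (1 - s) ^ (d - 1) * ((1 - s) * (E1 * z + E2 * w) - (1 - s) * Q' * E - of_nat d * \<omega> * w * E)"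
      unfolding pw by (simp add: algebra_simps)
    moreover have "(1 - s) * (E1 * z + E2 * w) - (1 - s) * Q' * E - of_nat d * \<omega> * w * E = 0"
    proof -
      have dk: "of_nat d = (2 * of_real k :: complex)"
        using kd by (metis of_real_mult of_real_numeral of_real_of_nat_eq)
      have q: "4 * (1 - s)\<^sup>2 * Q' = 2 * (1 - s) * N' + 2 * N * \<omega> * w"
      proof -
        have "Q' * (2 * (1 - s) * (2 * (1 - s))) = N' * (2 * (1 - s)) - N * (- 2 * \<omega> * w)"
          by (subst nonzero_eq_divide_eq[symmetric]) (use s in \<open>simp_all add: Q'_def\<close>)
        then show ?thesis
          by (simp add: power2_eq_square algebra_simps)
      qed
      have NN: "2 * (1 - s) * N' + 2 * N * \<omega> * w = 4 * (1 - s) * p * z + 2 * p\<^sup>2 * w"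
        unfolding N_def N'_def p_def s_def by (simp add: algebra_simps power2_eq_square)
      \<comment> \<open>The factor 4 (1 - s) clears the denominators, so that the equations for E1,
        E2 and Q' can be substituted as they stand.\<close>
      have "4 * (1 - s) * ((1 - s) * (E1 * z + E2 * w) - (1 - s) * Q' * E - of_nat d * \<omega> * w * E)
        = 4 * (1 - s) * z * ((1 - s) * E1) + 2 * w * (2 * (1 - s)\<^sup>2 * E2) - (4 * (1 - s)\<^sup>2 * Q') * E - 8 * of_real k * (1 - s) * \<omega> * w * E"
        unfolding dk by (simp add: algebra_simps power2_eq_square)
      also have "\<dots> = 0"
        unfolding p1 p2 q NN by (simp add: algebra_simps power2_eq_square)
      finally show ?thesis
        using s by simp
    qed
    ultimately have "(G has_field_derivative 0) (at t)"
      by simp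
    then show ?thesis
      by (rule has_field_derivative_at_within)
  qed
  obtain b where b: "\<And>t. t \<in> cball 0 1 \<Longrightarrow> G t = b"
    using has_field_derivative_zero_constant[OF convex_cball G0] by metis
  have "G 0 = c 0 0"
    by (simp add: G_def Q_def dps_zero)
  also have "c 0 0 = cnj (ip e0 (ev y))"
    unfolding c_def cf_def using ip_ev_swap[OF smV[OF e0_smooth] y] by simp
  also have "\<dots> = 1"
    by (simp add: ip_e0_ev[OF y])
  finally have "G 1 = 1"
    using b[of 0] b[of 1] by simp
  then have "dps c x * (exp (- Q 1) * (1 - \<omega> * w) ^ d) = 1"
    by (simp add: G_def xe)
  then have "dps c x = exp (Q 1) * inverse ((1 - \<omega> * w) ^ d)"
    using nz[of 1] by (simp add: exp_minus field_simps)
  moreover have "jacobi_kernel k x y = inverse ((1 - w * \<omega>) ^ d) * exp ((2 * \<eta> * z + z\<^sup>2 * \<omega> + \<eta>\<^sup>2 * w) / (2 * (1 - w * \<omega>)))"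
    using jacobi_kernel_eq[OF kd w, of "snd y" z "fst y"] \<omega> by (simp add: xe \<eta>_def \<omega>_def)
  ultimately show ?thesis
    using ip_ev[OF ev_V[OF y] x] by (simp add: c_def Q_def ac_simps)
qed

end

lemma cosh_of_real: "cosh (complex_of_real s) = of_real (cosh s)"
  and sinh_of_real: "sinh (complex_of_real s) = of_real (sinh s)"
  by (simp_all add: cosh_def sinh_def scaleR_conv_of_real exp_of_real flip: of_real_minus)

context half_lowest_weight
begin

section \<open>Transport of coherent vectors along one-parameter subgroups\<close>

lemma sm_rep: "h \<in> carrier jacobi_group \<Longrightarrow> u \<in> sm \<Longrightarrow> rep h u \<in> sm"
  by (rule smooth_rep[OF jacobi_one_parameter_conj[OF rep_axioms]])

lemma span_orbit_sm: "span ((\<lambda>h. rep h e0) ` carrier jacobi_group) \<subseteq> sm"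
  by (rule span_minimal) (auto simp: sm_rep e0_smooth intro!: subspaceI)

text \<open>Smooth vectors are dense, since they contain the span of the orbit of the cyclic vector.
  A nonzero vector orthogonal to them would be closer to some smooth \<open>y\<close> than its own
  norm allows.\<close>

lemma sm_total:
  assumes v: "v \<in> V" and 0: "\<And>u. u \<in> sm \<Longrightarrow> ip u v = 0"
  shows "v = 0"
proof (rule ccontr)
  assume "v \<noteq> 0"
  then have pos: "0 < nrm v"
    using nrm_eq_0[OF v] nrm_nonneg[OF v] by fastforce
  have "v \<in> htopology V ip closure_of span ((\<lambda>h. rep h e0) ` carrier jacobi_group)"
    using v by (simp add: e0_cyclic)
  then obtain y where y: "y \<in> sm" "hdist V ip v y < nrm v"
    unfolding Metric_space.metric_closure_of[OF metric] Metric_space.in_mball[OF metric]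
    using pos span_orbit_sm by blast
  have "ip v v = ip (v - y) v"
    using v y by (simp add: ip_diff_left 0)
  then have "(nrm v)\<^sup>2 = cmod (ip (v - y) v)"
    using ip_self[OF v] by (metis abs_of_nonneg norm_of_real zero_le_power2)
  also have "\<dots> \<le> nrm (v - y) * nrm v"
    using v y by (intro cauchy_schwarz) auto
  also have "\<dots> < nrm v * nrm v"
    using pos y v by (intro mult_strict_right_mono) (simp_all add: hdist_nrm)
  finally show False
    by (simp add: power2_eq_square)
qed

lemma nrm_ev: "x \<in> jacobi_disk \<Longrightarrow> nrm (ev x) = sqrt (1 / weight_density k x)"
  by (simp add: nrm_def ip_ev_ev half_integer_weight.kernel_diag[OF weight])

text \<open>Hypothesis \<open>eq\<close> is the infinitesimal covariance. Both slots of \<open>ip\<close> depend on \<open>s\<close>, but the second one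
  need not be differentiable: as its norm stays bounded, weak differentiability suffices.\<close>

lemma flow_derivative:
  assumes \<gamma>: "one_parameter_subgroup \<gamma>" and u: "u \<in> sm" and X: "rep_deriv \<gamma> u X"
    and y: "\<And>s. (Z (of_real s), W (of_real s)) \<in> jacobi_disk"
    and L0: "L 0 = 1"
    and dL: "(L has_field_derivative L') (at 0)" and dZ: "(Z has_field_derivative p) (at 0)"
    and dW: "(W has_field_derivative q) (at 0)"
    and eq: "L' * dps (cf u) (Z 0, W 0) + ip X (ev (Z 0, W 0))
      + dps (pd1 (cf u)) (Z 0, W 0) * p + dps (pd2 (cf u)) (Z 0, W 0) * q = 0"
  shows "((\<lambda>s. L (of_real s) * ip (rep (\<gamma> s) u) (ev (Z (of_real s), W (of_real s)))) has_vector_derivative 0) (at 0)"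
proof -
  define Y where "Y s = (Z (of_real s), W (of_real s))" for s :: real
  define D where "D = dps (pd1 (cf u)) (Z 0, W 0) * p + dps (pd2 (cf u)) (Z 0, W 0) * q"
  have Yd: "Y s \<in> jacobi_disk" for s
    using y by (simp add: Y_def)
  have Y0: "Y 0 = (Z 0, W 0)"
    by (simp add: Y_def)
  have g: "\<gamma> s \<in> carrier jacobi_group" for s
    using \<gamma> by (rule one_parameter_carrier)
  have uV: "u \<in> V" and XV: "X \<in> V" and gV: "rep (\<gamma> s) u - u \<in> V" for s
    using u X g unfolding rep_deriv_def limitin_iff by (auto simp: rep_closed)
  have "((\<lambda>t. dps (cf u) (Z t, W t)) has_field_derivative D) (at 0)"
    unfolding D_def by (rule dps_curve[OF adm_cf[OF uV] _ dZ dW]) (use y[of 0] in simp)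
  from DERIV_mult[OF dL this]
  have "((\<lambda>t. L t * dps (cf u) (Z t, W t)) has_field_derivative (L' * dps (cf u) (Z 0, W 0) + D)) (at (of_real 0))"
    by (simp add: L0)
  from has_vector_derivative_real_field[OF this]
  have 1: "((\<lambda>s. L (of_real s) * ip u (ev (Y s))) has_vector_derivative (L' * dps (cf u) (Z 0, W 0) + D)) (at 0)"
    using ip_ev[OF uV Yd] by (simp add: Y_def)
  have cont: "isCont L 0" "isCont Z 0" "isCont W 0"
    using dL dZ dW DERIV_isCont by blast+
  have "((\<lambda>s. complex_of_real s) \<longlongrightarrow> 0) (at 0)"
    by (rule tendsto_eq_intros) auto
  then have lim: "((\<lambda>s. L (of_real s)) \<longlongrightarrow> 1) (at 0)" "(Y \<longlongrightarrow> Y 0) (at 0)"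
    unfolding Y_def[abs_def]
    using isCont_tendsto_compose[OF cont(1)] isCont_tendsto_compose[OF cont(2)] isCont_tendsto_compose[OF cont(3)]
    by (force simp: L0 intro!: tendsto_Pair)+
  define Q where "Q s = scale (of_real (inverse s)) (rep (\<gamma> s) u - u)" for s
  have QV: "Q s \<in> V" for s
    using gV by (simp add: Q_def)
  have "((\<lambda>s. nrm (Q s - X)) \<longlongrightarrow> 0) (at 0)"
    using X unfolding rep_deriv_def limitin_iff Q_def by blast
  moreover have "((\<lambda>s. nrm (ev (Y s))) \<longlongrightarrow> sqrt (1 / weight_density k (Y 0))) (at 0)"
  proof -
    have "isCont (weight_density k) (Y 0)"
      using half_integer_weight.continuous_weight_density[OF weight] jacobi_disk_open Yd
      by (simp add: continuous_on_eq_continuous_at)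
    from isCont_tendsto_compose[OF this lim(2)] show ?thesis
      unfolding nrm_ev[OF Yd] using weight_density_pos[OF Yd[of 0], of k] by (intro tendsto_intros) auto
  qed
  ultimately have "((\<lambda>s. nrm (Q s - X) * nrm (ev (Y s))) \<longlongrightarrow> 0) (at 0)"
    by (rule tendsto_mult_left_zero[OF _ , THEN tendsto_eq_rhs] tendsto_mult[THEN tendsto_eq_rhs]) simp
  then have "((\<lambda>s. ip (Q s - X) (ev (Y s))) \<longlongrightarrow> 0) (at 0)"
    by (rule Lim_null_comparison[rotated]) (use QV XV Yd in \<open>simp add: cauchy_schwarz\<close>)
  moreover have "((\<lambda>s. ip X (ev (Y s))) \<longlongrightarrow> ip X (ev (Y 0))) (at 0)"
  proof -
    have "isCont (dps (cf X)) (Y 0)"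
      by (rule has_derivative_continuous[OF dps_has_derivative[OF adm_cf[OF XV] Yd]])
    from isCont_tendsto_compose[OF this lim(2)] show ?thesis
      unfolding ip_ev[OF XV Yd] .
  qed
  ultimately have "((\<lambda>s. ip (Q s - X) (ev (Y s)) + ip X (ev (Y s))) \<longlongrightarrow> 0 + ip X (ev (Y 0))) (at 0)"
    by (rule tendsto_add)
  from tendsto_mult[OF lim(1) this]
  have q: "((\<lambda>s. L (of_real s) * ip (Q s) (ev (Y s))) \<longlongrightarrow> ip X (ev (Y 0))) (at 0)"
    using QV XV Yd by (simp add: ip_diff_left)
  \<comment> \<open>The product is split: with \<open>u\<close> fixed it is a power series along a
    curve (\<open>1\<close>), and \<open>R\<close> carries the motion of the group element
    (\<open>2\<close>). Each part is differentiated separately.\<close>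
  define R where "R s = L (of_real s) * ip (rep (\<gamma> s) u - u) (ev (Y s))" for s
  have "\<gamma> 0 \<otimes>\<^bsub>jacobi_group\<^esub> \<gamma> 0 = \<gamma> 0"
    using \<gamma> unfolding one_parameter_subgroup_def by (metis add_0)
  then have "\<gamma> 0 = \<one>\<^bsub>jacobi_group\<^esub>"
    using g by (simp add: l_cancel_one)
  then have R0: "R 0 = 0"
    using uV Yd by (simp add: R_def rep_one)
  have 2: "(R has_vector_derivative ip X (ev (Y 0))) (at 0)"
    unfolding has_vector_derivative_def has_derivative_at
  proof (intro conjI bounded_linear_scaleR_left)
    have "((\<lambda>s. norm (L (of_real s) * ip (Q s) (ev (Y s)) - ip X (ev (Y 0)))) \<longlongrightarrow> 0) (at 0)"
      using q by (simp add: LIM_zero tendsto_norm_zero)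
    moreover have "\<forall>\<^sub>F s in at 0. norm (L (of_real s) * ip (Q s) (ev (Y s)) - ip X (ev (Y 0)))
        = norm (R (0 + s) - R 0 - s *\<^sub>R ip X (ev (Y 0))) / norm s"
    proof (rule eventually_mono[OF eventually_neq_at_within])
      fix s :: real assume s: "s \<noteq> 0"
      have "L (of_real s) * ip (Q s) (ev (Y s)) = of_real (inverse s) * R s"
        using gV Yd by (simp add: Q_def R_def ip_scale_left)
      then have "L (of_real s) * ip (Q s) (ev (Y s)) - ip X (ev (Y 0)) = (R s - s *\<^sub>R ip X (ev (Y 0))) / of_real s"
        using s by (simp add: scaleR_conv_of_real field_simps)
      then show "norm (L (of_real s) * ip (Q s) (ev (Y s)) - ip X (ev (Y 0)))
        = norm (R (0 + s) - R 0 - s *\<^sub>R ip X (ev (Y 0))) / norm s"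
        by (simp add: R0 norm_divide)
    qed
    ultimately show "((\<lambda>s. norm (R (0 + s) - R 0 - s *\<^sub>R ip X (ev (Y 0))) / norm s) \<longlongrightarrow> 0) (at 0)"
      by (rule Lim_transform_eventually)
  qed
  have "L (of_real s) * ip u (ev (Y s)) + R s = L (of_real s) * ip (rep (\<gamma> s) u) (ev (Y s))" for s
    using rep_closed[OF g uV] uV Yd by (simp add: R_def ip_diff_left algebra_simps)
  then show ?thesis
    using has_vector_derivative_add[OF 1 2] eq by (simp add: D_def Y0 Y_def[symmetric] algebra_simps)
qed

definition covariant :: "jacobi \<Rightarrow> bool" where
  "covariant h \<longleftrightarrow> (\<forall>x\<in>jacobi_disk. rep h (ev x) = scale (inverse (jacobi_cocycle k h x)) (ev (jacobi_act h x)))"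

text \<open>By the group law and the cocycle identity a derivative at s = t is one at s = 0, for the
  smooth vector \<open>rep (\<gamma> t) v\<close> and the point \<gamma>(t).x. So the pairing is
  constant in s, and \<open>sm_total\<close> turns this weak equation into one between
  vectors.\<close>

lemma flow_covariant:
  assumes \<gamma>: "one_parameter_subgroup \<gamma>" and X: "\<And>u. u \<in> sm \<Longrightarrow> rep_deriv \<gamma> u (X u)"
    and J: "\<And>y s. y \<in> jacobi_disk \<Longrightarrow> inverse (jacobi_cocycle k (\<gamma> s) y) = L y (of_real s)"
    and act: "\<And>y s. y \<in> jacobi_disk \<Longrightarrow> jacobi_act (\<gamma> s) y = (Z y (of_real s), W y (of_real s))"
    and dL: "\<And>y. y \<in> jacobi_disk \<Longrightarrow> (L y has_field_derivative L' y) (at 0)"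
    and dZ: "\<And>y. y \<in> jacobi_disk \<Longrightarrow> (Z y has_field_derivative p y) (at 0)"
    and dW: "\<And>y. y \<in> jacobi_disk \<Longrightarrow> (W y has_field_derivative q y) (at 0)"
    and eq: "\<And>u y. u \<in> sm \<Longrightarrow> y \<in> jacobi_disk \<Longrightarrow> L' y * dps (cf u) y + ip (X u) (ev y)
      + dps (pd1 (cf u)) y * p y + dps (pd2 (cf u)) y * q y = 0"
  shows "covariant (\<gamma> s)"
  unfolding covariant_def
proof
  fix x assume x: "x \<in> jacobi_disk"
  have g: "\<gamma> s \<in> carrier jacobi_group" for s
    using \<gamma> by (rule one_parameter_carrier)
  have ga: "jacobi_act (\<gamma> s) y \<in> jacobi_disk" if "y \<in> jacobi_disk" for s y
    by (rule jacobi_act_in_disk[OF g that])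
  have add: "\<gamma> (s + t) = \<gamma> s \<otimes>\<^bsub>jacobi_group\<^esub> \<gamma> t" for s t
    using \<gamma> unfolding one_parameter_subgroup_def by blast
  have "\<gamma> 0 \<otimes>\<^bsub>jacobi_group\<^esub> \<gamma> 0 = \<gamma> 0"
    using add[of 0 0] by simp
  then have one: "\<gamma> 0 = \<one>\<^bsub>jacobi_group\<^esub>"
    using g by (simp add: l_cancel_one)
  have act0: "jacobi_act (\<gamma> 0) y = y" and J0: "jacobi_cocycle k (\<gamma> 0) y = 1" if "y \<in> jacobi_disk" for y
    unfolding one jacobi_one using that
    by (cases y; simp add: jacobi_act_su_mat su_den_def jacobi_cocycle_eq[OF kd] su_pair_def jacobi_mult_factor_def)+
  define G where "G v s = inverse (jacobi_cocycle k (\<gamma> s) x) * ip (rep (\<gamma> s) v) (ev (jacobi_act (\<gamma> s) x))" for v s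
  have const: "G v s = ip v (ev x)" if v: "v \<in> sm" for v s
  proof -
    have "(G v has_vector_derivative 0) (at t)" for t
    proof -
      define y where "y = jacobi_act (\<gamma> t) x"
      define u where "u = rep (\<gamma> t) v"
      have y: "y \<in> jacobi_disk" and u: "u \<in> sm"
        unfolding y_def u_def using ga[OF x] sm_rep[OF g v] by auto
      have Y: "(Z y (of_real s), W y (of_real s)) \<in> jacobi_disk" for s
        unfolding act[OF y, symmetric] by (rule ga[OF y])
      have Y0: "(Z y 0, W y 0) = y"
        using act0[OF y] act[OF y, of 0] by simp
      have L0: "L y 0 = 1"
        using J0[OF y] J[OF y, of 0] by simp
      have "((\<lambda>s. L y (of_real s) * ip (rep (\<gamma> s) u) (ev (Z y (of_real s), W y (of_real s)))) has_vector_derivative 0) (at 0)"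
        by (rule flow_derivative[OF \<gamma> u X[OF u] Y L0 dL[OF y] dZ[OF y] dW[OF y]]) (unfold Y0, rule eq[OF u y])
      then have "((\<lambda>s. inverse (jacobi_cocycle k (\<gamma> t) x) * (L y (of_real s) * ip (rep (\<gamma> s) u) (ev (Z y (of_real s), W y (of_real s)))))
          has_vector_derivative inverse (jacobi_cocycle k (\<gamma> t) x) * 0) (at 0)"
        by (rule has_vector_derivative_mult_right)
      moreover have "inverse (jacobi_cocycle k (\<gamma> t) x) * (L y (of_real s) * ip (rep (\<gamma> s) u) (ev (Z y (of_real s), W y (of_real s)))) = G v (t + s)" for s
        unfolding G_def add.commute[of t s] add jacobi_cocycle_mult[OF kd g g x] jacobi_act_mult[OF g g x]
          rep_mult[OF g g smV[OF v]] y_def[symmetric] u_def[symmetric] J[OF y, symmetric] act[OF y, symmetric] by simp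
      ultimately have "((\<lambda>s. G v (t + s)) has_vector_derivative 0) (at 0)"
        by simp
      then show ?thesis
        unfolding has_vector_derivative_def has_derivative_at by simp
    qed
    then obtain c where "\<And>s. G v s = c"
      using has_vector_derivative_zero_constant[of UNIV "G v"] by auto
    then have "G v s = G v 0"
      by simp
    then show ?thesis
      using J0[OF x] act0[OF x] one v by (simp add: G_def rep_one)
  qed
  define y where "y = jacobi_act (\<gamma> s) x"
  define c where "c = inverse (jacobi_cocycle k (\<gamma> s) x)"
  have y: "y \<in> jacobi_disk"
    unfolding y_def by (rule ga[OF x])
  have V: "rep (\<gamma> s) (ev x) \<in> V"
    by (rule rep_closed[OF g ev_V[OF x]])
  have "scale c (ev y) - rep (\<gamma> s) (ev x) = 0"
  proof (rule sm_total)
    show "scale c (ev y) - rep (\<gamma> s) (ev x) \<in> V"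
      using y V by simp
    fix u assume u: "u \<in> sm"
    define v where "v = rep (inv\<^bsub>jacobi_group\<^esub> \<gamma> s) u"
    have v: "v \<in> sm"
      unfolding v_def using g u by (simp add: sm_rep)
    have uv: "u = rep (\<gamma> s) v"
      using g u by (simp add: v_def rep_mult[symmetric] rep_one)
    have "c * ip u (ev y) = ip v (ev x)"
      using const[OF v, of s] unfolding G_def c_def y_def uv .
    also have "\<dots> = ip u (rep (\<gamma> s) (ev x))"
      unfolding uv using v x by (simp add: rep_unitary[OF g])
    finally show "ip u (scale c (ev y) - rep (\<gamma> s) (ev x)) = 0"
      using u y V by (simp add: ip_diff_right ip_scale_right)
  qed
  then show "rep (\<gamma> s) (ev x) = scale (inverse (jacobi_cocycle k (\<gamma> s) x)) (ev (jacobi_act (\<gamma> s) x))"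
    by (simp add: c_def y_def)
qed

lemma covariant_mult:
  assumes h: "h1 \<in> carrier jacobi_group" "h2 \<in> carrier jacobi_group" and c: "covariant h1" "covariant h2"
  shows "covariant (h1 \<otimes>\<^bsub>jacobi_group\<^esub> h2)"
  unfolding covariant_def
proof
  fix x assume x: "x \<in> jacobi_disk"
  have y: "jacobi_act h2 x \<in> jacobi_disk"
    by (rule jacobi_act_in_disk[OF h(2) x])
  have "rep (h1 \<otimes>\<^bsub>jacobi_group\<^esub> h2) (ev x) = scale (inverse (jacobi_cocycle k h2 x)) (rep h1 (ev (jacobi_act h2 x)))"
    using c(2) x y h by (simp add: covariant_def rep_mult rep_scale)
  also have "\<dots> = scale (inverse (jacobi_cocycle k (h1 \<otimes>\<^bsub>jacobi_group\<^esub> h2) x)) (ev (jacobi_act (h1 \<otimes>\<^bsub>jacobi_group\<^esub> h2) x))"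
    using c(1) y unfolding covariant_def jacobi_cocycle_mult[OF kd h x] jacobi_act_mult[OF h x] by (simp add: mult.commute)
  finally show "rep (h1 \<otimes>\<^bsub>jacobi_group\<^esub> h2) (ev x)
      = scale (inverse (jacobi_cocycle k (h1 \<otimes>\<^bsub>jacobi_group\<^esub> h2) x)) (ev (jacobi_act (h1 \<otimes>\<^bsub>jacobi_group\<^esub> h2) x))" .
qed

text \<open>\<open>L\<close>, \<open>Z\<close> and \<open>W\<close> are written for complex t, with
  cnj \<alpha> held fixed, because \<open>dps_curve\<close> wants holomorphic curves; at real t they
  are tied to the cocycle and the action.\<close>

lemma covariant_D: "covariant (orbit_D \<alpha> s)"
proof (rule flow_covariant[OF one_parameter_D D_deriv,
      where L="\<lambda>y t. exp (- t\<^sup>2 * \<alpha> * cnj \<alpha> / 2 + t\<^sup>2 * (cnj \<alpha>)\<^sup>2 * snd y / 2 - t * fst y * cnj \<alpha>)"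
        and Z="\<lambda>y t. fst y + t * (\<alpha> - cnj \<alpha> * snd y)" and W="\<lambda>y t. snd y"
        and L'="\<lambda>y. - fst y * cnj \<alpha>" and p="\<lambda>y. \<alpha> - cnj \<alpha> * snd y" and q="\<lambda>y. 0"])
  fix y :: "complex \<times> complex" and s :: real assume y: "y \<in> jacobi_disk"
  have p: "su_pair 1 0"
    by (simp add: su_pair_def)
  show "jacobi_act (orbit_D \<alpha> s) y = (fst y + of_real s * (\<alpha> - cnj \<alpha> * snd y), snd y)"
    by (cases y) (simp add: orbit_D_eq jacobi_act_su_mat su_den_def algebra_simps)
  show "inverse (jacobi_cocycle k (orbit_D \<alpha> s) y)
      = exp (- (of_real s)\<^sup>2 * \<alpha> * cnj \<alpha> / 2 + (of_real s)\<^sup>2 * (cnj \<alpha>)\<^sup>2 * snd y / 2 - of_real s * fst y * cnj \<alpha>)"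
    using y by (cases y) (simp add: orbit_D_eq jacobi_cocycle_eq[OF kd p] jacobi_mult_factor_def su_den_def power2_eq_square ac_simps)
next
  fix u y assume u: "u \<in> sm" and y: "y \<in> jacobi_disk"
  show "- fst y * cnj \<alpha> * dps (cf u) y + ip (scale \<alpha> (A' u) - scale (cnj \<alpha>) (A u)) (ev y)
      + dps (pd1 (cf u)) y * (\<alpha> - cnj \<alpha> * snd y) + dps (pd2 (cf u)) y * 0 = 0"
    using u y by (simp add: ip_diff_left ip_scale_left ip_ops_ev algebra_simps del: jacobi_disk_iff)
qed (auto intro!: derivative_eq_intros)

lemma dk: "of_nat d = (2 * of_real k :: complex)"
  using kd by (metis of_real_mult of_real_numeral of_real_of_nat_eq)

text \<open>w turns twice as fast as z, since for w both numerator and denominator of the Moebius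
  map rotate.\<close>

lemma covariant_rot: "covariant (orbit_S \<theta> 0 s)"
proof (rule flow_covariant[OF one_parameter_rot S_deriv,
      where L="\<lambda>y t. exp (\<i> * t * \<theta> * of_nat d)"
        and Z="\<lambda>y t. fst y * exp (\<i> * t * \<theta>)" and W="\<lambda>y t. snd y * exp (2 * \<i> * t * \<theta>)"
        and L'="\<lambda>y. \<i> * \<theta> * of_nat d" and p="\<lambda>y. fst y * (\<i> * \<theta>)" and q="\<lambda>y. snd y * (2 * \<i> * \<theta>)"])
  fix y :: "complex \<times> complex" and s :: real assume y: "y \<in> jacobi_disk"
  have den: "su_den (cis (s * \<theta>)) 0 w = exp (- (\<i> * of_real s * of_real \<theta>))" for w
    by (simp add: su_den_def cis_conv_exp exp_cnj ac_simps)
  have e: "cis (s * \<theta>) = exp (\<i> * of_real s * of_real \<theta>)"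
    by (simp add: cis_conv_exp ac_simps)
  show "jacobi_act (orbit_S \<theta> 0 s) y = (fst y * exp (\<i> * of_real s * of_real \<theta>), snd y * exp (2 * \<i> * of_real s * of_real \<theta>))"
  proof -
    have 1: "z / su_den (cis (s * \<theta>)) 0 w = z * exp (\<i> * of_real s * of_real \<theta>)" for z w
      by (simp add: den exp_minus divide_inverse)
    have 2: "exp (2 * \<i> * of_real s * of_real \<theta>) = exp (\<i> * of_real s * of_real \<theta>) * exp (\<i> * of_real s * of_real \<theta>)"
      by (simp flip: exp_add) (simp add: algebra_simps)
    show ?thesis
      by (cases y) (simp only: orbit_S_rot jacobi_act_su_mat 1 2, simp only: e, simp add: mult.commute)
  qed
  show "inverse (jacobi_cocycle k (orbit_S \<theta> 0 s) y) = exp (\<i> * of_real s * of_real \<theta> * of_nat d)"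
    using y by (cases y)
      (simp add: orbit_S_rot jacobi_cocycle_eq[OF kd su_pair_rot] jacobi_mult_factor_def den exp_minus power_inverse flip: exp_of_nat2_mult)
next
  fix u y assume u: "u \<in> sm" and y: "y \<in> jacobi_disk"
  show "\<i> * of_real \<theta> * of_nat d * dps (cf u) y
      + ip (scale (2 * \<i> * of_real \<theta>) (K0 u) + scale 0 (Kp u) - scale (cnj 0) (Km u)) (ev y)
      + dps (pd1 (cf u)) y * (fst y * (\<i> * of_real \<theta>)) + dps (pd2 (cf u)) y * (snd y * (2 * \<i> * of_real \<theta>)) = 0"
    using u y by (simp add: dk ip_scale_left ip_ops_ev algebra_simps del: jacobi_disk_iff)
qed (auto intro!: derivative_eq_intros)

lemma covariant_boost:
  assumes \<zeta>: "\<zeta> * cnj \<zeta> = 1"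
  shows "covariant (orbit_S 0 \<zeta> s)"
proof (rule flow_covariant[OF one_parameter_boost[OF \<zeta>] S_deriv,
      where L="\<lambda>y t. inverse ((cnj \<zeta> * sinh t * snd y + cosh t) ^ d)
          * exp (- (cnj \<zeta> * sinh t * (fst y)\<^sup>2 / (2 * (cnj \<zeta> * sinh t * snd y + cosh t))))"
        and Z="\<lambda>y t. fst y / (cnj \<zeta> * sinh t * snd y + cosh t)"
        and W="\<lambda>y t. (cosh t * snd y + \<zeta> * sinh t) / (cnj \<zeta> * sinh t * snd y + cosh t)"
        and L'="\<lambda>y. - of_nat d * cnj \<zeta> * snd y - cnj \<zeta> * (fst y)\<^sup>2 / 2"
        and p="\<lambda>y. - fst y * cnj \<zeta> * snd y" and q="\<lambda>y. \<zeta> - cnj \<zeta> * (snd y)\<^sup>2"])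
  fix y :: "complex \<times> complex" and s :: real assume y: "y \<in> jacobi_disk"
  have den: "su_den (of_real (cosh s)) (of_real (sinh s) * \<zeta>) w
      = cnj \<zeta> * sinh (of_real s) * w + cosh (of_real s)" for w
    by (simp add: su_den_def cosh_of_real sinh_of_real)
  show "jacobi_act (orbit_S 0 \<zeta> s) y = (fst y / (cnj \<zeta> * sinh (of_real s) * snd y + cosh (of_real s)),
      (cosh (of_real s) * snd y + \<zeta> * sinh (of_real s)) / (cnj \<zeta> * sinh (of_real s) * snd y + cosh (of_real s)))"
    by (cases y) (simp only: orbit_S_boost[OF \<zeta>] jacobi_act_su_mat den, simp add: cosh_of_real sinh_of_real mult.commute)
  show "inverse (jacobi_cocycle k (orbit_S 0 \<zeta> s) y)
      = inverse ((cnj \<zeta> * sinh (of_real s) * snd y + cosh (of_real s)) ^ d)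
        * exp (- (cnj \<zeta> * sinh (of_real s) * (fst y)\<^sup>2 / (2 * (cnj \<zeta> * sinh (of_real s) * snd y + cosh (of_real s)))))"
  proof -
    obtain z w where [simp]: "y = (z, w)" and w: "cmod w < 1"
      using y by (cases y) auto
    show ?thesis
      unfolding orbit_S_boost[OF \<zeta>] \<open>y = (z, w)\<close> jacobi_cocycle_eq[OF kd su_pair_boost[OF \<zeta>] w] jacobi_mult_factor_def den
      by (simp add: cosh_of_real sinh_of_real mult.commute)
  qed
next
  fix u y assume u: "u \<in> sm" and y: "y \<in> jacobi_disk"
  show "(- of_nat d * cnj \<zeta> * snd y - cnj \<zeta> * (fst y)\<^sup>2 / 2) * dps (cf u) y
      + ip (scale (2 * \<i> * of_real 0) (K0 u) + scale \<zeta> (Kp u) - scale (cnj \<zeta>) (Km u)) (ev y)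
      + dps (pd1 (cf u)) y * (- fst y * cnj \<zeta> * snd y) + dps (pd2 (cf u)) y * (\<zeta> - cnj \<zeta> * (snd y)\<^sup>2) = 0"
    using u y by (simp add: dk ip_diff_left ip_scale_left ip_ops_ev algebra_simps del: jacobi_disk_iff)
next
  fix y :: "complex \<times> complex" assume "y \<in> jacobi_disk"
  show "((\<lambda>t. inverse ((cnj \<zeta> * sinh t * snd y + cosh t) ^ d)
          * exp (- (cnj \<zeta> * sinh t * (fst y)\<^sup>2 / (2 * (cnj \<zeta> * sinh t * snd y + cosh t)))))
     has_field_derivative (- of_nat d * cnj \<zeta> * snd y - cnj \<zeta> * (fst y)\<^sup>2 / 2)) (at 0)"
    by (auto intro!: derivative_eq_intros simp: power2_eq_square algebra_simps)
  show "((\<lambda>t. fst y / (cnj \<zeta> * sinh t * snd y + cosh t)) has_field_derivative - fst y * cnj \<zeta> * snd y) (at 0)"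
    by (auto intro!: derivative_eq_intros)
  show "((\<lambda>t. (cosh t * snd y + \<zeta> * sinh t) / (cnj \<zeta> * sinh t * snd y + cosh t))
      has_field_derivative \<zeta> - cnj \<zeta> * (snd y)\<^sup>2) (at 0)"
    by (auto intro!: derivative_eq_intros simp: power2_eq_square)
qed

text \<open>The polar decomposition of SU(1,1): a boost times a rotation, with |a| = cosh r, |b| =
  sinh r and \<theta> the argument of a.\<close>

lemma covariant_su:
  assumes ab: "su_pair a b"
  shows "covariant (su_mat a b, 0, 0)"
proof -
  define r where "r = arcosh (cmod a)"
  define \<theta> where "\<theta> = Arg a"
  \<comment> \<open>The rotation on the right turns b by -\<theta>, which the factor cis \<theta>
    anticipates; the value 1 keeps \<zeta> unimodular when b = 0.\<close>
  define \<zeta> where "\<zeta> = (if b = 0 then 1 else sgn b * cis \<theta>)"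
  have 1: "(cmod a)\<^sup>2 - (cmod b)\<^sup>2 = 1"
    using ab by (simp add: su_pair_cmod)
  then have a1: "cmod a \<ge> 1"
    by (smt (verit) one_le_power power2_le_imp_le power_one zero_le_power2 norm_ge_zero)
  have \<zeta>: "\<zeta> * cnj \<zeta> = 1"
    by (simp add: \<zeta>_def complex_norm_square[symmetric] norm_mult norm_sgn)
  have ch: "cosh r = cmod a"
    using a1 by (simp add: r_def)
  have "0 \<le> r"
    using a1 by (simp add: r_def)
  then have "0 \<le> sinh r"
    by simp
  moreover have "(sinh r)\<^sup>2 = (cmod b)\<^sup>2"
    using 1 hyperbolic_pythagoras[of r] by (simp add: ch)
  ultimately have sh: "sinh r = cmod b"
    by (simp add: power2_eq_iff_nonneg)
  have "of_real (cmod a) * cis \<theta> = a"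
    by (metis \<theta>_def rcis_cmod_Arg rcis_def)
  moreover have "of_real (cmod b) * \<zeta> * cis (- \<theta>) = b"
    by (simp add: \<zeta>_def sgn_eq cis_mult mult.assoc)
  ultimately have "(su_mat a b, 0, 0) = orbit_S 0 \<zeta> r \<otimes>\<^bsub>jacobi_group\<^esub> orbit_S \<theta> 0 1"
    unfolding orbit_S_boost[OF \<zeta>] orbit_S_rot jacobi_mult[OF su_pair_rot] ch sh by (simp add: cis_cnj)
  moreover have "covariant (orbit_S 0 \<zeta> r \<otimes>\<^bsub>jacobi_group\<^esub> orbit_S \<theta> 0 1)"
    by (intro covariant_mult covariant_boost[OF \<zeta>] covariant_rot one_parameter_carrier[OF one_parameter_boost[OF \<zeta>]]
        one_parameter_carrier[OF one_parameter_rot])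
  ultimately show ?thesis
    by simp
qed

lemma lowest_weight_covariance:
  assumes g: "g \<in> SU11" and x: "x \<in> jacobi_disk"
  shows "rep (g, 0, 0) (rep (mat 1, \<alpha>, 0) (ev x)) = scale (jacobi_lambda k g \<alpha> x) (ev (jacobi_act (g, \<alpha>, 0) x))"
proof -
  obtain a b where ab: "g = su_mat a b" "su_pair a b"
    using g by (auto simp: SU11_iff)
  have D: "(mat 1, \<alpha>, 0) = orbit_D \<alpha> 1"
    by (simp add: orbit_D_def)
  have cD: "orbit_D \<alpha> 1 \<in> carrier jacobi_group"
    by (rule one_parameter_carrier[OF one_parameter_D])
  have m: "(g, \<alpha>, 0) = (g, 0, 0) \<otimes>\<^bsub>jacobi_group\<^esub> orbit_D \<alpha> 1"
    unfolding ab(1) orbit_D_eq by (subst jacobi_mult) (simp_all add: su_pair_def)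
  have "covariant (g, \<alpha>, 0)"
    unfolding m using covariant_su[OF ab(2)] g cD by (intro covariant_mult covariant_D) (simp_all add: ab)
  then have "rep (g, \<alpha>, 0) (ev x) = scale (inverse (jacobi_cocycle k (g, \<alpha>, 0) x)) (ev (jacobi_act (g, \<alpha>, 0) x))"
    using x by (simp add: covariant_def)
  moreover have "rep (g, \<alpha>, 0) (ev x) = rep (g, 0, 0) (rep (mat 1, \<alpha>, 0) (ev x))"
    unfolding m D using g x cD by (simp add: rep_mult)
  ultimately show ?thesis
    by (simp add: jacobi_cocycle.simps)
qed

end

section \<open>The representation attached to the kernel\<close>

theorem proposition3:
  fixes k :: real
    and sc :: "complex \<Rightarrow> 'v::ab_group_add \<Rightarrow> 'v" and V :: "'v set"
    and ip :: "'v \<Rightarrow> 'v \<Rightarrow> complex" and rep :: "jacobi \<Rightarrow> 'v \<Rightarrow> 'v"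
    and A A' K0 Kp Km :: "'v \<Rightarrow> 'v" and e0 :: 'v
  assumes k_pos: "k > 0" and k_half_integer: "\<exists>n::nat. n \<ge> 2 \<and> 2 * k = real n"
  shows
    "(jacobi_lowest_weight_rep sc V ip rep k A A' K0 Kp Km e0 \<longrightarrow>
       (\<exists>e. (\<forall>x\<in>jacobi_disk. coherent_vector sc V ip A' Kp e0 x (e x)) \<and>
         (\<forall>g\<in>SU11. \<forall>\<alpha>. \<forall>x\<in>jacobi_disk.
            rep (g, 0, 0) (rep (mat 1, \<alpha>, 0) (e x))
              = sc (jacobi_lambda k g \<alpha> x) (e (jacobi_act (g, \<alpha>, 0) x))) \<and>
         (\<forall>z w z' w'. (z, w) \<in> jacobi_disk \<and> (z', w') \<in> jacobi_disk \<longrightarrow>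
            ip (e (cnj z, cnj w)) (e (cnj z', cnj w')) = jacobi_kernel k (z, w) (z', w'))))
     \<and> positive_definite_holomorphic_kernel jacobi_disk (jacobi_kernel k)
     \<and> reproducing_kernel_hilbert_space jacobi_disk (jacobi_kernel k) (jacobi_space k) (jacobi_ip k)
     \<and> (\<forall>h\<in>carrier jacobi_group. \<forall>x\<in>jacobi_disk.
          jacobi_act h x \<in> jacobi_disk \<and> jacobi_cocycle k h x \<noteq> 0)
     \<and> (\<forall>h1\<in>carrier jacobi_group. \<forall>h2\<in>carrier jacobi_group. \<forall>x\<in>jacobi_disk.
          jacobi_act (h1 \<otimes>\<^bsub>jacobi_group\<^esub> h2) x = jacobi_act h1 (jacobi_act h2 x) \<and>
          jacobi_cocycle k (h1 \<otimes>\<^bsub>jacobi_group\<^esub> h2) x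
            = jacobi_cocycle k h1 (jacobi_act h2 x) * jacobi_cocycle k h2 x)
     \<and> (\<forall>h\<in>carrier jacobi_group. \<forall>x\<in>jacobi_disk. \<forall>y\<in>jacobi_disk.
          jacobi_kernel k (jacobi_act h x) (jacobi_act h y)
            = jacobi_cocycle k h x * jacobi_kernel k x y * cnj (jacobi_cocycle k h y))
     \<and> (\<exists>rep\<^sub>K. continuous_unitary_rep (\<lambda>c f x. c * f x) (jacobi_space k) (jacobi_ip k)
                jacobi_group rep\<^sub>K \<and>
          (\<forall>g\<in>SU11. \<forall>\<alpha>. \<forall>f\<in>jacobi_space k. \<forall>x\<in>jacobi_disk.
             let h' = inv\<^bsub>jacobi_group\<^esub> (g, \<alpha>, 0) in
             rep\<^sub>K (g, \<alpha>, 0) f x = inverse (jacobi_cocycle k h' x) * f (jacobi_act h' x)) \<and>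
          (\<forall>rep'. continuous_unitary_rep (\<lambda>c f x. c * f x) (jacobi_space k) (jacobi_ip k)
                  jacobi_group rep' \<and>
             (\<forall>g\<in>SU11. \<forall>\<alpha>. \<forall>f\<in>jacobi_space k. \<forall>x\<in>jacobi_disk.
                let h' = inv\<^bsub>jacobi_group\<^esub> (g, \<alpha>, 0) in
                rep' (g, \<alpha>, 0) f x = inverse (jacobi_cocycle k h' x) * f (jacobi_act h' x)) \<longrightarrow>
             (\<forall>h\<in>carrier jacobi_group. \<forall>f\<in>jacobi_space k. rep' h f = rep\<^sub>K h f)))"
proof -
  obtain n :: nat where nk: "2 * k = real n" "n \<ge> 2"
    using k_half_integer by blast
  interpret half_integer_weight k n
    by unfold_locales (rule nk)+
  have coherent: "\<exists>e. (\<forall>x\<in>jacobi_disk. coherent_vector sc V ip A' Kp e0 x (e x)) \<and>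
      (\<forall>g\<in>SU11. \<forall>\<alpha>. \<forall>x\<in>jacobi_disk.
         rep (g, 0, 0) (rep (mat 1, \<alpha>, 0) (e x)) = sc (jacobi_lambda k g \<alpha> x) (e (jacobi_act (g, \<alpha>, 0) x))) \<and>
      (\<forall>z w z' w'. (z, w) \<in> jacobi_disk \<and> (z', w') \<in> jacobi_disk \<longrightarrow>
         ip (e (cnj z, cnj w)) (e (cnj z', cnj w')) = jacobi_kernel k (z, w) (z', w'))"
    if lw: "jacobi_lowest_weight_rep sc V ip rep k A A' K0 Kp Km e0"
  proof -
    interpret half_lowest_weight sc V ip rep k A A' K0 Kp Km e0 n
      by (rule half_lowest_weight.intro[OF lw half_lowest_weight_axioms.intro[OF nk]])
    \<comment> \<open>\<open>ip_ev_ev\<close> puts the points in reverse order, and conjugating both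
      restores the kernel, whose formula is symmetric in (z, w) and the conjugate of (z',
      w').\<close>
    have "ip (ev (cnj z, cnj w)) (ev (cnj z', cnj w')) = jacobi_kernel k (z, w) (z', w')"
      if "(z, w) \<in> jacobi_disk" "(z', w') \<in> jacobi_disk" for z w z' w'
      using that by (simp add: ip_ev_ev jacobi_kernel_eq[OF nk(1)] ac_simps)
    then show ?thesis
      using ev_coherent lowest_weight_covariance by blast
  qed
  \<comment> \<open>\<open>rep_determined\<close> reduces the claim to elements with vanishing last
    coordinate; there the functions agree on the disk by the formula, and off the disk both are
    extended by zero.\<close>
  have agree: "rep' h f = pi_K h f"
    if r: "continuous_unitary_rep (\<lambda>c f x. c * f x) (jacobi_space k) (jacobi_ip k) jacobi_group rep'"
      and eq: "\<forall>g\<in>SU11. \<forall>\<alpha>. \<forall>f\<in>jacobi_space k. \<forall>x\<in>jacobi_disk.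
        let h' = inv\<^bsub>jacobi_group\<^esub> (g, \<alpha>, 0) in
        rep' (g, \<alpha>, 0) f x = inverse (jacobi_cocycle k h' x) * f (jacobi_act h' x)"
      and h: "h \<in> carrier jacobi_group" and f: "f \<in> jacobi_space k" for rep' h f
  proof (rule rep_determined[OF r pi_K_rep _ h f])
    fix a b \<alpha> v assume ab: "su_pair a b" and v: "v \<in> jacobi_space k"
    have g: "su_mat a b \<in> SU11"
      by (simp add: su_mat_in_SU11 ab)
    have "rep' (su_mat a b, \<alpha>, 0) v \<in> jacobi_space k"
      using continuous_unitary_rep.rep_closed[OF r _ v] g by simp
    then have "rep' (su_mat a b, \<alpha>, 0) v x = pi_K (su_mat a b, \<alpha>, 0) v x" for x
      using eq[unfolded Let_def, rule_format, OF g v, of x] jacobi_spaceD(2)[of _ k x] pi_K_outside[of x]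
      by (cases "x \<in> jacobi_disk") (simp_all add: pi_K_def)
    then show "rep' (su_mat a b, \<alpha>, 0) v = pi_K (su_mat a b, \<alpha>, 0) v"
      by (rule ext)
  qed
  have rep_K: "\<exists>rep\<^sub>K. continuous_unitary_rep (\<lambda>c f x. c * f x) (jacobi_space k) (jacobi_ip k) jacobi_group rep\<^sub>K \<and>
      (\<forall>g\<in>SU11. \<forall>\<alpha>. \<forall>f\<in>jacobi_space k. \<forall>x\<in>jacobi_disk.
         let h' = inv\<^bsub>jacobi_group\<^esub> (g, \<alpha>, 0) in
         rep\<^sub>K (g, \<alpha>, 0) f x = inverse (jacobi_cocycle k h' x) * f (jacobi_act h' x)) \<and>
      (\<forall>rep'. continuous_unitary_rep (\<lambda>c f x. c * f x) (jacobi_space k) (jacobi_ip k) jacobi_group rep' \<and>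
         (\<forall>g\<in>SU11. \<forall>\<alpha>. \<forall>f\<in>jacobi_space k. \<forall>x\<in>jacobi_disk.
            let h' = inv\<^bsub>jacobi_group\<^esub> (g, \<alpha>, 0) in
            rep' (g, \<alpha>, 0) f x = inverse (jacobi_cocycle k h' x) * f (jacobi_act h' x)) \<longrightarrow>
         (\<forall>h\<in>carrier jacobi_group. \<forall>f\<in>jacobi_space k. rep' h f = rep\<^sub>K h f))"
  proof (intro exI[of _ pi_K] conjI allI impI)
    show "\<forall>g\<in>SU11. \<forall>\<alpha>. \<forall>f\<in>jacobi_space k. \<forall>x\<in>jacobi_disk.
        let h' = inv\<^bsub>jacobi_group\<^esub> (g, \<alpha>, 0) in
        pi_K (g, \<alpha>, 0) f x = inverse (jacobi_cocycle k h' x) * f (jacobi_act h' x)"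
      by (simp add: pi_K_def Let_def)
  qed (rule pi_K_rep, elim conjE, intro ballI, rule agree)
  show ?thesis
    by (intro conjI impI ballI rep_K coherent jacobi_positive_definite jacobi_rkhs jacobi_act_in_disk
        jacobi_cocycle_nonzero[OF nk(1)] jacobi_act_mult jacobi_cocycle_mult[OF nk(1)] jacobi_kernel_act[OF nk(1)])
qed

end
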